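(* Let $1\le p<\infty$, $0<\gamma<1$, and let the collision frequency be space-homogeneous: $\Sigma(x,v)=\Sigma(v)$ for all $(x,v)\in\mathcal{D}\times\mathbb{R}^N$, where $\Sigma\in L^\infty(\mathbb{R}^N)$ is non-negative and $\Sigma(v)=\Sigma(-v)$. Let $T$ be the streaming operator on $X_p$ with bounce-back boundary conditions $\psi_{|\Gamma_-}(x,v)=\gamma\,\psi_{|\Gamma_+}(x,-v)$. Then the $C_0$-semigroup $(U(t))_{t\ge 0}$ in $X_p$ generated by $T$ is given by $$U(t)=\sum_{n=0}^\infty U_n(t),\qquad \forall t\ge 0,$$ where, for any fixed $t\ge 0$, any $\varphi\in X_p$ and any $(x,v)\in\mathcal{D}\times\mathbb{R}^N$, $$[U_0(t)\varphi](x,v)=\varphi(x-tv,v)\exp(-\Sigma(v)t)\,\chi_{\{t<t_-(x,v)\}},$$ and, for any integer $n\ge 0$, $$[U_{2n+2}(t)\varphi](x,v)=\gamma^{2n+2}\exp(-\Sigma(v)t)\,\chi_{\mathcal{I}_{2n+1}(x,v)}(t)\,\varphi\big(x-tv+(2n+2)\tau(x,v)v,\,v\big),$$ $$[U_{2n+1}(t)\varphi](x,v)=\gamma^{2n+1}\exp(-\Sigma(v)t)\,\chi_{\mathcal{I}_{2n}(x,v)}(t)\,\varphi\big(x+tv-2t_-(x,v)v-2n\tau(x,v)v,\,-v\big),$$ with $$\mathcal{I}_k(x,v)=[\,k\tau(x,v)+t_-(x,v),\,(k+1)\tau(x,v)+t_-(x,v)\,],\qquad k\in\mathbb{N}=\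{0,1,2,\dots\}.$$
   Context: Let $\mathcal{D}$ be a smooth bounded convex open subset of $\mathbb{R}^N$ ($N\ge 1$), with outward unit normal $n(x)$ at $x\in\partial\mathcal{D}$. Put $X_p=L^p(\mathcal{D}\times\mathbb{R}^N,dx\otimes dv)$ and $W_p=\{\psi\in X_p : v\cdot\nabla_x\psi\in X_p\}$. Let $\Gamma_\pm=\{(x,v)\in\partial\mathcal{D}\times\mathbb{R}^N : \pm v\cdot n(x)\ge 0\}$ and $L^p_\pm=L^p(\Gamma_\pm;|v\cdot n(x)|\,d\gamma(x)\otimes dv)$, where $d\gamma(\cdot)$ is the Lebesgue (surface) measure on $\partial\mathcal{D}$. Every $\psi\in W_p$ has traces $\psi_{|\Gamma_\pm}$ on $\Gamma_\pm$; put $\widetilde W_p=\{\psi\in W_p : \psi_{|\Gamma_\pm}\in L^p_\pm\}$. The streaming operator $T$ with bounce-back boundary conditions is $$T\varphi(x,v)=-v\cdot\nabla_x\varphi(x,v)-\Sigma(x,v)\varphi(x,v),\qquad \mathscr{D}(T)=\{\psi\in\widetilde W_p : \psi_{|\Gamma_-}(x,v)=\gamma\,\psi_{|\Gamma_+}(x,-v)\}.$$ It is known that $T$ generates a non-negative $C_0$-semigroup of contractions in $X_p$. For $(x,v)\in\overline{\mathcal{D}}\times\mathbb{R}^N$ define $t_\pm(x,v)=\inf\{s>0 : x\pm sv\notin\mathcal{D}\}$ and $\tau(x,v)=t_-(x,v)+t_+(x,v)$. The symbol $\chi_A$ denotes the characteristic function of $A$. Functions in $X_p$ are identified when equal almost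 everywhere. *)

theory Defs
  imports "HOL-Analysis.Analysis"
begin

section \<open>\<open>L\<^sup>p\<close> spaces, semigroups and generators\<close>

text \<open>
  Elements of \<open>L\<^sup>p\<close> are represented by functions; two functions represent the same element iff they
  agree almost everywhere. Accordingly, all identities between elements of \<open>L\<^sup>p\<close> are stated almost
  everywhere or through the norm.
\<close>

definition Lp_space :: "'a measure \<Rightarrow> real \<Rightarrow> ('a \<Rightarrow> real) set" where
  "Lp_space M p = {f \<in> borel_measurable M. integrable M (\<lambda>x. \<bar>f x\<bar> powr p)}"

definition Lp_norm :: "'a measure \<Rightarrow> real \<Rightarrow> ('a \<Rightarrow> real) \<Rightarrow> real" where
  "Lp_norm M p f = (LINT x|M. \<bar>f x\<bar> powr p) powr (1 / p)"

definition Lp_bounded_operator ::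
    "'a measure \<Rightarrow> real \<Rightarrow> (('a \<Rightarrow> real) \<Rightarrow> ('a \<Rightarrow> real)) \<Rightarrow> bool" where
  "Lp_bounded_operator M p A \<longleftrightarrow>
     (\<forall>f\<in>Lp_space M p. A f \<in> Lp_space M p) \<and>
     (\<forall>f\<in>Lp_space M p. \<forall>g\<in>Lp_space M p. (AE x in M. f x = g x) \<longrightarrow> (AE x in M. A f x = A g x)) \<and>
     (\<forall>f\<in>Lp_space M p. \<forall>g\<in>Lp_space M p. \<forall>a b.
        AE x in M. A (\<lambda>y. a * f y + b * g y) x = a * A f x + b * A g x) \<and>
     (\<exists>C. \<forall>f\<in>Lp_space M p. Lp_norm M p (A f) \<le> C * Lp_norm M p f)"

text \<open>\<open>Lp_operator_sums M p A S\<close>: the series of the bounded operators \<open>A n\<close> converges to \<open>S\<close> in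
  operator norm.\<close>

definition Lp_operator_sums ::
    "'a measure \<Rightarrow> real \<Rightarrow> (nat \<Rightarrow> ('a \<Rightarrow> real) \<Rightarrow> ('a \<Rightarrow> real)) \<Rightarrow>
      (('a \<Rightarrow> real) \<Rightarrow> ('a \<Rightarrow> real)) \<Rightarrow> bool" where
  "Lp_operator_sums M p A S \<longleftrightarrow>
     (\<forall>n. Lp_bounded_operator M p (A n)) \<and> Lp_bounded_operator M p S \<and>
     (\<forall>e>0. \<exists>m. \<forall>n\<ge>m. \<forall>f\<in>Lp_space M p.
        Lp_norm M p (\<lambda>x. S f x - (\<Sum>k<n. A k f x)) \<le> e * Lp_norm M p f)"

definition C0_semigroup ::
    "'a measure \<Rightarrow> real \<Rightarrow> (real \<Rightarrow> ('a \<Rightarrow> real) \<Rightarrow> ('a \<Rightarrow> real)) \<Rightarrow> bool" where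
  "C0_semigroup M p U \<longleftrightarrow>
     (\<forall>t\<ge>0. Lp_bounded_operator M p (U t)) \<and>
     (\<forall>f\<in>Lp_space M p. AE x in M. U 0 f x = f x) \<and>
     (\<forall>s\<ge>0. \<forall>t\<ge>0. \<forall>f\<in>Lp_space M p. AE x in M. U (s + t) f x = U s (U t f) x) \<and>
     (\<forall>f\<in>Lp_space M p. ((\<lambda>t. Lp_norm M p (\<lambda>x. U t f x - f x)) \<longlongrightarrow> 0) (at_right 0))"

definition right_derivative_at_0 ::
    "'a measure \<Rightarrow> real \<Rightarrow> (real \<Rightarrow> ('a \<Rightarrow> real) \<Rightarrow> ('a \<Rightarrow> real)) \<Rightarrow>
      ('a \<Rightarrow> real) \<Rightarrow> ('a \<Rightarrow> real) \<Rightarrow> bool" where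
  "right_derivative_at_0 M p U f g \<longleftrightarrow> g \<in> Lp_space M p \<and>
     ((\<lambda>h. Lp_norm M p (\<lambda>x. (U h f x - f x) / h - g x)) \<longlongrightarrow> 0) (at_right 0)"

text \<open>The operator \<open>A\<close> with domain \<open>Dom\<close> is the generator of \<open>U\<close>.\<close>

definition is_generator ::
    "'a measure \<Rightarrow> real \<Rightarrow> (real \<Rightarrow> ('a \<Rightarrow> real) \<Rightarrow> ('a \<Rightarrow> real)) \<Rightarrow>
      (('a \<Rightarrow> real) \<Rightarrow> ('a \<Rightarrow> real)) \<Rightarrow> ('a \<Rightarrow> real) set \<Rightarrow> bool" where
  "is_generator M p U A Dom \<longleftrightarrow>
     Dom = {f \<in> Lp_space M p. \<exists>g. right_derivative_at_0 M p U f g} \<and>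
     (\<forall>f\<in>Dom. right_derivative_at_0 M p U f (A f))"

section \<open>Smooth domains, outward normal and surface measure\<close>

primrec Ck_on :: "nat \<Rightarrow> ('a::euclidean_space \<Rightarrow> real) \<Rightarrow> 'a set \<Rightarrow> bool" where
  "Ck_on 0 f S \<longleftrightarrow> continuous_on S f"
| "Ck_on (Suc k) f S \<longleftrightarrow> f differentiable_on S \<and>
     (\<forall>v. Ck_on k (\<lambda>x. frechet_derivative f (at x) v) S)"

definition smooth_on :: "('a::euclidean_space \<Rightarrow> real) \<Rightarrow> 'a set \<Rightarrow> bool" where
  "smooth_on f S \<longleftrightarrow> (\<forall>k. Ck_on k f S)"

definition local_defining_function ::
    "'a::euclidean_space set \<Rightarrow> 'a \<Rightarrow> 'a set \<Rightarrow> ('a \<Rightarrow> real) \<Rightarrow> bool" where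
  "local_defining_function D x V \<rho> \<longleftrightarrow>
     open V \<and> x \<in> V \<and> smooth_on \<rho> V \<and> (\<forall>y\<in>V. \<not> GDERIV \<rho> y :> 0) \<and>
     D \<inter> V = {y \<in> V. \<rho> y < 0} \<and> frontier D \<inter> V = {y \<in> V. \<rho> y = 0}"

definition smooth_domain :: "'a::euclidean_space set \<Rightarrow> bool" where
  "smooth_domain D \<longleftrightarrow> open D \<and> (\<forall>x\<in>frontier D. \<exists>V \<rho>. local_defining_function D x V \<rho>)"

definition outward_normal :: "'a::euclidean_space set \<Rightarrow> 'a \<Rightarrow> 'a" where
  "outward_normal D x =
     (THE n. \<exists>V \<rho> g. local_defining_function D x V \<rho> \<and> GDERIV \<rho> x :> g \<and> n = g /\<^sub>R norm g)"

text \<open>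
  The surface measure on the boundary is the Hausdorff measure of dimension \<open>DIM('a) - 1\<close>, normalised
  to agree with Lebesgue measure on affine hyperplanes. The case distinction only matters in
  dimension \<open>0\<close>, where \<open>0 ^ 0 = 1\<close>: it makes the \<open>0\<close>-dimensional measure the counting measure.
\<close>

definition hausdorff_premeasure :: "nat \<Rightarrow> real \<Rightarrow> 'a::metric_space set \<Rightarrow> ennreal" where
  "hausdorff_premeasure k \<delta> A =
     (INF C \<in> {C :: nat \<Rightarrow> 'a set. A \<subseteq> (\<Union>i. C i) \<and> (\<forall>i. bounded (C i) \<and> diameter (C i) \<le> \<delta>)}.
        \<Sum>i. if C i = {} then 0 else ennreal (unit_ball_vol (real k) * (diameter (C i) / 2) ^ k))"

definition hausdorff_measure :: "nat \<Rightarrow> 'a::metric_space measure" where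
  "hausdorff_measure k =
     measure_of UNIV (sets borel) (\<lambda>A. SUP \<delta>\<in>{0<..}. hausdorff_premeasure k \<delta> A)"

definition surface_measure :: "'a::euclidean_space set \<Rightarrow> 'a measure" where
  "surface_measure D = restrict_space (hausdorff_measure (DIM('a) - 1)) (frontier D)"

section \<open>Phase space, traces and the streaming operator\<close>

definition phase_space :: "'a::euclidean_space set \<Rightarrow> ('a \<times> 'a) measure" where
  "phase_space D = lebesgue_on (D \<times> UNIV)"

definition Gamma_plus :: "'a::euclidean_space set \<Rightarrow> ('a \<times> 'a) set" where
  "Gamma_plus D = {(x, v). x \<in> frontier D \<and> v \<bullet> outward_normal D x \<ge> 0}"

definition Gamma_minus :: "'a::euclidean_space set \<Rightarrow> ('a \<times> 'a) set" where
  "Gamma_minus D = {(x, v). x \<in> frontier D \<and> - (v \<bullet> outward_normal D x) \<ge> 0}"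

definition flux_measure :: "'a::euclidean_space set \<Rightarrow> ('a \<times> 'a) set \<Rightarrow> ('a \<times> 'a) measure" where
  "flux_measure D G =
     restrict_space (density (surface_measure D \<Otimes>\<^sub>M lborel)
       (\<lambda>(x, v). ennreal \<bar>v \<bullet> outward_normal D x\<bar>)) G"

definition test_function :: "'a::euclidean_space set \<Rightarrow> ('a \<times> 'a \<Rightarrow> real) \<Rightarrow> bool" where
  "test_function D \<eta> \<longleftrightarrow> smooth_on \<eta> UNIV \<and>
     compact (closure {z. \<eta> z \<noteq> 0}) \<and> closure {z. \<eta> z \<noteq> 0} \<subseteq> D \<times> UNIV"

text \<open>\<open>g\<close> is the distribution \<open>v \<bullet> \<nabla>\<^sub>x \<psi>\<close> on \<open>D \<times> UNIV\<close>; the classical \<open>v \<bullet> \<nabla>\<^sub>x \<eta>\<close> is the derivative of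
  \<open>\<eta>\<close> in the direction \<open>(v, 0)\<close>.\<close>

definition weak_streaming_derivative ::
    "'a::euclidean_space set \<Rightarrow> ('a \<times> 'a \<Rightarrow> real) \<Rightarrow> ('a \<times> 'a \<Rightarrow> real) \<Rightarrow> bool" where
  "weak_streaming_derivative D \<psi> g \<longleftrightarrow> (\<forall>\<eta>. test_function D \<eta> \<longrightarrow>
     (LINT z|phase_space D. \<psi> z * frechet_derivative \<eta> (at z) (snd z, 0)) =
     - (LINT z|phase_space D. g z * \<eta> z))"

definition W_space :: "'a::euclidean_space set \<Rightarrow> real \<Rightarrow> ('a \<times> 'a \<Rightarrow> real) set" where
  "W_space D p = {\<psi> \<in> Lp_space (phase_space D) p.
     \<exists>g\<in>Lp_space (phase_space D) p. weak_streaming_derivative D \<psi> g}"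

definition streaming_derivative ::
    "'a::euclidean_space set \<Rightarrow> real \<Rightarrow> ('a \<times> 'a \<Rightarrow> real) \<Rightarrow> ('a \<times> 'a \<Rightarrow> real)" where
  "streaming_derivative D p \<psi> =
     (SOME g. g \<in> Lp_space (phase_space D) p \<and> weak_streaming_derivative D \<psi> g)"

text \<open>
  Traces are boundary limits along the characteristics \<open>s \<mapsto> (x + s v, v)\<close>. An element of \<open>W_space D p\<close>
  has a representative that is absolutely continuous along almost every characteristic; the limits
  then exist. Any two representatives that have the limits almost everywhere yield the same trace
  almost everywhere, by Fubini's theorem.
\<close>

definition has_trace_minus ::
    "'a::euclidean_space set \<Rightarrow> ('a \<times> 'a \<Rightarrow> real) \<Rightarrow> ('a \<times> 'a \<Rightarrow> real) \<Rightarrow> bool" where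
  "has_trace_minus D \<psi> g \<longleftrightarrow> (\<exists>\<psi>'. (AE z in phase_space D. \<psi>' z = \<psi> z) \<and>
     (AE (x, v) in flux_measure D (Gamma_minus D).
        ((\<lambda>s. \<psi>' (x + s *\<^sub>R v, v)) \<longlongrightarrow> g (x, v)) (at_right 0)))"

definition has_trace_plus ::
    "'a::euclidean_space set \<Rightarrow> ('a \<times> 'a \<Rightarrow> real) \<Rightarrow> ('a \<times> 'a \<Rightarrow> real) \<Rightarrow> bool" where
  "has_trace_plus D \<psi> g \<longleftrightarrow> (\<exists>\<psi>'. (AE z in phase_space D. \<psi>' z = \<psi> z) \<and>
     (AE (x, v) in flux_measure D (Gamma_plus D).
        ((\<lambda>s. \<psi>' (x - s *\<^sub>R v, v)) \<longlongrightarrow> g (x, v)) (at_right 0)))"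

definition W_tilde :: "'a::euclidean_space set \<Rightarrow> real \<Rightarrow> ('a \<times> 'a \<Rightarrow> real) set" where
  "W_tilde D p = {\<psi> \<in> W_space D p.
     (\<exists>g\<in>Lp_space (flux_measure D (Gamma_minus D)) p. has_trace_minus D \<psi> g) \<and>
     (\<exists>g\<in>Lp_space (flux_measure D (Gamma_plus D)) p. has_trace_plus D \<psi> g)}"

definition streaming_operator ::
    "'a::euclidean_space set \<Rightarrow> real \<Rightarrow> ('a \<times> 'a \<Rightarrow> real) \<Rightarrow>
      ('a \<times> 'a \<Rightarrow> real) \<Rightarrow> ('a \<times> 'a \<Rightarrow> real)" where
  "streaming_operator D p \<Sigma> \<phi> = (\<lambda>z. - streaming_derivative D p \<phi> z - \<Sigma> z * \<phi> z)"

definition bounce_back_domain ::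
    "'a::euclidean_space set \<Rightarrow> real \<Rightarrow> real \<Rightarrow> ('a \<times> 'a \<Rightarrow> real) set" where
  "bounce_back_domain D p \<gamma> = {\<psi> \<in> W_tilde D p.
     \<exists>g\<^sub>m g\<^sub>p. has_trace_minus D \<psi> g\<^sub>m \<and> has_trace_plus D \<psi> g\<^sub>p \<and>
       (AE (x, v) in flux_measure D (Gamma_minus D). g\<^sub>m (x, v) = \<gamma> * g\<^sub>p (x, - v))}"

section \<open>Exit times\<close>

text \<open>Extended reals are used because the exit times are infinite for \<open>x \<in> D\<close>, \<open>v = 0\<close>.\<close>

definition t_minus :: "'a::euclidean_space set \<Rightarrow> 'a \<Rightarrow> 'a \<Rightarrow> ereal" where
  "t_minus D x v = (INF s\<in>{s. s > 0 \<and> x - s *\<^sub>R v \<notin> D}. ereal s)"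

definition t_plus :: "'a::euclidean_space set \<Rightarrow> 'a \<Rightarrow> 'a \<Rightarrow> ereal" where
  "t_plus D x v = (INF s\<in>{s. s > 0 \<and> x + s *\<^sub>R v \<notin> D}. ereal s)"

definition tau :: "'a::euclidean_space set \<Rightarrow> 'a \<Rightarrow> 'a \<Rightarrow> ereal" where
  "tau D x v = t_minus D x v + t_plus D x v"

definition bounce_interval :: "'a::euclidean_space set \<Rightarrow> nat \<Rightarrow> 'a \<Rightarrow> 'a \<Rightarrow> real set" where
  "bounce_interval D k x v =
     {t. ereal (real k) * tau D x v + t_minus D x v \<le> ereal t \<and>
         ereal t \<le> ereal (real (k + 1)) * tau D x v + t_minus D x v}"

end

theory Submission
  imports Defs
begin

text \<open>
  The series is the operator \<open>S t\<close> that transports \<open>\<phi>\<close> backwards along the billiard trajectory with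
  velocity reversal, damped by \<open>\<gamma>\<close> at every bounce and by \<open>\<Sigma>\<close> in between. Since the trajectories form
  a measure preserving flow, \<open>S\<close> is a \<open>C\<^sub>0\<close>-semigroup, and the tail of the series after \<open>n\<close> bounces has
  norm at most \<open>(\<gamma>\<^sup>n / (1 - \<gamma>)) powr (1 / p)\<close>.
  If \<open>\<psi>\<close> lies in the domain of \<open>T\<close>, then \<open>\<psi>\<close> is absolutely continuous along almost every line, and
  the boundary condition says that \<open>\<gamma>\<close> times its value at the end of a chord is its value at the start
  of the reversed chord. Hence \<open>S t \<psi> - \<psi>\<close> is the integral of \<open>- S s (v \<bullet> \<nabla>\<^sub>x \<psi>)\<close> over \<open>s \<le> t\<close> (for
  \<open>\<Sigma> = 0\<close>), so the generator of \<open>S\<close> extends \<open>T\<close>. Two semigroups whose generators agree on the domain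
  of one of them agree on that domain, hence everywhere, because averages of test functions along
  lines show that it is dense.
\<close>

text \<open>\<open>C0_semigroup\<close> describes small times and gives no growth bound, so the
  comparison of two semigroups on [0,t] rests on uniform boundedness. As the hypothesis on
  \<open>U\<close> fixes its generator completely, an inclusion of generators is all that has to be
  shown for \<open>S\<close>, and no resolvent is computed.

  The obstacle is the boundary. Traces and the boundary condition are given almost everywhere for
  the flux measure, a density over Hausdorff measure, whereas trajectories live in phase space with
  Lebesgue null sets. To pass from one to the other, the surface measure has to be finite, so that
  Fubini applies, and the tube swept out from a surface null set by a fixed velocity has to be a
  Lebesgue null set. The first comes from projecting the faces of a box onto the closure of
  \<open>D\<close>, the second from covering tubes by balls.

  The factor 1 / (1 - \<gamma>) arises from splitting phase space by the number of bounces: on each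
  piece composition with the flow does not increase integrals, and the bounds for the pieces are
  added.\<close>

abbreviation Borel :: "('a::topological_space => 'b::topological_space) set" where
  "Borel \<equiv> borel_measurable borel"

lemmas borel_continuous = borel_measurable_continuous_onI

section \<open>\<open>L\<^sup>p\<close> spaces\<close>

lemma Lp_space_measurable: "f \<in> Lp_space M p ==> f \<in> borel_measurable M"
  by (simp add: Lp_space_def)

lemma Lp_norm_nonneg [simp]: "0 \<le> Lp_norm M p f"
  by (simp add: Lp_norm_def)

lemma Lp_norm_powr:
  assumes "1 \<le> p" "f \<in> Lp_space M p"
  shows "(\<integral>\<^sup>+x. ennreal (\<bar>f x\<bar> powr p) \<partial>M) = ennreal (Lp_norm M p f powr p)"
proof -
  have i: "integrable M (\<lambda>x. \<bar>f x\<bar> powr p)" using assms by (simp add: Lp_space_def)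
  have "(\<integral>\<^sup>+x. ennreal (\<bar>f x\<bar> powr p) \<partial>M) = ennreal (LINT x|M. \<bar>f x\<bar> powr p)"
    by (rule nn_integral_eq_integral[OF i]) simp
  moreover have "0 \<le> (LINT x|M. \<bar>f x\<bar> powr p)" by (rule integral_nonneg_AE) simp
  ultimately show ?thesis using assms(1) by (simp add: Lp_norm_def powr_powr)
qed

text \<open>Membership and bound are merged into one condition on a nonnegative integral, which
  exists for every measurable function. Fubini, Fatou and monotone convergence can then be applied
  before integrability is known, and no p-th root of an \<open>ennreal\<close> occurs.\<close>

lemma Lp_space_norm_le_iff:
  assumes p: "1 \<le> p" and C: "0 \<le> C"
  shows "f \<in> Lp_space M p \<and> Lp_norm M p f \<le> C \<longleftrightarrow>
    f \<in> borel_measurable M \<and> (\<integral>\<^sup>+x. ennreal (\<bar>f x\<bar> powr p) \<partial>M) \<le> ennreal (C powr p)"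
proof safe
  assume f: "f \<in> Lp_space M p" and le: "Lp_norm M p f \<le> C"
  show "f \<in> borel_measurable M" using f by (rule Lp_space_measurable)
  show "(\<integral>\<^sup>+x. ennreal (\<bar>f x\<bar> powr p) \<partial>M) \<le> ennreal (C powr p)"
    unfolding Lp_norm_powr[OF p f] using p le by (intro ennreal_leI powr_mono2) auto
next
  assume f: "f \<in> borel_measurable M" and le: "(\<integral>\<^sup>+x. ennreal (\<bar>f x\<bar> powr p) \<partial>M) \<le> ennreal (C powr p)"
  have i: "integrable M (\<lambda>x. \<bar>f x\<bar> powr p)"
  proof (rule integrableI_nonneg)
    show "(\<lambda>x. \<bar>f x\<bar> powr p) \<in> borel_measurable M" using f by measurable
    show "(\<integral>\<^sup>+x. ennreal (\<bar>f x\<bar> powr p) \<partial>M) < \<infinity>" using le by (rule order.strict_trans1) simp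
  qed simp
  show fL: "f \<in> Lp_space M p" using f i by (simp add: Lp_space_def)
  have "Lp_norm M p f powr p \<le> C powr p"
    using le unfolding Lp_norm_powr[OF p fL] by (simp add: ennreal_le_iff)
  then show "Lp_norm M p f \<le> C"
    using p C by (metis Lp_norm_nonneg leD linorder_not_less powr_less_mono2 zero_less_one order.strict_trans2)
qed

lemma Lp_space_norm_leI:
  assumes "1 \<le> p" "0 \<le> C" "f \<in> borel_measurable M"
    "(\<integral>\<^sup>+x. ennreal (\<bar>f x\<bar> powr p) \<partial>M) \<le> ennreal (C powr p)"
  shows "f \<in> Lp_space M p" "Lp_norm M p f \<le> C"
  using Lp_space_norm_le_iff[OF assms(1,2), of f M] assms(3,4) by auto

lemma Lp_spaceI_finite:
  assumes p: "1 \<le> p" and f: "f \<in> borel_measurable M"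
    and fin: "(\<integral>\<^sup>+x. ennreal (\<bar>f x\<bar> powr p) \<partial>M) < \<infinity>"
  shows "f \<in> Lp_space M p"
proof -
  have "integrable M (\<lambda>x. \<bar>f x\<bar> powr p)"
    using fin f by (intro integrableI_nonneg) auto
  then show ?thesis using f by (simp add: Lp_space_def)
qed

lemma Lp_dominated:
  assumes p: "1 \<le> p" and f: "f \<in> Lp_space M p" and g: "g \<in> borel_measurable M"
    and le: "AE x in M. \<bar>g x\<bar> \<le> \<bar>f x\<bar>"
  shows "g \<in> Lp_space M p" "Lp_norm M p g \<le> Lp_norm M p f"
proof -
  have "(\<integral>\<^sup>+x. ennreal (\<bar>g x\<bar> powr p) \<partial>M) \<le> (\<integral>\<^sup>+x. ennreal (\<bar>f x\<bar> powr p) \<partial>M)"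
  proof (rule nn_integral_mono_AE)
    show "AE x in M. ennreal (\<bar>g x\<bar> powr p) \<le> ennreal (\<bar>f x\<bar> powr p)"
      using le by (rule eventually_mono) (use p in \<open>auto intro!: ennreal_leI powr_mono2\<close>)
  qed
  then have "(\<integral>\<^sup>+x. ennreal (\<bar>g x\<bar> powr p) \<partial>M) \<le> ennreal (Lp_norm M p f powr p)"
    by (simp add: Lp_norm_powr[OF p f])
  from Lp_space_norm_leI[OF p Lp_norm_nonneg g this]
  show "g \<in> Lp_space M p" "Lp_norm M p g \<le> Lp_norm M p f" .
qed

lemma Lp_norm_cong_AE:
  assumes "f \<in> borel_measurable M" "g \<in> borel_measurable M" "AE x in M. f x = g x"
  shows "Lp_norm M p f = Lp_norm M p g"
proof -
  have "(LINT x|M. \<bar>f x\<bar> powr p) = (LINT x|M. \<bar>g x\<bar> powr p)"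
    by (rule integral_cong_AE) (use assms in \<open>auto elim: eventually_mono\<close>)
  then show ?thesis by (simp add: Lp_norm_def)
qed

lemma Lp_norm_cong:
  assumes "\<And>x. x \<in> space M ==> f x = g x"
  shows "Lp_norm M p f = Lp_norm M p g"
proof -
  have "(LINT x|M. \<bar>f x\<bar> powr p) = (LINT x|M. \<bar>g x\<bar> powr p)"
    by (rule Bochner_Integration.integral_cong) (use assms in auto)
  then show ?thesis by (simp add: Lp_norm_def)
qed

lemma Lp_space_cong_AE:
  assumes "1 \<le> p" "f \<in> Lp_space M p" "g \<in> borel_measurable M" "AE x in M. f x = g x"
  shows "g \<in> Lp_space M p"
  using assms(4) by (intro Lp_dominated(1)[OF assms(1-3)]) (auto elim: eventually_mono)

lemma Lp_scale:
  assumes p: "1 \<le> p" and f: "f \<in> Lp_space M p"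
  shows "(\<lambda>x. a * f x) \<in> Lp_space M p" "Lp_norm M p (\<lambda>x. a * f x) = \<bar>a\<bar> * Lp_norm M p f"
proof -
  have i: "integrable M (\<lambda>x. \<bar>f x\<bar> powr p)" using f by (simp add: Lp_space_def)
  have e: "\<bar>a * f x\<bar> powr p = \<bar>a\<bar> powr p * \<bar>f x\<bar> powr p" for x
    by (simp add: abs_mult powr_mult)
  show "(\<lambda>x. a * f x) \<in> Lp_space M p"
    using i f unfolding Lp_space_def mem_Collect_eq e by auto
  show "Lp_norm M p (\<lambda>x. a * f x) = \<bar>a\<bar> * Lp_norm M p f"
    using p unfolding Lp_norm_def e by (simp add: powr_mult powr_powr integral_nonneg_AE)
qed

lemma Lp_zero: "(\<lambda>x. 0) \<in> Lp_space M p" "1 \<le> p ==> Lp_norm M p (\<lambda>x. 0) = 0"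
  by (auto simp: Lp_space_def Lp_norm_def)

lemma Lp_norm_eq_0:
  assumes p: "1 \<le> p" and f: "f \<in> Lp_space M p" and 0: "Lp_norm M p f = 0"
  shows "AE x in M. f x = 0"
proof -
  have "(\<integral>\<^sup>+x. ennreal (\<bar>f x\<bar> powr p) \<partial>M) = 0"
    unfolding Lp_norm_powr[OF p f] 0 using p by simp
  then have "AE x in M. ennreal (\<bar>f x\<bar> powr p) = 0"
    by (subst (asm) nn_integral_0_iff_AE) (use Lp_space_measurable[OF f] in auto)
  then show ?thesis by (auto elim!: eventually_mono)
qed

section \<open>Minkowski's inequality\<close>

lemma convex_powr:
  assumes p: "1 \<le> (p::real)"
  shows "convex_on {0..} (\<lambda>x::real. x powr p)"
proof (rule convex_onI)
  fix t x y :: real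
  assume t: "0 < t" "t < 1" and xy: "x \<in> {0..}" "y \<in> {0..}"
  \<comment> \<open>At the end point 0 convexity reduces to this inequality for weights between 0
    and 1.\<close>
  have s: "(s * z) powr p \<le> s * z powr p" if "0 < s" "s < 1" "0 \<le> z" for s z :: real
  proof -
    have "s powr p \<le> s powr 1" using that p by (intro powr_mono') auto
    then show ?thesis using that by (simp add: powr_mult mult_right_mono)
  qed
  show "((1 - t) *\<^sub>R x + t *\<^sub>R y) powr p \<le> (1 - t) * x powr p + t * y powr p"
  proof (cases "x = 0 \<or> y = 0")
    case True
    then show ?thesis using s[of t y] s[of "1 - t" x] t xy p by auto
  next
    case False
    then show ?thesis using convex_onD[OF powr_convex[OF p], of t x y] t xy by simp
  qed
qed simp

text \<open>Convexity of \<open>t \<mapsto> t powr p\<close>, applied at the weights \<open>a / (a + b)\<close> and \<open>b / (a + b)\<close>.\<close>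

lemma powr_add_le_convex:
  fixes x y :: real
  assumes p: "1 \<le> p" and ab: "0 < a" "0 < b"
  shows "\<bar>x + y\<bar> powr p \<le> (a + b) powr (p - 1) * (a powr (1 - p) * \<bar>x\<bar> powr p + b powr (1 - p) * \<bar>y\<bar> powr p)"
proof -
  let ?l = "a / (a + b)"
  have cv: "convex_on {0..} (\<lambda>x. x powr p)"
    using p by (rule convex_powr)
  have "(?l * (\<bar>x\<bar> / a) + (1 - ?l) * (\<bar>y\<bar> / b)) powr p \<le> ?l * (\<bar>x\<bar> / a) powr p + (1 - ?l) * (\<bar>y\<bar> / b) powr p"
    using convex_onD[OF cv, of "1 - ?l" "\<bar>x\<bar> / a" "\<bar>y\<bar> / b"] ab by simp
  moreover have "1 - ?l = b / (a + b)" using ab by (simp add: field_simps)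
  moreover have "?l * (\<bar>x\<bar> / a) + b / (a + b) * (\<bar>y\<bar> / b) = (\<bar>x\<bar> + \<bar>y\<bar>) / (a + b)"
    using ab by (simp add: add_divide_distrib)
  ultimately have 1: "((\<bar>x\<bar> + \<bar>y\<bar>) / (a + b)) powr p \<le> a / (a + b) * (\<bar>x\<bar> / a) powr p + b / (a + b) * (\<bar>y\<bar> / b) powr p"
    by metis
  have "\<bar>x + y\<bar> powr p \<le> (\<bar>x\<bar> + \<bar>y\<bar>) powr p" using p by (intro powr_mono2) auto
  also have "... = (a + b) powr p * ((\<bar>x\<bar> + \<bar>y\<bar>) / (a + b)) powr p"
    using ab by (subst powr_mult[symmetric]) auto
  also have "... \<le> (a + b) powr p * (a / (a + b) * (\<bar>x\<bar> / a) powr p + b / (a + b) * (\<bar>y\<bar> / b) powr p)"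
    by (rule mult_left_mono[OF 1]) simp
  also have "... = (a + b) powr (p - 1) * (a powr (1 - p) * \<bar>x\<bar> powr p + b powr (1 - p) * \<bar>y\<bar> powr p)"
  proof -
    have e: "s powr p * (c / s * (\<bar>z\<bar> / c) powr p) = s powr (p - 1) * (c powr (1 - p) * \<bar>z\<bar> powr p)"
      if "0 < s" "0 < c" for s c z :: real
      using that by (simp add: powr_divide powr_diff)
    show ?thesis using e[of "a + b" a x] e[of "a + b" b y] ab by (simp add: distrib_left)
  qed
  finally show ?thesis .
qed

text \<open>The convexity inequality is integrated with weights \<open>a\<close>, \<open>b\<close>
  strictly above the two norms, since the norms may vanish and the weights must be positive. Then
  \<open>a powr (1 - p) * a powr p = a\<close> collapses the bound to the p-th power of
  \<open>a + b\<close>, and \<open>a\<close>, \<open>b\<close> decrease to the norms.\<close>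

lemma Lp_add:
  assumes p: "1 \<le> p" and f: "f \<in> Lp_space M p" and g: "g \<in> Lp_space M p"
  shows "(\<lambda>x. f x + g x) \<in> Lp_space M p"
    and Lp_norm_triangle: "Lp_norm M p (\<lambda>x. f x + g x) \<le> Lp_norm M p f + Lp_norm M p g"
proof -
  have [measurable]: "f \<in> borel_measurable M" "g \<in> borel_measurable M"
    using f g by (auto simp: Lp_space_measurable)
  have *: "(\<lambda>x. f x + g x) \<in> Lp_space M p \<and> Lp_norm M p (\<lambda>x. f x + g x) \<le> a + b"
    if a: "Lp_norm M p f < a" and b: "Lp_norm M p g < b" for a b
  proof -
    have ab: "0 < a" "0 < b" using a b Lp_norm_nonneg[of M p] by (metis order.strict_trans1)+
    have fa: "(\<integral>\<^sup>+x. ennreal (\<bar>f x\<bar> powr p) \<partial>M) \<le> ennreal (a powr p)"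
      and gb: "(\<integral>\<^sup>+x. ennreal (\<bar>g x\<bar> powr p) \<partial>M) \<le> ennreal (b powr p)"
      using Lp_space_norm_le_iff[OF p, of a f M] Lp_space_norm_le_iff[OF p, of b g M] a b ab f g by auto
    let ?c = "ennreal ((a + b) powr (p - 1))" and ?A = "ennreal (a powr (1 - p))" and ?B = "ennreal (b powr (1 - p))"
    have "(\<integral>\<^sup>+x. ennreal (\<bar>f x + g x\<bar> powr p) \<partial>M)
      \<le> (\<integral>\<^sup>+x. ?c * (?A * ennreal (\<bar>f x\<bar> powr p) + ?B * ennreal (\<bar>g x\<bar> powr p)) \<partial>M)"
      using powr_add_le_convex[OF p ab]
      by (intro nn_integral_mono) (simp add: ennreal_mult'[symmetric] ennreal_plus[symmetric] del: ennreal_plus)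
    also have "... = ?c * (?A * (\<integral>\<^sup>+x. ennreal (\<bar>f x\<bar> powr p) \<partial>M) + ?B * (\<integral>\<^sup>+x. ennreal (\<bar>g x\<bar> powr p) \<partial>M))"
      by (simp add: nn_integral_cmult nn_integral_add)
    also have "... \<le> ?c * (?A * ennreal (a powr p) + ?B * ennreal (b powr p))"
      by (intro mult_left_mono add_mono fa gb) auto
    also have "... = ennreal ((a + b) powr (p - 1) * (a powr (1 - p) * a powr p + b powr (1 - p) * b powr p))"
      by (simp add: ennreal_mult'[symmetric] ennreal_plus[symmetric] del: ennreal_plus)
    also have "(a + b) powr (p - 1) * (a powr (1 - p) * a powr p + b powr (1 - p) * b powr p) = (a + b) powr p"
      using ab by (simp add: powr_add[symmetric] powr_mult_base' powr_diff)
    finally show ?thesis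
      using Lp_space_norm_leI[OF p, of "a + b" "\<lambda>x. f x + g x" M] ab by auto
  qed
  show "(\<lambda>x. f x + g x) \<in> Lp_space M p"
    using *[of "Lp_norm M p f + 1" "Lp_norm M p g + 1"] by simp
  show "Lp_norm M p (\<lambda>x. f x + g x) \<le> Lp_norm M p f + Lp_norm M p g"
  proof (rule field_le_epsilon)
    fix e :: real assume "0 < e"
    then show "Lp_norm M p (\<lambda>x. f x + g x) \<le> Lp_norm M p f + Lp_norm M p g + e"
      using *[of "Lp_norm M p f + e/2" "Lp_norm M p g + e/2"] by simp
  qed
qed

lemma Lp_diff:
  assumes p: "1 \<le> p" and f: "f \<in> Lp_space M p" and g: "g \<in> Lp_space M p"
  shows "(\<lambda>x. f x - g x) \<in> Lp_space M p"
    and Lp_norm_diff_triangle: "Lp_norm M p (\<lambda>x. f x - g x) \<le> Lp_norm M p f + Lp_norm M p g"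
  using Lp_add[OF p f Lp_scale(1)[OF p g, of "-1"]] Lp_scale(2)[OF p g, of "-1"] by simp_all

lemma Lp_norm_minus_commute: "Lp_norm M p (\<lambda>x. f x - g x) = Lp_norm M p (\<lambda>x. g x - f x)"
  by (simp add: Lp_norm_def abs_minus_commute)

lemma Lp_norm_triangle_diff:
  assumes p: "1 \<le> p" and f: "f \<in> Lp_space M p" and g: "g \<in> Lp_space M p" and h: "h \<in> Lp_space M p"
  shows "Lp_norm M p (\<lambda>x. f x - h x) \<le> Lp_norm M p (\<lambda>x. f x - g x) + Lp_norm M p (\<lambda>x. g x - h x)"
  using Lp_norm_triangle[OF p Lp_diff(1)[OF p f g] Lp_diff(1)[OF p g h]] by simp

lemma Lp_norm_le_diff:
  assumes p: "1 \<le> p" and f: "f \<in> Lp_space M p" and g: "g \<in> Lp_space M p"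
  shows "Lp_norm M p f \<le> Lp_norm M p g + Lp_norm M p (\<lambda>x. f x - g x)"
  using Lp_norm_triangle[OF p g Lp_diff(1)[OF p f g]] by simp

lemma Lp_sum:
  assumes p: "1 \<le> p" and "\<And>i. i \<in> I ==> f i \<in> Lp_space M p"
  shows "(\<lambda>x. \<Sum>i\<in>I. f i x) \<in> Lp_space M p"
    and Lp_norm_sum: "Lp_norm M p (\<lambda>x. \<Sum>i\<in>I. f i x) \<le> (\<Sum>i\<in>I. Lp_norm M p (f i))"
proof -
  have "(\<lambda>x. \<Sum>i\<in>I. f i x) \<in> Lp_space M p \<and> Lp_norm M p (\<lambda>x. \<Sum>i\<in>I. f i x) \<le> (\<Sum>i\<in>I. Lp_norm M p (f i))"
    using assms(2)
  proof (induction I rule: infinite_finite_induct)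
    case (insert i I)
    then have a: "f i \<in> Lp_space M p" "(\<lambda>x. \<Sum>i\<in>I. f i x) \<in> Lp_space M p"
      and b: "Lp_norm M p (\<lambda>x. \<Sum>i\<in>I. f i x) \<le> (\<Sum>i\<in>I. Lp_norm M p (f i))" by auto
    show ?case
      using Lp_add(1)[OF p a] Lp_norm_triangle[OF p a] b insert(1,2) by simp
  qed (use p in \<open>auto simp: Lp_zero\<close>)
  then show "(\<lambda>x. \<Sum>i\<in>I. f i x) \<in> Lp_space M p"
    "Lp_norm M p (\<lambda>x. \<Sum>i\<in>I. f i x) \<le> (\<Sum>i\<in>I. Lp_norm M p (f i))" by auto
qed

section \<open>Fatou's lemma and completeness\<close>

lemma Lp_Fatou:
  assumes p: "1 \<le> p" and C: "0 \<le> C" and u: "\<And>n. u n \<in> Lp_space M p" and le: "\<And>n. Lp_norm M p (u n) \<le> C"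
    and f: "f \<in> borel_measurable M" and lim: "AE x in M. (\<lambda>n. u n x) \<longlonglongrightarrow> f x"
  shows "f \<in> Lp_space M p" "Lp_norm M p f \<le> C"
proof -
  have "(\<integral>\<^sup>+x. ennreal (\<bar>f x\<bar> powr p) \<partial>M) = (\<integral>\<^sup>+x. liminf (\<lambda>n. ennreal (\<bar>u n x\<bar> powr p)) \<partial>M)"
  proof (rule nn_integral_cong_AE)
    show "AE x in M. ennreal (\<bar>f x\<bar> powr p) = liminf (\<lambda>n. ennreal (\<bar>u n x\<bar> powr p))"
      using lim
    proof (rule eventually_mono)
      fix x assume "(\<lambda>n. u n x) \<longlonglongrightarrow> f x"
      then have "(\<lambda>n. \<bar>u n x\<bar> powr p) \<longlonglongrightarrow> \<bar>f x\<bar> powr p"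
        using p by (intro tendsto_powr2 tendsto_rabs tendsto_const) auto
      then have "(\<lambda>n. ennreal (\<bar>u n x\<bar> powr p)) \<longlonglongrightarrow> ennreal (\<bar>f x\<bar> powr p)"
        by (rule tendsto_ennrealI)
      then show "ennreal (\<bar>f x\<bar> powr p) = liminf (\<lambda>n. ennreal (\<bar>u n x\<bar> powr p))"
        by (rule lim_imp_Liminf[OF sequentially_bot, symmetric])
    qed
  qed
  also have "... \<le> liminf (\<lambda>n. \<integral>\<^sup>+x. ennreal (\<bar>u n x\<bar> powr p) \<partial>M)"
    by (rule nn_integral_liminf) (use Lp_space_measurable[OF u] in auto)
  also have "... \<le> liminf (\<lambda>n. ennreal (C powr p))"
    by (intro Liminf_mono always_eventually allI)
      (use Lp_space_norm_le_iff[OF p C, of _ M] u le in blast)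
  also have "... = ennreal (C powr p)" by (simp add: Liminf_const)
  finally have "(\<integral>\<^sup>+x. ennreal (\<bar>f x\<bar> powr p) \<partial>M) \<le> ennreal (C powr p)" .
  from Lp_space_norm_leI[OF p C f this] show "f \<in> Lp_space M p" "Lp_norm M p f \<le> C" .
qed

text \<open>Riesz-Fischer for absolutely convergent series. The tail estimate is part of the
  conclusion because the gliding hump construction needs the distance to the limit with its
  constant.\<close>

lemma Lp_complete:
  assumes p: "1 \<le> p" and u: "\<And>n. u n \<in> Lp_space M p" and le: "\<And>n. Lp_norm M p (u n) \<le> c n"
    and c: "summable c"
  obtains f where "f \<in> Lp_space M p"
    "\<And>m. Lp_norm M p (\<lambda>x. f x - (\<Sum>k<m. u k x)) \<le> (\<Sum>k. c (k + m))"
proof -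
  have [measurable]: "u n \<in> borel_measurable M" for n using u[of n] by (rule Lp_space_measurable)
  have c0: "0 \<le> c n" for n using le[of n] Lp_norm_nonneg[of M p "u n"] by linarith
  have C0: "0 \<le> suminf c" using c c0 by (simp add: suminf_nonneg)
  let ?G = "\<lambda>m x. \<Sum>k<m. \<bar>u k x\<bar>"
  have absu: "(\<lambda>x. \<bar>u k x\<bar>) \<in> Lp_space M p" "Lp_norm M p (\<lambda>x. \<bar>u k x\<bar>) \<le> c k" for k
    using u[of k] le[of k] by (auto simp: Lp_space_def Lp_norm_def)
  have GL: "?G m \<in> Lp_space M p" "Lp_norm M p (?G m) \<le> suminf c" for m
  proof -
    show "?G m \<in> Lp_space M p" using Lp_sum(1)[OF p, of "{..<m}" "\<lambda>k x. \<bar>u k x\<bar>"] absu by auto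
    have "Lp_norm M p (?G m) \<le> (\<Sum>k<m. Lp_norm M p (\<lambda>x. \<bar>u k x\<bar>))"
      using Lp_norm_sum[OF p, of "{..<m}" "\<lambda>k x. \<bar>u k x\<bar>"] absu by auto
    also have "... \<le> (\<Sum>k<m. c k)" by (intro sum_mono absu)
    also have "... \<le> suminf c" by (intro sum_le_suminf c) (use c0 in auto)
    finally show "Lp_norm M p (?G m) \<le> suminf c" .
  qed
  have nn: "(\<integral>\<^sup>+x. ennreal (\<bar>?G m x\<bar> powr p) \<partial>M) \<le> ennreal (suminf c powr p)" for m
    using Lp_space_norm_le_iff[OF p C0, of "?G m" M] GL[of m] by blast
  have "(\<integral>\<^sup>+x. (SUP m. ennreal (\<bar>?G m x\<bar> powr p)) \<partial>M) = (SUP m. \<integral>\<^sup>+x. ennreal (\<bar>?G m x\<bar> powr p) \<partial>M)"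
  proof (rule nn_integral_monotone_convergence_SUP)
    show "incseq (\<lambda>m x. ennreal (\<bar>?G m x\<bar> powr p))"
      unfolding incseq_def le_fun_def
      using p by (auto intro!: ennreal_leI powr_mono2 sum_mono2 simp: sum_nonneg)
  qed auto
  also have "... \<le> ennreal (suminf c powr p)" by (rule SUP_least) (rule nn)
  finally have "(\<integral>\<^sup>+x. (SUP m. ennreal (\<bar>?G m x\<bar> powr p)) \<partial>M) \<noteq> \<infinity>"
    by (auto simp: top_unique)
  then have "AE x in M. (SUP m. ennreal (\<bar>?G m x\<bar> powr p)) \<noteq> \<infinity>"
    by (intro nn_integral_PInf_AE) auto
  \<comment> \<open>A finite integral of the supremum makes the partial sums of absolute values
    bounded at almost every point.\<close>
  then have sm: "AE x in M. summable (\<lambda>k. u k x)"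
  proof (rule eventually_mono)
    fix x assume fin: "(SUP m. ennreal (\<bar>?G m x\<bar> powr p)) \<noteq> \<infinity>"
    then obtain r where r: "(SUP m. ennreal (\<bar>?G m x\<bar> powr p)) = ennreal r" "0 \<le> r"
      by (metis ennreal_cases infinity_ennreal_def)
    have "?G m x \<le> r powr (1 / p)" for m
    proof -
      have "ennreal (\<bar>?G m x\<bar> powr p) \<le> ennreal r" unfolding r(1)[symmetric] by (rule SUP_upper) simp
      then have "?G m x powr p \<le> r" using r(2) by (simp add: ennreal_le_iff sum_nonneg)
      then have "(?G m x powr p) powr (1 / p) \<le> r powr (1/p)" using p by (intro powr_mono2) auto
      then show ?thesis using p by (simp add: powr_powr sum_nonneg)
    qed
    then have "summable (\<lambda>k. \<bar>u k x\<bar>)" by (intro bounded_imp_summable[of _ "r powr (1/p)"])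
       (auto simp: lessThan_Suc_atMost[symmetric] simp del: sum.lessThan_Suc)
    then show "summable (\<lambda>k. u k x)" by (rule summable_rabs_cancel)
  qed
  let ?f = "\<lambda>x. \<Sum>k. u k x"
  have *: "(\<lambda>x. ?f x - (\<Sum>k<m. u k x)) \<in> Lp_space M p \<and>
     Lp_norm M p (\<lambda>x. ?f x - (\<Sum>k<m. u k x)) \<le> (\<Sum>k. c (k + m))" for m
  proof -
    have cm: "summable (\<lambda>k. c (k + m))" using c by (simp add: summable_iff_shift)
    have s0: "0 \<le> (\<Sum>k. c (k + m))" using cm c0 by (simp add: suminf_nonneg)
    let ?w = "\<lambda>n x. \<Sum>k<n. u (k + m) x"
    have w1: "?w n \<in> Lp_space M p" for n using Lp_sum(1)[OF p, of "{..<n}" "\<lambda>k. u (k+m)"] u by auto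
    have w2: "Lp_norm M p (?w n) \<le> (\<Sum>k. c (k + m))" for n
    proof -
      have "Lp_norm M p (?w n) \<le> (\<Sum>k<n. Lp_norm M p (u (k + m)))"
        using Lp_norm_sum[OF p, of "{..<n}" "\<lambda>k. u (k+m)"] u by auto
      also have "... \<le> (\<Sum>k<n. c (k + m))" by (intro sum_mono le)
      also have "... \<le> (\<Sum>k. c (k + m))" by (intro sum_le_suminf cm) (use c0 in auto)
      finally show ?thesis .
    qed
    \<comment> \<open>The remainder is the pointwise limit of the shifted partial sums, so Fatou's
      lemma bounds its norm.\<close>
    have lim: "AE x in M. (\<lambda>n. ?w n x) \<longlonglongrightarrow> ?f x - (\<Sum>k<m. u k x)"
      using sm
    proof (rule eventually_mono)
      fix x assume s: "summable (\<lambda>k. u k x)"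
      then have "(\<lambda>k. u (k + m) x) sums (?f x - (\<Sum>k<m. u k x))"
        by (intro sums_split_initial_segment[of "\<lambda>k. u k x"] summable_sums)
      then show "(\<lambda>n. ?w n x) \<longlonglongrightarrow> ?f x - (\<Sum>k<m. u k x)" by (simp add: sums_def)
    qed
    show ?thesis using Lp_Fatou[OF p s0 w1 w2 _ lim] by simp
  qed
  show thesis
    by (rule that[of ?f]) (use *[of 0] * in auto)
qed

section \<open>Semigroups and generators\<close>

lemma Lp_op_space: "Lp_bounded_operator M p A ==> f \<in> Lp_space M p ==> A f \<in> Lp_space M p"
  by (simp add: Lp_bounded_operator_def)

lemma Lp_op_cong:
  "Lp_bounded_operator M p A ==> f \<in> Lp_space M p ==> g \<in> Lp_space M p ==>
   AE x in M. f x = g x ==> AE x in M. A f x = A g x"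
  by (simp add: Lp_bounded_operator_def)

lemma Lp_op_linear:
  "Lp_bounded_operator M p A ==> f \<in> Lp_space M p ==> g \<in> Lp_space M p ==>
   AE x in M. A (\<lambda>y. a * f y + b * g y) x = a * A f x + b * A g x"
  by (simp add: Lp_bounded_operator_def)

lemma Lp_lincomb:
  "1 \<le> p ==> f \<in> Lp_space M p ==> g \<in> Lp_space M p ==> (\<lambda>y. a * f y + b * g y) \<in> Lp_space M p"
  by (intro Lp_add Lp_scale)

lemma Lp_op_norm_lincomb:
  assumes p: "1 \<le> p" and A: "Lp_bounded_operator M p A" and f: "f \<in> Lp_space M p" and g: "g \<in> Lp_space M p"
  shows "Lp_norm M p (A (\<lambda>y. a * f y + b * g y)) = Lp_norm M p (\<lambda>x. a * A f x + b * A g x)"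
  by (intro Lp_norm_cong_AE Lp_op_linear[OF A f g] Lp_space_measurable[of _ M p]
      Lp_op_space[OF A] Lp_lincomb p f g)

lemma Lp_op_norm_scale:
  assumes p: "1 \<le> p" and A: "Lp_bounded_operator M p A" and f: "f \<in> Lp_space M p"
  shows "Lp_norm M p (A (\<lambda>y. a * f y)) = \<bar>a\<bar> * Lp_norm M p (A f)"
  using Lp_op_norm_lincomb[OF p A f f, of a 0] Lp_scale(2)[OF p Lp_op_space[OF A f], of a] by simp

lemma Lp_op_norm_diff:
  assumes p: "1 \<le> p" and A: "Lp_bounded_operator M p A" and f: "f \<in> Lp_space M p" and g: "g \<in> Lp_space M p"
  shows "Lp_norm M p (A (\<lambda>y. f y - g y)) = Lp_norm M p (\<lambda>x. A f x - A g x)"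
  using Lp_op_norm_lincomb[OF p A f g, of 1 "-1"] by simp

text \<open>The gliding hump argument of Sokal, which avoids the Baire category theorem.\<close>

lemma Lp_uniform_boundedness:
  fixes A :: "nat => ('a => real) => ('a => real)"
  assumes p: "1 \<le> p" and A: "\<And>n. Lp_bounded_operator M p (A n)"
    and pt: "\<And>f. f \<in> Lp_space M p ==> \<exists>C. \<forall>n. Lp_norm M p (A n f) \<le> C"
  shows "\<exists>C. \<forall>n. \<forall>f\<in>Lp_space M p. Lp_norm M p (A n f) \<le> C * Lp_norm M p f"
proof (rule ccontr)
  assume contra: "\<nexists>C. \<forall>n. \<forall>f\<in>Lp_space M p. Lp_norm M p (A n f) \<le> C * Lp_norm M p f"
  let ?N = "Lp_norm M p"
  define Q where "Q n = (\<lambda>f. ?N (A n f)) ` {f \<in> Lp_space M p. ?N f \<le> 1}" for n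
  \<comment> \<open>The operator norm of \<open>A n\<close>, as a supremum over the closed unit
    ball.\<close>
  define B where "B n = Sup (Q n)" for n
  have bdd: "bdd_above (Q n)" for n
  proof -
    from A[of n] obtain C where C: "\<And>f. f \<in> Lp_space M p ==> ?N (A n f) \<le> C * ?N f"
      unfolding Lp_bounded_operator_def by blast
    have "y \<le> \<bar>C\<bar>" if "y \<in> Q n" for y
    proof -
      from that obtain f where f: "f \<in> Lp_space M p" "?N f \<le> 1" "y = ?N (A n f)" by (auto simp: Q_def)
      have "C * ?N f \<le> \<bar>C\<bar> * 1" using f(2) by (intro mult_mono) auto
      then show ?thesis using C[OF f(1)] f(3) by simp
    qed
    then show ?thesis by (rule bdd_aboveI)
  qed
  have ne: "Q n \<noteq> {}" for n using Lp_zero(1)[of M p] Lp_zero(2)[of p M] p by (force simp: Q_def)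
  have B: "?N (A n f) \<le> B n * ?N f" if f: "f \<in> Lp_space M p" for n f
  proof (cases "?N f = 0")
    case True
    from A[of n] obtain C where "?N (A n f) \<le> C * ?N f"
      unfolding Lp_bounded_operator_def using f by blast
    then show ?thesis using True by simp
  next
    case False
    then have pos: "0 < ?N f" using Lp_norm_nonneg[of M p f] by linarith
    have "?N (\<lambda>x. 1 / ?N f * f x) \<le> 1" using Lp_scale(2)[OF p f, of "1 / ?N f"] pos by simp
    then have "?N (A n (\<lambda>x. 1 / ?N f * f x)) \<in> Q n"
      using Lp_scale(1)[OF p f, of "1 / ?N f"] by (auto simp: Q_def)
    then have "?N (A n (\<lambda>x. 1 / ?N f * f x)) \<le> B n" unfolding B_def using bdd by (rule cSup_upper)
    then show ?thesis unfolding Lp_op_norm_scale[OF p A f] using pos by (simp add: field_simps)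
  qed
  \<comment> \<open>The rate 12 is chosen against the weights (1/3)^k of the series below: the
    product 4^k still tends to infinity.\<close>
  have "\<exists>n. 12 ^ k < B n" for k :: nat
  proof (rule ccontr)
    assume "\<nexists>n. 12 ^ k < B n"
    then have le: "B n \<le> 12 ^ k" for n by (simp add: not_less)
    have "?N (A n f) \<le> 12 ^ k * ?N f" if "f \<in> Lp_space M p" for n f
      using B[OF that, of n] mult_right_mono[OF le, of "?N f" n] by simp
    then show False using contra by blast
  qed
  then have "\<exists>n. \<forall>k::nat. 12 ^ k < B (n k)" by (rule choice[OF allI])
  then obtain n where n: "\<And>k::nat. 12 ^ k < B (n k)" by blast
  have Bpos: "0 < B (n k)" for k using n[of k] by (rule order.strict_trans[rotated]) simp
  have "\<exists>f. f \<in> Lp_space M p \<and> ?N f \<le> 1 \<and> 3/4 * B (n k) < ?N (A (n k) f)" for k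
  proof -
    have "3/4 * B (n k) < Sup (Q (n k))" using Bpos[of k] by (simp add: B_def)
    then obtain y where "y \<in> Q (n k)" "3/4 * B (n k) < y" using less_cSupE[OF _ ne] by blast
    then show ?thesis by (auto simp: Q_def)
  qed
  then obtain f where f: "\<And>k. f k \<in> Lp_space M p" "\<And>k. ?N (f k) \<le> 1"
    "\<And>k. 3/4 * B (n k) < ?N (A (n k) (f k))" using choice[of "\<lambda>k f. f \<in> Lp_space M p \<and> ?N f \<le> 1 \<and> 3/4 * B (n k) < ?N (A (n k) f)"] by blast
  \<comment> \<open>The sign of the next hump is 1 if that already makes the image under
    \<open>A (n k)\<close> as large as the image of the hump, and -1 otherwise.\<close>
  let ?y = "\<lambda>k x s z. x z + s * ((1/3)^k * f k z)"
  define x where "x = rec_nat (\<lambda>_. 0::real) (\<lambda>k x. if (1/3)^k * ?N (A (n k) (f k)) \<le> ?N (A (n k) (?y k x 1))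
       then ?y k x 1 else ?y k x (-1))"
  define e where "e k = (if (1/3)^k * ?N (A (n k) (f k)) \<le> ?N (A (n k) (?y k (x k) 1)) then 1 else -1::real)" for k
  have x0: "x 0 = (\<lambda>_. 0)" by (simp add: x_def)
  have xS: "x (Suc k) = ?y k (x k) (e k)" for k by (simp add: x_def e_def)
  have e1: "\<bar>e k\<bar> = 1" for k by (simp add: e_def)
  have xL: "x k \<in> Lp_space M p" for k
    by (induction k) (auto simp: x0 xS Lp_zero intro!: Lp_add Lp_scale p f)
  have big: "(1/3)^k * ?N (A (n k) (f k)) \<le> ?N (A (n k) (x (Suc k)))" for k
  proof (cases "(1/3)^k * ?N (A (n k) (f k)) \<le> ?N (A (n k) (?y k (x k) 1))")
    case True then show ?thesis by (simp add: xS e_def)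
  next
    case False
    let ?g = "\<lambda>z. (1/3)^k * f k z"
    have g: "?g \<in> Lp_space M p" by (intro Lp_scale p f)
    have Ag: "?N (A (n k) ?g) = (1/3)^k * ?N (A (n k) (f k))" using Lp_op_norm_scale[OF p A f(1)] by simp
    have L: "A (n k) (?y k (x k) s) \<in> Lp_space M p" for s by (intro Lp_op_space[OF A] Lp_add Lp_scale p f xL)
    have L': "?y k (x k) s \<in> Lp_space M p" for s by (intro Lp_add Lp_scale p f xL)
    \<comment> \<open>The hump is half the difference of the two candidates, so at least one of them
      has an image as large as that of the hump.\<close>
    have "?N (A (n k) (\<lambda>z. 1/2 * ?y k (x k) 1 z + (-1/2) * ?y k (x k) (-1) z))
      = ?N (\<lambda>z. 1/2 * A (n k) (?y k (x k) 1) z + (-1/2) * A (n k) (?y k (x k) (-1)) z)"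
      by (rule Lp_op_norm_lincomb[OF p A L' L'])
    also have "... \<le> ?N (\<lambda>z. 1/2 * A (n k) (?y k (x k) 1) z) + ?N (\<lambda>z. (-1/2) * A (n k) (?y k (x k) (-1)) z)"
      by (intro Lp_norm_triangle[OF p] Lp_scale p L)
    also have "... = 1/2 * ?N (A (n k) (?y k (x k) 1)) + 1/2 * ?N (A (n k) (?y k (x k) (-1)))"
      using Lp_scale(2)[OF p L[of 1], of "1/2"] Lp_scale(2)[OF p L[of "-1"], of "-1/2"] by simp
    also have "(\<lambda>z. 1/2 * ?y k (x k) 1 z + (-1/2) * ?y k (x k) (-1) z) = ?g" by (auto simp: field_simps)
    finally have "2 * ?N (A (n k) ?g) \<le> ?N (A (n k) (?y k (x k) 1)) + ?N (A (n k) (?y k (x k) (-1)))" by simp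
    then show ?thesis using False Ag by (simp add: xS e_def)
  qed
  let ?u = "\<lambda>k z. e k * ((1/3)^k * f k z)"
  have uL: "?u k \<in> Lp_space M p" for k by (intro Lp_scale p f)
  have uN: "?N (?u k) \<le> (1/3)^k" for k
    using Lp_scale(2)[OF p Lp_scale(1)[OF p f(1)], of "e k" "(1/3)^k" k] Lp_scale(2)[OF p f(1), of "(1/3)^k" k] e1[of k] f(2)[of k]
    by (simp add: field_simps)
  have sm: "summable (\<lambda>k. (1/3::real)^k)" by (simp add: summable_geometric)
  obtain g where g: "g \<in> Lp_space M p" "\<And>m. ?N (\<lambda>z. g z - (\<Sum>k<m. ?u k z)) \<le> (\<Sum>k. (1/3)^(k+m))"
    using Lp_complete[OF p uL uN sm] by blast
  have xsum: "x m = (\<lambda>z. \<Sum>k<m. ?u k z)" for m by (induction m) (auto simp: x0 xS)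
  \<comment> \<open>The later humps sum to at most (1/3)^(k+1) * 3/2, which is half the weight at
    step \<open>k\<close>. As each hump attains 3/4 of the operator norm, a quarter survives
    below.\<close>
  have gx: "?N (\<lambda>z. g z - x (Suc k) z) \<le> 1/2 * (1/3)^k" for k
  proof -
    have "(\<Sum>j. (1/3::real)^(j + Suc k)) = (\<Sum>j. (1/3)^Suc k * (1/3)^j)" by (simp add: power_add mult_ac)
    also have "... = (1/3)^Suc k * (\<Sum>j. (1/3)^j)" using sm by (rule suminf_mult)
    also have "(\<Sum>j. (1/3::real)^j) = 3/2" by (subst suminf_geometric) auto
    finally show ?thesis using g(2)[of "Suc k"] by (simp add: xsum)
  qed
  have low: "1/4 * 4 ^ k \<le> ?N (A (n k) g)" for k
  proof -
    have "(1/3)^k * (3/4 * B (n k)) \<le> (1/3)^k * ?N (A (n k) (f k))"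
      using f(3)[of k] by (intro mult_left_mono) auto
    also have "... \<le> ?N (A (n k) (x (Suc k)))" by (rule big)
    also have "... \<le> ?N (A (n k) g) + ?N (\<lambda>z. A (n k) (x (Suc k)) z - A (n k) g z)"
      by (rule Lp_norm_le_diff[OF p Lp_op_space[OF A xL] Lp_op_space[OF A g(1)]])
    also have "?N (\<lambda>z. A (n k) (x (Suc k)) z - A (n k) g z) = ?N (A (n k) (\<lambda>z. x (Suc k) z - g z))"
      by (rule Lp_op_norm_diff[OF p A xL g(1), symmetric])
    also have "... \<le> B (n k) * ?N (\<lambda>z. x (Suc k) z - g z)" by (rule B[OF Lp_diff(1)[OF p xL g(1)]])
    also have "... \<le> B (n k) * (1/2 * (1/3)^k)"
      using gx[of k] Bpos[of k] by (intro mult_left_mono) (auto simp: Lp_norm_minus_commute)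
    finally have "1/4 * ((1/3)^k * B (n k)) \<le> ?N (A (n k) g)" by (simp add: algebra_simps)
    moreover have "(1/3)^k * 12 ^ k \<le> (1/3)^k * B (n k)" using n[of k] by (intro mult_left_mono) auto
    moreover have "(1/3::real)^k * 12 ^ k = 4 ^ k" by (simp add: power_mult_distrib[symmetric])
    ultimately show ?thesis by simp
  qed
  obtain C where C: "\<And>n. ?N (A n g) \<le> C" using pt[OF g(1)] by blast
  obtain k where "4 * C < 4 ^ k" using real_arch_pow[of 4 "4 * C"] by auto
  then show False using low[of k] C[of "n k"] by simp
qed

section \<open>Growth and continuity of orbits\<close>

lemma C0_semigroupD:
  assumes "C0_semigroup M p U"
  shows "0 \<le> t ==> Lp_bounded_operator M p (U t)"
    and "f \<in> Lp_space M p ==> AE x in M. U 0 f x = f x"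
    and "0 \<le> s ==> 0 \<le> t ==> f \<in> Lp_space M p ==> AE x in M. U (s + t) f x = U s (U t f) x"
    and "f \<in> Lp_space M p ==> ((\<lambda>t. Lp_norm M p (\<lambda>x. U t f x - f x)) \<longlongrightarrow> 0) (at_right 0)"
  using assms unfolding C0_semigroup_def by auto

text \<open>If every interval [0,d] failed for every constant, there would be times
  \<open>s k\<close> tending to 0 with operator norms above \<open>k\<close>. Strong continuity at 0
  bounds each orbit along these times, which contradicts uniform boundedness. The semigroup law
  carries the bound from [0,d] to [0,t].\<close>

lemma C0_semigroup_locally_bounded:
  assumes p: "1 \<le> p" and U: "C0_semigroup M p U"
  shows "\<exists>C\<ge>0. \<forall>s\<in>{0..t}. \<forall>f\<in>Lp_space M p. Lp_norm M p (U s f) \<le> C * Lp_norm M p f"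
proof -
  let ?N = "Lp_norm M p"
  note Ub = C0_semigroupD(1)[OF U]
  have UL: "U s f \<in> Lp_space M p" if "0 \<le> s" "f \<in> Lp_space M p" for s f
    using Lp_op_space[OF Ub] that by auto
  have U0: "?N (U 0 f) = ?N f" if "f \<in> Lp_space M p" for f
    by (rule Lp_norm_cong_AE) (use that UL C0_semigroupD(2)[OF U that] in \<open>auto intro: Lp_space_measurable\<close>)
  have US: "?N (U (s + r) f) = ?N (U s (U r f))" if "f \<in> Lp_space M p" "0 \<le> s" "0 \<le> r" for f s r
    by (rule Lp_norm_cong_AE)
      (use that UL C0_semigroupD(3)[OF U that(2,3,1)] in \<open>auto intro!: Lp_space_measurable[of _ M p]\<close>)
  have "\<exists>d>0. \<exists>C. \<forall>s\<in>{0..d}. \<forall>f\<in>Lp_space M p. ?N (U s f) \<le> C * ?N f"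
  proof (rule ccontr)
    assume contra: "\<not> ?thesis"
    have "\<exists>s. s \<in> {0..inverse (real (Suc k))} \<and> (\<exists>f\<in>Lp_space M p. real k * ?N f < ?N (U s f))" for k
    proof -
      have "0 < inverse (real (Suc k))" by simp
      then have "\<not> (\<exists>C. \<forall>s\<in>{0..inverse (real (Suc k))}. \<forall>f\<in>Lp_space M p. ?N (U s f) \<le> C * ?N f)"
        using contra by blast
      then have "\<not> (\<forall>s\<in>{0..inverse (real (Suc k))}. \<forall>f\<in>Lp_space M p. ?N (U s f) \<le> real k * ?N f)" by blast
      then obtain s f where "s \<in> {0..inverse (real (Suc k))}" "f \<in> Lp_space M p" "\<not> (?N (U s f) \<le> real k * ?N f)"
        by blast
      then show ?thesis by (intro exI[of _ s] conjI bexI[of _ f]) auto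
    qed
    then obtain s where s: "\<And>k. s k \<in> {0..inverse (real (Suc k))}"
      "\<And>k. \<exists>f\<in>Lp_space M p. real k * ?N f < ?N (U (s k) f)" by metis
    have s0: "0 \<le> s k" for k using s(1)[of k] by simp
    have "\<exists>C. \<forall>n. ?N (U (s n) f) \<le> C" if f: "f \<in> Lp_space M p" for f
    proof -
      have "eventually (\<lambda>h. ?N (\<lambda>x. U h f x - f x) < 1) (at_right 0)"
        using C0_semigroupD(4)[OF U f] by (rule order_tendstoD) simp
      then obtain d where d: "0 < d" "\<And>h. 0 < h ==> h < d ==> ?N (\<lambda>x. U h f x - f x) < 1"
        unfolding eventually_at_right_field by auto
      obtain K where K: "inverse (real (Suc K)) < d" using reals_Archimedean[OF d(1)] by auto
      \<comment> \<open>From index \<open>K\<close> on the times lie below \<open>d\<close>, where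
        the orbit stays within 1 of \<open>f\<close>; the finitely many earlier norms are added
        up.\<close>
      define C where "C = ?N f + 1 + (\<Sum>k<K. ?N (U (s k) f))"
      have sn: "0 \<le> (\<Sum>k<K. ?N (U (s k) f))" by (simp add: sum_nonneg)
      have "?N (U (s n) f) \<le> C" for n
      proof (cases "n < K")
        case True
        have "?N (U (s n) f) \<le> (\<Sum>k<K. ?N (U (s k) f))" by (rule member_le_sum) (use True in auto)
        then show ?thesis using Lp_norm_nonneg[of M p f] unfolding C_def by linarith
      next
        case False
        have "inverse (real (Suc n)) \<le> inverse (real (Suc K))" using False by (intro le_imp_inverse_le) auto
        then have sd: "s n < d" using K s(1)[of n] unfolding atLeastAtMost_iff by linarith
        have "?N (U (s n) f) \<le> ?N f + 1"
        proof (cases "s n = 0")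
          case True then show ?thesis using U0[OF f] by simp
        next
          case False
          then have "?N (\<lambda>x. U (s n) f x - f x) < 1" using d(2) sd s0[of n] by simp
          then show ?thesis using Lp_norm_le_diff[OF p UL[OF s0 f] f, of n] by simp
        qed
        then show ?thesis using sn unfolding C_def by linarith
      qed
      then show ?thesis by blast
    qed
    from Lp_uniform_boundedness[OF p Ub[OF s0] this] obtain C
      where C: "\<And>n f. f \<in> Lp_space M p ==> ?N (U (s n) f) \<le> C * ?N f" by blast
    obtain k where k: "C \<le> real k" using real_arch_simple by blast
    obtain f where f: "f \<in> Lp_space M p" "real k * ?N f < ?N (U (s k) f)" using s(2) by blast
    have "C * ?N f \<le> real k * ?N f" using k by (intro mult_right_mono) auto
    then show False using C[OF f(1), of k] f(2) by simp
  qed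
  then obtain d C0 where d: "0 < d"
    and C0: "\<And>s f. s \<in> {0..d} ==> f \<in> Lp_space M p ==> ?N (U s f) \<le> C0 * ?N f" by blast
  \<comment> \<open>At least 1, so that its powers increase with the number of steps.\<close>
  define C where "C = max 1 C0"
  have C1: "1 \<le> C" by (simp add: C_def)
  have C: "?N (U s f) \<le> C * ?N f" if "s \<in> {0..d}" "f \<in> Lp_space M p" for s f
    using C0[OF that] mult_right_mono[of C0 C "?N f"] by (simp add: C_def)
  have *: "?N (U s f) \<le> C ^ Suc n * ?N f" if "s \<in> {0..real (Suc n) * d}" "f \<in> Lp_space M p" for n s f
    using that
  proof (induction n arbitrary: s f)
    case 0 then show ?case using C by simp
  next
    case (Suc n)
    show ?case
    proof (cases "s \<le> d")
      case True
      then have "?N (U s f) \<le> C * ?N f" using Suc by (intro C) auto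
      also have "... \<le> C ^ Suc (Suc n) * ?N f"
        using C1 power_increasing[of 1 "Suc (Suc n)" C] by (intro mult_right_mono) auto
      finally show ?thesis .
    next
      case False
      have r: "s - d \<in> {0..real (Suc n) * d}" using False Suc.prems by (auto simp: algebra_simps)
      have "?N (U s f) = ?N (U d (U (s - d) f))"
        using US[OF Suc.prems(2), of d "s - d"] False d by simp
      also have "... \<le> C * ?N (U (s - d) f)" using d r UL Suc.prems by (intro C) auto
      also have "... \<le> C * (C ^ Suc n * ?N f)" using C1 Suc.IH[OF r Suc.prems(2)] by (intro mult_left_mono) auto
      finally show ?thesis by simp
    qed
  qed
  obtain n where n: "t < real n * d" using reals_Archimedean3[OF d] by blast
  show ?thesis
  proof (intro exI[of _ "C ^ Suc n"] conjI ballI)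
    fix s f assume "s \<in> {0..t}" "f \<in> Lp_space M p"
    moreover have "real n * d \<le> real (Suc n) * d" using d by simp
    ultimately show "?N (U s f) \<le> C ^ Suc n * ?N f" using n by (intro *) auto
  qed (use C1 in simp)
qed

text \<open>Continuous induction: with the slack \<open>e * s\<close> the Dini condition extends the
  set of admissible times to the right, and continuity closes it. Right derivatives are what the
  definition of a generator provides.\<close>

lemma right_Dini_le_imp_le:
  fixes \<phi> :: "real => real"
  assumes t: "0 \<le> t" and cont: "continuous_on {0..t} \<phi>"
    and D: "\<And>s e. 0 \<le> s ==> s < t ==> 0 < e ==> eventually (\<lambda>h. \<phi> (s + h) \<le> \<phi> s + e * h) (at_right 0)"
  shows "\<phi> t \<le> \<phi> 0"
proof (rule field_le_epsilon)
  fix e' :: real assume e': "0 < e'"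
  define e where "e = e' / (t + 1)"
  have e: "0 < e" using t e' by (simp add: e_def)
  define S where "S = {s \<in> {0..t}. \<phi> s - \<phi> 0 - e * s \<le> 0}"
  define Z where "Z = {s \<in> {0..t}. {0..s} \<subseteq> S}"
  have Z0: "0 \<in> Z" using t by (auto simp: Z_def S_def)
  have bdd: "bdd_above Z" by (rule bdd_aboveI[of _ t]) (auto simp: Z_def)
  define m where "m = Sup Z"
  have m0: "0 \<le> m" unfolding m_def by (rule cSup_upper[OF Z0 bdd])
  have mt: "m \<le> t" unfolding m_def by (rule cSup_least) (use Z0 in \<open>auto simp: Z_def\<close>)
  have below: "s \<in> S" if s: "0 \<le> s" "s < m" for s
  proof -
    obtain z where "z \<in> Z" "s < z" using s(2) unfolding m_def by (rule less_cSupE) (use Z0 in auto)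
    then show ?thesis using s(1) by (auto simp: Z_def)
  qed
  have mS: "m \<in> S"
  proof (cases "m = 0")
    case True then show ?thesis using t by (simp add: S_def)
  next
    case False
    have "closed S" unfolding S_def
      by (intro continuous_on_closed_Collect_le continuous_intros cont)
    moreover have "m \<in> closure {0..<m}" using False m0 by simp
    moreover have "{0..<m} \<subseteq> S" using below by auto
    ultimately show ?thesis by (metis closure_minimal subsetD)
  qed
  have mZ: "m \<in> Z" unfolding Z_def
  proof safe
    fix s assume "s \<in> {0..m}"
    then show "s \<in> S" using below mS by (cases "s = m") auto
  qed (use m0 mt in auto)
  have "m = t"
  proof (rule ccontr)
    assume "m \<noteq> t"
    then have "m < t" using mt by simp
    from D[OF m0 this e] obtain d where d: "0 < d" "\<And>h. 0 < h ==> h < d ==> \<phi> (m + h) \<le> \<phi> m + e * h"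
      unfolding eventually_at_right_field by auto
    define h where "h = min (d/2) (t - m)"
    have h: "0 < h" "h < d" "m + h \<le> t" using d(1) \<open>m < t\<close> by (auto simp: h_def)
    have "m + h \<in> Z" unfolding Z_def
    proof safe
      fix s assume s: "s \<in> {0..m+h}"
      show "s \<in> S"
      proof (cases "s \<le> m")
        case True then show ?thesis using mZ s by (auto simp: Z_def)
      next
        case False
        then have "\<phi> (m + (s - m)) \<le> \<phi> m + e * (s - m)" using d(2)[of "s - m"] s h by auto
        moreover have "\<phi> m - \<phi> 0 - e * m \<le> 0" using mS by (simp add: S_def)
        ultimately show ?thesis using s h by (auto simp: S_def algebra_simps)
      qed
    qed (use h m0 in auto)
    then have "m + h \<le> m" unfolding m_def by (rule cSup_upper[OF _ bdd])
    then show False using h by simp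
  qed
  then have "\<phi> t \<le> \<phi> 0 + e * t" using mS by (simp add: S_def)
  also have "e * t \<le> e'" using t e' by (simp add: e_def field_simps)
  finally show "\<phi> t \<le> \<phi> 0 + e'" by simp
qed


lemma Lp_norm_triangle_diff_AE:
  assumes p: "1 \<le> p" and f: "f \<in> Lp_space M p" and f': "f' \<in> Lp_space M p" and g: "g \<in> Lp_space M p" and g': "g' \<in> Lp_space M p"
    and "AE x in M. f x = f' x" "AE x in M. g x = g' x"
  shows "Lp_norm M p (\<lambda>x. f x - g x) = Lp_norm M p (\<lambda>x. f' x - g' x)"
  by (rule Lp_norm_cong_AE)
    (use assms(6,7) Lp_space_measurable[OF f] Lp_space_measurable[OF f'] Lp_space_measurable[OF g] Lp_space_measurable[OF g'] in auto)

text \<open>For \<open>a \<le> b\<close> the increment is \<open>S a\<close> applied to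
  \<open>S (b - a) f - f\<close>. Continuity of the orbit from both sides thus reduces to right
  continuity at 0.\<close>

lemma C0_semigroup_increment_le:
  assumes p: "1 \<le> p" and S: "C0_semigroup M p S" and f: "f \<in> Lp_space M p"
    and K: "\<And>s f. s \<in> {0..t} ==> f \<in> Lp_space M p ==> Lp_norm M p (S s f) \<le> K * Lp_norm M p f"
    and ab: "a \<in> {0..t}" "b \<in> {0..t}"
  shows "Lp_norm M p (\<lambda>x. S b f x - S a f x) \<le> K * Lp_norm M p (\<lambda>x. S \<bar>b - a\<bar> f x - f x)"
proof -
  note Sb = C0_semigroupD(1)[OF S]
  have *: "Lp_norm M p (\<lambda>x. S b f x - S a f x) \<le> K * Lp_norm M p (\<lambda>x. S (b - a) f x - f x)"
    if "0 \<le> a" "a \<le> b" "b \<le> t" for a b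
  proof -
    have L: "S (b - a) f \<in> Lp_space M p" using that f by (intro Lp_op_space[OF Sb]) auto
    have "AE x in M. S b f x = S a (S (b - a) f) x"
      using C0_semigroupD(3)[OF S, of a "b - a" f] that f by simp
    then have "Lp_norm M p (\<lambda>x. S b f x - S a f x) = Lp_norm M p (\<lambda>x. S a (S (b - a) f) x - S a f x)"
      using that by (intro Lp_norm_triangle_diff_AE[OF p] Lp_op_space[OF Sb] L f) auto
    also have "... = Lp_norm M p (S a (\<lambda>x. S (b - a) f x - f x))"
      using that by (intro Lp_op_norm_diff[OF p Sb L f, symmetric])
    also have "... \<le> K * Lp_norm M p (\<lambda>x. S (b - a) f x - f x)"
      using that by (intro K Lp_diff p L f) auto
    finally show ?thesis .
  qed
  show ?thesis
  proof (cases "a \<le> b")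
    case True then show ?thesis using *[of a b] ab by simp
  next
    case False then show ?thesis using *[of b a] ab by (simp add: Lp_norm_minus_commute[of M p "S b f"])
  qed
qed

text \<open>Includes \<open>h = 0\<close>, which the limit along \<open>at_right 0\<close> leaves
  out.\<close>

lemma C0_semigroup_near_0:
  assumes p: "1 \<le> p" and S: "C0_semigroup M p S" and f: "f \<in> Lp_space M p" and e: "0 < e"
  shows "\<exists>d>0. \<forall>h. 0 \<le> h --> h < d --> Lp_norm M p (\<lambda>x. S h f x - f x) < e"
proof -
  have "eventually (\<lambda>h. Lp_norm M p (\<lambda>x. S h f x - f x) < e) (at_right 0)"
    using C0_semigroupD(4)[OF S f] by (rule order_tendstoD) (rule e)
  then obtain d where d: "0 < d" "\<And>h. 0 < h ==> h < d ==> Lp_norm M p (\<lambda>x. S h f x - f x) < e"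
    unfolding eventually_at_right_field by auto
  have S0: "S 0 f \<in> Lp_space M p" by (intro Lp_op_space[OF C0_semigroupD(1)[OF S]] f) simp
  have "Lp_norm M p (\<lambda>x. S 0 f x - f x) = Lp_norm M p (\<lambda>x. f x - f x)"
    by (intro Lp_norm_triangle_diff_AE[OF p] S0 f C0_semigroupD(2)[OF S f]) auto
  then have "Lp_norm M p (\<lambda>x. S 0 f x - f x) < e" using Lp_zero(2)[OF p, of M] e by simp
  then show ?thesis using d by (metis less_eq_real_def)
qed

text \<open>\<open>U s\<close> commutes with the difference quotients at 0 and is bounded, so it
  maps right derivatives to right derivatives.\<close>

lemma generator_domain_invariant:
  assumes p: "1 \<le> p" and U: "C0_semigroup M p U" and gen: "is_generator M p U A Dom"
    and f: "f \<in> Dom" and s: "0 \<le> s"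
  shows "U s f \<in> Dom"
proof -
  note Ub = C0_semigroupD(1)[OF U]
  have fL: "f \<in> Lp_space M p" and g: "right_derivative_at_0 M p U f (A f)"
    using gen f by (auto simp: is_generator_def)
  have gL: "A f \<in> Lp_space M p" and lim: "((\<lambda>h. Lp_norm M p (\<lambda>x. (U h f x - f x) / h - A f x)) \<longlongrightarrow> 0) (at_right 0)"
    using g by (auto simp: right_derivative_at_0_def)
  obtain C where C: "\<And>f. f \<in> Lp_space M p ==> Lp_norm M p (U s f) \<le> C * Lp_norm M p f"
    using Ub[OF s] unfolding Lp_bounded_operator_def by blast
  have UsL: "U s f \<in> Lp_space M p" by (rule Lp_op_space[OF Ub[OF s] fL])
  have "((\<lambda>h. Lp_norm M p (\<lambda>x. (U h (U s f) x - U s f x) / h - U s (A f) x)) \<longlongrightarrow> 0) (at_right 0)"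
  proof (rule tendsto_sandwich[OF _ _ tendsto_const tendsto_mult_right_zero[OF lim, of C]])
    show "\<forall>\<^sub>F h in at_right 0. Lp_norm M p (\<lambda>x. (U h (U s f) x - U s f x) / h - U s (A f) x)
       \<le> C * Lp_norm M p (\<lambda>x. (U h f x - f x) / h - A f x)"
      unfolding eventually_at_right_field
    proof (intro exI[of _ 1] conjI allI impI)
      fix h :: real assume h: "0 < h"
      have Uh: "U h f \<in> Lp_space M p" by (rule Lp_op_space[OF Ub fL]) (use h in simp)
      let ?d = "\<lambda>x. (1 / h) * U h f x + (- 1 / h) * f x"
      have dL: "?d \<in> Lp_space M p" by (rule Lp_lincomb[OF p Uh fL])
      have a1: "AE x in M. U h (U s f) x = U (s + h) f x"
        using C0_semigroupD(3)[OF U, of h s f] h s fL unfolding add.commute[of h s]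
        by (auto elim!: eventually_mono)
      have a2: "AE x in M. U (s + h) f x = U s (U h f) x"
        using C0_semigroupD(3)[OF U, of s h f] h s fL by simp
      have a3: "AE x in M. U s ?d x = (1 / h) * U s (U h f) x + (- 1 / h) * U s f x"
        by (rule Lp_op_linear[OF Ub[OF s] Uh fL])
      have L1: "(\<lambda>x. (1 / h) * U h (U s f) x + (- 1 / h) * U s f x) \<in> Lp_space M p"
        by (intro Lp_lincomb p Lp_op_space[OF Ub] fL s) (use h in simp)
      have "Lp_norm M p (\<lambda>x. ((1 / h) * U h (U s f) x + (- 1 / h) * U s f x) - U s (A f) x)
        = Lp_norm M p (\<lambda>x. U s ?d x - U s (A f) x)"
        by (intro Lp_norm_triangle_diff_AE[OF p] L1 Lp_op_space[OF Ub[OF s]] dL gL)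
          (use a1 a2 a3 in \<open>eventually_elim, simp\<close>, simp)
      also have "... = Lp_norm M p (U s (\<lambda>x. ?d x - A f x))"
        by (rule Lp_op_norm_diff[OF p Ub[OF s] dL gL, symmetric])
      also have "... \<le> C * Lp_norm M p (\<lambda>x. ?d x - A f x)" by (intro C Lp_diff p dL gL)
      finally show "Lp_norm M p (\<lambda>x. (U h (U s f) x - U s f x) / h - U s (A f) x)
       \<le> C * Lp_norm M p (\<lambda>x. (U h f x - f x) / h - A f x)"
        by (simp add: diff_divide_distrib)
    qed simp
  qed simp
  then have "right_derivative_at_0 M p U (U s f) (U s (A f))"
    using Lp_op_space[OF Ub[OF s] gL] by (simp add: right_derivative_at_0_def)
  then show ?thesis using gen UsL by (auto simp: is_generator_def)
qed

text \<open>If the generator of \<open>U\<close> is a restriction of that of \<open>S\<close>, then \<open>s \<mapsto> S (t - s) (U s f)\<close> is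
  continuous with right derivative \<open>0\<close>, hence constant.\<close>

lemma C0_semigroup_eq_on_domain:
  assumes p: "1 \<le> p" and U: "C0_semigroup M p U" and S: "C0_semigroup M p S"
    and gen: "is_generator M p U A Dom"
    and SA: "\<And>f. f \<in> Dom ==> right_derivative_at_0 M p S f (A f)"
    and f: "f \<in> Dom" and t: "0 \<le> t"
  shows "AE x in M. U t f x = S t f x"
proof -
  let ?N = "Lp_norm M p"
  note Ub = C0_semigroupD(1)[OF U] and Sb = C0_semigroupD(1)[OF S]
  have UL: "U s g \<in> Lp_space M p" if "0 \<le> s" "g \<in> Lp_space M p" for s g
    using Lp_op_space[OF Ub] that by auto
  have SL: "S s g \<in> Lp_space M p" if "0 \<le> s" "g \<in> Lp_space M p" for s g
    using Lp_op_space[OF Sb] that by auto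
  have fL: "f \<in> Lp_space M p" using gen f by (auto simp: is_generator_def)
  obtain C where C: "0 \<le> C" "\<And>s f. s \<in> {0..t} ==> f \<in> Lp_space M p ==> ?N (U s f) \<le> C * ?N f"
    using C0_semigroup_locally_bounded[OF p U] by blast
  obtain K where K: "0 \<le> K" "\<And>s f. s \<in> {0..t} ==> f \<in> Lp_space M p ==> ?N (S s f) \<le> K * ?N f"
    using C0_semigroup_locally_bounded[OF p S] by blast
  define w where "w s = S (t - s) (U s f)" for s
  define \<phi> where "\<phi> s = ?N (\<lambda>x. w s x - w 0 x)" for s
  have wL: "w s \<in> Lp_space M p" if "s \<in> {0..t}" for s using that unfolding w_def by (intro SL UL fL) auto
  have phi: "\<bar>\<phi> s - \<phi> r\<bar> \<le> ?N (\<lambda>x. w s x - w r x)" if "s \<in> {0..t}" "r \<in> {0..t}" for s r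
  proof -
    have z: "0 \<in> {0..t}" using t by simp
    show ?thesis
      using Lp_norm_triangle_diff[OF p wL[OF that(1)] wL[OF that(2)] wL[OF z]]
        Lp_norm_triangle_diff[OF p wL[OF that(2)] wL[OF that(1)] wL[OF z]]
      unfolding \<phi>_def by (simp add: Lp_norm_minus_commute[of M p "w r" "w s"])
  qed
  \<comment> \<open>The increment of \<open>w\<close> splits into \<open>S (t - s)\<close> applied
    to an increment of the orbit of \<open>f\<close> under \<open>U\<close>, and an increment of the
    orbit of the fixed element \<open>U r f\<close> under \<open>S\<close>.\<close>
  have cont: "continuous_on {0..t} \<phi>"
    unfolding continuous_on_iff
  proof (intro ballI allI impI)
    fix r e :: real assume r: "r \<in> {0..t}" and e: "0 < e"
    have urL: "U r f \<in> Lp_space M p" using r by (intro UL fL) auto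
    define e' where "e' = e / (2 * (K * C + K + 1))"
    have pos: "0 < 2 * (K * C + K + 1)" using C(1) K(1) by (simp add: add_nonneg_pos)
    have e': "0 < e'" using e pos by (simp add: e'_def)
    obtain d1 where d1: "0 < d1" "\<And>h. 0 \<le> h ==> h < d1 ==> ?N (\<lambda>x. U h f x - f x) < e'"
      using C0_semigroup_near_0[OF p U fL e'] by blast
    obtain d2 where d2: "0 < d2" "\<And>h. 0 \<le> h ==> h < d2 ==> ?N (\<lambda>x. S h (U r f) x - U r f x) < e'"
      using C0_semigroup_near_0[OF p S urL e'] by blast
    show "\<exists>d>0. \<forall>s\<in>{0..t}. dist s r < d --> dist (\<phi> s) (\<phi> r) < e"
    proof (intro exI[of _ "min d1 d2"] conjI ballI impI)
      fix s assume s: "s \<in> {0..t}" and d: "dist s r < min d1 d2"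
      have usL: "U s f \<in> Lp_space M p" using s by (intro UL fL) auto
      have ts: "t - s \<in> {0..t}" "t - r \<in> {0..t}" using s r by auto
      have tri: "?N (\<lambda>x. w s x - w r x) \<le> ?N (\<lambda>x. S (t-s) (U s f) x - S (t-s) (U r f) x) + ?N (\<lambda>x. S (t-s) (U r f) x - S (t-r) (U r f) x)"
        unfolding w_def using ts by (intro Lp_norm_triangle_diff p SL usL urL) auto
      have "?N (\<lambda>x. S (t-s) (U s f) x - S (t-s) (U r f) x) = ?N (S (t-s) (\<lambda>x. U s f x - U r f x))"
        using ts by (intro Lp_op_norm_diff[OF p Sb usL urL, symmetric]) auto
      also have "... \<le> K * ?N (\<lambda>x. U s f x - U r f x)"
        by (rule K(2)[OF ts(1) Lp_diff(1)[OF p usL urL]])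
      also have "... \<le> K * (C * ?N (\<lambda>x. U \<bar>s - r\<bar> f x - f x))"
        using C0_semigroup_increment_le[OF p U fL C(2) r s] K(1) by (intro mult_left_mono) auto
      also have "... \<le> K * (C * e')"
        using d1(2)[of "\<bar>s - r\<bar>"] d C(1) K(1) by (intro mult_left_mono) (auto simp: dist_real_def)
      finally have b1: "?N (\<lambda>x. S (t-s) (U s f) x - S (t-s) (U r f) x) \<le> K * (C * e')" .
      have "?N (\<lambda>x. S (t-s) (U r f) x - S (t-r) (U r f) x) \<le> K * ?N (\<lambda>x. S \<bar>(t-s)-(t-r)\<bar> (U r f) x - U r f x)"
        using C0_semigroup_increment_le[OF p S urL K(2) ts(2) ts(1)] .
      also have "... \<le> K * e'"
        using d2(2)[of "\<bar>(t-s)-(t-r)\<bar>"] d K(1) by (intro mult_left_mono) (auto simp: dist_real_def abs_minus_commute)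
      finally have b2: "?N (\<lambda>x. S (t-s) (U r f) x - S (t-r) (U r f) x) \<le> K * e'" .
      have "\<bar>\<phi> s - \<phi> r\<bar> \<le> (K * C + K) * e'" using phi[OF s r] tri b1 b2 by (simp add: distrib_right)
      also have "... \<le> (K * C + K + 1) * e'" using e' by simp
      also have "... = e / 2" unfolding e'_def using pos by (simp add: field_simps)
      also have "... < e" using e by simp
      finally show "dist (\<phi> s) (\<phi> r) < e" by (simp add: dist_real_def)
    qed (use d1 d2 in auto)
  qed
  have "\<phi> t \<le> \<phi> 0"
  proof (rule right_Dini_le_imp_le[OF t cont])
    fix s e :: real assume s: "0 \<le> s" "s < t" and e: "0 < e"
    let ?u = "U s f"
    have uD: "?u \<in> Dom" by (rule generator_domain_invariant[OF p U gen f s(1)])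
    have uL: "?u \<in> Lp_space M p" using gen uD by (auto simp: is_generator_def)
    have r1: "right_derivative_at_0 M p U ?u (A ?u)" using gen uD by (auto simp: is_generator_def)
    have AL: "A ?u \<in> Lp_space M p" using r1 by (simp add: right_derivative_at_0_def)
    let ?a = "\<lambda>h. ?N (\<lambda>x. (U h ?u x - ?u x) / h - A ?u x)" and ?b = "\<lambda>h. ?N (\<lambda>x. (S h ?u x - ?u x) / h - A ?u x)"
    have "((\<lambda>h. K * (?a h + ?b h)) \<longlongrightarrow> K * (0 + 0)) (at_right 0)"
      using r1 SA[OF uD] by (intro tendsto_intros) (auto simp: right_derivative_at_0_def)
    then have "eventually (\<lambda>h. K * (?a h + ?b h) < e) (at_right 0)"
      by (rule order_tendstoD) (use e in simp)
    moreover have "eventually (\<lambda>h. 0 < h \<and> h < t - s) (at_right 0)"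
      unfolding eventually_at_right_field using s by (intro exI[of _ "t - s"]) auto
    ultimately show "eventually (\<lambda>h. \<phi> (s + h) \<le> \<phi> s + e * h) (at_right 0)"
    proof eventually_elim
      fix h assume h: "K * (?a h + ?b h) < e" "0 < h \<and> h < t - s"
      have UhL: "U h ?u \<in> Lp_space M p" and ShL: "S h ?u \<in> Lp_space M p" using h uL by (auto intro: UL SL)
      have r: "t - s - h \<in> {0..t}" using h s by auto
      have e1: "AE x in M. U (s + h) f x = U h ?u x"
        using C0_semigroupD(3)[OF U, of h s f] h s fL by (simp add: add.commute)
      have e1': "AE x in M. w (s + h) x = S (t - s - h) (U h ?u) x"
        unfolding w_def using Lp_op_cong[OF Sb _ UhL e1, of "t - s - h"] h s fL UL by (simp add: diff_diff_eq)
      have e2: "AE x in M. w s x = S (t - s - h) (S h ?u) x"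
        unfolding w_def using C0_semigroupD(3)[OF S, of "t - s - h" h ?u] h uL by simp
      \<comment> \<open>The increment of \<open>w\<close> is \<open>S (t - s - h)\<close> applied to
        \<open>U h ?u - S h ?u\<close>. As \<open>?u\<close> is still in the domain, both orbits
        leave it with the same derivative, and their difference is o(h).\<close>
      have b: "?N (\<lambda>x. U h ?u x - S h ?u x) \<le> h * (?a h + ?b h)"
      proof -
        have L: "(\<lambda>x. (g x - ?u x) / h - A ?u x) \<in> Lp_space M p" if "g \<in> Lp_space M p" for g
          using Lp_diff(1)[OF p Lp_scale(1)[OF p Lp_diff(1)[OF p that uL], of "1 / h"] AL] by simp
        have d: "a - b = h * (((a - c) / h - z) - ((b - c) / h - z))" for a b c z :: real
          using h by (simp add: diff_divide_distrib[symmetric] del: divide_diff_eq_iff diff_divide_eq_iff)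
        have "(\<lambda>x. U h ?u x - S h ?u x) = (\<lambda>x. h * (((U h ?u x - ?u x) / h - A ?u x) - ((S h ?u x - ?u x) / h - A ?u x)))"
          by (rule ext) (rule d)
        then have "?N (\<lambda>x. U h ?u x - S h ?u x) = \<bar>h\<bar> * ?N (\<lambda>x. ((U h ?u x - ?u x) / h - A ?u x) - ((S h ?u x - ?u x) / h - A ?u x))"
          using Lp_scale(2)[OF p Lp_diff(1)[OF p L[OF UhL] L[OF ShL]], of h] by (simp only:)
        also have "... \<le> \<bar>h\<bar> * (?a h + ?b h)"
          by (intro mult_left_mono Lp_norm_diff_triangle[OF p L[OF UhL] L[OF ShL]]) simp
        finally show ?thesis using h by simp
      qed
      have "?N (\<lambda>x. w (s + h) x - w s x) = ?N (\<lambda>x. S (t - s - h) (U h ?u) x - S (t - s - h) (S h ?u) x)"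
        using r h s by (intro Lp_norm_triangle_diff_AE[OF p] wL SL UhL ShL e1' e2) auto
      also have "... = ?N (S (t - s - h) (\<lambda>x. U h ?u x - S h ?u x))"
        using r by (intro Lp_op_norm_diff[OF p Sb UhL ShL, symmetric]) auto
      also have "... \<le> K * ?N (\<lambda>x. U h ?u x - S h ?u x)" by (rule K(2)[OF r Lp_diff(1)[OF p UhL ShL]])
      also have "... \<le> K * (h * (?a h + ?b h))" by (rule mult_left_mono[OF b K(1)])
      finally have c: "?N (\<lambda>x. w (s + h) x - w s x) \<le> h * (K * (?a h + ?b h))"
        by (simp only: mult.left_commute)
      have "h * (K * (?a h + ?b h)) \<le> h * e" using h by (intro mult_left_mono) auto
      with c have "?N (\<lambda>x. w (s + h) x - w s x) \<le> h * e" by (rule order_trans)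
      moreover have "\<bar>\<phi> (s + h) - \<phi> s\<bar> \<le> ?N (\<lambda>x. w (s + h) x - w s x)" using h s by (intro phi) auto
      ultimately show "\<phi> (s + h) \<le> \<phi> s + e * h" by (simp add: mult.commute)
    qed
  qed
  also have "\<phi> 0 = 0" using Lp_zero(2)[OF p, of M] by (simp add: \<phi>_def)
  finally have "?N (\<lambda>x. w t x - w 0 x) = 0" unfolding \<phi>_def using Lp_norm_nonneg[of M p "\<lambda>x. w t x - w 0 x"] by linarith
  then have "AE x in M. w t x - w 0 x = 0" using t by (intro Lp_norm_eq_0[OF p] Lp_diff p wL) auto
  moreover have "AE x in M. w t x = U t f x"
    using C0_semigroupD(2)[OF S UL[OF t fL]] by (simp add: w_def)
  moreover have "AE x in M. w 0 x = S t f x"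
    unfolding w_def using Lp_op_cong[OF Sb _ fL C0_semigroupD(2)[OF U fL], of t] t UL fL by simp
  ultimately show ?thesis by eventually_elim simp
qed

section \<open>Integration along lines\<close>

lemma nn_integral_lborel_translate:
  fixes f :: "'a::euclidean_space => ennreal"
  assumes [measurable]: "f \<in> Borel"
  shows "(\<integral>\<^sup>+x. f (x + c) \<partial>lborel) = (\<integral>\<^sup>+x. f x \<partial>lborel)"
proof -
  have "(\<integral>\<^sup>+x. f x \<partial>lborel) = (\<integral>\<^sup>+x. f x \<partial>distr lborel borel ((+) c))"
    by (simp add: lborel_distr_plus)
  also have "... = (\<integral>\<^sup>+x. f (c + x) \<partial>lborel)" by (rule nn_integral_distr) auto
  finally show ?thesis by (simp add: add.commute)
qed

lemma nn_integral_lborel_uminus: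
  fixes f :: "'a::euclidean_space => ennreal"
  assumes [measurable]: "f \<in> Borel"
  shows "(\<integral>\<^sup>+x. f (- x) \<partial>lborel) = (\<integral>\<^sup>+x. f x \<partial>lborel)"
proof -
  have "(\<integral>\<^sup>+x. f x \<partial>lborel) = (\<integral>\<^sup>+x. f x \<partial>distr lborel borel uminus)"
    by (subst lborel_affine[of "-1" 0]) (simp_all add: density_1)
  also have "... = (\<integral>\<^sup>+x. f (- x) \<partial>lborel)" by (rule nn_integral_distr) auto
  finally show ?thesis by simp
qed

lemma nn_integral_lborel_prod:
  fixes G :: "'a::euclidean_space \<times> 'b::euclidean_space => ennreal"
  assumes [measurable]: "G \<in> Borel"
  shows "(\<integral>\<^sup>+v. (\<integral>\<^sup>+x. G (x, v) \<partial>lborel) \<partial>lborel) = (\<integral>\<^sup>+z. G z \<partial>lborel)"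
    and "(\<integral>\<^sup>+x. (\<integral>\<^sup>+v. G (x, v) \<partial>lborel) \<partial>lborel) = (\<integral>\<^sup>+z. G z \<partial>lborel)"
proof -
  have [measurable]: "G \<in> borel_measurable (lborel \<Otimes>\<^sub>M lborel)" by (simp add: lborel_prod)
  show "(\<integral>\<^sup>+v. (\<integral>\<^sup>+x. G (x, v) \<partial>lborel) \<partial>lborel) = (\<integral>\<^sup>+z. G z \<partial>lborel)"
    by (subst lborel_pair.nn_integral_snd) (auto simp: lborel_prod)
  show "(\<integral>\<^sup>+x. (\<integral>\<^sup>+v. G (x, v) \<partial>lborel) \<partial>lborel) = (\<integral>\<^sup>+z. G z \<partial>lborel)"
    by (subst lborel.nn_integral_fst) (auto simp: lborel_prod)
qed

lemma nn_integral_lborel_swap: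
  fixes G :: "'a::euclidean_space => 'b::euclidean_space => ennreal"
  assumes "(\<lambda>z. G (fst z) (snd z)) \<in> Borel"
  shows "(\<integral>\<^sup>+v. (\<integral>\<^sup>+x. G x v \<partial>lborel) \<partial>lborel) = (\<integral>\<^sup>+x. (\<integral>\<^sup>+v. G x v \<partial>lborel) \<partial>lborel)"
  using nn_integral_lborel_prod[OF assms] by simp

text \<open>For fixed \<open>v\<close> the map is a translation in \<open>x\<close>.\<close>

lemma nn_integral_shear:
  fixes G :: "'a::euclidean_space \<times> 'a => ennreal"
  assumes [measurable]: "G \<in> Borel"
  shows "(\<integral>\<^sup>+z. G (fst z + s *\<^sub>R snd z, snd z) \<partial>lborel) = (\<integral>\<^sup>+z. G z \<partial>lborel)"
proof -
  have [measurable]: "(\<lambda>z::'a\<times>'a. G (fst z + s *\<^sub>R snd z, snd z)) \<in> Borel"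
    by (rule measurable_compose[OF borel_continuous assms]) (intro continuous_intros)
  have [measurable]: "(\<lambda>x. G (x, v)) \<in> Borel" for v
    by (rule measurable_compose[OF borel_continuous assms]) (intro continuous_intros)
  have "(\<integral>\<^sup>+z. G (fst z + s *\<^sub>R snd z, snd z) \<partial>lborel) = (\<integral>\<^sup>+v. (\<integral>\<^sup>+x. G (x + s *\<^sub>R v, v) \<partial>lborel) \<partial>lborel)"
    by (subst nn_integral_lborel_prod(1)[symmetric]) auto
  also have "... = (\<integral>\<^sup>+v. (\<integral>\<^sup>+x. G (x, v) \<partial>lborel) \<partial>lborel)"
    by (intro nn_integral_cong nn_integral_lborel_translate[of "\<lambda>x. G (x, _)"]) simp
  finally show ?thesis by (simp add: nn_integral_lborel_prod)
qed

lemma nn_integral_reflect_velocity: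
  fixes G :: "'a::euclidean_space \<times> 'a => ennreal"
  assumes [measurable]: "G \<in> Borel"
  shows "(\<integral>\<^sup>+z. G (fst z, - snd z) \<partial>lborel) = (\<integral>\<^sup>+z. G z \<partial>lborel)"
proof -
  have [measurable]: "(\<lambda>z::'a\<times>'a. G (fst z, - snd z)) \<in> Borel"
    by (rule measurable_compose[OF borel_continuous assms]) (intro continuous_intros)
  have [measurable]: "(\<lambda>v. G (x, v)) \<in> Borel" for x
    by (rule measurable_compose[OF borel_continuous assms]) (intro continuous_intros)
  have "(\<integral>\<^sup>+z. G (fst z, - snd z) \<partial>lborel) = (\<integral>\<^sup>+x. (\<integral>\<^sup>+v. G (x, - v) \<partial>lborel) \<partial>lborel)"
    by (subst nn_integral_lborel_prod(2)[symmetric]) auto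
  also have "... = (\<integral>\<^sup>+x. (\<integral>\<^sup>+v. G (x, v) \<partial>lborel) \<partial>lborel)"
    by (simp add: nn_integral_lborel_uminus[of "\<lambda>v. G (_, v)"])
  finally show ?thesis by (simp add: nn_integral_lborel_prod)
qed

text \<open>Along \<open>s \<mapsto> x - s v\<close> the inner product with \<open>v\<close> moves
  at constant speed \<open>v \<bullet> v\<close>, hence spends time
  \<open>2 / (v \<bullet> v)\<close> in [-1,1]; the prefactor normalises this to 1. The weight
  selects a segment of every line without a choice of origin on it.\<close>

definition line_weight :: "'a::euclidean_space \<times> 'a => ennreal" where
  "line_weight z = ennreal ((norm (snd z))\<^sup>2 / 2) * indicator {-1..1} (fst z \<bullet> snd z)"

lemma borel_measurable_line_weight [measurable]: "line_weight \<in> Borel"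
proof -
  have [measurable]: "(\<lambda>z::'a\<times>'a. fst z \<bullet> snd z) \<in> Borel"
    "(\<lambda>z::'a\<times>'a. norm (snd z)) \<in> Borel"
    by (intro borel_continuous continuous_intros)+
  show ?thesis unfolding line_weight_def by measurable
qed

lemma nn_integral_line_weight:
  assumes v: "v \<noteq> 0"
  shows "(\<integral>\<^sup>+s. line_weight (x - s *\<^sub>R v, v) \<partial>lborel) = 1"
proof -
  let ?c = "- (v \<bullet> v)"
  have c: "?c \<noteq> 0" using v by simp
  have "2 = (\<integral>\<^sup>+s. indicator {-1..1::real} s \<partial>lborel)" by simp
  also have "... = ennreal \<bar>?c\<bar> * (\<integral>\<^sup>+s. indicator {-1..1} (x \<bullet> v + ?c * s) \<partial>lborel)"
    by (rule nn_integral_real_affine[OF _ c]) simp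
  finally have 2: "ennreal (v \<bullet> v) * (\<integral>\<^sup>+s. indicator {-1..1} (x \<bullet> v + ?c * s) \<partial>lborel) = 2" by simp
  have "(\<integral>\<^sup>+s. line_weight (x - s *\<^sub>R v, v) \<partial>lborel)
    = (\<integral>\<^sup>+s. ennreal (v \<bullet> v / 2) * indicator {-1..1} (x \<bullet> v + ?c * s) \<partial>lborel)"
    by (intro nn_integral_cong) (simp add: line_weight_def power2_norm_eq_inner inner_diff_left mult.commute)
  also have "... = ennreal (v \<bullet> v / 2) * (\<integral>\<^sup>+s. indicator {-1..1} (x \<bullet> v + ?c * s) \<partial>lborel)"
    by (rule nn_integral_cmult) simp
  also have "ennreal (v \<bullet> v / 2) = ennreal (1/2) * ennreal (v \<bullet> v)"
    by (subst ennreal_mult[symmetric]) auto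
  also have "... * (\<integral>\<^sup>+s. indicator {-1..1} (x \<bullet> v + ?c * s) \<partial>lborel) = ennreal (1/2) * 2"
    by (simp only: 2 mult.assoc)
  also have "... = 1" by (subst ennreal_numeral[symmetric], subst ennreal_mult[symmetric]) auto
  finally show ?thesis .
qed

lemma AE_velocity_nonzero: "AE z in (lborel :: ('a::euclidean_space \<times> 'a) measure). snd z \<noteq> 0"
proof -
  have m: "{z :: 'a \<times> 'a. snd z = 0} \<in> sets borel"
    by (intro borel_closed closed_Collect_eq continuous_intros)
  have "(\<integral>\<^sup>+z. indicator {z. snd z = (0::'a)} z \<partial>(lborel :: ('a\<times>'a) measure))
    = (\<integral>\<^sup>+x. (\<integral>\<^sup>+v. indicator {z. snd z = (0::'a)} (x, v) \<partial>lborel) \<partial>(lborel::'a measure))"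
    by (rule nn_integral_lborel_prod(2)[symmetric]) (use m in \<open>rule borel_measurable_indicator\<close>)
  also have "... = (\<integral>\<^sup>+x. (\<integral>\<^sup>+v. indicator {0} v \<partial>(lborel :: 'a measure)) \<partial>(lborel::'a measure))"
    by (intro nn_integral_cong) (simp add: indicator_def)
  also have "... = 0" by (subst nn_integral_indicator) auto
  finally have "emeasure lborel {z :: 'a \<times> 'a. snd z = 0} = 0" using m by simp
  then show ?thesis using m by (intro AE_I[of _ _ "{z. snd z = 0}"]) auto
qed

text \<open>Integration over phase space along lines with constant velocity: every line carries total
  weight \<open>1\<close>, so no choice of coordinates transversal to \<open>v\<close> is needed.\<close>

lemma nn_integral_lines:
  fixes G :: "'a::euclidean_space \<times> 'a => ennreal"
  assumes [measurable]: "G \<in> Borel"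
  shows "(\<integral>\<^sup>+z. G z \<partial>lborel) =
    (\<integral>\<^sup>+z. line_weight z * (\<integral>\<^sup>+s. G (fst z + s *\<^sub>R snd z, snd z) \<partial>lborel) \<partial>lborel)"
proof -
  have Gs: "(\<lambda>y::('a\<times>'a)\<times>real. G (fst (fst y) + snd y *\<^sub>R snd (fst y), snd (fst y))) \<in> Borel"
    by (rule measurable_compose[OF borel_continuous assms]) (intro continuous_intros)
  have lws: "(\<lambda>y::('a\<times>'a)\<times>real. line_weight (fst (fst y) - snd y *\<^sub>R snd (fst y), snd (fst y))) \<in> Borel"
    by (rule measurable_compose[OF borel_continuous borel_measurable_line_weight]) (intro continuous_intros)
  have lw: "(\<lambda>y::('a\<times>'a)\<times>real. line_weight (fst y)) \<in> Borel"
    by (rule measurable_compose[OF borel_continuous borel_measurable_line_weight]) (intro continuous_intros)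
  have Gf: "(\<lambda>y::('a\<times>'a)\<times>real. G (fst y)) \<in> Borel"
    by (rule measurable_compose[OF borel_continuous assms]) (intro continuous_intros)
  have [measurable]: "(\<lambda>z::'a\<times>'a. G (fst z + s *\<^sub>R snd z, snd z)) \<in> Borel" for s
    by (rule measurable_compose[OF borel_continuous assms]) (intro continuous_intros)
  have [measurable]: "(\<lambda>z::'a\<times>'a. line_weight (fst z - s *\<^sub>R snd z, snd z)) \<in> Borel" for s
    by (rule measurable_compose[OF borel_continuous borel_measurable_line_weight]) (intro continuous_intros)
  have [measurable]: "(\<lambda>s. G (fst z + s *\<^sub>R snd z, snd z)) \<in> Borel" for z :: "'a \<times> 'a"
    by (rule measurable_compose[OF borel_continuous assms]) (intro continuous_intros)
  have [measurable]: "(\<lambda>s. line_weight (fst z - s *\<^sub>R snd z, snd z)) \<in> Borel" for z :: "'a \<times> 'a"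
    by (rule measurable_compose[OF borel_continuous borel_measurable_line_weight]) (intro continuous_intros)

  have "(\<integral>\<^sup>+z. line_weight z * (\<integral>\<^sup>+s. G (fst z + s *\<^sub>R snd z, snd z) \<partial>lborel) \<partial>lborel)
    = (\<integral>\<^sup>+z. (\<integral>\<^sup>+s. line_weight z * G (fst z + s *\<^sub>R snd z, snd z) \<partial>lborel) \<partial>lborel)"
    by (intro nn_integral_cong nn_integral_cmult[symmetric]) simp
  also have "... = (\<integral>\<^sup>+s. (\<integral>\<^sup>+z. line_weight z * G (fst z + s *\<^sub>R snd z, snd z) \<partial>lborel) \<partial>lborel)"
    by (rule nn_integral_lborel_swap[symmetric]) (rule borel_measurable_times_ennreal[OF lw Gs])
  also have "... = (\<integral>\<^sup>+s. (\<integral>\<^sup>+z. line_weight (fst z - s *\<^sub>R snd z, snd z) * G z \<partial>lborel) \<partial>lborel)"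
  \<comment> \<open>For each \<open>s\<close> the shear moves the shift from \<open>G\<close> to the
    weight, whose integral over \<open>s\<close> is then 1.\<close>
  proof (rule nn_integral_cong)
    fix s :: real
    show "(\<integral>\<^sup>+z. line_weight z * G (fst z + s *\<^sub>R snd z, snd z) \<partial>lborel) = (\<integral>\<^sup>+z. line_weight (fst z - s *\<^sub>R snd z, snd z) * G z \<partial>lborel)"
      by (subst nn_integral_shear[symmetric, of "\<lambda>z. line_weight (fst z - s *\<^sub>R snd z, snd z) * G z" s]) auto
  qed
  also have "... = (\<integral>\<^sup>+z. (\<integral>\<^sup>+s. line_weight (fst z - s *\<^sub>R snd z, snd z) * G z \<partial>lborel) \<partial>lborel)"
    by (rule nn_integral_lborel_swap) (rule borel_measurable_times_ennreal[OF lws Gf])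
  also have "... = (\<integral>\<^sup>+z. (\<integral>\<^sup>+s. line_weight (fst z - s *\<^sub>R snd z, snd z) \<partial>lborel) * G z \<partial>lborel)"
    by (intro nn_integral_cong nn_integral_multc) simp
  also have "... = (\<integral>\<^sup>+z. G z \<partial>lborel)"
    by (rule nn_integral_cong_AE) (use AE_velocity_nonzero in \<open>auto elim!: eventually_mono simp: nn_integral_line_weight\<close>)
  finally show ?thesis by simp
qed

text \<open>Meant for properties such as \<open>regular\<close>, which fail at countably many points
  of every line: the indicator of the exceptional set is integrated by
  \<open>nn_integral_lines\<close>.\<close>

lemma AE_lines_imp_AE:
  fixes P :: "'a::euclidean_space \<times> 'a => bool"
  assumes [measurable]: "Measurable.pred borel P"
    and ae: "\<And>x v. v \<noteq> 0 ==> AE s in lborel. P (x + s *\<^sub>R v, v)"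
  shows "AE z in lborel. P z"
proof -
  let ?G = "\<lambda>z. indicator {z. \<not> P z} z :: ennreal"
  have m: "?G \<in> Borel" by measurable
  have mm: "(\<lambda>s. ?G (x + s *\<^sub>R v, v)) \<in> Borel" for x v
    by (rule measurable_compose[OF borel_continuous m]) (intro continuous_intros)
  have z: "line_weight z * (\<integral>\<^sup>+s. ?G (fst z + s *\<^sub>R snd z, snd z) \<partial>lborel) = 0" for z :: "'a \<times> 'a"
  proof (cases "snd z = 0")
    case True then show ?thesis by (simp add: line_weight_def)
  next
    case False
    have "(\<integral>\<^sup>+s. ?G (fst z + s *\<^sub>R snd z, snd z) \<partial>lborel) = 0"
      by (subst nn_integral_0_iff_AE) (use ae[OF False, of "fst z"] mm in \<open>auto elim!: eventually_mono\<close>)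
    then show ?thesis by simp
  qed
  have "(\<integral>\<^sup>+z. ?G z \<partial>lborel) = 0" by (subst nn_integral_lines[OF m]) (simp only: z nn_integral_const, simp)
  then have "AE z in lborel. ?G z = 0" by (subst (asm) nn_integral_0_iff_AE) (use m in auto)
  then show ?thesis by eventually_elim (auto simp: indicator_def split: if_splits)
qed

lemma AE_shear:
  fixes P :: "'a::euclidean_space \<times> 'a => bool"
  assumes "AE z in lborel. P z"
  shows "AE z in lborel. P (fst z + s *\<^sub>R snd z, snd z)"
proof -
  from assms obtain N where N: "{z. \<not> P z} \<subseteq> N" "N \<in> sets borel" "emeasure lborel N = 0"
    by (auto elim!: AE_E)
  have "(\<integral>\<^sup>+z. indicator N (fst z + s *\<^sub>R snd z, snd z) \<partial>(lborel :: ('a\<times>'a) measure)) = 0"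
    using nn_integral_shear[of "indicator N" s] N by simp
  moreover have "(\<lambda>z::'a\<times>'a. indicator N (fst z + s *\<^sub>R snd z, snd z) :: ennreal) \<in> Borel"
    by (rule measurable_compose[OF borel_continuous]) (use N in \<open>auto intro!: continuous_intros\<close>)
  ultimately have "AE z in lborel. indicator N (fst z + s *\<^sub>R snd z, snd z :: 'a) = (0::ennreal)"
    by (subst (asm) nn_integral_0_iff_AE) auto
  then show ?thesis by eventually_elim (use N(1) in \<open>auto simp: indicator_def split: if_splits\<close>)
qed

lemma AE_reflect_velocity:
  fixes P :: "'a::euclidean_space \<times> 'a => bool"
  assumes "AE z in lborel. P z"
  shows "AE z in lborel. P (fst z, - snd z)"
proof -
  from assms obtain N where N: "{z. \<not> P z} \<subseteq> N" "N \<in> sets borel" "emeasure lborel N = 0"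
    by (auto elim!: AE_E)
  have "(\<integral>\<^sup>+z. indicator N (fst z, - snd z) \<partial>(lborel :: ('a\<times>'a) measure)) = 0"
    using nn_integral_reflect_velocity[of "indicator N"] N by simp
  moreover have "(\<lambda>z::'a\<times>'a. indicator N (fst z, - snd z) :: ennreal) \<in> Borel"
    by (rule measurable_compose[OF borel_continuous]) (use N in \<open>auto intro!: continuous_intros\<close>)
  ultimately have "AE z in lborel. indicator N (fst z, - snd z :: 'a) = (0::ennreal)"
    by (subst (asm) nn_integral_0_iff_AE) auto
  then show ?thesis by eventually_elim (use N(1) in \<open>auto simp: indicator_def split: if_splits\<close>)
qed

text \<open>Fubini for null sets; joint measurability of \<open>P\<close> is what allows the
  exchange.\<close>

lemma AE_swap_param:
  fixes P :: "'b::euclidean_space => 'c::euclidean_space => bool"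
  assumes m: "Measurable.pred borel (\<lambda>y. P (fst y) (snd y))" and ae: "\<And>s. AE z in lborel. P s z"
  shows "AE z in lborel. AE s in lborel. P s z"
proof -
  let ?G = "\<lambda>s z. indicator {y. \<not> P (fst y) (snd y)} (s, z) :: ennreal"
  have mG: "(\<lambda>y. ?G (fst y) (snd y)) \<in> Borel" using m by simp
  have m1: "(\<lambda>z. ?G s z) \<in> Borel" for s
    by (rule measurable_compose[OF borel_continuous[of "\<lambda>z. (s, z)"]]) (use m in \<open>auto intro!: continuous_intros\<close>)
  have m2: "(\<lambda>s. ?G s z) \<in> Borel" for z
    by (rule measurable_compose[OF borel_continuous[of "\<lambda>s. (s, z)"]]) (use m in \<open>auto intro!: continuous_intros\<close>)
  have "(\<integral>\<^sup>+z. ?G s z \<partial>lborel) = 0" for s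
    by (subst nn_integral_0_iff_AE) (use ae[of s] m1[of s] in \<open>auto elim!: eventually_mono\<close>)
  then have "(\<integral>\<^sup>+z. (\<integral>\<^sup>+s. ?G s z \<partial>lborel) \<partial>lborel) = 0"
    by (subst nn_integral_lborel_swap[OF mG]) simp
  moreover have "(\<lambda>z. \<integral>\<^sup>+s. ?G s z \<partial>lborel) \<in> borel_measurable lborel"
  proof -
    have "(\<lambda>(z, s). ?G s z) \<in> borel_measurable (borel :: ('c \<times> 'b) measure)"
      unfolding case_prod_unfold
      by (rule measurable_compose[OF borel_continuous[of "\<lambda>y::'c\<times>'b. (snd y, fst y)"]]) (use m in \<open>auto intro!: continuous_intros\<close>)
    then have "(\<lambda>(z, s). ?G s z) \<in> borel_measurable (lborel \<Otimes>\<^sub>M lborel)"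
      by (simp add: lborel_prod)
    then show ?thesis by (rule lborel.borel_measurable_nn_integral)
  qed
  ultimately have "AE z in lborel. (\<integral>\<^sup>+s. ?G s z \<partial>lborel) = 0"
    by (subst (asm) nn_integral_0_iff_AE) auto
  then show ?thesis
  proof eventually_elim
    fix z assume "(\<integral>\<^sup>+s. ?G s z \<partial>lborel) = 0"
    then have "AE s in lborel. ?G s z = 0" by (subst (asm) nn_integral_0_iff_AE) (use m2[of z] in auto)
    then show "AE s in lborel. P s z" by eventually_elim (auto simp: indicator_def split: if_splits)
  qed
qed

text \<open>The exceptional set is enlarged to a Borel null set, whose preimage under every shear is
  null, before parameter and point are exchanged.\<close>

lemma AE_imp_AE_lines:
  fixes P :: "'a::euclidean_space \<times> 'a => bool"
  assumes "AE z in lborel. P z"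
  shows "AE z in lborel. AE s in lborel. P (fst z + s *\<^sub>R snd z, snd z)"
proof -
  from assms obtain N where N: "{z. \<not> P z} \<subseteq> N" "N \<in> sets borel" "emeasure lborel N = 0"
    by (auto elim!: AE_E)
  have ae: "AE z in lborel. z \<notin> N" using N by (intro AE_not_in) (auto simp: null_sets_def)
  have "Measurable.pred borel (\<lambda>y::real\<times>('a\<times>'a). (fst (snd y) + fst y *\<^sub>R snd (snd y), snd (snd y)) \<notin> N)"
    by (rule measurable_compose[OF borel_continuous[of "\<lambda>y::real\<times>('a\<times>'a). (fst (snd y) + fst y *\<^sub>R snd (snd y), snd (snd y))"]])
       (use N in \<open>auto intro!: continuous_intros\<close>)
  then have "AE z in lborel. AE s in lborel. (fst z + s *\<^sub>R snd z, snd z) \<notin> N"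
    by (rule AE_swap_param) (rule AE_shear[OF ae])
  then show ?thesis by eventually_elim (use N(1) in \<open>auto elim!: eventually_mono\<close>)
qed

text \<open>On each line the part in \<open>E\<close> is shifted by one constant, so translation
  invariance on the line gives the bound. \<open>E\<close> may miss points of the line, hence an
  inequality.\<close>

lemma nn_integral_chord_translation_le:
  fixes G :: "'a::euclidean_space \<times> 'a => ennreal"
  assumes G: "G \<in> Borel"
    and F: "(\<lambda>z. indicator E z * G (\<Phi> z)) \<in> Borel"
    and \<Phi>: "\<And>x v. v \<noteq> 0 ==> \<exists>c. \<forall>s. (x + s *\<^sub>R v, v) \<in> E --> \<Phi> (x + s *\<^sub>R v, v) = (x + (s + c) *\<^sub>R v, v)"
  shows "(\<integral>\<^sup>+z. indicator E z * G (\<Phi> z) \<partial>lborel) \<le> (\<integral>\<^sup>+z. G z \<partial>lborel)"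
  unfolding nn_integral_lines[OF G] nn_integral_lines[OF F]
proof (intro nn_integral_mono)
  fix z :: "'a \<times> 'a"
  let ?x = "fst z" and ?v = "snd z"
  have m: "(\<lambda>s. G (?x + s *\<^sub>R ?v, ?v)) \<in> Borel"
    by (rule measurable_compose[OF borel_continuous G]) (intro continuous_intros)
  show "line_weight z * (\<integral>\<^sup>+s. indicator E (?x + s *\<^sub>R ?v, ?v) * G (\<Phi> (?x + s *\<^sub>R ?v, ?v)) \<partial>lborel)
    \<le> line_weight z * (\<integral>\<^sup>+s. G (?x + s *\<^sub>R ?v, ?v) \<partial>lborel)"
  proof (cases "?v = 0")
    case True then show ?thesis by (simp add: line_weight_def)
  next
    case False
    then obtain c where c: "\<And>s. (?x + s *\<^sub>R ?v, ?v) \<in> E ==> \<Phi> (?x + s *\<^sub>R ?v, ?v) = (?x + (s + c) *\<^sub>R ?v, ?v)"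
      using \<Phi>[of ?v ?x] by blast
    have "(\<integral>\<^sup>+s. indicator E (?x + s *\<^sub>R ?v, ?v) * G (\<Phi> (?x + s *\<^sub>R ?v, ?v)) \<partial>lborel)
      \<le> (\<integral>\<^sup>+s. G (?x + (s + c) *\<^sub>R ?v, ?v) \<partial>lborel)"
      by (intro nn_integral_mono) (auto simp: c split: split_indicator)
    also have "... = (\<integral>\<^sup>+s. G (?x + s *\<^sub>R ?v, ?v) \<partial>lborel)"
      by (rule nn_integral_lborel_translate[of "\<lambda>s. G (?x + s *\<^sub>R ?v, ?v)" c, OF m])
    finally show ?thesis by (rule mult_left_mono) simp
  qed
qed

text \<open>After a reversal of all velocities, the map acts along each line as
  \<open>s \<mapsto> c - s\<close>, which preserves Lebesgue measure like a translation.\<close>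

lemma nn_integral_chord_reflection_le:
  fixes G :: "'a::euclidean_space \<times> 'a => ennreal"
  assumes G: "G \<in> Borel"
    and F: "(\<lambda>z. indicator E z * G (\<Phi> z)) \<in> Borel"
    and \<Phi>: "\<And>x v. v \<noteq> 0 ==> \<exists>c. \<forall>s. (x + s *\<^sub>R v, v) \<in> E --> \<Phi> (x + s *\<^sub>R v, v) = (x + (c - s) *\<^sub>R v, - v)"
  shows "(\<integral>\<^sup>+z. indicator E z * G (\<Phi> z) \<partial>lborel) \<le> (\<integral>\<^sup>+z. G z \<partial>lborel)"
proof -
  have G': "(\<lambda>z. G (fst z, - snd z)) \<in> Borel"
    by (rule measurable_compose[OF borel_continuous G]) (intro continuous_intros)
  show ?thesis
  unfolding nn_integral_reflect_velocity[OF G, symmetric] nn_integral_lines[OF G'] nn_integral_lines[OF F]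
  proof (intro nn_integral_mono)
    fix z :: "'a \<times> 'a"
    let ?x = "fst z" and ?v = "snd z"
    have m: "(\<lambda>s. G (?x + s *\<^sub>R ?v, - ?v)) \<in> Borel"
      by (rule measurable_compose[OF borel_continuous G]) (intro continuous_intros)
    have m': "(\<lambda>s. G (?x + (c + s) *\<^sub>R ?v, - ?v)) \<in> Borel" for c
      by (rule measurable_compose[OF borel_continuous G]) (intro continuous_intros)
    show "line_weight z * (\<integral>\<^sup>+s. indicator E (?x + s *\<^sub>R ?v, ?v) * G (\<Phi> (?x + s *\<^sub>R ?v, ?v)) \<partial>lborel)
      \<le> line_weight z * (\<integral>\<^sup>+s. G (fst (?x + s *\<^sub>R ?v, ?v), - snd (?x + s *\<^sub>R ?v, ?v)) \<partial>lborel)"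
    proof (cases "?v = 0")
      case True then show ?thesis by (simp add: line_weight_def)
    next
      case False
      then obtain c where c: "\<And>s. (?x + s *\<^sub>R ?v, ?v) \<in> E ==> \<Phi> (?x + s *\<^sub>R ?v, ?v) = (?x + (c - s) *\<^sub>R ?v, - ?v)"
        using \<Phi>[of ?v ?x] by blast
      have "(\<integral>\<^sup>+s. indicator E (?x + s *\<^sub>R ?v, ?v) * G (\<Phi> (?x + s *\<^sub>R ?v, ?v)) \<partial>lborel)
        \<le> (\<integral>\<^sup>+s. G (?x + (c + - s) *\<^sub>R ?v, - ?v) \<partial>lborel)"
        by (intro nn_integral_mono) (auto simp: c split: split_indicator)
      also have "... = (\<integral>\<^sup>+s. G (?x + (c + s) *\<^sub>R ?v, - ?v) \<partial>lborel)"
        by (rule nn_integral_lborel_uminus[of "\<lambda>s. G (?x + (c + s) *\<^sub>R ?v, - ?v)", OF m'])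
      also have "... = (\<integral>\<^sup>+s. G (?x + s *\<^sub>R ?v, - ?v) \<partial>lborel)"
        using nn_integral_lborel_translate[of "\<lambda>s. G (?x + s *\<^sub>R ?v, - ?v)" c, OF m] by (simp add: add.commute)
      finally show ?thesis by (simp add: mult_left_mono)
    qed
  qed
qed

section \<open>Billiard trajectories with velocity reversal\<close>

lemma phase_set_lebesgue: "open D ==> D \<times> (UNIV :: 'a::euclidean_space set) \<in> sets lebesgue"
  by (rule sets_completionI_sets) (simp add: open_Times borel_open)

lemma nn_integral_phase_space:
  fixes D :: "'a::euclidean_space set"
  assumes "open D"
  shows "(\<integral>\<^sup>+z. f z \<partial>phase_space D) = (\<integral>\<^sup>+z. f z * indicator (D \<times> UNIV) z \<partial>lborel)"
  unfolding phase_space_def using phase_set_lebesgue[OF assms]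
  by (subst nn_integral_restrict_space) (auto simp: nn_integral_completion)

lemma AE_phase_space:
  fixes D :: "'a::euclidean_space set"
  assumes "open D"
  shows "(AE z in phase_space D. P z) \<longleftrightarrow> (AE z in lborel. fst z \<in> D --> P z)"
  unfolding phase_space_def using phase_set_lebesgue[OF assms]
  by (subst AE_restrict_space_iff) (auto simp: AE_completion_iff mem_Times_iff)

lemma borel_imp_measurable_phase_space:
  assumes "f \<in> Borel"
  shows "f \<in> borel_measurable (phase_space D)"
  unfolding phase_space_def
  by (intro measurable_restrict_space1 measurable_completion) (use assms in simp)

lemma borel_measurable_completion_AE:
  fixes f g :: "'a::euclidean_space => real"
  assumes f: "f \<in> borel_measurable lebesgue" and eq: "AE x in lebesgue. f x = g x"
  shows "g \<in> borel_measurable lebesgue"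
proof (rule measurableI)
  fix A :: "real set" assume A: "A \<in> sets borel"
  show "g -` A \<inter> space lebesgue \<in> sets lebesgue"
  proof (rule completion.in_sets_AE)
    show "AE x in lebesgue. (x \<in> f -` A \<inter> space lebesgue) = (x \<in> g -` A \<inter> space lebesgue)"
      using eq by eventually_elim simp
    show "f -` A \<inter> space lebesgue \<in> sets lebesgue" using f A by (rule measurable_sets)
  qed auto
qed simp

text \<open>Completeness of Lebesgue measure lets measurability pass to functions known almost
  everywhere, such as a term of the series, identified at regular points, or an operator applied to
  an arbitrary representative.\<close>

lemma measurable_phase_space_AE:
  fixes D :: "'a::euclidean_space set" and f :: "'a \<times> 'a => real"
  assumes D: "open D" and g: "g \<in> borel_measurable (phase_space D)" and eq: "AE z in phase_space D. f z = g z"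
  shows "f \<in> borel_measurable (phase_space D)"
proof -
  note S = phase_set_lebesgue[OF D]
  have "(\<lambda>z. if z \<in> D \<times> UNIV then g z else 0) \<in> borel_measurable lebesgue"
    using g by (simp add: phase_space_def borel_measurable_if[OF S])
  moreover have "AE z in lebesgue. (if z \<in> D \<times> UNIV then g z else 0) = (if z \<in> D \<times> UNIV then f z else 0)"
    unfolding AE_completion_iff using eq[unfolded AE_phase_space[OF D]] by eventually_elim auto
  ultimately have "(\<lambda>z. if z \<in> D \<times> UNIV then f z else 0) \<in> borel_measurable lebesgue"
    by (rule borel_measurable_completion_AE)
  then show ?thesis by (simp add: phase_space_def borel_measurable_if[OF S])
qed

text \<open>Composition with the flow preserves measurability of Borel functions at once, but not of
  Lebesgue measurable ones. The extension by 0 outside \<open>D\<close> lets integrals be taken over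
  the whole space.\<close>

lemma phase_space_borel_version:
  fixes D :: "'a::euclidean_space set" and f :: "'a \<times> 'a => real"
  assumes D: "open D" and f: "f \<in> borel_measurable (phase_space D)"
  obtains f' where "f' \<in> Borel" "\<And>z. fst z \<notin> D ==> f' z = 0" "AE z in phase_space D. f' z = f z"
proof -
  note S = phase_set_lebesgue[OF D]
  have "(\<lambda>z. if z \<in> D \<times> UNIV then f z else 0) \<in> borel_measurable lebesgue"
    using f by (simp add: phase_space_def borel_measurable_if[OF S])
  then obtain g where g: "g \<in> borel_measurable lborel" "AE z in lborel. (if z \<in> D \<times> UNIV then f z else 0) = g z"
    using completion_ex_borel_measurable_real by blast
  have B: "D \<times> UNIV \<in> sets (borel :: ('a \<times> 'a) measure)" using D by (simp add: open_Times borel_open)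
  show thesis
  proof (rule that[of "\<lambda>z. g z * indicator (D \<times> UNIV) z"])
    show "(\<lambda>z. g z * indicator (D \<times> UNIV) z) \<in> Borel" using g(1) B by simp
    show "AE z in phase_space D. g z * indicator (D \<times> UNIV) z = f z"
      unfolding AE_phase_space[OF D] using g(2) by eventually_elim (auto simp: mem_Times_iff)
  qed (auto simp: mem_Times_iff)
qed

text \<open>The real-valued \<open>t_minus\<close>. The value 0 is a default for points outside
  \<open>D\<close> and for velocity 0, where \<open>t_minus\<close> is infinite at points of
  \<open>D\<close>.\<close>

definition exit_time :: "'a::euclidean_space set => 'a => 'a => real" where
  "exit_time D x v = (if x \<in> D \<and> v \<noteq> 0 then real_of_ereal (t_minus D x v) else 0)"

locale bounded_convex_domain =
  fixes D :: "'a::euclidean_space set"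
  assumes open_D: "open D" and bounded_D: "bounded D" and convex_D: "convex D"
begin

abbreviation "et \<equiv> exit_time D"

lemma exit_time_aux:
  assumes x: "x \<in> D" and v: "v \<noteq> 0"
  shows "t_minus D x v = ereal (et x v)" "0 < et x v" "0 \<le> s ==> x - s *\<^sub>R v \<in> D \<longleftrightarrow> s < et x v"
proof -
  define T where "T = {s. s > 0 \<and> x - s *\<^sub>R v \<notin> D}"
  define A where "A = Inf T"
  obtain B where B: "\<And>y. y \<in> D ==> norm y \<le> B" using bounded_D by (auto simp: bounded_iff)
  \<comment> \<open>At this time the displacement has length \<open>B + norm x + 1\<close>, so the
    point has left the ball of radius \<open>B\<close>.\<close>
  have "x - ((B + norm x + 1) / norm v) *\<^sub>R v \<notin> D"
  proof
    assume "x - ((B + norm x + 1) / norm v) *\<^sub>R v \<in> D"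
    then have "norm (x - ((B + norm x + 1) / norm v) *\<^sub>R v) \<le> B" by (rule B)
    moreover have "norm (((B + norm x + 1) / norm v) *\<^sub>R v) \<le> norm (x - ((B + norm x + 1) / norm v) *\<^sub>R v) + norm x"
      using norm_triangle_sub[of "((B + norm x + 1) / norm v) *\<^sub>R v" x] by (simp add: norm_minus_commute)
    moreover have "norm (((B + norm x + 1) / norm v) *\<^sub>R v) = \<bar>B + norm x + 1\<bar>" using v by simp
    ultimately show False by linarith
  qed
  moreover have "0 < (B + norm x + 1) / norm v"
    using B[OF x] v norm_ge_zero[of x] by (intro divide_pos_pos) (linarith, simp)
  ultimately have ne: "T \<noteq> {}" by (auto simp: T_def)
  have bd: "bdd_below T" by (rule bdd_belowI[of _ 0]) (auto simp: T_def)
  have conv: "x - s *\<^sub>R v \<in> D" if "0 \<le> s" "s \<le> r" "x - r *\<^sub>R v \<in> D" for s r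
  proof (cases "r = 0")
    case False
    then have "0 < r" using that by simp
    then have "x - s *\<^sub>R v = (1 - s/r) *\<^sub>R x + (s/r) *\<^sub>R (x - r *\<^sub>R v)" by (simp add: algebra_simps)
    then show ?thesis using convexD_alt[OF convex_D x that(3), of "s/r"] that \<open>0 < r\<close> by simp
  qed (use that x in simp)
  have A0: "0 \<le> A" unfolding A_def using ne by (intro cInf_greatest) (auto simp: T_def)
  have in1: "x - s *\<^sub>R v \<in> D" if "0 \<le> s" "s < A" for s
  proof (cases "s = 0")
    case False
    then show ?thesis using that cInf_lower[OF _ bd, of s] by (force simp: A_def T_def)
  qed (use x in simp)
  \<comment> \<open>Otherwise openness would extend the line in \<open>D\<close> by a further time
    \<open>d\<close>, convexity would leave no gap before, and \<open>A\<close> would not be the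
    infimum.\<close>
  have nA: "x - A *\<^sub>R v \<notin> D"
  proof
    assume "x - A *\<^sub>R v \<in> D"
    then obtain e where e: "0 < e" "ball (x - A *\<^sub>R v) e \<subseteq> D" using open_D open_contains_ball by blast
    define d where "d = e / (2 * norm v)"
    have d: "0 < d" "d * norm v < e" using e v by (auto simp: d_def)
    have "dist (x - A *\<^sub>R v) (x - (A + d) *\<^sub>R v) = d * norm v" using d by (simp add: dist_norm algebra_simps)
    then have "x - (A + d) *\<^sub>R v \<in> D" using e d by (auto simp: subset_iff)
    then have "A + d \<le> s" if "s \<in> T" for s
      using that conv[of s "A + d"] by (fastforce simp: T_def)
    then have "A + d \<le> A" unfolding A_def[symmetric] using ne by (subst (2) A_def) (intro cInf_greatest)
    then show False using d by simp
  qed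
  have tm: "t_minus D x v = ereal A"
    unfolding t_minus_def A_def T_def[symmetric] using ereal_Inf'[OF bd ne] by simp
  have et: "et x v = A" using x v by (simp add: exit_time_def tm)
  show "t_minus D x v = ereal (et x v)" by (simp add: tm et)
  show "0 < et x v" using A0 nA x et by (cases "A = 0") auto
  show "0 \<le> s ==> x - s *\<^sub>R v \<in> D \<longleftrightarrow> s < et x v"
    using in1[of s] conv[of A s] nA A0 unfolding et by (meson not_less)
qed

lemmas t_minus_eq = exit_time_aux(1) and exit_time_pos = exit_time_aux(2)

lemma t_plus_eq: "x \<in> D ==> v \<noteq> 0 ==> t_plus D x v = ereal (et x (- v))"
  using t_minus_eq[of x "- v"] by (simp add: t_minus_def t_plus_def)

lemma line_in_D_iff:
  assumes "x \<in> D" "v \<noteq> 0"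
  shows "x + s *\<^sub>R v \<in> D \<longleftrightarrow> - et x v < s \<and> s < et x (- v)"
  using exit_time_aux(3)[OF assms, of "- s"] exit_time_aux(3)[of x "- v" s]
    exit_time_pos[OF assms] exit_time_pos[of x "- v"] assms by (cases "0 \<le> s") auto

text \<open>For \<open>r > max 0 s\<close> both conditions on \<open>r\<close> describe the same
  point of the line being in \<open>D\<close>, so the two thresholds coincide.\<close>

lemma exit_time_line:
  assumes x: "x \<in> D" and v: "v \<noteq> 0" and s: "x + s *\<^sub>R v \<in> D"
  shows "et (x + s *\<^sub>R v) v = et x v + s"
proof -
  let ?y = "x + s *\<^sub>R v"
  have "r < et ?y v \<longleftrightarrow> r < et x v + s" if "0 < r" "s < r" for r
  proof -
    have "r < et ?y v \<longleftrightarrow> ?y + (- r) *\<^sub>R v \<in> D"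
      using line_in_D_iff[OF s v, of "- r"] that exit_time_pos[OF s, of "- v"] v by auto
    also have "?y + (- r) *\<^sub>R v = x + (s - r) *\<^sub>R v" by (simp add: algebra_simps)
    also have "... \<in> D \<longleftrightarrow> r < et x v + s"
      using line_in_D_iff[OF x v, of "s - r"] that exit_time_pos[OF x, of "- v"] v by auto
    finally show ?thesis .
  qed
  note * = this
  have p: "0 < et ?y v" "0 < et x v + s" "s < et x v + s"
    using exit_time_pos[OF s v] exit_time_pos[OF x v] line_in_D_iff[OF x v, of s] s by auto
  have q: "s < et ?y v"
    using line_in_D_iff[OF s v, of "- s"] x exit_time_pos[OF s v] by auto
  show ?thesis using *[of "et ?y v"] *[of "et x v + s"] p q by (meson less_irrefl linorder_neqE_linordered_idom)
qed

text \<open>For \<open>a \<ge> 0\<close> the superlevel set is open, being described by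
  \<open>x \<in> D\<close>, \<open>v \<noteq> 0\<close> and \<open>x - a v \<in> D\<close>; for
  \<open>a < 0\<close> it is the whole space.\<close>

lemma exit_time_measurable [measurable]: "(\<lambda>z. et (fst z) (snd z)) \<in> Borel"
proof -
  have "{z. a < et (fst z) (snd z)} \<in> sets borel" for a
  proof (cases "0 \<le> a")
    case True
    have "{z. a < et (fst z) (snd z)} = {z. fst z \<in> D \<and> snd z \<noteq> 0 \<and> fst z - a *\<^sub>R snd z \<in> D}"
    proof (intro Collect_cong)
      fix z :: "'a \<times> 'a"
      show "a < et (fst z) (snd z) \<longleftrightarrow> fst z \<in> D \<and> snd z \<noteq> 0 \<and> fst z - a *\<^sub>R snd z \<in> D"
      proof (cases "fst z \<in> D \<and> snd z \<noteq> 0")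
        case True': True
        then show ?thesis using exit_time_aux(3)[of "fst z" "snd z" a] True by simp
      next
        case False
        then show ?thesis using True by (auto simp: exit_time_def)
      qed
    qed
    also have "open ..."
      using open_D by (intro open_Collect_conj open_Collect_neq continuous_intros)
        (auto intro!: open_vimage[unfolded vimage_def] continuous_intros)
    finally show ?thesis by (rule borel_open)
  next
    case False
    have "{z. a < et (fst z) (snd z)} = UNIV"
    proof safe
      fix x v :: 'a
      show "a < et (fst (x, v)) (snd (x, v))"
        using False exit_time_pos[of x v] by (cases "x \<in> D \<and> v \<noteq> 0") (auto simp: exit_time_def)
    qed simp
    then show ?thesis by simp
  qed
  then show ?thesis by (simp add: borel_measurable_iff_greater)
qed

definition chord :: "'a \<times> 'a => real" where "chord z = et (fst z) (snd z) + et (fst z) (- snd z)"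

lemma tau_eq: "x \<in> D ==> v \<noteq> 0 ==> tau D x v = ereal (chord (x, v))"
  by (simp add: tau_def t_minus_eq t_plus_eq chord_def)

lemma measurable_fst_snd_borel [measurable]:
  "fst \<in> borel_measurable (borel :: ('x::second_countable_topology \<times> 'y::second_countable_topology) measure)"
  "snd \<in> borel_measurable (borel :: ('x \<times> 'y) measure)"
  by (intro borel_continuous continuous_intros)+

lemma exit_time_rev_measurable [measurable]: "(\<lambda>z. et (fst z) (- snd z)) \<in> Borel"
  by (rule measurable_compose[OF borel_continuous[of "\<lambda>z. (fst z, - snd z)"] exit_time_measurable, simplified])
    (intro continuous_intros)

lemma chord_measurable [measurable]: "chord \<in> Borel"
  unfolding chord_def by measurable

text \<open>Follow the trajectory through \<open>z\<close> backwards for a time \<open>t\<close>: \<open>bounces t z\<close> counts its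
  reflections, \<open>since t z\<close> is the time that the particle at the end of this trajectory has travelled
  since its last reflection, i.e. its value of \<open>t_minus\<close>.\<close>

definition bounces :: "real => 'a \<times> 'a => nat" where
  "bounces t z = nat (\<lfloor>(t - et (fst z) (snd z)) / chord z\<rfloor> + 1)"

definition since :: "real => 'a \<times> 'a => real" where
  "since t z = et (fst z) (snd z) - t + real (bounces t z) * chord z"

definition flow :: "real => 'a \<times> 'a => 'a \<times> 'a" where
  "flow t z = (if even (bounces t z)
     then (fst z + (since t z - et (fst z) (snd z)) *\<^sub>R snd z, snd z)
     else (fst z + (et (fst z) (- snd z) - since t z) *\<^sub>R snd z, - snd z))"

text \<open>The points whose trajectory is not exactly at the boundary after time \<open>t\<close>.\<close>

definition regular :: "real => 'a \<times> 'a => bool" where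
  "regular t z \<longleftrightarrow> fst z \<in> D \<and> snd z \<noteq> 0 \<and> 0 < since t z \<and> since t z < chord z"

section \<open>The law of the billiard flow\<close>

lemma chord_pos: "x \<in> D ==> v \<noteq> 0 ==> 0 < chord (x, v)"
  using exit_time_pos[of x v] exit_time_pos[of x "- v"] by (simp add: chord_def)

lemma exit_time_less_chord: "x \<in> D ==> v \<noteq> 0 ==> et x v < chord (x, v)"
  using exit_time_pos[of x "- v"] by (simp add: chord_def)

text \<open>The two bounds fix a convention: a bounce exactly at time \<open>t\<close> is already
  counted, and \<open>since\<close> then equals the whole chord.\<close>

lemma bounces_eqI:
  assumes "x \<in> D" "v \<noteq> 0" "0 < et x v - t + real n * chord (x, v)" "et x v - t + real n * chord (x, v) \<le> chord (x, v)"
  shows "bounces t (x, v) = n"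
proof -
  have "\<lfloor>(t - et x v) / chord (x, v)\<rfloor> = int n - 1"
    using assms chord_pos[of x v] by (intro floor_unique) (auto simp: field_simps)
  then show ?thesis by (simp add: bounces_def)
qed

lemma since_bounds:
  assumes "x \<in> D" "v \<noteq> 0" "0 \<le> t"
  shows "0 < since t (x, v)" "since t (x, v) \<le> chord (x, v)"
proof -
  let ?c = "chord (x, v)" and ?y = "(t - et x v) / chord (x, v)"
  have c: "0 < ?c" using assms chord_pos by simp
  \<comment> \<open>Keeps \<open>nat\<close> in the definition of \<open>bounces\<close> from
    truncating; \<open>?y\<close> is negative before the first bounce.\<close>
  have "-1 < ?y" using exit_time_less_chord[of x v] assms c by (simp add: field_simps)
  then have "-1 \<le> \<lfloor>?y\<rfloor>" by (simp add: le_floor_iff)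
  then have n: "real (bounces t (x, v)) = of_int \<lfloor>?y\<rfloor> + 1" by (simp add: bounces_def)
  have y: "?y * ?c = t - et x v" using c by simp
  have "?y * ?c < (of_int \<lfloor>?y\<rfloor> + 1) * ?c" using c floor_correct[of ?y] by (intro mult_strict_right_mono) auto
  then show "0 < since t (x, v)" unfolding since_def n y by simp
  have "of_int \<lfloor>?y\<rfloor> * ?c \<le> ?y * ?c" using c floor_correct[of ?y] by (intro mult_right_mono) auto
  then show "since t (x, v) \<le> chord (x, v)" unfolding since_def n y by (simp add: distrib_right)
qed

lemma exit_time_chord_line:
  assumes "x \<in> D" "v \<noteq> 0" "x + s *\<^sub>R v \<in> D"
  shows "et (x + s *\<^sub>R v) v = et x v + s" "et (x + s *\<^sub>R v) (- v) = et x (- v) - s"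
    "chord (x + s *\<^sub>R v, v) = chord (x, v)"
  using exit_time_line[of x v s] exit_time_line[of x "- v" "- s"] assms by (auto simp: chord_def)

lemma chord_uminus: "chord (x, - v) = chord (x, v)" by (simp add: chord_def)

text \<open>The end point has \<open>since\<close> as its backward exit time, so the next piece of
  the trajectory can be followed from there.\<close>

lemma flow_regular:
  assumes r: "regular t (x, v)"
  shows "fst (flow t (x, v)) \<in> D" "snd (flow t (x, v)) = (if even (bounces t (x, v)) then v else - v)"
    "et (fst (flow t (x, v))) (snd (flow t (x, v))) = since t (x, v)"
    "et (fst (flow t (x, v))) (- snd (flow t (x, v))) = chord (x, v) - since t (x, v)"
    "chord (flow t (x, v)) = chord (x, v)"
proof -
  let ?p = "since t (x, v)" and ?A = "et x v" and ?B = "et x (- v)"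
  have x: "x \<in> D" and v: "v \<noteq> 0" and p: "0 < ?p" "?p < ?A + ?B"
    using r by (auto simp: regular_def chord_def)
  define s where "s = (if even (bounces t (x, v)) then ?p - ?A else ?B - ?p)"
  have fl: "flow t (x, v) = (x + s *\<^sub>R v, if even (bounces t (x, v)) then v else - v)"
    by (simp add: flow_def s_def)
  have y: "x + s *\<^sub>R v \<in> D" unfolding line_in_D_iff[OF x v] using p by (auto simp: s_def)
  note e = exit_time_chord_line[OF x v y]
  show "fst (flow t (x, v)) \<in> D" using y by (simp add: fl)
  show "snd (flow t (x, v)) = (if even (bounces t (x, v)) then v else - v)" by (simp add: fl)
  show "et (fst (flow t (x, v))) (snd (flow t (x, v))) = ?p"
    using e unfolding fl s_def by (cases "even (bounces t (x, v))") simp_all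
  show "et (fst (flow t (x, v))) (- snd (flow t (x, v))) = chord (x, v) - ?p"
    using e unfolding fl s_def chord_def by (cases "even (bounces t (x, v))") simp_all
  show "chord (flow t (x, v)) = chord (x, v)"
    using e by (simp add: fl chord_uminus)
qed

text \<open>With \<open>bounces s z + bounces t (flow s z)\<close> as the count, the formula for
  \<open>since\<close> at time \<open>s + t\<close> yields \<open>since t (flow s z)\<close>, which
  lies strictly between 0 and the chord. This determines the count, and the parity of the sum
  determines the orientation.\<close>

lemma flow_add:
  assumes "0 \<le> s" "0 \<le> t" and r: "regular s z" and r': "regular t (flow s z)"
  shows "regular (s + t) z" "bounces (s + t) z = bounces s z + bounces t (flow s z)"
    "flow (s + t) z = flow t (flow s z)"
proof -
  obtain x v where z: "z = (x, v)" by (cases z)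
  let ?w = "flow s z" and ?c = "chord z"
  let ?p = "since s z" and ?p' = "since t ?w" and ?n = "bounces s z" and ?n' = "bounces t ?w"
  have x: "x \<in> D" and v: "v \<noteq> 0" and p: "0 < ?p" "?p < ?c" using r by (auto simp: regular_def z)
  note fr = flow_regular[OF r[unfolded z], folded z]
  have p': "0 < ?p'" "?p' < ?c" using r' fr(5) by (auto simp: regular_def)
  have p'eq: "?p' = ?p - t + real ?n' * ?c" using fr(3,5) by (simp add: since_def[of t])
  have eq: "et x v - (s + t) + real (?n + ?n') * ?c = ?p'"
    unfolding p'eq since_def[of s] by (simp add: z algebra_simps)
  have "bounces (s + t) (x, v) = ?n + ?n'"
    by (rule bounces_eqI[OF x v]) (use eq p' z in auto)
  then show b: "bounces (s + t) z = ?n + ?n'" by (simp add: z)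
  have sn: "since (s + t) z = ?p'" using eq unfolding since_def[of "s + t"] b by (simp add: z)
  show "regular (s + t) z" using x v p' by (simp add: regular_def sn z[symmetric]) (simp add: z)
  have c: "?c = et x v + et x (- v)" by (simp add: z chord_def)
  have w: "?w = (x + (if even ?n then ?p - et x v else et x (- v) - ?p) *\<^sub>R v, if even ?n then v else - v)"
    by (simp add: flow_def z)
  have e1: "et (fst ?w) (snd ?w) = ?p" and e2: "et (fst ?w) (- snd ?w) = ?c - ?p" using fr by auto
  have "flow t ?w = (if even ?n' then (fst ?w + (?p' - ?p) *\<^sub>R snd ?w, snd ?w)
     else (fst ?w + (?c - ?p - ?p') *\<^sub>R snd ?w, - snd ?w))"
    by (simp only: flow_def[of t] e1 e2)
  also have "... = (if even (?n + ?n') then (x + (?p' - et x v) *\<^sub>R v, v) else (x + (et x (- v) - ?p') *\<^sub>R v, - v))"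
    unfolding w c by (auto simp: algebra_simps)
  also have "... = flow (s + t) z" unfolding flow_def[of "s + t"] sn b by (simp add: z)
  finally show "flow (s + t) z = flow t ?w" by simp
qed

section \<open>Measurability and null sets under the flow\<close>

lemma bounces_measurable [measurable]:
  "(\<lambda>y. bounces (fst y) (snd y)) \<in> measurable (borel :: (real \<times> ('a \<times> 'a)) measure) (count_space UNIV)"
proof -
  have [measurable]: "(\<lambda>y :: real \<times> ('a \<times> 'a). et (fst (snd y)) (snd (snd y))) \<in> Borel"
    "(\<lambda>y :: real \<times> ('a \<times> 'a). chord (snd y)) \<in> Borel"
    by (rule measurable_compose[OF measurable_fst_snd_borel(2)], measurable)+
  show ?thesis unfolding bounces_def by measurable
qed

lemma since_measurable [measurable]:
  "(\<lambda>y. since (fst y) (snd y)) \<in> borel_measurable (borel :: (real \<times> ('a \<times> 'a)) measure)"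
proof -
  have [measurable]: "(\<lambda>y :: real \<times> ('a \<times> 'a). et (fst (snd y)) (snd (snd y))) \<in> Borel"
    "(\<lambda>y :: real \<times> ('a \<times> 'a). chord (snd y)) \<in> Borel"
    by (rule measurable_compose[OF measurable_fst_snd_borel(2)], measurable)+
  show ?thesis unfolding since_def by measurable
qed

lemma flow_measurable [measurable]:
  "(\<lambda>y. flow (fst y) (snd y)) \<in> borel_measurable (borel :: (real \<times> ('a \<times> 'a)) measure)"
proof -
  have [measurable]: "(\<lambda>y :: real \<times> ('a \<times> 'a). et (fst (snd y)) (snd (snd y))) \<in> Borel"
    "(\<lambda>y :: real \<times> ('a \<times> 'a). et (fst (snd y)) (- snd (snd y))) \<in> Borel"
    by (rule measurable_compose[OF measurable_fst_snd_borel(2)], measurable)+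
  have [measurable]: "(\<lambda>y :: real \<times> ('a \<times> 'a). fst (snd y)) \<in> Borel"
    "(\<lambda>y :: real \<times> ('a \<times> 'a). snd (snd y)) \<in> Borel"
    by (intro borel_continuous continuous_intros)+
  show ?thesis unfolding flow_def by measurable
qed

lemma Pair_const_measurable: "Pair t \<in> borel_measurable (borel :: ('x::second_countable_topology) measure)"
  for t :: "'y::second_countable_topology"
  by (intro borel_continuous continuous_intros)

lemma flow_measurable1 [measurable]: "flow t \<in> Borel"
  using measurable_compose[OF Pair_const_measurable flow_measurable, of t] by simp

lemma bounces_measurable1 [measurable]: "bounces t \<in> measurable borel (count_space UNIV)"
  using measurable_compose[OF Pair_const_measurable bounces_measurable, of t] by simp

lemma since_measurable1 [measurable]: "since t \<in> Borel"
  using measurable_compose[OF Pair_const_measurable since_measurable, of t] by simp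

lemma regular_measurable [measurable]: "Measurable.pred borel (regular t)"
proof -
  have [measurable]: "D \<in> sets borel" using open_D by simp
  show ?thesis unfolding regular_def by measurable
qed

text \<open>By \<open>since_bounds\<close>, an irregular point of nonzero velocity has
  \<open>since\<close> equal to the chord. On a line the exit time is affine in the parameter and
  the chord is constant, so each bounce count excludes one parameter value.\<close>

lemma AE_regular:
  assumes t: "0 \<le> t"
  shows "AE z in lborel. fst z \<in> D --> regular t z"
proof -
  have [measurable]: "D \<in> sets borel" using open_D by simp
  have "AE z in lborel. fst z \<in> D \<and> snd z \<noteq> 0 --> regular t z"
  proof (rule AE_lines_imp_AE)
    fix x v :: 'a assume v: "v \<noteq> 0"
    show "AE s in lborel. fst (x + s *\<^sub>R v, v) \<in> D \<and> snd (x + s *\<^sub>R v, v) \<noteq> 0 --> regular t (x + s *\<^sub>R v, v)"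
    proof (cases "\<exists>s. x + s *\<^sub>R v \<in> D")
      case True
      then obtain s0 where s0: "x + s0 *\<^sub>R v \<in> D" by blast
      let ?y = "x + s0 *\<^sub>R v"
      let ?C = "range (\<lambda>n::nat. t - et ?y v + s0 - (real n - 1) * chord (?y, v))"
      have "AE s in lborel. s \<notin> ?C"
        by (intro AE_not_in countable_imp_null_set_lborel countable_image countableI_type)
      then show ?thesis
      proof eventually_elim
        fix s assume s: "s \<notin> ?C"
        show "fst (x + s *\<^sub>R v, v) \<in> D \<and> snd (x + s *\<^sub>R v, v) \<noteq> 0 --> regular t (x + s *\<^sub>R v, v)"
        proof
          let ?z = "(x + s *\<^sub>R v, v)"
          assume a: "fst ?z \<in> D \<and> snd ?z \<noteq> 0"
          have eq: "x + s *\<^sub>R v = ?y + (s - s0) *\<^sub>R v" by (simp add: algebra_simps)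
          have e: "et (x + s *\<^sub>R v) v = et ?y v + (s - s0)" "chord ?z = chord (?y, v)"
            using exit_time_chord_line[OF s0 v, of "s - s0"] a unfolding eq by auto
          have "since t ?z \<noteq> chord ?z"
          proof
            assume "since t ?z = chord ?z"
            then have "s = t - et ?y v + s0 - (real (bounces t ?z) - 1) * chord (?y, v)"
              unfolding since_def fst_conv snd_conv e by (simp add: algebra_simps)
            then show False using s by blast
          qed
          then show "regular t ?z" using since_bounds[of "x + s *\<^sub>R v" v t] a t by (auto simp: regular_def)
        qed
      qed
    qed simp
  qed measurable
  then show ?thesis using AE_velocity_nonzero by eventually_elim simp
qed

text \<open>With the number of bounces fixed, the flow acts on each line as a translation (even
  count) or a reflection (odd count), since backward and forward exit times change along the line at
  rates 1 and -1. The constants of these maps depend on the count.\<close>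

lemma nn_integral_flow_le:
  assumes G [measurable]: "G \<in> Borel"
  shows "(\<integral>\<^sup>+z. indicator {z. regular t z \<and> bounces t z = n} z * G (flow t z) \<partial>lborel) \<le> (\<integral>\<^sup>+z. G z \<partial>lborel)"
proof -
  let ?E = "{z. regular t z \<and> bounces t z = n}"
  have F: "(\<lambda>z. indicator ?E z * G (flow t z)) \<in> Borel" by measurable
  have key: "et (x + s *\<^sub>R v) v = et (x + r *\<^sub>R v) v + (s - r) \<and> et (x + s *\<^sub>R v) (- v) = et (x + r *\<^sub>R v) (- v) - (s - r)
      \<and> chord (x + s *\<^sub>R v, v) = chord (x + r *\<^sub>R v, v)"
    if "v \<noteq> 0" "(x + s *\<^sub>R v, v) \<in> ?E" "(x + r *\<^sub>R v, v) \<in> ?E" for x v s r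
  proof -
    have eq: "x + s *\<^sub>R v = (x + r *\<^sub>R v) + (s - r) *\<^sub>R v" by (simp add: algebra_simps)
    show ?thesis using exit_time_chord_line[of "x + r *\<^sub>R v" v "s - r"] that unfolding eq by (simp add: regular_def)
  qed
  show ?thesis
  proof (cases "even n")
    case True
    show ?thesis
    proof (rule nn_integral_chord_translation_le[OF G F])
      fix x v :: 'a assume v: "v \<noteq> 0"
      show "\<exists>c. \<forall>s. (x + s *\<^sub>R v, v) \<in> ?E --> flow t (x + s *\<^sub>R v, v) = (x + (s + c) *\<^sub>R v, v)"
      proof (cases "\<exists>r. (x + r *\<^sub>R v, v) \<in> ?E")
        case r: True
        then obtain r where r: "(x + r *\<^sub>R v, v) \<in> ?E" by blast
        show ?thesis
        proof (intro exI[of _ "real n * chord (x + r *\<^sub>R v, v) - t"] allI impI)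
          fix s assume s: "(x + s *\<^sub>R v, v) \<in> ?E"
          have b: "bounces t (x + s *\<^sub>R v, v) = n" using s by simp
          have "since t (x + s *\<^sub>R v, v) - et (x + s *\<^sub>R v) v = real n * chord (x + r *\<^sub>R v, v) - t"
            using key[OF v s r] by (simp add: since_def b)
          then have "flow t (x + s *\<^sub>R v, v) = (x + s *\<^sub>R v + (real n * chord (x + r *\<^sub>R v, v) - t) *\<^sub>R v, v)"
            using True by (simp add: flow_def b)
          then show "flow t (x + s *\<^sub>R v, v) = (x + (s + (real n * chord (x + r *\<^sub>R v, v) - t)) *\<^sub>R v, v)"
            by (simp add: algebra_simps)
        qed
      qed blast
    qed
  next
    case False
    show ?thesis
    proof (rule nn_integral_chord_reflection_le[OF G F])
      fix x v :: 'a assume v: "v \<noteq> 0"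
      show "\<exists>c. \<forall>s. (x + s *\<^sub>R v, v) \<in> ?E --> flow t (x + s *\<^sub>R v, v) = (x + (c - s) *\<^sub>R v, - v)"
      proof (cases "\<exists>r. (x + r *\<^sub>R v, v) \<in> ?E")
        case r: True
        then obtain r where r: "(x + r *\<^sub>R v, v) \<in> ?E" by blast
        let ?y = "x + r *\<^sub>R v"
        have vec: "x + s *\<^sub>R v + (c - s - s) *\<^sub>R v = x + (c - s) *\<^sub>R v" for c s
          by (simp only: add.assoc scaleR_add_left[symmetric]) simp
        show ?thesis
        \<comment> \<open>The forward exit time minus \<open>since\<close> is affine in
          \<open>s\<close> with slope -2; adding the position \<open>s\<close> itself leaves slope
          -1.\<close>
        proof (intro exI[of _ "2 * r + et ?y (- v) - et ?y v + t - real n * chord (?y, v)"] allI impI)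
          fix s assume s: "(x + s *\<^sub>R v, v) \<in> ?E"
          have b: "bounces t (x + s *\<^sub>R v, v) = n" using s by simp
          have "et (x + s *\<^sub>R v) (- v) - since t (x + s *\<^sub>R v, v) = (2 * r + et ?y (- v) - et ?y v + t - real n * chord (?y, v)) - s - s"
            using key[OF v s r] by (simp add: since_def b)
          then have "flow t (x + s *\<^sub>R v, v) = (x + s *\<^sub>R v + ((2 * r + et ?y (- v) - et ?y v + t - real n * chord (?y, v)) - s - s) *\<^sub>R v, - v)"
            using False by (simp add: flow_def b)
          then show "flow t (x + s *\<^sub>R v, v) = (x + ((2 * r + et ?y (- v) - et ?y v + t - real n * chord (?y, v)) - s) *\<^sub>R v, - v)"
            by (simp only: vec)
        qed
      qed blast
    qed
  qed
qed

text \<open>Preimages of null sets under the flow are null, because the count takes countably many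
  values and each piece satisfies \<open>nn_integral_flow_le\<close>. This makes composition with
  the flow well defined on classes of functions.\<close>

lemma AE_flow:
  assumes t: "0 \<le> t" and P: "AE z in lborel. fst z \<in> D --> P z"
  shows "AE z in lborel. fst z \<in> D --> regular t z \<and> P (flow t z)"
proof -
  from P obtain N where N: "{z. \<not> (fst z \<in> D --> P z)} \<subseteq> N" "N \<in> sets borel" "emeasure lborel N = 0"
    by (auto elim!: AE_E)
  have [measurable]: "N \<in> sets borel" by fact
  have "AE z in lborel. regular t z \<and> bounces t z = n --> flow t z \<notin> N" for n
  proof -
    have "(\<integral>\<^sup>+z. indicator {z. regular t z \<and> bounces t z = n} z * indicator N (flow t z) \<partial>lborel) \<le> 0"
      using nn_integral_flow_le[of "indicator N" t n] N by simp
    then have "AE z in lborel. indicator {z. regular t z \<and> bounces t z = n} z * indicator N (flow t z) = (0::ennreal)"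
      by (subst (asm) le_zero_eq, subst (asm) nn_integral_0_iff_AE) auto
    then show ?thesis by eventually_elim (auto simp: indicator_def split: if_splits)
  qed
  then have "AE z in lborel. \<forall>n. regular t z \<and> bounces t z = n --> flow t z \<notin> N"
    unfolding AE_all_countable by blast
  then show ?thesis using AE_regular[OF t]
  proof eventually_elim
    fix z assume a: "\<forall>n. regular t z \<and> bounces t z = n --> flow t z \<notin> N" "fst z \<in> D --> regular t z"
    show "fst z \<in> D --> regular t z \<and> P (flow t z)"
    proof
      assume "fst z \<in> D"
      then have r: "regular t z" using a by simp
      then have "fst (flow t z) \<in> D" using flow_regular(1)[of t "fst z" "snd z"] by simp
      then show "regular t z \<and> P (flow t z)" using r a N(1) by auto
    qed
  qed
qed

end

section \<open>The bounce-back semigroup\<close>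

lemma Lp_phase_space_borel_version:
  fixes D :: "'a::euclidean_space set"
  assumes D: "open D" and p: "1 \<le> p" and f: "f \<in> Lp_space (phase_space D) p"
  obtains f' where "f' \<in> Borel" "\<And>z. fst z \<notin> D ==> f' z = 0"
    "AE z in phase_space D. f' z = f z" "f' \<in> Lp_space (phase_space D) p"
proof -
  obtain f' where f': "f' \<in> Borel" "\<And>z. fst z \<notin> D ==> f' z = 0" "AE z in phase_space D. f' z = f z"
    using phase_space_borel_version[OF D Lp_space_measurable[OF f]] by blast
  have "f' \<in> Lp_space (phase_space D) p"
    by (rule Lp_space_cong_AE[OF p f borel_imp_measurable_phase_space[OF f'(1)]]) (use f'(3) in \<open>auto elim: eventually_mono\<close>)
  then show thesis using that f' by blast
qed

lemma Lp_dominated_convergence: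
  assumes p: "1 \<le> p" and u: "\<And>n. u n \<in> borel_measurable M" and f: "f \<in> borel_measurable M"
    and w: "w \<in> Lp_space M p" and le: "\<And>n. AE x in M. \<bar>u n x\<bar> \<le> \<bar>w x\<bar>"
    and lim: "AE x in M. (\<lambda>n. u n x) \<longlonglongrightarrow> f x"
  shows "(\<lambda>n. Lp_norm M p (\<lambda>x. u n x - f x)) \<longlonglongrightarrow> 0" "f \<in> Lp_space M p"
proof -
  have ae: "AE x in M. \<forall>n. \<bar>u n x\<bar> \<le> \<bar>w x\<bar>" using le by (simp add: AE_all_countable)
  have fle: "AE x in M. \<bar>f x\<bar> \<le> \<bar>w x\<bar>" using ae lim
  proof eventually_elim
    fix x assume a: "\<forall>n. \<bar>u n x\<bar> \<le> \<bar>w x\<bar>" "(\<lambda>n. u n x) \<longlonglongrightarrow> f x"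
    show "\<bar>f x\<bar> \<le> \<bar>w x\<bar>" by (rule LIMSEQ_le_const2[OF tendsto_rabs[OF a(2)]]) (use a(1) in auto)
  qed
  show "f \<in> Lp_space M p" by (rule Lp_dominated(1)[OF p w f fle])
  have "(\<lambda>n. LINT x|M. \<bar>u n x - f x\<bar> powr p) \<longlonglongrightarrow> (LINT x|M. 0)"
  proof (rule integral_dominated_convergence)
    show "integrable M (\<lambda>x. \<bar>2 * w x\<bar> powr p)" using Lp_scale(1)[OF p w, of 2] by (simp add: Lp_space_def)
    show "AE x in M. (\<lambda>n. \<bar>u n x - f x\<bar> powr p) \<longlonglongrightarrow> 0" using lim
    proof eventually_elim
      fix x assume "(\<lambda>n. u n x) \<longlonglongrightarrow> f x"
      then have "(\<lambda>n. \<bar>u n x - f x\<bar> powr p) \<longlonglongrightarrow> \<bar>f x - f x\<bar> powr p"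
        using p by (intro tendsto_powr2 tendsto_rabs tendsto_diff tendsto_const) auto
      then show "(\<lambda>n. \<bar>u n x - f x\<bar> powr p) \<longlonglongrightarrow> 0" using p by simp
    qed
    show "AE x in M. norm (\<bar>u n x - f x\<bar> powr p) \<le> \<bar>2 * w x\<bar> powr p" for n
      using ae fle
    proof eventually_elim
      fix x assume a: "\<forall>n. \<bar>u n x\<bar> \<le> \<bar>w x\<bar>" "\<bar>f x\<bar> \<le> \<bar>w x\<bar>"
      have "\<bar>u n x - f x\<bar> \<le> \<bar>2 * w x\<bar>" using a(1)[rule_format, of n] a(2) by linarith
      then show "norm (\<bar>u n x - f x\<bar> powr p) \<le> \<bar>2 * w x\<bar> powr p" using p by (auto intro: powr_mono2)
    qed
  qed (use u f in auto)
  then have "(\<lambda>n. (LINT x|M. \<bar>u n x - f x\<bar> powr p) powr (1/p)) \<longlonglongrightarrow> 0 powr (1/p)"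
    using p by (intro tendsto_powr2 tendsto_const) (auto intro!: always_eventually integral_nonneg_AE)
  then show "(\<lambda>n. Lp_norm M p (\<lambda>x. u n x - f x)) \<longlonglongrightarrow> 0" using p by (simp add: Lp_norm_def)
qed

lemma Lp_bounded_support:
  fixes D :: "'a::euclidean_space set" and f :: "'a \<times> 'a => real"
  assumes D: "open D" and p: "1 \<le> p" and f: "f \<in> borel_measurable (phase_space D)"
    and B: "bounded B" and le: "AE z in phase_space D. \<bar>f z\<bar> \<le> C * indicator B z"
  shows "f \<in> Lp_space (phase_space D) p"
proof -
  obtain r where "\<And>z. z \<in> B ==> norm z \<le> r" using B by (auto simp: bounded_iff)
  then have r: "B \<subseteq> cball 0 r" by auto
  let ?w = "\<lambda>z. \<bar>C\<bar> * indicator (cball 0 r) z :: real"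
  have w: "?w \<in> Borel"
    by (intro borel_measurable_times borel_measurable_const borel_measurable_indicator borel_closed closed_cball)
  have "?w \<in> Lp_space (phase_space D) p"
  proof (rule Lp_spaceI_finite[OF p borel_imp_measurable_phase_space[OF w]])
    have "(\<integral>\<^sup>+z. ennreal (\<bar>?w z\<bar> powr p) \<partial>phase_space D) \<le> (\<integral>\<^sup>+z. ennreal (\<bar>C\<bar> powr p) * indicator (cball (0::'a\<times>'a) r) z \<partial>lborel)"
      unfolding nn_integral_phase_space[OF D] by (intro nn_integral_mono) (use p in \<open>auto simp: indicator_def\<close>)
    also have "... = ennreal (\<bar>C\<bar> powr p) * emeasure lborel (cball (0 :: 'a \<times> 'a) r)"
      by (rule nn_integral_cmult_indicator) simp
    also have "... < \<infinity>" using emeasure_lborel_cball_finite[of "0::'a\<times>'a" r] by (simp add: ennreal_mult_less_top)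
    finally show "(\<integral>\<^sup>+z. ennreal (\<bar>?w z\<bar> powr p) \<partial>phase_space D) < \<infinity>" .
  qed
  then show ?thesis
  proof (rule Lp_dominated(1)[OF p _ f])
    show "AE z in phase_space D. \<bar>f z\<bar> \<le> \<bar>?w z\<bar>"
      using le
    proof eventually_elim
      fix z assume "\<bar>f z\<bar> \<le> C * indicator B z"
      also have "... \<le> \<bar>C\<bar> * indicator (cball 0 r) z" using r by (auto simp: indicator_def)
      finally show "\<bar>f z\<bar> \<le> \<bar>?w z\<bar>" by (simp add: abs_mult)
    qed
  qed
qed

lemma compact_support_bounded:
  fixes f :: "'c::euclidean_space => real"
  assumes f: "continuous_on UNIV f" and K: "compact K" "\<And>z. z \<notin> K ==> f z = 0"
  obtains C where "0 \<le> C" "\<And>z. \<bar>f z\<bar> \<le> C"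
proof -
  have "bounded (f ` K)" by (intro compact_imp_bounded compact_continuous_image K continuous_on_subset[OF f]) simp
  then obtain C where C: "\<And>z. z \<in> K ==> \<bar>f z\<bar> \<le> C" unfolding bounded_iff by auto
  show thesis
  proof (rule that[of "\<bar>C\<bar>"])
    fix z show "\<bar>f z\<bar> \<le> \<bar>C\<bar>" using C[of z] K(2)[of z] by (cases "z \<in> K") auto
  qed simp
qed

context bounded_convex_domain
begin

text \<open>\<open>bounce_op \<gamma> \<sigma> m t\<close> collects the contributions of the trajectories with at least \<open>m\<close>
  reflections; \<open>m = 0\<close> yields the semigroup, and the other values the remainders of the series.\<close>

definition bounce_op :: "real => ('a => real) => nat => real => ('a \<times> 'a => real) => 'a \<times> 'a => real" where
  "bounce_op \<gamma> \<sigma> m t f z = (if m \<le> bounces t z then \<gamma> ^ bounces t z * exp (- \<sigma> (snd z) * t) * f (flow t z) else 0)"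

section \<open>Bounds and the semigroup law\<close>

lemma bounce_op_measurable:
  assumes [measurable]: "\<sigma> \<in> Borel" "f \<in> Borel"
  shows "(\<lambda>y. bounce_op \<gamma> \<sigma> m (fst y) f (snd y)) \<in> borel_measurable (borel :: (real \<times> ('a \<times> 'a)) measure)"
proof -
  have [measurable]: "(\<lambda>y :: real \<times> ('a \<times> 'a). snd (snd y)) \<in> Borel"
    by (intro borel_continuous continuous_intros)
  have [measurable]: "(\<lambda>y :: real \<times> ('a \<times> 'a). f (flow (fst y) (snd y))) \<in> Borel"
    by (rule measurable_compose[OF flow_measurable assms(2)])
  show ?thesis unfolding bounce_op_def by measurable
qed

lemma bounce_op_measurable1:
  assumes "\<sigma> \<in> Borel" "f \<in> Borel"
  shows "bounce_op \<gamma> \<sigma> m t f \<in> Borel"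
  using measurable_compose[OF Pair_const_measurable[of t] bounce_op_measurable[OF assms, of \<gamma> m]] by simp

lemma bounce_op_cong_AE:
  assumes t: "0 \<le> t" and eq: "AE z in phase_space D. f z = g z"
  shows "AE z in phase_space D. bounce_op \<gamma> \<sigma> m t f z = bounce_op \<gamma> \<sigma> m t g z"
  using AE_flow[OF t eq[unfolded AE_phase_space[OF open_D]]] unfolding AE_phase_space[OF open_D]
  by eventually_elim (auto simp: bounce_op_def)

text \<open>Split by the number n of bounces. The damping factor is at most \<gamma>^n \<le> 1 and p
  \<ge> 1, so its p-th power is still at most \<gamma>^n; the geometric tail from \<open>m\<close>
  on sums to the stated constant.\<close>

lemma bounce_op_nn_integral_le:
  assumes \<gamma>: "0 < \<gamma>" "\<gamma> < 1" and \<sigma>: "\<sigma> \<in> Borel" "\<And>v. 0 \<le> \<sigma> v" and p: "1 \<le> p" and t: "0 \<le> t"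
    and f: "f \<in> Borel"
  shows "(\<integral>\<^sup>+z. ennreal (\<bar>bounce_op \<gamma> \<sigma> m t f z\<bar> powr p) \<partial>phase_space D) \<le>
    ennreal (\<gamma> ^ m / (1 - \<gamma>)) * (\<integral>\<^sup>+z. ennreal (\<bar>f z\<bar> powr p) \<partial>phase_space D)"
proof -
  have [measurable]: "D \<in> sets borel" using open_D by simp
  have [measurable]: "f \<in> Borel" "\<sigma> \<in> Borel" by fact+
  have [measurable]: "indicator (D \<times> UNIV) \<in> borel_measurable (borel :: ('a\<times>'a) measure)"
    using open_D by (intro borel_measurable_indicator borel_open open_Times) auto
  let ?G = "\<lambda>z. ennreal (\<bar>f z\<bar> powr p) * indicator (D \<times> UNIV) z"
  have [measurable]: "?G \<in> Borel" by measurable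
  let ?E = "\<lambda>n. {z. regular t z \<and> bounces t z = n}"
  let ?a = "\<lambda>n. if m \<le> n then \<gamma> ^ n else 0"
  have "(\<integral>\<^sup>+z. ennreal (\<bar>bounce_op \<gamma> \<sigma> m t f z\<bar> powr p) \<partial>phase_space D)
    = (\<integral>\<^sup>+z. ennreal (\<bar>bounce_op \<gamma> \<sigma> m t f z\<bar> powr p) * indicator (D \<times> UNIV) z \<partial>lborel)"
    by (rule nn_integral_phase_space[OF open_D])
  also have "... \<le> (\<integral>\<^sup>+z. (\<Sum>n. ennreal (?a n) * (indicator (?E n) z * ?G (flow t z))) \<partial>lborel)"
  proof (rule nn_integral_mono_AE)
    show "AE z in lborel. ennreal (\<bar>bounce_op \<gamma> \<sigma> m t f z\<bar> powr p) * indicator (D \<times> UNIV) z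
      \<le> (\<Sum>n. ennreal (?a n) * (indicator (?E n) z * ?G (flow t z)))"
      using AE_regular[OF t]
    proof eventually_elim
      fix z assume r: "fst z \<in> D --> regular t z"
      show "ennreal (\<bar>bounce_op \<gamma> \<sigma> m t f z\<bar> powr p) * indicator (D \<times> UNIV) z
        \<le> (\<Sum>n. ennreal (?a n) * (indicator (?E n) z * ?G (flow t z)))"
      proof (cases "fst z \<in> D \<and> m \<le> bounces t z")
        case True
        then have rz: "regular t z" using r by simp
        then have fD: "flow t z \<in> D \<times> UNIV" using flow_regular(1)[of t "fst z" "snd z"] by (simp add: mem_Times_iff)
        let ?n = "bounces t z"
        let ?c = "\<gamma> ^ ?n * exp (- \<sigma> (snd z) * t)"
        have c1: "exp (- \<sigma> (snd z) * t) \<le> 1" using \<sigma>(2)[of "snd z"] t by simp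
        have c: "0 \<le> ?c" "?c \<le> \<gamma> ^ ?n" "?c \<le> 1"
          using \<gamma> c1 mult_left_mono[OF c1, of "\<gamma> ^ ?n"] power_le_one[of \<gamma> ?n] mult_mono[of "\<gamma> ^ ?n" 1 "exp (- \<sigma> (snd z) * t)" 1]
          by auto
        have "?c powr p \<le> ?c"
        proof -
          have "?c powr p \<le> ?c powr 1" using c p by (intro powr_mono') auto
          then show ?thesis using c(1) by simp
        qed
        then have cp: "?c powr p \<le> \<gamma> ^ ?n" using c by linarith
        have "\<bar>bounce_op \<gamma> \<sigma> m t f z\<bar> powr p = ?c powr p * \<bar>f (flow t z)\<bar> powr p"
          using True c(1) \<gamma> by (simp add: bounce_op_def abs_mult powr_mult)
        also have "... \<le> \<gamma> ^ ?n * \<bar>f (flow t z)\<bar> powr p" using cp by (intro mult_right_mono) auto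
        finally have "ennreal (\<bar>bounce_op \<gamma> \<sigma> m t f z\<bar> powr p) \<le> ennreal (\<gamma> ^ ?n) * ennreal (\<bar>f (flow t z)\<bar> powr p)"
          using \<gamma> by (subst ennreal_mult[symmetric]) (auto intro: ennreal_leI)
        also have "... = (\<Sum>n\<in>{?n}. ennreal (?a n) * (indicator (?E n) z * ?G (flow t z)))"
          using True rz fD by simp
        also have "... \<le> (\<Sum>n. ennreal (?a n) * (indicator (?E n) z * ?G (flow t z)))"
          by (rule sum_le_suminf) auto
        finally show ?thesis using True by (simp add: mem_Times_iff)
      qed (auto simp: bounce_op_def mem_Times_iff)
    qed
  qed
  also have "... = (\<Sum>n. \<integral>\<^sup>+z. ennreal (?a n) * (indicator (?E n) z * ?G (flow t z)) \<partial>lborel)"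
    by (rule nn_integral_suminf) measurable
  also have "... = (\<Sum>n. ennreal (?a n) * (\<integral>\<^sup>+z. indicator (?E n) z * ?G (flow t z) \<partial>lborel))"
    by (intro suminf_cong nn_integral_cmult) measurable
  also have "... \<le> (\<Sum>n. ennreal (?a n) * (\<integral>\<^sup>+z. ?G z \<partial>lborel))"
    by (intro suminf_le mult_left_mono nn_integral_flow_le) auto
  also have "... = (\<Sum>n. ennreal (?a n)) * (\<integral>\<^sup>+z. ?G z \<partial>lborel)"
    by (rule ennreal_suminf_multc)
  also have "(\<Sum>n. ennreal (?a n)) = ennreal (\<gamma> ^ m / (1 - \<gamma>))"
  proof (rule suminf_ennreal_eq)
    have "(\<lambda>n. \<gamma> ^ m * \<gamma> ^ n) sums (\<gamma> ^ m * (1 / (1 - \<gamma>)))"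
      using \<gamma> by (intro sums_mult geometric_sums) simp
    then have "(\<lambda>n. ?a (n + m)) sums (\<gamma> ^ m / (1 - \<gamma>))" by (simp add: power_add mult.commute)
    then show "?a sums (\<gamma> ^ m / (1 - \<gamma>))" by (subst (asm) sums_iff_shift) simp
  qed (use \<gamma> in auto)
  finally show ?thesis unfolding nn_integral_phase_space[OF open_D] .
qed

text \<open>The estimate for a Borel version passes to every representative, because the flow
  respects null sets and Lebesgue measure is complete.\<close>

lemma bounce_op_norm_le:
  assumes \<gamma>: "0 < \<gamma>" "\<gamma> < 1" and \<sigma>: "\<sigma> \<in> Borel" "\<And>v. 0 \<le> \<sigma> v" and p: "1 \<le> p" and t: "0 \<le> t"
    and f: "f \<in> Lp_space (phase_space D) p"
  shows "bounce_op \<gamma> \<sigma> m t f \<in> Lp_space (phase_space D) p"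
    "Lp_norm (phase_space D) p (bounce_op \<gamma> \<sigma> m t f) \<le> (\<gamma> ^ m / (1 - \<gamma>)) powr (1 / p) * Lp_norm (phase_space D) p f"
proof -
  let ?M = "phase_space D" and ?K = "\<gamma> ^ m / (1 - \<gamma>)"
  obtain f' where f': "f' \<in> Borel" "AE z in ?M. f' z = f z" "f' \<in> Lp_space ?M p"
    using Lp_phase_space_borel_version[OF open_D p f] by metis
  let ?T = "bounce_op \<gamma> \<sigma> m t" and ?C = "?K powr (1 / p) * Lp_norm (phase_space D) p f"
  have K: "0 \<le> ?K" using \<gamma> by simp
  have Tm: "?T f' \<in> borel_measurable ?M" by (intro borel_imp_measurable_phase_space bounce_op_measurable1 \<sigma> f')
  have nf: "Lp_norm ?M p f' = Lp_norm ?M p f"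
    by (rule Lp_norm_cong_AE) (use f' f Lp_space_measurable in auto)
  have "(\<integral>\<^sup>+z. ennreal (\<bar>?T f' z\<bar> powr p) \<partial>?M) \<le> ennreal ?K * (\<integral>\<^sup>+z. ennreal (\<bar>f' z\<bar> powr p) \<partial>?M)"
    by (rule bounce_op_nn_integral_le[OF \<gamma> \<sigma> p t f'(1)])
  also have "... = ennreal (?C powr p)"
    unfolding Lp_norm_powr[OF p f'(3)] nf using p K \<gamma>
    by (simp add: ennreal_mult'[symmetric] powr_mult powr_powr)
  finally have *: "(\<integral>\<^sup>+z. ennreal (\<bar>?T f' z\<bar> powr p) \<partial>?M) \<le> ennreal (?C powr p)" .
  have C0: "0 \<le> ?C" by simp
  have T: "?T f' \<in> Lp_space ?M p" "Lp_norm ?M p (?T f') \<le> ?C" using Lp_space_norm_leI[OF p C0 Tm *] by auto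
  have eq: "AE z in ?M. ?T f' z = ?T f z" by (rule bounce_op_cong_AE[OF t f'(2)])
  have eq': "AE z in ?M. ?T f z = ?T f' z" using eq by eventually_elim simp
  have Tfm: "?T f \<in> borel_measurable ?M" by (rule measurable_phase_space_AE[OF open_D Tm eq'])
  show "?T f \<in> Lp_space ?M p" by (rule Lp_space_cong_AE[OF p T(1) Tfm eq])
  show "Lp_norm ?M p (?T f) \<le> ?C" using T(2) Lp_norm_cong_AE[OF Tm Tfm eq] by simp
qed

lemma bounce_op_linear:
  "bounce_op \<gamma> \<sigma> m t (\<lambda>z. a * f z + b * g z) z = a * bounce_op \<gamma> \<sigma> m t f z + b * bounce_op \<gamma> \<sigma> m t g z"
  by (simp add: bounce_op_def algebra_simps)

lemma bounce_op_bounded_operator: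
  assumes \<gamma>: "0 < \<gamma>" "\<gamma> < 1" and \<sigma>: "\<sigma> \<in> Borel" "\<And>v. 0 \<le> \<sigma> v" and p: "1 \<le> p" and t: "0 \<le> t"
  shows "Lp_bounded_operator (phase_space D) p (bounce_op \<gamma> \<sigma> m t)"
  unfolding Lp_bounded_operator_def
proof (intro conjI ballI impI allI)
  show "\<exists>C. \<forall>f\<in>Lp_space (phase_space D) p. Lp_norm (phase_space D) p (bounce_op \<gamma> \<sigma> m t f) \<le> C * Lp_norm (phase_space D) p f"
    using bounce_op_norm_le(2)[OF assms] by blast
qed (use bounce_op_norm_le(1)[OF assms] bounce_op_cong_AE[OF t] bounce_op_linear in auto)

lemma bounce_op_0:
  "AE z in phase_space D. bounce_op \<gamma> \<sigma> 0 0 f z = f z"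
proof -
  have "bounce_op \<gamma> \<sigma> 0 0 f z = f z" if "fst z \<in> D" "snd z \<noteq> 0" for z
  proof -
    obtain x v where z: "z = (x, v)" by (cases z)
    have "bounces 0 (x, v) = 0"
      using that exit_time_pos[of x v] exit_time_less_chord[of x v] by (intro bounces_eqI) (auto simp: z)
    then show ?thesis by (simp add: z bounce_op_def flow_def since_def)
  qed
  note * = this
  show ?thesis unfolding AE_phase_space[OF open_D] using AE_velocity_nonzero by eventually_elim (simp add: *)
qed

text \<open>The second piece of the trajectory is travelled with velocity \<open>v\<close> or
  \<open>- v\<close>; as \<open>\<sigma>\<close> is even, the exponents add. The powers of
  \<open>\<gamma>\<close> multiply because the numbers of bounces add.\<close>

lemma bounce_op_add:
  assumes st: "0 \<le> s" "0 \<le> t" and even: "\<And>v. \<sigma> (- v) = \<sigma> v"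
  shows "AE z in phase_space D. bounce_op \<gamma> \<sigma> 0 (s + t) f z = bounce_op \<gamma> \<sigma> 0 s (bounce_op \<gamma> \<sigma> 0 t f) z"
  unfolding AE_phase_space[OF open_D] using AE_flow[OF st(1) AE_regular[OF st(2)]]
proof eventually_elim
  fix z assume a: "fst z \<in> D --> regular s z \<and> regular t (flow s z)"
  show "fst z \<in> D --> bounce_op \<gamma> \<sigma> 0 (s + t) f z = bounce_op \<gamma> \<sigma> 0 s (bounce_op \<gamma> \<sigma> 0 t f) z"
  proof
    assume "fst z \<in> D"
    with a have r: "regular s z" by simp
    note fr = flow_regular[of s "fst z" "snd z"]
    have r': "regular t (flow s z)" using a r fr(1) \<open>fst z \<in> D\<close> by simp
    have "\<sigma> (snd (flow s z)) = \<sigma> (snd z)" using fr(2) r even by simp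
    then show "bounce_op \<gamma> \<sigma> 0 (s + t) f z = bounce_op \<gamma> \<sigma> 0 s (bounce_op \<gamma> \<sigma> 0 t f) z"
      using flow_add[OF st r r'] by (simp add: bounce_op_def power_add distrib_left exp_diff exp_minus field_simps)
  qed
qed

section \<open>Density arguments and strong continuity\<close>

lemma indicator_in_Lp:
  assumes p: "1 \<le> p" and A: "A \<in> sets borel" "bounded A"
  shows "(indicator A :: 'a \<times> 'a => real) \<in> Lp_space (phase_space D) p"
  by (rule Lp_bounded_support[OF open_D p _ A(2), of _ 1]) (use A in \<open>auto intro!: borel_imp_measurable_phase_space\<close>)

text \<open>Density of continuous compactly supported functions as an induction rule, so that strong
  continuity and the identification of \<open>U\<close> both reduce to such functions. The class
  grows from indicators of compact sets to those of bounded Borel sets, then to simple and to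
  nonnegative functions.\<close>

lemma Lp_phase_space_dense_induct:
  fixes P :: "('a \<times> 'a => real) => bool"
  assumes p: "1 \<le> p" and f: "f \<in> Lp_space (phase_space D) p"
    and lin: "\<And>f g a b. f \<in> Lp_space (phase_space D) p ==> g \<in> Lp_space (phase_space D) p ==> P f ==> P g ==> P (\<lambda>z. a * f z + b * g z)"
    and lim: "\<And>f u. f \<in> Lp_space (phase_space D) p ==> (\<And>n::nat. u n \<in> Lp_space (phase_space D) p) ==> (\<And>n. P (u n)) ==>
       (\<lambda>n. Lp_norm (phase_space D) p (\<lambda>z. u n z - f z)) \<longlonglongrightarrow> 0 ==> P f"
    and cont: "\<And>\<phi> K. continuous_on UNIV \<phi> ==> compact K ==> K \<subseteq> D \<times> UNIV ==> (\<And>z. z \<notin> K ==> \<phi> z = 0) ==> P \<phi>"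
  shows "P f"
proof -
  let ?M = "phase_space D" and ?N = "Lp_norm (phase_space D) p"
  have P0: "P (\<lambda>z. 0)" by (rule cont[of _ "{}"]) auto
  have B: "D \<times> UNIV \<in> sets (borel :: ('a \<times> 'a) measure)" using open_D by (simp add: open_Times borel_open)
  have compact: "P (indicator K)" if K: "compact K" "K \<subseteq> D \<times> UNIV" for K
  proof (cases "K = {}")
    case True
    then have "(indicator K :: 'a \<times> 'a => real) = (\<lambda>z. 0)" by auto
    then show ?thesis using P0 by simp
  next
    case False
    obtain e where e: "0 < e" "{z. infdist z K \<le> e} \<subseteq> D \<times> UNIV"
      using compact_in_open_separated[OF False K(1) open_Times[OF open_D open_UNIV] K(2)] by blast
    \<comment> \<open>Tents that shrink to \<open>K\<close>; the summand \<open>1 / e\<close> keeps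
      their supports in the \<open>e\<close>-neighbourhood for every \<open>n\<close>, including
      0.\<close>
    define u where "u n z = max 0 (1 - (real n + 1 / e) * infdist z K)" for n z
    have c: "continuous_on UNIV (u n)" for n
      unfolding u_def by (intro continuous_intros)
    have supp: "u n z = 0" if "z \<notin> {z. infdist z K \<le> e}" for n z
    proof -
      have "1 = (1 / e) * e" using e by simp
      also have "... \<le> (real n + 1 / e) * infdist z K" using that e by (intro mult_mono) auto
      finally show ?thesis by (simp add: u_def)
    qed
    have cK: "compact {z. infdist z K \<le> e}" by (rule compact_infdist_le[OF False K(1) e(1)])
    have u01: "0 \<le> u n z" "u n z \<le> 1" for n z
      using e infdist_nonneg[of z K] by (auto simp: u_def intro!: add_nonneg_nonneg)
    have w: "indicator {z. infdist z K \<le> e} \<in> Lp_space ?M p"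
      by (rule indicator_in_Lp[OF p borel_compact[OF cK] compact_imp_bounded[OF cK]])
    have um: "u n \<in> borel_measurable ?M" for n
      by (intro borel_imp_measurable_phase_space borel_continuous c)
    have ule: "AE z in ?M. \<bar>u n z\<bar> \<le> \<bar>indicator {z. infdist z K \<le> e} z\<bar>" for n
      using u01[of n] supp[of _ n] by (intro AE_I2) (auto simp: indicator_def)
    have ulim: "AE z in ?M. (\<lambda>n. u n z) \<longlonglongrightarrow> indicator K z"
    proof (intro AE_I2)
      fix z
      show "(\<lambda>n. u n z) \<longlonglongrightarrow> indicator K z"
      proof (cases "z \<in> K")
        case True
        then show ?thesis by (simp add: u_def)
      next
        case False
        then have pos: "0 < infdist z K"
          using compact_imp_closed[OF K(1)] \<open>K \<noteq> {}\<close> in_closed_iff_infdist_zero infdist_nonneg[of z K] by (metis less_eq_real_def)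
        obtain n0 where n0: "1 < real n0 * infdist z K" using reals_Archimedean3[OF pos] by blast
        have "u n z = 0" if "n0 \<le> n" for n
        proof -
          have "real n0 * infdist z K \<le> (real n + 1/e) * infdist z K"
            using that e pos by (intro mult_right_mono) (auto intro: add_increasing2)
          then show ?thesis using n0 by (simp add: u_def)
        qed
        then have "eventually (\<lambda>n. u n z = 0) sequentially" unfolding eventually_sequentially by blast
        then show ?thesis using False by (simp add: tendsto_eventually)
      qed
    qed
    have Km: "indicator K \<in> borel_measurable ?M"
      using borel_compact[OF K(1)] by (intro borel_imp_measurable_phase_space) simp
    note dc = Lp_dominated_convergence[OF p um Km w ule ulim]
    show ?thesis
    proof (rule lim[OF dc(2) _ _ dc(1)])
      show "u n \<in> Lp_space ?M p" for n by (rule Lp_dominated(1)[OF p w um ule])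
      show "P (u n)" for n by (rule cont[OF c cK e(2) supp])
    qed
  qed
  have borel: "P (indicator A)" if A: "A \<in> sets borel" "bounded A" "A \<subseteq> D \<times> UNIV" for A
  proof -
    \<comment> \<open>Inner regularity gives closed subsets with small complement; boundedness of
      \<open>A\<close> makes them compact.\<close>
    have "\<exists>T. closed T \<and> T \<subseteq> A \<and> emeasure lebesgue (A - T) < ennreal (inverse (real (Suc n)))" for n
      using sets_lebesgue_inner_closed[of A "inverse (real (Suc n))"] A(1) by (metis inverse_positive_iff_positive of_nat_0_less_iff sets_completionI_sets sets_lborel zero_less_Suc)
    then obtain T where T: "\<And>n. closed (T n)" "\<And>n. T n \<subseteq> A" "\<And>n. emeasure lebesgue (A - T n) < ennreal (inverse (real (Suc n)))"
      by metis
    have cT: "compact (T n)" for n using T A(2) by (meson bounded_subset compact_eq_bounded_closed)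
    have Tb: "T n \<in> sets borel" for n using T(1) by simp
    have iA: "indicator A \<in> Lp_space ?M p" by (rule indicator_in_Lp[OF p A(1,2)])
    have iT: "indicator (T n) \<in> Lp_space ?M p" for n
      by (rule indicator_in_Lp[OF p Tb compact_imp_bounded[OF cT]])
    have "?N (\<lambda>z. indicator (T n) z - indicator A z) \<le> (inverse (real (Suc n))) powr (1 / p)" for n
    proof (rule Lp_space_norm_leI(2)[OF p])
      have "(\<integral>\<^sup>+z. ennreal (\<bar>indicator (T n) z - indicator A z\<bar> powr p) \<partial>?M) \<le> (\<integral>\<^sup>+z. indicator (A - T n) z \<partial>lborel)"
        unfolding nn_integral_phase_space[OF open_D]
        by (intro nn_integral_mono) (use T(2)[of n] in \<open>auto simp: indicator_def\<close>)
      also have "... = emeasure lborel (A - T n)" using A Tb by (intro nn_integral_indicator) auto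
      also have "... = emeasure lebesgue (A - T n)" using A Tb[of n] by simp
      also have "... \<le> ennreal (inverse (real (Suc n)))" using T(3)[of n] by simp
      also have "... = ennreal ((inverse (real (Suc n)) powr (1/p)) powr p)" using p by (simp add: powr_powr)
      finally show "(\<integral>\<^sup>+z. ennreal (\<bar>indicator (T n) z - indicator A z\<bar> powr p) \<partial>?M) \<le> ennreal ((inverse (real (Suc n)) powr (1/p)) powr p)" .
      show "(\<lambda>z. indicator (T n) z - indicator A z :: real) \<in> borel_measurable ?M"
        using A Tb by (intro borel_imp_measurable_phase_space borel_measurable_diff borel_measurable_indicator)
    qed simp
    note bound = this
    have z: "(\<lambda>n. inverse (real (Suc n)) powr (1 / p)) \<longlonglongrightarrow> 0 powr (1/p)"
      using p LIMSEQ_inverse_real_of_nat by (intro tendsto_powr2 tendsto_const) auto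
    have "(\<lambda>n. ?N (\<lambda>z. indicator (T n) z - indicator A z)) \<longlonglongrightarrow> 0"
      by (rule tendsto_sandwich[OF _ _ tendsto_const]) (use bound z in \<open>auto intro: always_eventually\<close>)
    then show ?thesis using T(2) A(3) by (intro lim[OF iA iT] compact cT) auto
  qed
  have nonneg: "P g" if g: "g \<in> Borel" "g \<in> Lp_space ?M p" "\<And>z. 0 \<le> g z" "\<And>z. fst z \<notin> D ==> g z = 0" for g
  proof -
    \<comment> \<open>Level sets of the integer part of \<open>real n * g z\<close>, cut off to a
      ball to make them bounded. The sum below omits level 0, which contributes nothing, and the
      levels above \<open>n * n\<close>.\<close>
    define A where "A n k = {z. norm z \<le> real n \<and> \<lfloor>real n * g z\<rfloor> = int k} \<inter> D \<times> UNIV" for n k :: nat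
    have [measurable]: "g \<in> Borel" by fact
    have Ab: "A n k \<in> sets borel" for n k unfolding A_def using B by measurable
    have Abd: "bounded (A n k)" for n k by (rule boundedI[of _ "real n"]) (auto simp: A_def)
    define u where "u n z = (\<Sum>k\<in>{1..n*n}. real k / real n * indicator (A n k) z)" for n z
    have uval: "u n z = (if norm z \<le> real n \<and> \<lfloor>real n * g z\<rfloor> \<le> int (n*n) \<and> fst z \<in> D then real_of_int \<lfloor>real n * g z\<rfloor> / real n else 0)" for n z
    proof (cases "norm z \<le> real n \<and> \<lfloor>real n * g z\<rfloor> \<in> int ` {1..n*n} \<and> fst z \<in> D")
      case True
      then obtain k where k: "k \<in> {1..n*n}" "\<lfloor>real n * g z\<rfloor> = int k" by auto
      have "u n z = (\<Sum>j\<in>{1..n*n}. if j = k then real k / real n else 0)"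
        unfolding u_def using True k by (intro sum.cong) (auto simp: A_def indicator_def mem_Times_iff)
      also have "... = real k / real n" using k(1) by simp
      moreover have "int k \<le> int (n * n)" using k(1) unfolding of_nat_le_iff by simp
      ultimately show ?thesis using True k by (simp only: k(2)) simp
    next
      case False
      then have u0: "u n z = 0" unfolding u_def by (intro sum.neutral) (auto simp: A_def indicator_def mem_Times_iff)
      have fl: "0 \<le> \<lfloor>real n * g z\<rfloor>" using g(3)[of z] by simp
      show ?thesis
      proof (cases "norm z \<le> real n \<and> \<lfloor>real n * g z\<rfloor> \<le> int (n*n) \<and> fst z \<in> D")
        case True
        then have "\<lfloor>real n * g z\<rfloor> \<notin> int ` {1..n*n}" using False by simp
        then have "\<lfloor>real n * g z\<rfloor> = 0" using True fl
          by (metis (no_types, lifting) atLeastAtMost_iff image_eqI nat_le_iff nonneg_int_cases of_nat_le_iff of_nat_0 less_one not_less)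
        then show ?thesis using u0 by simp
      qed (use u0 in auto)
    qed
    have um: "u n \<in> Borel" for n unfolding u_def using Ab by measurable
    have um': "u n \<in> borel_measurable ?M" for n by (intro borel_imp_measurable_phase_space um)
    have ule: "\<bar>u n z\<bar> \<le> \<bar>g z\<bar>" for n z
    proof (cases "n = 0")
      case False
      have "real_of_int \<lfloor>real n * g z\<rfloor> / real n \<le> real n * g z / real n" by (intro divide_right_mono) auto
      then show ?thesis using False g(3)[of z] by (auto simp: uval)
    qed (simp add: uval)
    have ulim: "(\<lambda>n. u n z) \<longlonglongrightarrow> g z" if z: "fst z \<in> D" for z
    proof -
      obtain m where m: "norm z + g z \<le> real m" using real_arch_simple by blast
      have ev: "eventually (\<lambda>n. \<bar>u n z - g z\<bar> \<le> 1 / real n) sequentially"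
        unfolding eventually_sequentially
      proof (intro exI[of _ "Suc m"] allI impI)
        fix n assume n: "Suc m \<le> n"
        have a: "norm z \<le> real n" "g z \<le> real n" using m n g(3)[of z] norm_ge_zero[of z] by linarith+
        have "real n * g z \<le> real n * real n" using a by (intro mult_left_mono) auto
        then have "\<lfloor>real n * g z\<rfloor> \<le> int (n * n)" by (simp add: floor_le_iff)
        then have uv: "u n z = real_of_int \<lfloor>real n * g z\<rfloor> / real n" using a z by (simp add: uval)
        have "g z - 1 / real n \<le> u n z" "u n z \<le> g z"
        proof -
          have "(real n * g z - 1) / real n \<le> u n z" unfolding uv by (intro divide_right_mono) linarith+
          then show "g z - 1 / real n \<le> u n z" using n by (simp add: diff_divide_distrib)
          show "u n z \<le> g z" using ule[of n z] g(3)[of z] by linarith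
        qed
        then show "\<bar>u n z - g z\<bar> \<le> 1 / real n" by linarith
      qed
      have "(\<lambda>n. u n z - g z) \<longlonglongrightarrow> 0"
        by (rule Lim_null_comparison[of _ "\<lambda>n. 1 / real n"]) (use ev lim_1_over_n in auto)
      then show ?thesis by (simp add: LIM_zero_iff)
    qed
    have lim': "AE z in ?M. (\<lambda>n. u n z) \<longlonglongrightarrow> g z"
      unfolding AE_phase_space[OF open_D] by (intro AE_I2) (use ulim in auto)
    have gm: "g \<in> borel_measurable ?M" by (rule Lp_space_measurable[OF g(2)])
    have ule': "AE z in ?M. \<bar>u n z\<bar> \<le> \<bar>g z\<bar>" for n using ule by simp
    have uL: "u n \<in> Lp_space ?M p" for n by (rule Lp_dominated(1)[OF p g(2) um' ule'])
    have Pu: "P (u n)" for n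
    proof -
      have "P (\<lambda>z. \<Sum>k\<in>I. real k / real n * indicator (A n k) z) \<and> (\<lambda>z. \<Sum>k\<in>I. real k / real n * indicator (A n k) z) \<in> Lp_space ?M p"
        if "finite I" for I
        using that
      proof (induction I)
        case empty then show ?case using P0 by (simp add: Lp_zero)
      next
        case (insert k I)
        have iA: "indicator (A n k) \<in> Lp_space ?M p" by (rule indicator_in_Lp[OF p Ab Abd])
        have PA: "P (indicator (A n k))" by (rule borel[OF Ab Abd]) (auto simp: A_def)
        let ?s = "\<lambda>z. \<Sum>k\<in>I. real k / real n * indicator (A n k) z"
        have eq: "(\<lambda>z. \<Sum>k\<in>insert k I. real k / real n * indicator (A n k) z) = (\<lambda>z. real k / real n * indicator (A n k) z + 1 * ?s z)"
          using insert by simp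
        show ?case unfolding eq using insert lin[OF iA _ PA, of ?s "real k / real n" 1] Lp_lincomb[OF p iA, of ?s "real k / real n" 1] by blast
      qed
      then show ?thesis unfolding u_def by simp
    qed
    show ?thesis by (rule lim[OF g(2) uL Pu Lp_dominated_convergence(1)[OF p um' gm g(2) ule' lim']])
  qed
  obtain f' where f': "f' \<in> Borel" "\<And>z. fst z \<notin> D ==> f' z = 0" "AE z in ?M. f' z = f z" "f' \<in> Lp_space ?M p"
    using Lp_phase_space_borel_version[OF open_D p f] by metis
  have [measurable]: "f' \<in> Borel" by fact
  have L: "(\<lambda>z. max 0 (f' z)) \<in> Lp_space ?M p" "(\<lambda>z. max 0 (- f' z)) \<in> Lp_space ?M p"
    by (rule Lp_dominated(1)[OF p f'(4)]; auto intro!: borel_imp_measurable_phase_space)+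
  have "P (\<lambda>z. 1 * max 0 (f' z) + (- 1) * max 0 (- f' z))"
    by (intro lin L nonneg) (use f'(2) in auto)
  also have "(\<lambda>z. 1 * max 0 (f' z) + (- 1) * max 0 (- f' z)) = f'" by (auto simp: max_def)
  finally have Pf': "P f'" .
  show "P f"
  \<comment> \<open>A constant sequence transfers \<open>P\<close> from the Borel version to
    \<open>f\<close>.\<close>
  proof (rule lim[OF f, of "\<lambda>_. f'"])
    have "?N (\<lambda>z. f' z - f z) = ?N (\<lambda>z. f z - f z)"
      by (rule Lp_norm_triangle_diff_AE[OF p f'(4) f f f f'(3)]) simp
    then show "(\<lambda>n. ?N (\<lambda>z. f' z - f z)) \<longlonglongrightarrow> 0" using Lp_zero(2)[OF p, of ?M] by simp
  qed (use f' Pf' in auto)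
qed

text \<open>The bound uniform in \<open>t\<close> reduces the claim to continuous compactly
  supported functions. For those, a fixed point with nonzero velocity has no bounce for small
  \<open>t\<close>, and dominated convergence applies.\<close>

lemma bounce_op_strongly_continuous:
  assumes \<gamma>: "0 < \<gamma>" "\<gamma> < 1" and \<sigma>: "\<sigma> \<in> Borel" "\<And>v. 0 \<le> \<sigma> v" and p: "1 \<le> p"
    and f: "f \<in> Lp_space (phase_space D) p"
  shows "((\<lambda>t. Lp_norm (phase_space D) p (\<lambda>z. bounce_op \<gamma> \<sigma> 0 t f z - f z)) \<longlongrightarrow> 0) (at_right 0)"
proof -
  let ?M = "phase_space D" and ?N = "Lp_norm (phase_space D) p" and ?S = "bounce_op \<gamma> \<sigma> 0"
  define K where "K = (\<gamma> ^ 0 / (1 - \<gamma>)) powr (1 / p)"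
  have K0: "0 \<le> K" by (simp add: K_def)
  have K: "?N (?S t f) \<le> K * ?N f" "?S t f \<in> Lp_space ?M p" if "0 \<le> t" "f \<in> Lp_space ?M p" for t f
    using bounce_op_norm_le[OF \<gamma> \<sigma> p that, of 0] by (simp_all add: K_def)
  let ?P = "\<lambda>f. ((\<lambda>t. ?N (\<lambda>z. ?S t f z - f z)) \<longlongrightarrow> 0) (at_right 0)"
  have pos: "eventually (\<lambda>t. 0 < t) (at_right (0::real))" by (rule eventually_at_right_less)
  show "?P f"
  proof (rule Lp_phase_space_dense_induct[OF p f])
    fix f g a b assume f: "f \<in> Lp_space ?M p" and g: "g \<in> Lp_space ?M p" and Pf: "?P f" and Pg: "?P g"
    show "?P (\<lambda>z. a * f z + b * g z)"
    proof (rule tendsto_sandwich[OF _ _ tendsto_const])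
      show "((\<lambda>t. \<bar>a\<bar> * ?N (\<lambda>z. ?S t f z - f z) + \<bar>b\<bar> * ?N (\<lambda>z. ?S t g z - g z)) \<longlongrightarrow> 0) (at_right 0)"
        using tendsto_add[OF tendsto_mult_right_zero[OF Pf] tendsto_mult_right_zero[OF Pg]] by simp
      show "\<forall>\<^sub>F t in at_right 0. ?N (\<lambda>z. ?S t (\<lambda>z. a * f z + b * g z) z - (a * f z + b * g z))
        \<le> \<bar>a\<bar> * ?N (\<lambda>z. ?S t f z - f z) + \<bar>b\<bar> * ?N (\<lambda>z. ?S t g z - g z)"
        using pos
      proof eventually_elim
        fix t :: real assume t: "0 < t"
        have Lf: "(\<lambda>z. ?S t f z - f z) \<in> Lp_space ?M p" and Lg: "(\<lambda>z. ?S t g z - g z) \<in> Lp_space ?M p"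
          using t by (intro Lp_diff p K f g; simp)+
        have eq: "(\<lambda>z. ?S t (\<lambda>z. a * f z + b * g z) z - (a * f z + b * g z)) = (\<lambda>z. a * (?S t f z - f z) + b * (?S t g z - g z))"
          by (simp add: bounce_op_linear algebra_simps)
        show "?N (\<lambda>z. ?S t (\<lambda>z. a * f z + b * g z) z - (a * f z + b * g z))
          \<le> \<bar>a\<bar> * ?N (\<lambda>z. ?S t f z - f z) + \<bar>b\<bar> * ?N (\<lambda>z. ?S t g z - g z)"
          using Lp_norm_triangle[OF p Lp_scale(1)[OF p Lf, of a] Lp_scale(1)[OF p Lg, of b]]
          unfolding eq Lp_scale(2)[OF p Lf] Lp_scale(2)[OF p Lg] .
      qed
    qed (simp add: always_eventually)
  next
    fix f and u :: "nat => 'a \<times> 'a => real"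
    assume f: "f \<in> Lp_space ?M p" and u: "\<And>n. u n \<in> Lp_space ?M p" and Pu: "\<And>n. ?P (u n)"
      and lim: "(\<lambda>n. ?N (\<lambda>z. u n z - f z)) \<longlonglongrightarrow> 0"
    show "?P f"
    proof (rule tendstoI)
      fix e :: real assume e: "0 < e"
      define d where "d = e / (2 * (K + 1))"
      have d: "0 < d" using e K0 by (simp add: d_def)
      have "eventually (\<lambda>n. ?N (\<lambda>z. u n z - f z) < d) sequentially" using lim d by (rule order_tendstoD)
      then obtain n where n: "?N (\<lambda>z. u n z - f z) < d" unfolding eventually_sequentially by blast
      have "eventually (\<lambda>t. ?N (\<lambda>z. ?S t (u n) z - u n z) < e / 2) (at_right 0)"
        using Pu[of n] by (rule order_tendstoD) (use e in simp)
      then show "\<forall>\<^sub>F t in at_right 0. dist (?N (\<lambda>z. ?S t f z - f z)) 0 < e"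
        using pos
      proof eventually_elim
        fix t :: real assume a: "?N (\<lambda>z. ?S t (u n) z - u n z) < e / 2" and t: "0 < t"
        have t0: "0 \<le> t" using t by simp
        note Sf = K(2)[OF t0 f] and Su = K(2)[OF t0 u[of n]]
        have "?N (\<lambda>z. ?S t f z - ?S t (u n) z) = ?N (?S t (\<lambda>z. f z - u n z))"
          using bounce_op_linear[of \<gamma> \<sigma> 0 t 1 f "-1" "u n"] by (intro Lp_norm_cong) simp
        also have "... \<le> K * ?N (\<lambda>z. f z - u n z)" by (rule K(1)[OF t0 Lp_diff(1)[OF p f u]])
        also have "?N (\<lambda>z. f z - u n z) = ?N (\<lambda>z. u n z - f z)" by (rule Lp_norm_minus_commute)
        finally have 1: "?N (\<lambda>z. ?S t f z - ?S t (u n) z) \<le> K * ?N (\<lambda>z. u n z - f z)" .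
        have "(K + 1) * ?N (\<lambda>z. u n z - f z) \<le> (K + 1) * d" using n K0 by (intro mult_left_mono) auto
        also have "... = e / 2" unfolding d_def using K0 by (simp add: field_simps)
        finally have 2: "K * ?N (\<lambda>z. u n z - f z) + ?N (\<lambda>z. u n z - f z) \<le> e / 2" by (simp add: algebra_simps)
        have "?N (\<lambda>z. ?S t f z - f z) < e"
          using Lp_norm_triangle_diff[OF p Sf Su f] Lp_norm_triangle_diff[OF p Su u[of n] f] 1 2 a by linarith
        then show "dist (?N (\<lambda>z. ?S t f z - f z)) 0 < e" by simp
      qed
    qed
  next
    fix \<phi> :: "'a \<times> 'a => real" and Q
    assume c: "continuous_on UNIV \<phi>" and Q: "compact Q" "Q \<subseteq> D \<times> UNIV" and 0: "\<And>z. z \<notin> Q ==> \<phi> z = 0"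
    obtain C where C0: "0 \<le> C" and C: "\<And>z. \<bar>\<phi> z\<bar> \<le> C" using compact_support_bounded[OF c Q(1) 0] by blast
    obtain R where R: "\<And>z. z \<in> Q ==> norm z \<le> R" using compact_imp_bounded[OF Q(1)] by (auto simp: bounded_iff)
    have m\<phi>: "\<phi> \<in> Borel" by (rule borel_continuous[OF c])
    \<comment> \<open>The flow preserves \<open>norm v\<close> and \<open>D\<close> is bounded, so
      one bounded set carries the images of \<open>\<phi>\<close> at all times.\<close>
    let ?B = "D \<times> cball 0 R"
    have B: "?B \<in> sets borel" "bounded ?B" using open_D bounded_D
      by (auto intro!: bounded_Times) (metis borel_Times borel_closed borel_open closed_cball)
    let ?w = "\<lambda>z. C * indicator ?B z"
    have w: "?w \<in> Lp_space ?M p" by (rule Lp_scale(1)[OF p indicator_in_Lp[OF p B]])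
    show "?P \<phi>"
    proof (rule tendsto_at_right_sequentially[of 0 1])
      fix s :: "nat => real" assume s: "\<And>n. 0 < s n" "s \<longlonglongrightarrow> 0"
      show "(\<lambda>n. ?N (\<lambda>z. ?S (s n) \<phi> z - \<phi> z)) \<longlonglongrightarrow> 0"
      proof (rule Lp_dominated_convergence(1)[OF p _ _ w])
        show "?S (s n) \<phi> \<in> borel_measurable ?M" for n
          by (intro borel_imp_measurable_phase_space bounce_op_measurable1 \<sigma> m\<phi>)
        show "\<phi> \<in> borel_measurable ?M" by (intro borel_imp_measurable_phase_space m\<phi>)
        show "AE z in ?M. \<bar>?S (s n) \<phi> z\<bar> \<le> \<bar>?w z\<bar>" for n
        proof -
          have "AE z in lborel. fst z \<in> D --> regular (s n) z" using s(1)[of n] by (intro AE_regular) simp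
          then show ?thesis unfolding AE_phase_space[OF open_D]
          proof eventually_elim
            fix z assume r: "fst z \<in> D --> regular (s n) z"
            show "fst z \<in> D --> \<bar>?S (s n) \<phi> z\<bar> \<le> \<bar>?w z\<bar>"
            proof
              assume zD: "fst z \<in> D"
              then have r: "regular (s n) z" using r by simp
              show "\<bar>?S (s n) \<phi> z\<bar> \<le> \<bar>?w z\<bar>"
              proof (cases "flow (s n) z \<in> Q")
                case False
                then show ?thesis by (simp add: bounce_op_def 0)
              next
                case True
                have "norm (snd (flow (s n) z)) \<le> norm (fst (flow (s n) z), snd (flow (s n) z))" by (rule norm_snd_le)
                also have "... \<le> R" using R[OF True] by simp
                finally have "norm (snd z) \<le> R" using flow_regular(2)[of "s n" "fst z" "snd z"] r by (auto split: if_splits)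
                then have zB: "z \<in> ?B" using zD by (simp add: mem_Times_iff)
                have c1: "exp (- \<sigma> (snd z) * s n) \<le> 1" using \<sigma>(2)[of "snd z"] s(1)[of n] by simp
                have "\<bar>?S (s n) \<phi> z\<bar> = \<gamma> ^ bounces (s n) z * exp (- \<sigma> (snd z) * s n) * \<bar>\<phi> (flow (s n) z)\<bar>"
                  using \<gamma> by (simp add: bounce_op_def abs_mult)
                also have "... \<le> 1 * 1 * C" using \<gamma> C c1 C0 by (intro mult_mono power_le_one) auto
                finally show ?thesis using zB C0 by simp
              qed
            qed
          qed
        qed
        show "AE z in ?M. (\<lambda>n. ?S (s n) \<phi> z) \<longlonglongrightarrow> \<phi> z"
          unfolding AE_phase_space[OF open_D] using AE_velocity_nonzero
        proof eventually_elim
          fix z :: "'a \<times> 'a" assume v0: "snd z \<noteq> 0"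
          show "fst z \<in> D --> (\<lambda>n. ?S (s n) \<phi> z) \<longlonglongrightarrow> \<phi> z"
          proof
            assume zD: "fst z \<in> D"
            obtain x v where z: "z = (x, v)" by (cases z)
            have x: "x \<in> D" and v: "v \<noteq> 0" using zD v0 by (auto simp: z)
            have ev: "eventually (\<lambda>n. s n < et x v) sequentially"
              using s(2) exit_time_pos[OF x v] by (rule order_tendstoD)
            have "eventually (\<lambda>n. exp (- \<sigma> v * s n) * \<phi> (x - s n *\<^sub>R v, v) = ?S (s n) \<phi> z) sequentially"
              using ev
            proof eventually_elim
              fix n assume n: "s n < et x v"
              have "bounces (s n) (x, v) = 0"
                using n s(1)[of n] exit_time_less_chord[OF x v] by (intro bounces_eqI[OF x v]) auto
              then show "exp (- \<sigma> v * s n) * \<phi> (x - s n *\<^sub>R v, v) = ?S (s n) \<phi> z"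
                by (simp add: z bounce_op_def flow_def since_def)
            qed
            moreover have "(\<lambda>n. exp (- \<sigma> v * s n) * \<phi> (x - s n *\<^sub>R v, v)) \<longlonglongrightarrow> exp (- \<sigma> v * 0) * \<phi> (x - 0 *\<^sub>R v, v)"
            proof (intro tendsto_intros s(2))
              have "(\<lambda>n. (x - s n *\<^sub>R v, v)) \<longlonglongrightarrow> (x - 0 *\<^sub>R v, v)" by (intro tendsto_intros s(2))
              then show "(\<lambda>n. \<phi> (x - s n *\<^sub>R v, v)) \<longlonglongrightarrow> \<phi> (x - 0 *\<^sub>R v, v)"
                using c by (intro isCont_tendsto_compose[of _ \<phi>]) (auto simp: continuous_on_eq_continuous_at)
            qed
            ultimately show "(\<lambda>n. ?S (s n) \<phi> z) \<longlonglongrightarrow> \<phi> z" by (simp add: z Lim_transform_eventually)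
          qed
        qed
      qed
    qed simp
  qed
qed

lemma bounce_op_C0_semigroup:
  assumes \<gamma>: "0 < \<gamma>" "\<gamma> < 1" and \<sigma>: "\<sigma> \<in> Borel" "\<And>v. 0 \<le> \<sigma> v" "\<And>v. \<sigma> (- v) = \<sigma> v" and p: "1 \<le> p"
  shows "C0_semigroup (phase_space D) p (bounce_op \<gamma> \<sigma> 0)"
  unfolding C0_semigroup_def
proof (intro conjI allI impI ballI)
  show "((\<lambda>t. Lp_norm (phase_space D) p (\<lambda>x. bounce_op \<gamma> \<sigma> 0 t f x - f x)) \<longlongrightarrow> 0) (at_right 0)"
    if "f \<in> Lp_space (phase_space D) p" for f
    by (rule bounce_op_strongly_continuous[OF \<gamma> \<sigma>(1,2) p that])
qed (use bounce_op_bounded_operator[OF \<gamma> \<sigma>(1,2) p] bounce_op_0 bounce_op_add[where \<sigma> = \<sigma>] \<sigma>(3) in auto)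

end

section \<open>Test functions\<close>

lemma differentiable_on_UNIV_iff: "f differentiable_on UNIV \<longleftrightarrow> (\<forall>x. f differentiable at x)"
  by (simp add: differentiable_on_def)

lemma Ck_on_SucD: "Ck_on (Suc k) f S ==> Ck_on k f S"
  by (induction k arbitrary: f) (auto intro: differentiable_imp_continuous_on)

lemma Ck_on_UNIV_const: "Ck_on k (\<lambda>x. c) UNIV"
proof (induction k arbitrary: c)
  case (Suc k)
  have "(\<lambda>x. frechet_derivative (\<lambda>x. c) (at x) v) = (\<lambda>x. 0)" for v :: 'a
    by (simp add: frechet_derivative_const)
  then show ?case using Suc by simp
qed simp

lemma Ck_on_UNIV_add:
  "Ck_on k f UNIV ==> Ck_on k g UNIV ==> Ck_on k (\<lambda>x. f x + g x) UNIV"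
proof (induction k arbitrary: f g)
  case 0 then show ?case by (auto intro: continuous_intros)
next
  case (Suc k)
  have f: "(f has_derivative frechet_derivative f (at x)) (at x)" for x
    using Suc.prems by (auto simp: differentiable_on_UNIV_iff frechet_derivative_works)
  have g: "(g has_derivative frechet_derivative g (at x)) (at x)" for x
    using Suc.prems by (auto simp: differentiable_on_UNIV_iff frechet_derivative_works)
  note d = has_derivative_add[OF f g]
  have "frechet_derivative (\<lambda>x. f x + g x) (at x) = (\<lambda>v. frechet_derivative f (at x) v + frechet_derivative g (at x) v)" for x
    by (rule frechet_derivative_at[OF d, symmetric])
  moreover have "(\<lambda>x. f x + g x) differentiable_on UNIV"
    using d by (auto simp: differentiable_on_UNIV_iff differentiable_def)
  ultimately show ?case using Suc by simp
qed

lemma Ck_on_UNIV_mult: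
  "Ck_on k f UNIV ==> Ck_on k g UNIV ==> Ck_on k (\<lambda>x. f x * g x) UNIV"
proof (induction k arbitrary: f g)
  case 0 then show ?case by (auto intro: continuous_intros)
next
  case (Suc k)
  have f: "(f has_derivative frechet_derivative f (at x)) (at x)" for x
    using Suc.prems by (auto simp: differentiable_on_UNIV_iff frechet_derivative_works)
  have g: "(g has_derivative frechet_derivative g (at x)) (at x)" for x
    using Suc.prems by (auto simp: differentiable_on_UNIV_iff frechet_derivative_works)
  note d = has_derivative_mult[OF f g]
  have "frechet_derivative (\<lambda>x. f x * g x) (at x) = (\<lambda>v. f x * frechet_derivative g (at x) v + frechet_derivative f (at x) v * g x)" for x
    by (rule frechet_derivative_at[OF d, symmetric])
  moreover have "(\<lambda>x. f x * g x) differentiable_on UNIV"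
    using d by (auto simp: differentiable_on_UNIV_iff differentiable_def)
  moreover have "Ck_on k f UNIV" "Ck_on k g UNIV" using Suc.prems Ck_on_SucD by blast+
  ultimately show ?case using Suc by (simp add: Ck_on_UNIV_add)
qed

lemma Ck_on_UNIV_prod:
  "(\<And>i. i \<in> I ==> Ck_on k (f i) UNIV) ==> Ck_on k (\<lambda>x. \<Prod>i\<in>I. f i x) UNIV"
  by (induction I rule: infinite_finite_induct) (auto simp: Ck_on_UNIV_const intro: Ck_on_UNIV_mult)

lemma frechet_derivative_compose_affine:
  fixes f :: "'b::euclidean_space => real" and L :: "'c::euclidean_space => 'b"
  assumes L: "bounded_linear L" and f: "f differentiable at (L x + c)"
  shows "((\<lambda>x. f (L x + c)) has_derivative (\<lambda>v. frechet_derivative f (at (L x + c)) (L v))) (at x)"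
    "frechet_derivative (\<lambda>x. f (L x + c)) (at x) = (\<lambda>v. frechet_derivative f (at (L x + c)) (L v))"
proof -
  have "((\<lambda>x. L x + c) has_derivative L) (at x)"
    using bounded_linear.has_derivative[OF L has_derivative_ident] by (auto intro!: derivative_eq_intros)
  moreover have "(f has_derivative frechet_derivative f (at (L x + c))) (at (L x + c))"
    using f by (simp add: frechet_derivative_works)
  ultimately show d: "((\<lambda>x. f (L x + c)) has_derivative (\<lambda>v. frechet_derivative f (at (L x + c)) (L v))) (at x)"
    by (rule has_derivative_compose)
  show "frechet_derivative (\<lambda>x. f (L x + c)) (at x) = (\<lambda>v. frechet_derivative f (at (L x + c)) (L v))"
    by (rule frechet_derivative_at[OF d, symmetric])
qed

text \<open>The derivative of \<open>f (L x + c)\<close> in direction \<open>v\<close> has the same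
  form, with the derivative of \<open>f\<close> in the fixed direction \<open>L v\<close> in place
  of \<open>f\<close>; this closes the induction.\<close>

lemma Ck_on_UNIV_compose_affine:
  fixes f :: "'b::euclidean_space => real" and L :: "'c::euclidean_space => 'b"
  assumes L: "bounded_linear L"
  shows "Ck_on k f UNIV ==> Ck_on k (\<lambda>x. f (L x + c)) UNIV"
proof (induction k arbitrary: f)
  case 0
  then have "continuous_on UNIV f" by simp
  have "continuous_on UNIV (\<lambda>x. L x + c)"
    by (intro continuous_on_add linear_continuous_on[OF L] continuous_on_const)
  from continuous_on_compose2[OF \<open>continuous_on UNIV f\<close> this] show ?case by simp
next
  case (Suc k)
  have f: "f differentiable at x" for x using Suc.prems by (auto simp: differentiable_on_UNIV_iff)
  note d = frechet_derivative_compose_affine[OF L f]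
  have "Ck_on k (\<lambda>x. frechet_derivative (\<lambda>x. f (L x + c)) (at x) v) UNIV" for v
    unfolding d(2) by (rule Suc.IH[of "\<lambda>x. frechet_derivative f (at x) (L v)"]) (use Suc.prems in simp)
  moreover have "(\<lambda>x. f (L x + c)) differentiable_on UNIV"
    using d(1) by (auto simp: differentiable_on_UNIV_iff differentiable_def)
  ultimately show ?case by simp
qed

text \<open>The functions exp(-1/x) / x^m have derivatives that are linear combinations of members
  of the same family, so smoothness follows by one induction over all \<open>m\<close>.\<close>

definition smooth_cutoff :: "nat => real => real" where
  "smooth_cutoff m x = (if 0 < x then exp (- 1 / x) / x ^ m else 0)"

text \<open>The exponential exp(1/x) dominates the power \<open>m + 1\<close> of
  \<open>1 / ((m + 1) x)\<close>; after division by \<open>x ^ m\<close> one factor \<open>x\<close>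
  is left, which forces the limit 0.\<close>

lemma smooth_cutoff_le:
  assumes "0 < x"
  shows "smooth_cutoff m x \<le> real (Suc m) ^ Suc m * x"
proof -
  have "((1/x) / real (Suc m)) ^ Suc m \<le> (1 + (1/x) / real (Suc m)) ^ Suc m"
    using assms by (intro power_mono) auto
  also have "... \<le> exp (1/x)"
    using assms exp_ge_one_plus_x_over_n_power_n[of "Suc m" "1/x"] by (simp add: order_trans[of _ 0])
  finally have "1 \<le> exp (1/x) * (x * real (Suc m)) ^ Suc m"
    using assms by (simp add: power_divide divide_simps power_mult_distrib mult_ac del: power_Suc of_nat_Suc)
  then have "exp (-1/x) * 1 \<le> exp (-1/x) * (exp (1/x) * (x * real (Suc m)) ^ Suc m)"
    by (intro mult_left_mono) auto
  also have "... = (exp (-1/x) * exp (1/x)) * (x * real (Suc m)) ^ Suc m" by (simp only: mult.assoc)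
  also have "exp (-1/x) * exp (1/x) = 1" by (simp add: exp_add[symmetric])
  finally have "exp (-1/x) \<le> real (Suc m) ^ Suc m * x * x ^ m" by (simp add: power_mult_distrib mult_ac)
  then show ?thesis using assms by (simp add: smooth_cutoff_def divide_simps mult_ac)
qed

lemma smooth_cutoff_nonneg: "0 \<le> smooth_cutoff m x"
  by (simp add: smooth_cutoff_def)

lemma smooth_cutoff_tendsto_0: "(smooth_cutoff m \<longlongrightarrow> 0) (at 0)"
proof (rule Lim_null_comparison)
  show "\<forall>\<^sub>F x in at 0. norm (smooth_cutoff m x) \<le> real (Suc m) ^ Suc m * \<bar>x\<bar>"
  proof (rule always_eventually, rule allI)
    fix x :: real
    show "norm (smooth_cutoff m x) \<le> real (Suc m) ^ Suc m * \<bar>x\<bar>"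
    proof (cases "0 < x")
      case True
      then show ?thesis using smooth_cutoff_le[of x m] smooth_cutoff_nonneg[of m x] by simp
    next
      case False
      have "0 \<le> real (Suc m) ^ Suc m * \<bar>x\<bar>" by (intro mult_nonneg_nonneg) auto
      then show ?thesis using False by (simp only: smooth_cutoff_def) simp
    qed
  qed
  have "((\<lambda>x::real. real (Suc m) ^ Suc m * \<bar>x\<bar>) \<longlongrightarrow> real (Suc m) ^ Suc m * \<bar>0\<bar>) (at 0)"
    by (intro tendsto_intros)
  then show "((\<lambda>x::real. real (Suc m) ^ Suc m * \<bar>x\<bar>) \<longlongrightarrow> 0) (at 0)" by simp
qed

lemma smooth_cutoff_deriv:
  "(smooth_cutoff m has_real_derivative (smooth_cutoff (m + 2) x - real m * smooth_cutoff (m + 1) x)) (at x)"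
proof -
  consider "0 < x" | "x < 0" | "x = 0" by linarith
  then show ?thesis
  proof cases
    case 1
    have "((\<lambda>x. exp (- 1 / x) / x ^ m) has_real_derivative (smooth_cutoff (m + 2) x - real m * smooth_cutoff (m + 1) x)) (at x)"
    proof -
      have "((\<lambda>x. exp (- 1 / x) / x ^ m) has_real_derivative
        (exp (- 1 / x) * (1 / x\<^sup>2) * x ^ m - exp (- 1 / x) * (real m * x ^ (m - Suc 0))) / (x ^ m * x ^ m)) (at x)"
      proof (rule DERIV_divide)
        show "((\<lambda>x. exp (- 1 / x)) has_real_derivative exp (- 1 / x) * (1 / x\<^sup>2)) (at x)"
          using 1 by (auto intro!: derivative_eq_intros simp: power2_eq_square)
        show "((\<lambda>x. x ^ m) has_real_derivative real m * x ^ (m - Suc 0)) (at x)"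
          by (rule DERIV_pow)
      qed (use 1 in simp)
      moreover have "(exp (- 1 / x) * (1 / x\<^sup>2) * x ^ m - exp (- 1 / x) * (real m * x ^ (m - Suc 0))) / (x ^ m * x ^ m)
        = smooth_cutoff (m + 2) x - real m * smooth_cutoff (m + 1) x"
        using 1 by (cases m) (simp_all add: smooth_cutoff_def field_simps power2_eq_square)
      ultimately show ?thesis by simp
    qed
    then show ?thesis
      by (rule has_field_derivative_transform_within_open[of _ _ _ "{0<..}"]) (use 1 in \<open>auto simp: smooth_cutoff_def\<close>)
  next
    case 2
    have "((\<lambda>x. 0) has_real_derivative 0) (at x)" by simp
    then have "(smooth_cutoff m has_real_derivative 0) (at x)"
      by (rule has_field_derivative_transform_within_open[of _ _ _ "{..<0}"]) (use 2 in \<open>auto simp: smooth_cutoff_def\<close>)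
    then show ?thesis using 2 by (simp add: smooth_cutoff_def)
  next
    case 3
    \<comment> \<open>At 0 the difference quotient is the next member of the family, which tends to
      0.\<close>
    have eq: "(smooth_cutoff m h - smooth_cutoff m 0) / h = smooth_cutoff (m + 1) h" for h
      by (simp add: smooth_cutoff_def)
    have "(smooth_cutoff m has_real_derivative 0) (at 0)"
      unfolding DERIV_def using smooth_cutoff_tendsto_0[of "m + 1"] eq by simp
    then show ?thesis using 3 by (simp add: smooth_cutoff_def)
  qed
qed

lemma Ck_on_smooth_cutoff: "Ck_on k (smooth_cutoff m) UNIV"
proof (induction k arbitrary: m)
  case 0
  have "isCont (smooth_cutoff m) x" for x using smooth_cutoff_deriv by (rule DERIV_isCont)
  then show ?case by (simp add: continuous_on_eq_continuous_at)
next
  case (Suc k)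
  note d = smooth_cutoff_deriv[unfolded has_field_derivative_def]
  have "frechet_derivative (smooth_cutoff m) (at x) = (\<lambda>v. (smooth_cutoff (m + 2) x - real m * smooth_cutoff (m + 1) x) * v)" for x
    by (rule frechet_derivative_at[OF d, symmetric])
  then have eq: "(\<lambda>x. frechet_derivative (smooth_cutoff m) (at x) v) = (\<lambda>x. v * smooth_cutoff (m + 2) x + (- v * real m) * smooth_cutoff (m + 1) x)" for v
    by (auto simp: algebra_simps)
  have "Ck_on k (\<lambda>x. frechet_derivative (smooth_cutoff m) (at x) v) UNIV" for v
    unfolding eq by (intro Ck_on_UNIV_add Ck_on_UNIV_mult Ck_on_UNIV_const Suc)
  moreover have "smooth_cutoff m differentiable_on UNIV"
    using d by (auto simp: differentiable_on_UNIV_iff differentiable_def)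
  ultimately show ?case by simp
qed

text \<open>A product of one-dimensional cutoffs, positive exactly on the open box. The factor
  \<open>Suc n\<close> flattens it: exp(-1 / ((n + 1) y)) tends to 1 for y > 0, so the bumps tend to
  the indicator of the open box.\<close>

definition box_bump :: "nat => 'c::euclidean_space => 'c => 'c => real" where
  "box_bump n a b z = (\<Prod>i\<in>Basis. smooth_cutoff 0 (real (Suc n) * ((z - a) \<bullet> i)) * smooth_cutoff 0 (real (Suc n) * ((b - z) \<bullet> i)))"

lemma smooth_on_box_bump: "smooth_on (box_bump n a b) UNIV"
proof -
  have "Ck_on k (box_bump n a b) UNIV" for k
  proof -
    have 1: "Ck_on k (\<lambda>z. smooth_cutoff 0 (real (Suc n) * ((z - a) \<bullet> i))) UNIV" for i
      using Ck_on_UNIV_compose_affine[of "\<lambda>z. real (Suc n) * (z \<bullet> i)" k "smooth_cutoff 0" "- real (Suc n) * (a \<bullet> i)"]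
        Ck_on_smooth_cutoff[of k 0]
      by (simp add: bounded_linear_const_mult bounded_linear_inner_left inner_diff_left right_diff_distrib del: of_nat_Suc)
    have 2: "Ck_on k (\<lambda>z. smooth_cutoff 0 (real (Suc n) * ((b - z) \<bullet> i))) UNIV" for i
      using Ck_on_UNIV_compose_affine[of "\<lambda>z. (- real (Suc n)) * (z \<bullet> i)" k "smooth_cutoff 0" "real (Suc n) * (b \<bullet> i)"]
        Ck_on_smooth_cutoff[of k 0]
      by (simp add: bounded_linear_const_mult bounded_linear_inner_left inner_diff_left right_diff_distrib bounded_linear_minus del: of_nat_Suc)
    show ?thesis unfolding box_bump_def by (intro Ck_on_UNIV_prod Ck_on_UNIV_mult 1 2)
  qed
  then show ?thesis by (simp add: smooth_on_def)
qed

lemma box_bump_eq_0: "z \<notin> box a b ==> box_bump n a b z = 0"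
proof -
  assume "z \<notin> box a b"
  then obtain i where i: "i \<in> Basis" "z \<bullet> i \<le> a \<bullet> i \<or> b \<bullet> i \<le> z \<bullet> i" by (auto simp: mem_box not_less)
  then have "smooth_cutoff 0 (real (Suc n) * ((z - a) \<bullet> i)) * smooth_cutoff 0 (real (Suc n) * ((b - z) \<bullet> i)) = 0"
    by (auto simp: smooth_cutoff_def inner_diff_left zero_less_mult_iff)
  then show ?thesis unfolding box_bump_def using i(1) by (intro prod_zero) auto
qed

lemma box_bump_bounds: "0 \<le> box_bump n a b z" "box_bump n a b z \<le> 1"
proof -
  have s: "smooth_cutoff 0 x \<le> 1" for x by (simp add: smooth_cutoff_def)
  show "0 \<le> box_bump n a b z" unfolding box_bump_def by (intro prod_nonneg mult_nonneg_nonneg smooth_cutoff_nonneg)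
  show "box_bump n a b z \<le> 1" unfolding box_bump_def
    by (intro prod_le_1 conjI mult_nonneg_nonneg mult_le_one s smooth_cutoff_nonneg)
qed

lemma box_bump_tendsto: "(\<lambda>n. box_bump n a b z) \<longlonglongrightarrow> indicator (box a b) z"
proof (cases "z \<in> box a b")
  case True
  have 1: "(\<lambda>n. smooth_cutoff 0 (real (Suc n) * x)) \<longlonglongrightarrow> 1" if x: "0 < x" for x
  proof -
    have "(\<lambda>n. exp (- (1 / x) * inverse (real (Suc n)))) \<longlonglongrightarrow> exp (- (1/x) * 0)"
      by (intro tendsto_intros LIMSEQ_inverse_real_of_nat)
    moreover have "smooth_cutoff 0 (real (Suc n) * x) = exp (- (1 / x) * inverse (real (Suc n)))" for n
      using x by (simp add: smooth_cutoff_def divide_simps del: of_nat_Suc)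
    ultimately show ?thesis by simp
  qed
  have "(\<lambda>n. box_bump n a b z) \<longlonglongrightarrow> (\<Prod>i\<in>(Basis::'a set). 1 * 1)"
    unfolding box_bump_def using True
    by (intro tendsto_prod tendsto_mult 1) (auto simp: mem_box inner_diff_left)
  then show ?thesis using True by simp
qed (simp add: box_bump_eq_0)

text \<open>Du Bois-Reymond's lemma for boxes. Bumps tend boundedly to indicators, so the integrals
  of \<open>F\<close> over boxes in \<open>S\<close> vanish. On a fixed box the measures with
  densities the positive parts of \<open>F\<close> and \<open>- F\<close> then agree on all boxes, a
  generator stable under intersection.\<close>

lemma AE_zero_if_box_bump_integrals_zero:
  fixes F :: "'c::euclidean_space => real"
  assumes S: "open S" and F: "F \<in> Borel"
    and int: "\<And>r. integrable lborel (\<lambda>z. indicator (cball 0 r) z * F z)"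
    and zero: "\<And>n a b. cbox a b \<subseteq> S ==> (LINT z|lborel. box_bump n a b z * F z) = 0"
  shows "AE z in lborel. z \<in> S --> F z = 0"
proof -
  have [measurable]: "F \<in> Borel" by fact
  have bint: "integrable lborel (\<lambda>z. indicator (box a b) z * F z)" for a b
  proof -
    obtain r where r: "\<And>z. z \<in> box a b ==> norm z \<le> r" using bounded_box[of a b] by (auto simp: bounded_iff)
    show ?thesis
      by (rule Bochner_Integration.integrable_bound[OF int[of r]]) (use r in \<open>auto simp: indicator_def\<close>)
  qed
  have box0: "(LINT z|lborel. indicator (box a b) z * F z) = 0" if ab: "cbox a b \<subseteq> S" for a b
  proof -
    have bm: "box_bump n a b \<in> Borel" for n
      using smooth_on_box_bump[of n a b] by (intro borel_continuous) (auto simp: smooth_on_def dest: spec[of _ 0])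
    have "(\<lambda>n. LINT z|lborel. box_bump n a b z * F z) \<longlonglongrightarrow> (LINT z|lborel. indicator (box a b) z * F z)"
    proof (rule integral_dominated_convergence[where w = "\<lambda>z. \<bar>indicator (box a b) z * F z\<bar>"])
      show "AE z in lborel. (\<lambda>n. box_bump n a b z * F z) \<longlonglongrightarrow> indicator (box a b) z * F z"
        by (intro AE_I2 tendsto_mult box_bump_tendsto tendsto_const)
      show "AE z in lborel. norm (box_bump n a b z * F z) \<le> \<bar>indicator (box a b) z * F z\<bar>" for n
      proof (rule AE_I2)
        fix z
        show "norm (box_bump n a b z * F z) \<le> \<bar>indicator (box a b) z * F z\<bar>"
          using box_bump_bounds[of n a b z] box_bump_eq_0[of z a b n]
          by (cases "z \<in> box a b") (auto simp: abs_mult mult_left_le_one_le)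
      qed
    qed (use bint[of a b] bm in auto)
    then show ?thesis using zero[OF ab] by (simp add: LIMSEQ_const_iff)
  qed
  have cboxAE: "AE z in lborel. z \<in> box c d --> F z = 0" if cd: "cbox c d \<subseteq> S" for c d
  proof -
    \<comment> \<open>Localising to one box makes both measures finite.\<close>
    define F1 where "F1 z = indicator (box c d) z * F z" for z
    have F1: "integrable lborel F1" unfolding F1_def by (rule bint)
    have [measurable]: "F1 \<in> Borel" unfolding F1_def by measurable
    define M1 where "M1 = density lborel (\<lambda>z. ennreal (F1 z))"
    define M2 where "M2 = density lborel (\<lambda>z. ennreal (- F1 z))"
    have fin: "(\<integral>\<^sup>+z. ennreal (F1 z) * indicator A z \<partial>lborel) \<noteq> \<infinity>" "(\<integral>\<^sup>+z. ennreal (- F1 z) * indicator A z \<partial>lborel) \<noteq> \<infinity>" for A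
    proof -
      have "(\<integral>\<^sup>+z. ennreal (F1 z) * indicator A z \<partial>lborel) \<le> (\<integral>\<^sup>+z. ennreal (norm (F1 z)) \<partial>lborel)"
        "(\<integral>\<^sup>+z. ennreal (- F1 z) * indicator A z \<partial>lborel) \<le> (\<integral>\<^sup>+z. ennreal (norm (F1 z)) \<partial>lborel)"
        by (intro nn_integral_mono; auto simp: indicator_def intro!: ennreal_leI)+
      moreover have "(\<integral>\<^sup>+z. ennreal (norm (F1 z)) \<partial>lborel) < \<infinity>" using F1 by (simp add: integrable_iff_bounded)
      ultimately show "(\<integral>\<^sup>+z. ennreal (F1 z) * indicator A z \<partial>lborel) \<noteq> \<infinity>" "(\<integral>\<^sup>+z. ennreal (- F1 z) * indicator A z \<partial>lborel) \<noteq> \<infinity>"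
        by (auto simp: top_unique)
    qed
    have "M1 = M2"
    proof (rule measure_eqI_generator_eq[where E = "range (\<lambda>(a, b). box a b)" and \<Omega> = UNIV and A = "\<lambda>n. box (- (real n *\<^sub>R One)) (real n *\<^sub>R One)"])
      show "Int_stable (range (\<lambda>(a, b). box a b :: 'c set))"
      proof (rule Int_stableI, safe)
        fix a b a' b' :: 'c
        obtain u w where "box a b \<inter> box a' b' = box u w" using Int_interval[of a b a' b'] box_Int_box[of a b a' b'] by blast
        then show "box a b \<inter> box a' b' \<in> range (\<lambda>(a, b). box a b)" by auto
      qed
      show "range (\<lambda>(a, b). box a b :: 'c set) \<subseteq> Pow UNIV" by simp
      show "sets M1 = sigma_sets UNIV (range (\<lambda>(a, b). box a b))" "sets M2 = sigma_sets UNIV (range (\<lambda>(a, b). box a b))"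
        by (simp_all add: M1_def M2_def borel_eq_box)
      show "range (\<lambda>n. box (- (real n *\<^sub>R One)) (real n *\<^sub>R One) :: 'c set) \<subseteq> range (\<lambda>(a, b). box a b)" by auto
      show "(\<Union>n. box (- (real n *\<^sub>R One)) (real n *\<^sub>R One)) = (UNIV :: 'c set)" by (rule UN_box_eq_UNIV)
      show "emeasure M1 (box (- (real n *\<^sub>R One)) (real n *\<^sub>R One)) \<noteq> \<infinity>" for n
        unfolding M1_def using fin by (subst emeasure_density) auto
      fix X assume "X \<in> range (\<lambda>(a, b). box a b :: 'c set)"
      then obtain a b where X: "X = box a b" by auto
      obtain u w where uw: "box a b \<inter> box c d = box u w" and uwS: "box u w = {} \<or> cbox u w \<subseteq> S"
      proof -
        obtain u w where uw: "box a b \<inter> box c d = box u w" using box_Int_box[of a b c d] by blast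
        have "cbox u w \<subseteq> S" if "box u w \<noteq> {}"
        proof -
          have "cbox u w = closure (box u w)" using that by simp
          also have "... \<subseteq> closure (box c d)" using uw by (intro closure_mono) auto
          also have "... \<subseteq> cbox c d" by (intro closure_minimal box_subset_cbox closed_cbox)
          finally show ?thesis using cd by simp
        qed
        then show ?thesis using uw that by blast
      qed
      have "(LINT z|lborel. F1 z * indicator X z) = (LINT z|lborel. indicator (box u w) z * F z)"
        unfolding F1_def X uw[symmetric] by (intro Bochner_Integration.integral_cong) (auto simp: indicator_def)
      also have "... = 0" using uwS box0 by auto
      finally have z: "(LINT z|lborel. F1 z * indicator X z) = 0" .
      have i: "integrable lborel (\<lambda>z. F1 z * indicator X z)"
        by (rule Bochner_Integration.integrable_bound[OF F1]) (auto simp: X indicator_def)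
      have "ennreal (F1 z) * indicator X z = ennreal (F1 z * indicator X z)" "ennreal (- F1 z) * indicator X z = ennreal (- (F1 z * indicator X z))" for z
        by (auto simp: indicator_def)
      then have f1: "(\<integral>\<^sup>+z. ennreal (F1 z * indicator X z) \<partial>lborel) \<noteq> \<infinity>" "(\<integral>\<^sup>+z. ennreal (- (F1 z * indicator X z)) \<partial>lborel) \<noteq> \<infinity>"
        and e1: "emeasure M1 X = (\<integral>\<^sup>+z. ennreal (F1 z * indicator X z) \<partial>lborel)"
        and e2: "emeasure M2 X = (\<integral>\<^sup>+z. ennreal (- (F1 z * indicator X z)) \<partial>lborel)"
        using fin[of X] by (auto simp: M1_def M2_def X emeasure_density)
      show "emeasure M1 X = emeasure M2 X"
      proof -
        have eq: "a = b" if "enn2real a - enn2real b = 0" "a \<noteq> \<infinity>" "b \<noteq> \<infinity>" for a b :: ennreal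
          using that by (cases a; cases b) auto
        show ?thesis unfolding e1 e2
          by (rule eq[OF _ f1]) (use z in \<open>simp only: real_lebesgue_integral_def[OF i]\<close>)
      qed
    qed
    then have "AE z in lborel. ennreal (F1 z) = ennreal (- F1 z)"
      unfolding M1_def M2_def by (subst (asm) sigma_finite_measure.density_unique_iff[OF sigma_finite_lborel]) auto
    then show ?thesis
    proof eventually_elim
      fix z assume "ennreal (F1 z) = ennreal (- F1 z)"
      \<comment> \<open>One of the two sides is 0, as \<open>ennreal\<close> maps negative numbers
        to 0.\<close>
      then have "F1 z = 0" by (cases "0 \<le> F1 z") (auto simp: ennreal_neg)
      then show "z \<in> box c d --> F z = 0" by (simp add: F1_def indicator_def split: if_splits)
    qed
  qed
  \<comment> \<open>The open boxes inside these closed boxes miss only their boundaries, which are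
    null.\<close>
  obtain \<D> where \<D>: "countable \<D>" "\<D> \<subseteq> Pow S" "\<And>X. X \<in> \<D> ==> \<exists>a b. X = cbox a b" "\<Union>\<D> = S"
    by (rule open_countable_Union_open_cbox[OF S]) blast
  have "AE z in lborel. z \<in> X --> F z = 0" if X: "X \<in> \<D>" for X
  proof -
    obtain a b where ab: "X = cbox a b" using \<D>(3)[OF X] by blast
    have "AE z in lborel. z \<notin> cbox a b - box a b"
      by (intro AE_not_in) (simp add: null_sets_cbox_Diff_box)
    moreover have "AE z in lborel. z \<in> box a b --> F z = 0" by (rule cboxAE) (use \<D>(2) X ab in blast)
    ultimately show ?thesis by eventually_elim (auto simp: ab)
  qed
  then have "AE z in lborel. \<forall>X\<in>\<D>. z \<in> X --> F z = 0"     unfolding AE_ball_countable[OF \<D>(1)] by blast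
  then show ?thesis by eventually_elim (use \<D>(4) in auto)
qed

section \<open>Weak derivatives along lines\<close>

definition shear :: "real => 'a::euclidean_space \<times> 'a => 'a \<times> 'a" where
  "shear s z = (fst z + s *\<^sub>R snd z, snd z)"

lemma shear_simps [simp]: "fst (shear s z) = fst z + s *\<^sub>R snd z" "snd (shear s z) = snd z" "shear 0 z = z"
  by (simp_all add: shear_def)

lemma shear_shear: "shear s (shear r z) = shear (r + s) z"
  by (simp add: shear_def algebra_simps)

lemma continuous_on_shear [continuous_intros]:
  "continuous_on S f ==> continuous_on S g ==> continuous_on S (\<lambda>y. shear (f y) (g y))"
  unfolding shear_def by (intro continuous_intros)



lemma shear_measurable: "shear s \<in> Borel"
  by (intro borel_continuous continuous_intros)

lemma shear_measurable2: "(\<lambda>y. shear (fst y) (snd y)) \<in> borel_measurable (borel :: (real \<times> ('a::euclidean_space \<times> 'a)) measure)"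
  by (intro borel_continuous continuous_intros)

lemma shear_measurable2': "(\<lambda>y. shear (snd y) (fst y)) \<in> borel_measurable (borel :: (('a::euclidean_space \<times> 'a) \<times> real) measure)"
  by (intro borel_continuous continuous_intros)

lemma distr_shear: "distr lborel borel (shear s) = (lborel :: ('a::euclidean_space \<times> 'a) measure)"
proof (rule measure_eqI)
  fix A :: "('a \<times> 'a) set" assume "A \<in> sets (distr lborel borel (shear s))"
  then have A: "A \<in> sets borel" by simp
  have "emeasure (distr lborel borel (shear s)) A = (\<integral>\<^sup>+z. indicator A z \<partial>distr lborel borel (shear s))" using A by simp
  also have "... = (\<integral>\<^sup>+z. indicator A (shear s z) \<partial>lborel)"
    by (rule nn_integral_distr) (use shear_measurable A in auto)
  also have "... = (\<integral>\<^sup>+z. indicator A z \<partial>lborel)"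
    unfolding shear_def by (rule nn_integral_shear) (use A in simp)
  finally show "emeasure (distr lborel borel (shear s)) A = emeasure lborel A" using A by simp
qed simp

lemma integral_lborel_shear:
  fixes f :: "'a::euclidean_space \<times> 'a => real"
  assumes f: "f \<in> Borel"
  shows "(LINT z|lborel. f (shear s z)) = (LINT z|lborel. f z)"
    "integrable lborel (\<lambda>z. f (shear s z)) \<longleftrightarrow> integrable lborel f"
proof -
  have m: "shear s \<in> measurable lborel borel" using shear_measurable by simp
  have "(LINT z|lborel. f z) = (LINT z|distr lborel borel (shear s). f z)" by (simp only: distr_shear)
  also have "... = (LINT z|lborel. f (shear s z))" by (rule integral_distr[OF m f])
  finally show "(LINT z|lborel. f (shear s z)) = (LINT z|lborel. f z)" by simp
  have "integrable lborel f \<longleftrightarrow> integrable (distr lborel borel (shear s)) f" by (simp only: distr_shear)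
  also have "... \<longleftrightarrow> integrable lborel (\<lambda>z. f (shear s z))" by (rule integrable_distr_eq[OF m f])
  finally show "integrable lborel (\<lambda>z. f (shear s z)) \<longleftrightarrow> integrable lborel f" by simp
qed

definition locally_integrable :: "('c::euclidean_space => real) => bool" where
  "locally_integrable f \<longleftrightarrow> f \<in> Borel \<and> (\<forall>r. integrable lborel (\<lambda>z. indicator (cball 0 r) z * f z))"

lemma locally_integrable_mult:
  assumes f: "locally_integrable f" and \<phi>: "\<phi> \<in> Borel"
    and le: "\<And>z. \<bar>\<phi> z\<bar> \<le> C" and supp: "\<And>z. r < norm z ==> \<phi> z = 0"
  shows "integrable lborel (\<lambda>z. \<phi> z * f z)"
proof (rule Bochner_Integration.integrable_bound)
  show "integrable lborel (\<lambda>z. C * (indicator (cball 0 r) z * f z))"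
    using f by (auto simp: locally_integrable_def)
  show "AE z in lborel. norm (\<phi> z * f z) \<le> norm (C * (indicator (cball 0 r) z * f z))"
  proof (rule AE_I2)
    fix z
    have "\<bar>\<phi> z\<bar> \<le> \<bar>C\<bar>" using le[of z] by linarith
    then show "norm (\<phi> z * f z) \<le> norm (C * (indicator (cball 0 r) z * f z))"
      using supp[of z] by (cases "r < norm z") (auto simp: abs_mult intro: mult_right_mono)
  qed
qed (use f \<phi> in \<open>auto simp: locally_integrable_def\<close>)

lemma locally_integrable_diff:
  "locally_integrable f ==> locally_integrable g ==> locally_integrable (\<lambda>z. f z - g z)"
  by (auto simp: locally_integrable_def right_diff_distrib)

lemma norm_shear_le: "norm (shear s z) \<le> (1 + \<bar>s\<bar>) * norm z"
proof -
  have "shear s z = z + s *\<^sub>R (snd z, 0)" by (cases z) (simp add: shear_def)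
  then have "norm (shear s z) \<le> norm z + \<bar>s\<bar> * norm (snd z, 0 :: 'a)"
    by (metis norm_scaleR norm_triangle_ineq)
  also have "norm (snd z, 0 :: 'a) \<le> norm z" using norm_snd_le[of "snd z" "fst z"] by (simp add: norm_Pair)
  then have "\<bar>s\<bar> * norm (snd z, 0 :: 'a) \<le> \<bar>s\<bar> * norm z" by (rule mult_left_mono) simp
  finally show ?thesis by (simp add: algebra_simps)
qed

lemma bounded_linear_shear: "bounded_linear (shear s)"
proof (rule bounded_linear_intro)
  show "norm (shear s z) \<le> norm z * (1 + \<bar>s\<bar>)" for z :: "'a \<times> 'a"
    using norm_shear_le[of s z] by (simp add: mult.commute)
qed (auto simp: shear_def algebra_simps)

lemma indicator_cball_measurable:
  "(indicator (cball c r) :: 'c::real_normed_vector => real) \<in> Borel"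
  "(indicator (cball c r) :: 'c => ennreal) \<in> Borel"
  by (intro borel_measurable_indicator borel_closed closed_cball)+

lemma smooth_streaming_derivative:
  fixes \<eta> :: "'a::euclidean_space \<times> 'a => real"
  defines "E \<equiv> \<lambda>z. frechet_derivative \<eta> (at z) (snd z, 0)"
  assumes smooth: "smooth_on \<eta> UNIV"
  shows "continuous_on UNIV E" "((\<lambda>s. \<eta> (shear s z)) has_real_derivative E (shear s z)) (at s)"
    "z \<notin> closure {z. \<eta> z \<noteq> 0} ==> E z = 0"
proof -
  have Ck: "Ck_on (Suc 0) \<eta> UNIV" using smooth by (simp only: smooth_on_def)
  have diff: "\<eta> differentiable at z" for z using Ck unfolding Ck_on.simps differentiable_on_UNIV_iff by blast
  have der: "(\<eta> has_derivative frechet_derivative \<eta> (at z)) (at z)" for z using diff by (simp add: frechet_derivative_works)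
  have lin: "linear (frechet_derivative \<eta> (at z))" for z using der by (rule has_derivative_linear)
  \<comment> \<open>\<open>Ck_on\<close> controls derivatives in fixed directions, whereas the
    direction \<open>(snd z, 0)\<close> moves with \<open>z\<close>; the expansion in a basis
    separates the two.\<close>
  have E: "E = (\<lambda>z. \<Sum>i\<in>Basis. (snd z \<bullet> i) * frechet_derivative \<eta> (at z) (i, 0))"
  proof
    fix z :: "'a \<times> 'a"
    have "(snd z, 0 :: 'a) = (\<Sum>i\<in>Basis. (snd z \<bullet> i) *\<^sub>R (i, 0))"
      by (simp add: prod_eq_iff fst_sum snd_sum euclidean_representation)
    then show "E z = (\<Sum>i\<in>Basis. (snd z \<bullet> i) * frechet_derivative \<eta> (at z) (i, 0))"
      unfolding E_def by (simp only: linear_sum[OF lin] linear_scale[OF lin] real_scaleR_def)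
  qed
  have "continuous_on UNIV (\<lambda>z. frechet_derivative \<eta> (at z) (i, 0))" for i using Ck unfolding Ck_on.simps by blast
  then show "continuous_on UNIV E" unfolding E by (intro continuous_intros)
  have "((\<lambda>s. shear s z) has_derivative (\<lambda>h. (h *\<^sub>R snd z, 0))) (at s)"
    unfolding shear_def by (auto intro!: derivative_eq_intros)
  from has_derivative_compose[OF this der]
  have "((\<lambda>s. \<eta> (shear s z)) has_derivative (\<lambda>h. frechet_derivative \<eta> (at (shear s z)) (h *\<^sub>R snd z, 0))) (at s)" .
  moreover have "frechet_derivative \<eta> (at (shear s z)) (h *\<^sub>R snd z, 0) = E (shear s z) * h" for h
    using linear_scale[OF lin, of "shear s z" h "(snd z, 0)"] by (simp add: E_def)
  ultimately show "((\<lambda>s. \<eta> (shear s z)) has_real_derivative E (shear s z)) (at s)"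
    by (simp add: has_field_derivative_def)
  assume z: "z \<notin> closure {z. \<eta> z \<noteq> 0}"
  have "(\<eta> has_derivative (\<lambda>h. 0)) (at z)"
  proof (rule has_derivative_transform_within_open[of "\<lambda>_. 0" _ z UNIV "- closure {z. \<eta> z \<noteq> 0}"])
    show "0 = \<eta> w" if "w \<in> - closure {z. \<eta> z \<noteq> 0}" for w using that closure_subset[of "{z. \<eta> z \<noteq> 0}"] by auto
  qed (use z in auto)
  from frechet_derivative_at[OF this] show "E z = 0" unfolding E_def by (metis (no_types))
qed

text \<open>The fundamental theorem of calculus along the backward shear: test functions move
  backwards when the forward shear is taken off the other factor of an integral.\<close>

lemma integral_streaming_derivative:
  fixes \<eta> :: "'a::euclidean_space \<times> 'a => real"
  assumes smooth: "smooth_on \<eta> UNIV" and h: "0 \<le> h"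
  shows "(LINT s|lborel. indicator {0..h} s * frechet_derivative \<eta> (at (shear (- s) z)) (snd z, 0)) = \<eta> z - \<eta> (shear (- h) z)"
proof -
  let ?E = "\<lambda>z. frechet_derivative \<eta> (at z) (snd z, 0)"
  note E = smooth_streaming_derivative[OF smooth]
  have "has_bochner_integral lborel (\<lambda>s. ?E (shear (- s) z) * indicator {0..h} s) (- \<eta> (shear (- h) z) - (- \<eta> (shear (- 0) z)))"
  proof (rule has_bochner_integral_FTC_Icc_real[OF h])
    have "((\<lambda>s. \<eta> (shear (- s) z)) has_real_derivative ?E (shear (- s) z) * (- 1)) (at s)" for s
      by (rule DERIV_chain2[OF E(2)]) (auto intro!: derivative_eq_intros)
    from DERIV_minus[OF this] show "((\<lambda>s. - \<eta> (shear (- s) z)) has_real_derivative ?E (shear (- s) z)) (at s)" for s by simp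
    have "continuous_on UNIV (\<lambda>s. ?E (shear (- s) z))" by (intro continuous_on_compose2[OF E(1)] continuous_intros) auto
    then show "isCont (\<lambda>s. ?E (shear (- s) z)) s" for s by (simp add: continuous_on_eq_continuous_at)
  qed
  from has_bochner_integral_integral_eq[OF this] show ?thesis by (simp add: mult.commute)
qed

lemma line_integral_measurable:
  fixes g :: "'a::euclidean_space \<times> 'a => real"
  assumes g: "g \<in> Borel"
  shows "(\<lambda>z. LINT s|lborel. indicator {0..h} s * g (shear s z)) \<in> borel_measurable (borel :: ('a::euclidean_space \<times> 'a) measure)"
proof -
  have "(\<lambda>(z, s). indicator {0..h} s * g (shear s z)) \<in> borel_measurable (borel :: (('a \<times> 'a) \<times> real) measure)"
    unfolding case_prod_unfold
    by (intro borel_measurable_times measurable_compose[OF shear_measurable2' g]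
        measurable_compose[OF borel_continuous[of snd]]) (auto intro: continuous_intros)
  then have "(\<lambda>(z, s). indicator {0..h} s * g (shear s z)) \<in> borel_measurable (lborel \<Otimes>\<^sub>M lborel)"
    by (simp add: lborel_prod)
  then have "(\<lambda>z. LINT s|lborel. indicator {0..h} s * g (shear s z)) \<in> borel_measurable lborel"
    by (rule lborel.borel_measurable_lebesgue_integral)
  then show ?thesis by simp
qed

lemma locally_integrable_shear:
  assumes f: "locally_integrable (f :: 'a::euclidean_space \<times> 'a => real)"
  shows "locally_integrable (\<lambda>z. f (shear s z))"
  unfolding locally_integrable_def
proof (intro conjI allI)
  have fm: "f \<in> Borel" using f by (simp add: locally_integrable_def)
  show fs: "(\<lambda>z. f (shear s z)) \<in> Borel" by (rule measurable_compose[OF shear_measurable fm])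
  fix r :: real
  let ?\<phi> = "\<lambda>z :: 'a \<times> 'a. indicator (cball 0 r) (shear (- s) z) :: real"
  have m\<phi>: "?\<phi> \<in> Borel" by (rule measurable_compose[OF shear_measurable indicator_cball_measurable(1)])
  have "integrable lborel (\<lambda>z. ?\<phi> z * f z)"
  proof (rule locally_integrable_mult[OF f m\<phi>, of 1 "(1 + \<bar>s\<bar>) * r"])
    fix z :: "'a \<times> 'a" assume z: "(1 + \<bar>s\<bar>) * r < norm z"
    have "norm z = norm (shear s (shear (- s) z))" by (simp add: shear_shear)
    also have "... \<le> (1 + \<bar>s\<bar>) * norm (shear (- s) z)" by (rule norm_shear_le)
    finally have "(1 + \<bar>s\<bar>) * r < (1 + \<bar>s\<bar>) * norm (shear (- s) z)" using z by linarith
    then have "r < norm (shear (- s) z)" by (simp add: mult_less_cancel_left)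
    then show "?\<phi> z = 0" by simp
  qed simp
  then have "integrable lborel (\<lambda>z. (\<lambda>z. ?\<phi> z * f z) (shear s z))"
    by (subst integral_lborel_shear(2)) (use m\<phi> fm in auto)
  then show "integrable lborel (\<lambda>z. indicator (cball 0 r) z * f (shear s z))"
    by (simp add: shear_shear)
qed

text \<open>Every shear preserves the integral of the absolute value, and the parameter ranges over
  a bounded interval.\<close>

lemma integrable_product_shear:
  fixes F :: "'a::euclidean_space \<times> 'a => real"
  assumes F: "integrable lborel F"
  shows "integrable (lborel \<Otimes>\<^sub>M lborel) (\<lambda>y. indicator {0..h::real} (snd y) * F (shear (c * snd y) (fst y)))"
proof -
  have Fm: "F \<in> Borel" using F by auto
  have ind: "(\<lambda>y::real\<times>('a\<times>'a). indicator {0..h} (fst y) :: real) \<in> Borel"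
    by (rule measurable_compose[OF borel_continuous[of fst]]) (auto intro: continuous_intros)
  have sh: "(\<lambda>y::real\<times>('a\<times>'a). shear (c * fst y) (snd y)) \<in> Borel"
    by (intro borel_continuous continuous_intros)
  have "integrable (lborel \<Otimes>\<^sub>M lborel) (\<lambda>y. indicator {0..h} (fst y) * F (shear (c * fst y) (snd y)))"
  proof (rule lborel_pair.Fubini_integrable)
    show "(\<lambda>y. indicator {0..h} (fst y) * F (shear (c * fst y) (snd y))) \<in> borel_measurable (lborel \<Otimes>\<^sub>M lborel)"
      using borel_measurable_times[OF ind measurable_compose[OF sh Fm]] by (simp add: lborel_prod)
    have "(LINT z|lborel. \<bar>F (shear (c * s) z)\<bar>) = (LINT z|lborel. \<bar>F z\<bar>)" for s
      by (rule integral_lborel_shear(1)) (use Fm in simp)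
    moreover have "integrable lborel (indicator {0..h} :: real => real)"
      by (cases "0 \<le> h") (auto intro!: integrable_real_indicator)
    ultimately show "integrable lborel (\<lambda>s. LINT z|lborel. norm (indicator {0..h} (fst (s, z)) * F (shear (c * fst (s, z)) (snd (s, z)))))"
      by (simp add: abs_mult)
    show "AE s in lborel. integrable lborel (\<lambda>z. indicator {0..h} (fst (s, z)) * F (shear (c * fst (s, z)) (snd (s, z))))"
      using integral_lborel_shear(2)[OF Fm] F by simp
  qed
  from lborel_pair.integrable_product_swap[OF this] show ?thesis by (simp add: case_prod_unfold)
qed

lemma shear_product_integrable:
  fixes f :: "'a::euclidean_space \<times> 'a => real"
  assumes f: "locally_integrable f"
    and K: "\<And>y. norm (K y) \<le> C" "K \<in> borel_measurable (borel :: (('a \<times> 'a) \<times> real) measure)"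
    and supp: "\<And>z s. r < norm z ==> K (z, s) = 0"
  shows "integrable (lborel \<Otimes>\<^sub>M lborel) (\<lambda>y. K y * (indicator {0..h} (snd y) * f (fst y)))"
    "integrable (lborel \<Otimes>\<^sub>M lborel) (\<lambda>y. K y * (indicator {0..h} (snd y) * f (shear (snd y) (fst y))))"
proof -
  have fm: "f \<in> Borel" using f by (simp add: locally_integrable_def)
  \<comment> \<open>A shear by at most \<open>h\<close> enlarges norms at most by the factor
    \<open>1 + \<bar>h\<bar>\<close>, so \<open>f\<close> is sampled in one fixed ball.\<close>
  let ?q = "(1 + \<bar>h\<bar>) * \<bar>r\<bar>"
  have *: "integrable (lborel \<Otimes>\<^sub>M lborel) (\<lambda>y. K y * (indicator {0..h} (snd y) * f (shear (c * snd y) (fst y))))"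
    if c: "\<bar>c\<bar> \<le> 1" for c
  proof (rule Bochner_Integration.integrable_bound)
    let ?F = "\<lambda>z. indicator (cball 0 ?q) z * f z"
    have "integrable lborel ?F" using f by (simp add: locally_integrable_def)
    from integrable_mult_right[OF integrable_product_shear[OF this], of C h c]
    show "integrable (lborel \<Otimes>\<^sub>M lborel) (\<lambda>y. C * (indicator {0..h} (snd y) * ?F (shear (c * snd y) (fst y))))" by simp
    have ind: "(\<lambda>y::('a\<times>'a)\<times>real. indicator {0..h} (snd y) :: real) \<in> Borel"
      by (rule measurable_compose[OF borel_continuous[of snd]]) (auto intro: continuous_intros)
    have sh: "(\<lambda>y::('a\<times>'a)\<times>real. shear (c * snd y) (fst y)) \<in> Borel"
      by (intro borel_continuous continuous_intros)
    show "(\<lambda>y. K y * (indicator {0..h} (snd y) * f (shear (c * snd y) (fst y)))) \<in> borel_measurable (lborel \<Otimes>\<^sub>M lborel)"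
      using borel_measurable_times[OF K(2) borel_measurable_times[OF ind measurable_compose[OF sh fm]]] by (simp add: lborel_prod)
    show "AE y in lborel \<Otimes>\<^sub>M lborel. norm (K y * (indicator {0..h} (snd y) * f (shear (c * snd y) (fst y))))
      \<le> norm (C * (indicator {0..h} (snd y) * ?F (shear (c * snd y) (fst y))))"
    proof (rule AE_I2)
      fix y :: "('a \<times> 'a) \<times> real"
      obtain z s where y: "y = (z, s)" by (cases y)
      have C: "norm (K y) \<le> \<bar>C\<bar>" using K(1)[of y] by linarith
      show "norm (K y * (indicator {0..h} (snd y) * f (shear (c * snd y) (fst y))))
        \<le> norm (C * (indicator {0..h} (snd y) * ?F (shear (c * snd y) (fst y))))"
      proof (cases "r < norm z \<or> s \<notin> {0..h}")
        case False
        then have s: "norm z \<le> r" "0 \<le> s" "s \<le> h" by auto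
        have "\<bar>c * s\<bar> \<le> 1 * \<bar>h\<bar>" unfolding abs_mult using c s by (intro mult_mono) auto
        then have "(1 + \<bar>c * s\<bar>) * norm z \<le> ?q" using s by (intro mult_mono) auto
        then have "norm (shear (c * s) z) \<le> ?q" using norm_shear_le[of "c * s" z] by linarith
        then show ?thesis using s C by (simp add: y abs_mult mult_right_mono)
      qed (use supp[of z s] in \<open>auto simp: y\<close>)
    qed
  qed
  show "integrable (lborel \<Otimes>\<^sub>M lborel) (\<lambda>y. K y * (indicator {0..h} (snd y) * f (fst y)))" using *[of 0] by simp
  show "integrable (lborel \<Otimes>\<^sub>M lborel) (\<lambda>y. K y * (indicator {0..h} (snd y) * f (shear (snd y) (fst y))))" using *[of 1] by simp
qed

context bounded_convex_domain
begin

text \<open>The weak equation is tested with the transported functions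
  \<open>\<eta> (shear (- s) z)\<close> and integrated over \<open>s\<close> from 0 to
  \<open>h\<close>. On the side of \<open>f\<close> the derivative integrates to an increment of
  \<open>\<eta>\<close>, which a shear of variables turns into an increment of \<open>f\<close>; on
  the side of \<open>g\<close> the line integral appears. Bumps determine the result almost
  everywhere on the open set of \<open>z\<close> with both end points in \<open>D\<close>.\<close>

lemma weak_derivative_shear:
  fixes f g :: "'a \<times> 'a => real"
  assumes f: "locally_integrable f" and g: "locally_integrable g"
    and weak: "\<And>\<eta>. test_function D \<eta> ==>
      (LINT z|lborel. f z * frechet_derivative \<eta> (at z) (snd z, 0)) = - (LINT z|lborel. g z * \<eta> z)"
    and h: "0 \<le> h"
  shows "AE z in lborel. fst z \<in> D \<and> fst (shear h z) \<in> D -->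
    f (shear h z) = f z + (LINT s|lborel. indicator {0..h} s * g (shear s z))"
proof -
  define S where "S = {z. fst z \<in> D \<and> fst (shear h z) \<in> D}"
  define G where "G z = (LINT s|lborel. indicator {0..h} s * g (shear s z))" for z
  have fm: "f \<in> Borel" and gm: "g \<in> Borel"
    using f g by (auto simp: locally_integrable_def)
  have openS: "open S" unfolding S_def
    by (intro open_Collect_conj open_vimage[unfolded vimage_def] open_D continuous_intros)
  have Gm: "G \<in> Borel" unfolding G_def[abs_def] by (rule line_integral_measurable[OF gm])
  have G: "locally_integrable G"
    unfolding locally_integrable_def
  proof (intro conjI allI Gm)
    fix r :: real
    have i: "integrable (lborel \<Otimes>\<^sub>M lborel) (\<lambda>y. indicator (cball 0 r) (fst y) * (indicator {0..h} (snd y) * g (shear (snd y) (fst y))))"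
      by (rule shear_product_integrable(2)[OF g, of _ 1 r])
        (auto intro!: measurable_compose[OF borel_continuous[of fst] indicator_cball_measurable(1)] continuous_intros simp: indicator_def)
    from lborel_pair.integrable_fst'[OF i] show "integrable lborel (\<lambda>z. indicator (cball 0 r) z * G z)"
      by (simp add: G_def)
  qed
  define F where "F z = (f (shear h z) - f z) - G z" for z
  have F: "locally_integrable F" unfolding F_def
    by (intro locally_integrable_diff locally_integrable_shear f G)
  have "AE z in lborel. z \<in> S --> F z = 0"
  proof (rule AE_zero_if_box_bump_integrals_zero[OF openS])
    show "F \<in> Borel" "\<And>r. integrable lborel (\<lambda>z. indicator (cball 0 r) z * F z)"
      using F by (auto simp: locally_integrable_def)
    fix n and a b :: "'a \<times> 'a" assume ab: "cbox a b \<subseteq> S"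
    define \<eta> where "\<eta> = box_bump n a b"
    define E where "E z = frechet_derivative \<eta> (at z) (snd z, 0)" for z
    have sm: "smooth_on \<eta> UNIV" unfolding \<eta>_def by (rule smooth_on_box_bump)
    then have smooth: "Ck_on k \<eta> UNIV" for k by (simp add: smooth_on_def)
    have \<eta>c: "continuous_on UNIV \<eta>" using smooth[of 0] by simp
    have \<eta>m: "\<eta> \<in> Borel" by (rule borel_continuous[OF \<eta>c])
    have diff: "\<eta> differentiable at z" for z using smooth[of "Suc 0"] unfolding Ck_on.simps differentiable_on_UNIV_iff by blast
    have \<eta>0: "\<eta> z = 0" if "z \<notin> cbox a b" for z using box_bump_eq_0[of z a b n] that box_subset_cbox[of a b] by (auto simp: \<eta>_def)
    have "closure {z. \<eta> z \<noteq> 0} \<subseteq> cbox a b" by (rule closure_minimal) (use \<eta>0 in auto)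
    then have E0: "E z = 0" if "z \<notin> cbox a b" for z unfolding E_def using smooth_streaming_derivative(3)[OF sm] that by blast
    have Ec: "continuous_on UNIV E" unfolding E_def[abs_def] by (rule smooth_streaming_derivative(1)[OF sm])
    have Em: "E \<in> Borel" by (rule borel_continuous[OF Ec])
    obtain C where C0: "0 \<le> C" and C: "\<And>z. \<bar>E z\<bar> \<le> C" using compact_support_bounded[OF Ec compact_cbox E0] by blast
    obtain r where r: "\<And>z. z \<in> cbox a b ==> norm z \<le> r" using bounded_cbox[of a b] by (auto simp: bounded_iff)
    \<comment> \<open>Radius of a ball that contains the images of the box under all shears with
      \<open>0 \<le> s \<le> h\<close>; the absolute value covers an empty box.\<close>
    define q where "q = (1 + h) * \<bar>r\<bar>"
    have supp: "shear (- s) z \<notin> cbox a b" if "s \<in> {0..h}" "q < norm z" for s z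
    proof
      assume "shear (- s) z \<in> cbox a b"
      then have "norm (shear (- s) z) \<le> \<bar>r\<bar>" using r by fastforce
      have "norm z = norm (shear s (shear (- s) z))" by (simp add: shear_shear)
      also have "... \<le> (1 + \<bar>s\<bar>) * norm (shear (- s) z)" by (rule norm_shear_le)
      also have "... \<le> (1 + h) * \<bar>r\<bar>" using \<open>norm (shear (- s) z) \<le> \<bar>r\<bar>\<close> that by (intro mult_mono) auto
      finally show False using that by (simp add: q_def)
    qed
    have E1: "(LINT z|lborel. f z * E (shear (- s) z)) = - (LINT z|lborel. g z * \<eta> (shear (- s) z))" if s: "s \<in> {0..h}" for s
    proof -
      let ?\<eta> = "\<lambda>z. \<eta> (shear (- s) z)"
      have "Ck_on k ?\<eta> UNIV" for k
        using Ck_on_UNIV_compose_affine[OF bounded_linear_shear smooth[of k], of "- s" 0] by simp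
      then have sm: "smooth_on ?\<eta> UNIV" by (simp add: smooth_on_def)
      have cs: "compact (shear s ` cbox a b)"
        by (intro compact_continuous_image continuous_intros compact_cbox)
      have "{z. ?\<eta> z \<noteq> 0} \<subseteq> shear s ` cbox a b"
      proof
        fix z assume "z \<in> {z. ?\<eta> z \<noteq> 0}"
        then have "shear (- s) z \<in> cbox a b" using \<eta>0[of "shear (- s) z"] by blast
        moreover have "z = shear s (shear (- s) z)" by (simp add: shear_shear)
        ultimately show "z \<in> shear s ` cbox a b" by blast
      qed
      then have cl: "closure {z. ?\<eta> z \<noteq> 0} \<subseteq> shear s ` cbox a b"
        by (rule closure_minimal) (rule compact_imp_closed[OF cs])
      \<comment> \<open>Both end points lie in \<open>D\<close>, hence by convexity the positions in
        between: the transported bump is an admissible test function.\<close>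
      have sub: "shear s ` cbox a b \<subseteq> D \<times> UNIV"
      proof
        fix y assume "y \<in> shear s ` cbox a b"
        then obtain x v where y: "y = shear s (x, v)" and "(x, v) \<in> cbox a b" by auto
        then have "(x, v) \<in> S" using ab by blast
        then have xv: "x \<in> D" "x + h *\<^sub>R v \<in> D" by (simp_all add: S_def)
        have "x + s *\<^sub>R v \<in> D"
        proof (cases "h = 0")
          case False
          have "x + s *\<^sub>R v = (1 - s / h) *\<^sub>R x + (s / h) *\<^sub>R (x + h *\<^sub>R v)" using False by (simp add: algebra_simps)
          then show ?thesis using convexD_alt[OF convex_D xv, of "s / h"] s False by simp
        qed (use s xv in simp)
        then show "y \<in> D \<times> UNIV" by (simp add: y mem_Times_iff)
      qed
      have cc: "compact (closure {z. ?\<eta> z \<noteq> 0})"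
        unfolding compact_eq_bounded_closed using bounded_subset[OF compact_imp_bounded[OF cs] cl] by (intro conjI closed_closure)
      have "test_function D ?\<eta>" unfolding test_function_def by (intro conjI sm cc order_trans[OF cl sub])
      then have "(LINT z|lborel. f z * frechet_derivative ?\<eta> (at z) (snd z, 0)) = - (LINT z|lborel. g z * ?\<eta> z)" by (rule weak)
      moreover have "frechet_derivative ?\<eta> (at z) (snd z, 0) = E (shear (- s) z)" for z
        using frechet_derivative_compose_affine(2)[OF bounded_linear_shear, of \<eta> "- s" z 0] diff by (simp add: E_def shear_def)
      ultimately show ?thesis by simp
    qed
    \<comment> \<open>The indicator of the ball bounds the support in \<open>z\<close> uniformly in
      \<open>s\<close>, as needed for Fubini; for \<open>0 \<le> s \<le> h\<close> it changes
      nothing.\<close>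
    let ?K1 = "\<lambda>y :: ('a \<times> 'a) \<times> real. E (shear (- snd y) (fst y)) * indicator (cball 0 q) (fst y)"
    have K1m: "?K1 \<in> Borel"
      by (intro borel_measurable_times measurable_compose[OF borel_continuous[of "\<lambda>y :: ('a \<times> 'a) \<times> real. shear (- snd y) (fst y)"] Em]
        measurable_compose[OF borel_continuous[of fst] indicator_cball_measurable(1)] continuous_intros)
    have K1b: "norm (?K1 y) \<le> C" for y using C[of "shear (- snd y) (fst y)"] C0 by (auto simp: indicator_def)
    have iA: "integrable (lborel \<Otimes>\<^sub>M lborel) (\<lambda>y. ?K1 y * (indicator {0..h} (snd y) * f (fst y)))"
      by (rule shear_product_integrable(1)[OF f K1b K1m, of q]) simp
    have A: "(LINT s|lborel. indicator {0..h} s * (LINT z|lborel. f z * E (shear (- s) z))) = (LINT z|lborel. f z * (\<eta> z - \<eta> (shear (- h) z)))"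
    proof -
      have "(LINT s|lborel. (LINT z|lborel. ?K1 (z, s) * (indicator {0..h} s * f z))) = (LINT z|lborel. (LINT s|lborel. ?K1 (z, s) * (indicator {0..h} s * f z)))"
        by (rule lborel_pair.Fubini_integral) (use iA in \<open>simp add: case_prod_unfold\<close>)
      moreover have "(LINT z|lborel. ?K1 (z, s) * (indicator {0..h} s * f z)) = indicator {0..h} s * (LINT z|lborel. f z * E (shear (- s) z))" for s
      proof (cases "s \<in> {0..h}")
        case True
        have pt: "?K1 (z, s) * (indicator {0..h} s * f z) = f z * E (shear (- s) z)" for z
          using supp[OF True, of z] E0[of "shear (- s) z"] True by (cases "q < norm z") auto
        show ?thesis unfolding pt using True by simp
      qed simp
      moreover have "(LINT s|lborel. ?K1 (z, s) * (indicator {0..h} s * f z)) = f z * (\<eta> z - \<eta> (shear (- h) z))" for z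
      proof -
        have FTC: "(LINT s|lborel. indicator {0..h} s * E (shear (- s) z)) = \<eta> z - \<eta> (shear (- h) z)"
          using integral_streaming_derivative[OF sm h, of z] by (simp add: E_def)
        have "(LINT s|lborel. ?K1 (z, s) * (indicator {0..h} s * f z)) = (LINT s|lborel. f z * (indicator {0..h} s * E (shear (- s) z)))"
        proof (rule Bochner_Integration.integral_cong[OF refl])
          fix s
          show "?K1 (z, s) * (indicator {0..h} s * f z) = f z * (indicator {0..h} s * E (shear (- s) z))"
            using supp[of s z] E0[of "shear (- s) z"] by (cases "s \<in> {0..h}"; cases "q < norm z") auto
        qed
        then show ?thesis by (simp add: FTC)
      qed
      ultimately show ?thesis by simp
    qed
    let ?K2 = "\<lambda>y :: ('a \<times> 'a) \<times> real. \<eta> (fst y)"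
    have K2m: "?K2 \<in> Borel"
      by (rule measurable_compose[OF borel_continuous[of fst] \<eta>m]) (intro continuous_intros)
    have \<eta>b: "\<bar>\<eta> z\<bar> \<le> 1" for z using box_bump_bounds[of n a b z] by (simp add: \<eta>_def)
    have \<eta>r: "r < norm z ==> \<eta> z = 0" for z using r[of z] \<eta>0[of z] by force
    have iB: "integrable (lborel \<Otimes>\<^sub>M lborel) (\<lambda>y. ?K2 y * (indicator {0..h} (snd y) * g (shear (snd y) (fst y))))"
      by (rule shear_product_integrable(2)[OF g _ K2m, of 1 r]) (use \<eta>b \<eta>r in auto)
    have B: "(LINT s|lborel. indicator {0..h} s * (LINT z|lborel. g z * \<eta> (shear (- s) z))) = (LINT z|lborel. \<eta> z * G z)"
    proof -
      have "(LINT s|lborel. (LINT z|lborel. ?K2 (z, s) * (indicator {0..h} s * g (shear s z)))) = (LINT z|lborel. (LINT s|lborel. ?K2 (z, s) * (indicator {0..h} s * g (shear s z))))"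
        by (rule lborel_pair.Fubini_integral) (use iB in \<open>simp add: case_prod_unfold\<close>)
      moreover have "(LINT z|lborel. ?K2 (z, s) * (indicator {0..h} s * g (shear s z))) = indicator {0..h} s * (LINT z|lborel. g z * \<eta> (shear (- s) z))" for s
      proof -
        have "(\<lambda>z. g z * \<eta> (shear (- s) z)) \<in> Borel"
          by (intro borel_measurable_times gm measurable_compose[OF shear_measurable \<eta>m])
        from integral_lborel_shear(1)[OF this, of s]
        have "(LINT z|lborel. g z * \<eta> (shear (- s) z)) = (LINT z|lborel. g (shear s z) * \<eta> z)" by (simp add: shear_shear)
        moreover have "(LINT z|lborel. ?K2 (z, s) * (indicator {0..h} s * g (shear s z))) = (LINT z|lborel. indicator {0..h} s * (g (shear s z) * \<eta> z))"
          by (simp add: mult_ac)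
        ultimately show ?thesis by simp
      qed
      ultimately show ?thesis by (simp add: G_def)
    qed
    have AB: "(LINT z|lborel. f z * (\<eta> z - \<eta> (shear (- h) z))) = - (LINT z|lborel. \<eta> z * G z)"
    proof -
      have "(LINT s|lborel. indicator {0..h} s * (LINT z|lborel. f z * E (shear (- s) z))) = (LINT s|lborel. - (indicator {0..h} s * (LINT z|lborel. g z * \<eta> (shear (- s) z))))"
        by (intro Bochner_Integration.integral_cong refl) (use E1 in \<open>auto simp: indicator_def\<close>)
      then show ?thesis unfolding A using B by simp
    qed
    have i1: "integrable lborel (\<lambda>z. \<eta> z * f z)" by (rule locally_integrable_mult[OF f \<eta>m \<eta>b \<eta>r])
    have i2: "integrable lborel (\<lambda>z. \<eta> z * f (shear h z))" by (rule locally_integrable_mult[OF locally_integrable_shear[OF f] \<eta>m \<eta>b \<eta>r])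
    have i3: "integrable lborel (\<lambda>z. \<eta> z * G z)" by (rule locally_integrable_mult[OF G \<eta>m \<eta>b \<eta>r])
    have m4: "(\<lambda>z. f z * \<eta> (shear (- h) z)) \<in> Borel"
      by (intro borel_measurable_times fm measurable_compose[OF shear_measurable \<eta>m])
    have i4: "integrable lborel (\<lambda>z. f z * \<eta> (shear (- h) z))"
      using i2 integral_lborel_shear(2)[OF m4, of h] by (simp add: shear_shear mult.commute)
    have e4: "(LINT z|lborel. f z * \<eta> (shear (- h) z)) = (LINT z|lborel. \<eta> z * f (shear h z))"
      using integral_lborel_shear(1)[OF m4, of h] by (simp add: shear_shear mult.commute)
    have "(LINT z|lborel. f z * (\<eta> z - \<eta> (shear (- h) z))) = (LINT z|lborel. \<eta> z * f z) - (LINT z|lborel. \<eta> z * f (shear h z))"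
      unfolding e4[symmetric] using i1 i4 by (simp add: right_diff_distrib mult.commute Bochner_Integration.integral_diff)
    moreover have "(LINT z|lborel. \<eta> z * F z) = ((LINT z|lborel. \<eta> z * f (shear h z)) - (LINT z|lborel. \<eta> z * f z)) - (LINT z|lborel. \<eta> z * G z)"
      unfolding F_def right_diff_distrib
      using i1 i2 i3 by (simp add: Bochner_Integration.integral_diff Bochner_Integration.integrable_diff)
    ultimately show "(LINT z|lborel. box_bump n a b z * F z) = 0" using AB by (simp add: \<eta>_def)
  qed
  then show ?thesis by eventually_elim (auto simp: S_def F_def G_def)
qed

end

section \<open>The surface measure of a convex domain\<close>

definition hausdorff_cost :: "nat => 'a::metric_space set => ennreal" where
  "hausdorff_cost k X = (if X = {} then 0 else ennreal (unit_ball_vol (real k) * (diameter X / 2) ^ k))"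

text \<open>The set function behind \<open>hausdorff_measure\<close>, taken on all sets so that
  Caratheodory's construction applies.\<close>

definition hausdorff_outer :: "nat => 'a::metric_space set => ennreal" where
  "hausdorff_outer k A = (SUP \<delta>\<in>{0<..}. hausdorff_premeasure k \<delta> A)"

lemma hausdorff_premeasure_le:
  assumes "A \<subseteq> (\<Union>i. C i)" "\<And>i. bounded (C i)" "\<And>i. diameter (C i) \<le> \<delta>"
  shows "hausdorff_premeasure k \<delta> A \<le> (\<Sum>i. hausdorff_cost k (C i))"
  unfolding hausdorff_premeasure_def hausdorff_cost_def by (rule INF_lower) (use assms in auto)

lemma hausdorff_premeasure_cover:
  assumes "hausdorff_premeasure k \<delta> A \<noteq> \<infinity>" "0 < e"
  obtains C where "A \<subseteq> (\<Union>i::nat. C i)" "\<And>i. bounded (C i)" "\<And>i. diameter (C i) \<le> \<delta>"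
    "(\<Sum>i. hausdorff_cost k (C i)) < hausdorff_premeasure k \<delta> A + ennreal e"
proof -
  from INF_approx_ennreal[OF assms(2) hausdorff_premeasure_def assms(1)]
  obtain C where "C \<in> {C :: nat => 'a set. A \<subseteq> (\<Union>i. C i) \<and> (\<forall>i. bounded (C i) \<and> diameter (C i) \<le> \<delta>)}"
    "(\<Sum>i. if C i = {} then 0 else ennreal (unit_ball_vol (real k) * (diameter (C i) / 2) ^ k)) < hausdorff_premeasure k \<delta> A + ennreal e"
    by blast
  then show thesis by (intro that[of C]) (auto simp: hausdorff_cost_def)
qed

lemma hausdorff_premeasure_mono: "A \<subseteq> B ==> hausdorff_premeasure k \<delta> A \<le> hausdorff_premeasure k \<delta> B"
  unfolding hausdorff_premeasure_def by (rule INF_superset_mono) auto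

lemma hausdorff_premeasure_antimono: "d \<le> \<delta> ==> hausdorff_premeasure k \<delta> A \<le> hausdorff_premeasure k d A"
  unfolding hausdorff_premeasure_def by (rule INF_superset_mono) (auto intro: order_trans)

lemma hausdorff_premeasure_le_outer: "0 < \<delta> ==> hausdorff_premeasure k \<delta> A \<le> hausdorff_outer k A"
  unfolding hausdorff_outer_def by (rule SUP_upper) simp

lemma hausdorff_outer_mono: "A \<subseteq> B ==> hausdorff_outer k A \<le> hausdorff_outer k B"
  unfolding hausdorff_outer_def by (rule SUP_mono) (use hausdorff_premeasure_mono in blast)

lemma hausdorff_outer_empty [simp]: "hausdorff_outer k {} = 0"
proof -
  have "hausdorff_premeasure k \<delta> {} \<le> 0" if "0 < \<delta>" for \<delta> :: real
    using hausdorff_premeasure_le[of "{}" "\<lambda>_. {}" \<delta> k] that by (simp add: hausdorff_cost_def)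
  then have "hausdorff_outer k {} \<le> 0" unfolding hausdorff_outer_def by (intro SUP_least) auto
  then show ?thesis by simp
qed

lemma hausdorff_outer_subadditive:
  "hausdorff_outer k (\<Union>n::nat. A n) \<le> (\<Sum>n. hausdorff_outer k (A n))"
  unfolding hausdorff_outer_def[of k "\<Union>n. A n"]
proof (rule SUP_least)
  fix \<delta> :: real assume "\<delta> \<in> {0<..}"
  then have \<delta>: "0 < \<delta>" by simp
  show "hausdorff_premeasure k \<delta> (\<Union>n. A n) \<le> (\<Sum>n. hausdorff_outer k (A n))"
  proof (rule ennreal_le_epsilon)
    fix e :: real assume fin: "(\<Sum>n. hausdorff_outer k (A n)) < top" and e: "0 < e"
    have fin': "hausdorff_premeasure k \<delta> (A n) \<noteq> \<infinity>" for n
    proof -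
      have "hausdorff_outer k (A n) = (\<Sum>n\<in>{n}. hausdorff_outer k (A n))" by simp
      also have "... \<le> (\<Sum>n. hausdorff_outer k (A n))" by (rule sum_le_suminf) auto
      finally show ?thesis using fin hausdorff_premeasure_le_outer[OF \<delta>, of k "A n"] by auto
    qed
    have "\<exists>C. A n \<subseteq> (\<Union>i::nat. C i) \<and> (\<forall>i. bounded (C i)) \<and> (\<forall>i. diameter (C i) \<le> \<delta>) \<and>
      (\<Sum>i. hausdorff_cost k (C i)) \<le> hausdorff_premeasure k \<delta> (A n) + ennreal (e * (1/2) ^ Suc n)" for n
      by (rule hausdorff_premeasure_cover[OF fin'[of n], of "e * (1/2) ^ Suc n"]) (use e in \<open>auto intro: less_imp_le\<close>)
    then have "\<exists>C. \<forall>n. A n \<subseteq> (\<Union>i::nat. C n i) \<and> (\<forall>i. bounded (C n i)) \<and> (\<forall>i. diameter (C n i) \<le> \<delta>) \<and>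
      (\<Sum>i. hausdorff_cost k (C n i)) \<le> hausdorff_premeasure k \<delta> (A n) + ennreal (e * (1/2) ^ Suc n)"
      by (intro choice allI)
    then obtain C where C: "\<And>n. A n \<subseteq> (\<Union>i::nat. C n i)" "\<And>n i. bounded (C n i)" "\<And>n i. diameter (C n i) \<le> \<delta>"
      "\<And>n. (\<Sum>i. hausdorff_cost k (C n i)) \<le> hausdorff_premeasure k \<delta> (A n) + ennreal (e * (1/2) ^ Suc n)" by blast
    let ?C = "\<lambda>j. case prod_decode j of (n, i) => C n i"
    have "hausdorff_premeasure k \<delta> (\<Union>n. A n) \<le> (\<Sum>j. hausdorff_cost k (?C j))"
    proof (rule hausdorff_premeasure_le)
      show "(\<Union>n. A n) \<subseteq> (\<Union>j. ?C j)"
      proof safe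
        fix x n assume "x \<in> A n"
        then obtain i where "x \<in> C n i" using C(1) by blast
        then show "x \<in> (\<Union>j. ?C j)" by (intro UN_I[of "prod_encode (n, i)"]) auto
      qed
    qed (use C in \<open>auto split: prod.split\<close>)
    also have "... = (\<Sum>j. (\<lambda>(n, i). hausdorff_cost k (C n i)) (prod_decode j))"
      by (intro suminf_cong) (simp split: prod.split)
    also have "... = (\<Sum>n. \<Sum>i. hausdorff_cost k (C n i))" by (rule suminf_ennreal_2dimen) simp
    also have "... \<le> (\<Sum>n. hausdorff_outer k (A n) + ennreal (e * (1/2) ^ Suc n))"
      by (intro suminf_le order_trans[OF C(4)] add_right_mono hausdorff_premeasure_le_outer[OF \<delta>]) auto
    also have "... = (\<Sum>n. hausdorff_outer k (A n)) + (\<Sum>n. ennreal (e * (1/2) ^ Suc n))"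
      by (rule suminf_add[symmetric]) auto
    also have "(\<Sum>n. ennreal (e * (1/2) ^ Suc n)) = ennreal (e * 1)"
      using e by (intro suminf_ennreal_eq sums_mult power_half_series) auto
    finally show "hausdorff_premeasure k \<delta> (\<Union>n. A n) \<le> (\<Sum>n. hausdorff_outer k (A n)) + ennreal e" by simp
  qed
qed

lemma hausdorff_outer_Un: "hausdorff_outer k (A \<union> B) \<le> hausdorff_outer k A + hausdorff_outer k B"
proof -
  let ?C = "\<lambda>n::nat. if n = 0 then A else if n = 1 then B else {}"
  have "A \<union> B = (\<Union>n. ?C n)" by (auto split: if_splits)
  then have "hausdorff_outer k (A \<union> B) \<le> (\<Sum>n. hausdorff_outer k (?C n))" by (simp only: hausdorff_outer_subadditive)
  also have "... = (\<Sum>n\<in>{0,1}. hausdorff_outer k (?C n))" by (rule suminf_finite) auto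
  finally show ?thesis by simp
qed

text \<open>A set of diameter below \<open>d\<close> meets at most one of \<open>A\<close> and
  \<open>B\<close>, so a fine cover of the union splits into covers of the two.\<close>

lemma hausdorff_outer_separated:
  assumes d: "0 < d" and sep: "\<And>x y. x \<in> A ==> y \<in> B ==> d \<le> dist x y"
  shows "hausdorff_outer k A + hausdorff_outer k B \<le> hausdorff_outer k (A \<union> B)"
proof -
  have *: "hausdorff_premeasure k \<delta> A + hausdorff_premeasure k \<delta> B \<le> hausdorff_premeasure k \<delta> (A \<union> B)"
    if \<delta>: "0 < \<delta>" "\<delta> < d" for \<delta>
  proof (rule ennreal_le_epsilon)
    fix e :: real assume fin: "hausdorff_premeasure k \<delta> (A \<union> B) < top" and e: "0 < e"
    obtain C where C: "A \<union> B \<subseteq> (\<Union>i::nat. C i)" "\<And>i. bounded (C i)" "\<And>i. diameter (C i) \<le> \<delta>"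
      "(\<Sum>i. hausdorff_cost k (C i)) < hausdorff_premeasure k \<delta> (A \<union> B) + ennreal e"
      by (rule hausdorff_premeasure_cover[OF less_imp_neq[OF fin, folded infinity_ennreal_def] e]) blast
    let ?C = "\<lambda>X i. if C i \<inter> X = {} then {} else C i"
    have pre: "hausdorff_premeasure k \<delta> X \<le> (\<Sum>i. hausdorff_cost k (?C X i))" if X: "X \<subseteq> A \<union> B" for X
    proof (rule hausdorff_premeasure_le)
      show "X \<subseteq> (\<Union>i. ?C X i)"
      proof
        fix x assume x: "x \<in> X"
        then obtain i where "x \<in> C i" using C(1) X by blast
        then have "x \<in> ?C X i" using x by auto
        then show "x \<in> (\<Union>i. ?C X i)" by blast
      qed
    qed (use C \<delta> in auto)
    have le: "hausdorff_cost k (?C A i) + hausdorff_cost k (?C B i) \<le> hausdorff_cost k (C i)" for i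
    proof (cases "C i \<inter> A = {} \<or> C i \<inter> B = {}")
      case True
      then show ?thesis by (auto simp: hausdorff_cost_def)
    next
      case False
      then obtain x y where xy: "x \<in> C i" "x \<in> A" "y \<in> C i" "y \<in> B" by blast
      then have "d \<le> dist x y" using sep by simp
      also have "... \<le> diameter (C i)" by (rule diameter_bounded_bound[OF C(2) xy(1,3)])
      also have "... \<le> \<delta>" by (rule C(3))
      finally show ?thesis using \<delta> by simp
    qed
    have "hausdorff_premeasure k \<delta> A + hausdorff_premeasure k \<delta> B \<le> (\<Sum>i. hausdorff_cost k (?C A i)) + (\<Sum>i. hausdorff_cost k (?C B i))"
      by (intro add_mono pre) auto
    also have "... = (\<Sum>i. hausdorff_cost k (?C A i) + hausdorff_cost k (?C B i))" by (rule suminf_add) auto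
    also have "... \<le> (\<Sum>i. hausdorff_cost k (C i))" by (intro suminf_le le) auto
    finally show "hausdorff_premeasure k \<delta> A + hausdorff_premeasure k \<delta> B \<le> hausdorff_premeasure k \<delta> (A \<union> B) + ennreal e"
      using C(4) by simp
  qed
  have "hausdorff_outer k A + hausdorff_outer k B = (SUP \<delta>\<in>{0<..}. hausdorff_premeasure k \<delta> A + hausdorff_premeasure k \<delta> B)"
    unfolding hausdorff_outer_def
  proof (rule SUP_add_directed_ennreal[symmetric])
    fix i j :: real assume ij: "i \<in> {0<..}" "j \<in> {0<..}"
    show "\<exists>l\<in>{0<..}. hausdorff_premeasure k i A + hausdorff_premeasure k j B \<le> hausdorff_premeasure k l A + hausdorff_premeasure k l B"
      by (rule bexI[of _ "min i j"]) (use ij in \<open>auto intro!: add_mono hausdorff_premeasure_antimono\<close>)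
  qed
  also have "... \<le> hausdorff_outer k (A \<union> B)"
  proof (rule SUP_least)
    fix \<delta> :: real assume "\<delta> \<in> {0<..}"
    then have \<delta>: "0 < min \<delta> (d/2)" "min \<delta> (d/2) < d" using d by auto
    have "hausdorff_premeasure k \<delta> A + hausdorff_premeasure k \<delta> B \<le> hausdorff_premeasure k (min \<delta> (d/2)) A + hausdorff_premeasure k (min \<delta> (d/2)) B"
      by (intro add_mono hausdorff_premeasure_antimono) auto
    also have "... \<le> hausdorff_premeasure k (min \<delta> (d/2)) (A \<union> B)" by (rule *[OF \<delta>])
    also have "... \<le> hausdorff_outer k (A \<union> B)" by (rule hausdorff_premeasure_le_outer[OF \<delta>(1)])
    finally show "hausdorff_premeasure k \<delta> A + hausdorff_premeasure k \<delta> B \<le> hausdorff_outer k (A \<union> B)" .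
  qed
  finally show ?thesis .
qed

text \<open>Carath\'eodory's criterion for metric outer measures: the part of \<open>X\<close> close to \<open>F\<close> splits into
  shells, every other of which are at a positive distance, so the measures of the shells are summable.\<close>

lemma hausdorff_outer_closed_additive:
  fixes F :: "'a::metric_space set"
  assumes F: "closed F"
  shows "hausdorff_outer k (X \<inter> F) + hausdorff_outer k (X - F) = hausdorff_outer k X"
proof (rule antisym)
  have "X = (X \<inter> F) \<union> (X - F)" by blast
  then show "hausdorff_outer k X \<le> hausdorff_outer k (X \<inter> F) + hausdorff_outer k (X - F)"
    using hausdorff_outer_Un[of k "X \<inter> F" "X - F"] by simp
  show "hausdorff_outer k (X \<inter> F) + hausdorff_outer k (X - F) \<le> hausdorff_outer k X"
  proof (cases "F = {} \<or> hausdorff_outer k X = \<infinity>")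
    case True
    then show ?thesis by auto
  next
    case False
    then have Fne: "F \<noteq> {}" and fin: "hausdorff_outer k X \<noteq> \<infinity>" by auto
    \<comment> \<open>Shell \<open>R n\<close> consists of the points of \<open>X\<close> at
      distance at least \<open>c (Suc n)\<close> and below \<open>c n\<close> from \<open>F\<close>;
      two shells have positive distance once their indices differ by at least 2.\<close>
    define c where "c n = inverse (real (Suc n))" for n
    have cpos: "0 < c n" for n by (simp add: c_def)
    have cdec: "c n < c m" if "m < n" for m n using that by (simp add: c_def)
    define A where "A n = {x \<in> X. c n \<le> infdist x F}" for n
    define R where "R n = {x \<in> X. c (Suc n) \<le> infdist x F \<and> infdist x F < c n}" for n
    have sepR: "c (Suc i) - c j \<le> dist x y" if "x \<in> R i" "y \<in> R j" for i j x y
      using that infdist_triangle[of x F y] by (auto simp: R_def)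
    \<comment> \<open>The offset \<open>p\<close> is used with the values 0 and 1, for the even and
      the odd shells.\<close>
    have finsum: "(\<Sum>j<m. hausdorff_outer k (R (2 * j + p))) \<le> hausdorff_outer k X" for m p
    proof -
      have "(\<Sum>j<m. hausdorff_outer k (R (2 * j + p))) \<le> hausdorff_outer k (\<Union>j<m. R (2 * j + p))"
      proof (induction m)
        case (Suc m)
        have "hausdorff_outer k (\<Union>j<m. R (2 * j + p)) + hausdorff_outer k (R (2 * m + p)) \<le> hausdorff_outer k ((\<Union>j<m. R (2 * j + p)) \<union> R (2 * m + p))"
        \<comment> \<open>For \<open>m = 0\<close> the union is empty and any positive distance
          serves.\<close>
        proof (rule hausdorff_outer_separated[where d = "if m = 0 then 1 else c (2 * m + p - 1) - c (2 * m + p)"])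
          show "0 < (if m = 0 then 1 else c (2 * m + p - 1) - c (2 * m + p))" using cdec[of "2*m+p-1" "2*m+p"] by simp
          fix x y assume "x \<in> (\<Union>j<m. R (2 * j + p))" and y: "y \<in> R (2 * m + p)"
          then obtain j where j: "j < m" "x \<in> R (2 * j + p)" by blast
          have "c (2 * m + p - 1) \<le> c (Suc (2 * j + p))" using j(1) by (simp add: c_def)
          then show "(if m = 0 then 1 else c (2 * m + p - 1) - c (2 * m + p)) \<le> dist x y"
            using sepR[OF j(2) y] j(1) by simp
        qed
        moreover have "(\<Union>j<Suc m. R (2 * j + p)) = (\<Union>j<m. R (2 * j + p)) \<union> R (2 * m + p)" by (auto simp: less_Suc_eq)
        ultimately show ?case using Suc by (simp add: order_trans[OF add_right_mono])
      qed simp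
      also have "... \<le> hausdorff_outer k X" by (rule hausdorff_outer_mono) (auto simp: R_def)
      finally show ?thesis .
    qed
    have "(\<Sum>j. hausdorff_outer k (R j)) \<le> 2 * hausdorff_outer k X"
    proof (rule suminf_le_const[OF summableI])
      fix n :: nat
      have "(\<Sum>j<n. hausdorff_outer k (R j)) \<le> (\<Sum>j<2*n. hausdorff_outer k (R j))" by (rule sum_mono2) auto
      also have "... = (\<Sum>j<n. hausdorff_outer k (R (2 * j + 0))) + (\<Sum>j<n. hausdorff_outer k (R (2 * j + 1)))"
        by (induction n) (auto simp: algebra_simps)
      also have "... \<le> hausdorff_outer k X + hausdorff_outer k X" by (intro add_mono finsum)
      finally show "(\<Sum>j<n. hausdorff_outer k (R j)) \<le> 2 * hausdorff_outer k X" by (simp add: mult_2)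
    qed
    then have fs: "(\<Sum>j. hausdorff_outer k (R j)) \<noteq> \<infinity>"
      using fin by (auto simp: top_unique ennreal_mult_eq_top_iff)
    have Xn: "hausdorff_outer k (X \<inter> F) + hausdorff_outer k (X - F) \<le> hausdorff_outer k X + (\<Sum>j. hausdorff_outer k (R (j + n)))" for n
    proof -
      have sub: "X - F \<subseteq> A n \<union> (\<Union>j. R (j + n))"
      proof
        fix x assume x: "x \<in> X - F"
        then have pos: "0 < infdist x F"
          using F Fne in_closed_iff_infdist_zero[of F x] infdist_nonneg[of x F] by auto
        show "x \<in> A n \<union> (\<Union>j. R (j + n))"
        proof (cases "c n \<le> infdist x F")
          case True then show ?thesis using x by (simp add: A_def)
        next
          case False
          obtain m where m: "c m < infdist x F" using reals_Archimedean[OF pos] by (auto simp: c_def)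
          \<comment> \<open>The first index whose threshold is reached; the point lies in the shell
            just before it.\<close>
          define l where "l = (LEAST m. c m \<le> infdist x F)"
          have l: "c l \<le> infdist x F" unfolding l_def by (rule LeastI[of _ m]) (use m in simp)
          have nl: "n < l"
          proof (rule ccontr)
            assume "\<not> n < l"
            then have "c n \<le> c l" by (simp add: c_def)
            then show False using l False by simp
          qed
          then have "infdist x F < c (l - 1)" using not_less_Least[of "l - 1" "\<lambda>m. c m \<le> infdist x F"] by (simp add: l_def[symmetric] not_le)
          then have "x \<in> R ((l - 1 - n) + n)" using l nl x by (simp add: R_def)
          then show ?thesis by blast
        qed
      qed
      have "hausdorff_outer k (X - F) \<le> hausdorff_outer k (A n) + (\<Sum>j. hausdorff_outer k (R (j + n)))"
        using hausdorff_outer_mono[OF sub, of k] hausdorff_outer_Un[of k "A n" "\<Union>j. R (j + n)"]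
          hausdorff_outer_subadditive[of k "\<lambda>j. R (j + n)"] by (meson add_left_mono order_trans)
      then have "hausdorff_outer k (X \<inter> F) + hausdorff_outer k (X - F) \<le> (hausdorff_outer k (X \<inter> F) + hausdorff_outer k (A n)) + (\<Sum>j. hausdorff_outer k (R (j + n)))"
        by (simp add: add.assoc add_left_mono)
      also have "hausdorff_outer k (X \<inter> F) + hausdorff_outer k (A n) \<le> hausdorff_outer k ((X \<inter> F) \<union> A n)"
      proof (rule hausdorff_outer_separated[OF cpos[of n]])
        fix x y assume "x \<in> X \<inter> F" "y \<in> A n"
        then show "c n \<le> dist x y" using infdist_le[of x F y] by (auto simp: A_def dist_commute)
      qed
      also have "... \<le> hausdorff_outer k X" by (rule hausdorff_outer_mono) (auto simp: A_def)
      finally show ?thesis by (simp add: add_right_mono)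
    qed
    show ?thesis
    proof (rule ennreal_le_epsilon)
      fix e :: real assume e: "0 < e"
      have "(\<lambda>n. \<Sum>j. hausdorff_outer k (R (j + n))) \<longlonglongrightarrow> 0"
      proof -
        obtain r where r: "\<And>j. hausdorff_outer k (R j) = ennreal (r j)" "\<And>j. 0 \<le> r j"
        proof -
          have "hausdorff_outer k (R j) \<noteq> \<infinity>" for j
          proof -
            have "hausdorff_outer k (R j) = (\<Sum>j\<in>{j}. hausdorff_outer k (R j))" by simp
            also have "... \<le> (\<Sum>j. hausdorff_outer k (R j))" by (rule sum_le_suminf) auto
            finally show ?thesis using fs by (auto simp: top_unique)
          qed
          then show ?thesis by (intro that[of "\<lambda>j. enn2real (hausdorff_outer k (R j))"]) (auto simp: less_top)
        qed
        have sr: "summable r" using fs r by (intro summable_suminf_not_top) auto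
        have "(\<lambda>n. ennreal (\<Sum>j. r (j + n))) \<longlonglongrightarrow> ennreal 0"
          by (intro tendsto_ennrealI suminf_exist_split2 sr)
        moreover have "(\<Sum>j. hausdorff_outer k (R (j + n))) = ennreal (\<Sum>j. r (j + n))" for n
          unfolding r(1) using sr r(2) by (intro suminf_ennreal_eq summable_sums) (auto simp: summable_iff_shift)
        ultimately show ?thesis by simp
      qed
      then have "eventually (\<lambda>n. (\<Sum>j. hausdorff_outer k (R (j + n))) < ennreal e) sequentially"
        by (rule order_tendstoD) (use e in simp)
      then obtain n where n: "(\<Sum>j. hausdorff_outer k (R (j + n))) < ennreal e" unfolding eventually_sequentially by blast
      show "hausdorff_outer k (X \<inter> F) + hausdorff_outer k (X - F) \<le> hausdorff_outer k X + ennreal e"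
        using Xn[of n] n by (meson add_left_mono less_imp_le order_trans)
    qed
  qed
qed

text \<open>\<open>measure_of\<close> returns the prescribed set function when that is a measure, so
  countable additivity has to come first: closed sets satisfy Caratheodory's criterion and generate
  the Borel sets.\<close>

lemma emeasure_hausdorff_measure:
  assumes A: "A \<in> sets borel"
  shows "emeasure (hausdorff_measure k :: 'a::metric_space measure) A = hausdorff_outer k A"
proof -
  interpret P: sigma_algebra UNIV "Pow (UNIV :: 'a set)" by (rule sigma_algebra_Pow)
  have os: "outer_measure_space (Pow (UNIV :: 'a set)) (hausdorff_outer k)"
    by (auto simp: outer_measure_space_def positive_def increasing_def countably_subadditive_def
        intro: hausdorff_outer_mono hausdorff_outer_subadditive)
  have ms: "measure_space UNIV (lambda_system UNIV (Pow UNIV) (hausdorff_outer k)) (hausdorff_outer k :: 'a set => ennreal)"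
    by (rule P.caratheodory_lemma[OF os])
  then have sa: "sigma_algebra UNIV (lambda_system UNIV (Pow UNIV) (hausdorff_outer k :: 'a set => ennreal))"
    by (simp add: measure_space_def)
  have "Collect closed \<subseteq> lambda_system UNIV (Pow UNIV) (hausdorff_outer k :: 'a set => ennreal)"
    unfolding P.lambda_system_eq by (auto simp: hausdorff_outer_closed_additive)
  then have "sigma_sets UNIV (Collect closed) \<subseteq> lambda_system UNIV (Pow UNIV) (hausdorff_outer k :: 'a set => ennreal)"
    by (rule sigma_algebra.sigma_sets_subset[OF sa])
  then have sub: "sets (borel :: 'a measure) \<subseteq> lambda_system UNIV (Pow UNIV) (hausdorff_outer k)"
    by (simp add: borel_eq_closed)
  have "measure_space UNIV (sets (borel :: 'a measure)) (hausdorff_outer k)"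
    by (rule measure_down[OF ms _ sub]) (metis sets.sigma_algebra_axioms space_borel)
  then have "positive (sets (borel :: 'a measure)) (hausdorff_outer k)" "countably_additive (sets (borel :: 'a measure)) (hausdorff_outer k)"
    by (auto simp: measure_space_def)
  moreover have "(hausdorff_measure k :: 'a measure) = measure_of UNIV (sets borel) (hausdorff_outer k)"
    by (simp add: hausdorff_measure_def hausdorff_outer_def[abs_def])
  moreover have "sigma_algebra UNIV (sets (borel :: 'a measure))" by (metis sets.sigma_algebra_axioms space_borel)
  ultimately show ?thesis using A by (simp add: emeasure_measure_of_sigma)
qed

lemma sets_hausdorff_measure [simp]: "sets (hausdorff_measure k) = sets (borel :: 'a::metric_space measure)"
  by (simp add: hausdorff_measure_def) (metis sets.sigma_sets_eq space_borel)

lemma space_hausdorff_measure [simp]: "space (hausdorff_measure k :: 'a::metric_space measure) = UNIV"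
  by (simp add: hausdorff_measure_def)

section \<open>Finiteness of the surface measure and tubes over null sets\<close>

lemma hausdorff_premeasure_finite_cover:
  assumes I: "finite I" and A: "A \<subseteq> (\<Union>i\<in>I. B i)" and B: "\<And>i. i \<in> I ==> bounded (B i)" "\<And>i. i \<in> I ==> diameter (B i) \<le> \<delta>"
    and \<delta>: "0 \<le> \<delta>"
  shows "hausdorff_premeasure k \<delta> A \<le> (\<Sum>i\<in>I. hausdorff_cost k (B i))"
proof -
  obtain h where h: "bij_betw h {0..<card I} I" using ex_bij_betw_nat_finite[OF I] by blast
  let ?C = "\<lambda>n. if n < card I then B (h n) else {}"
  have hI: "h n \<in> I" if "n < card I" for n using h that by (auto simp: bij_betw_def)
  have "hausdorff_premeasure k \<delta> A \<le> (\<Sum>n. hausdorff_cost k (?C n))"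
  proof (rule hausdorff_premeasure_le)
    show "A \<subseteq> (\<Union>n. ?C n)"
    proof
      fix x assume "x \<in> A"
      then obtain i where i: "i \<in> I" "x \<in> B i" using A by blast
      then obtain n where n: "n < card I" "h n = i" using h unfolding bij_betw_def by (metis atLeastLessThan_iff imageE)
      then have "x \<in> ?C n" using i by simp
      then show "x \<in> (\<Union>n. ?C n)" by blast
    qed
  qed (use B hI \<delta> in auto)
  also have "... = (\<Sum>n\<in>{0..<card I}. hausdorff_cost k (?C n))"
    by (rule suminf_finite) (auto simp: hausdorff_cost_def)
  also have "... = (\<Sum>n\<in>{0..<card I}. hausdorff_cost k (B (h n)))" by (intro sum.cong) auto
  also have "... = (\<Sum>i\<in>I. hausdorff_cost k (B i))" by (rule sum.reindex_bij_betw[OF h])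
  finally show ?thesis .
qed

lemma hausdorff_cost_le:
  assumes "X \<noteq> {} ==> diameter X \<le> d" "bounded X" "0 \<le> d"
  shows "hausdorff_cost k X \<le> ennreal (unit_ball_vol (real k) * (d / 2) ^ k)"
proof (cases "X = {}")
  case False
  then show ?thesis
    using assms diameter_ge_0[OF assms(2)]
    by (auto simp: hausdorff_cost_def intro!: ennreal_leI mult_left_mono power_mono)
qed (simp add: hausdorff_cost_def)

text \<open>From a frontier point move along an outer normal until the boundary of the box is met:
  every point of that ray has the given frontier point as its closest point in the closure of
  \<open>D\<close>.\<close>

lemma frontier_convex_subset_closest_point:
  fixes D :: "'a::euclidean_space set"
  assumes D: "open D" "convex D" "D \<subseteq> box a b"
  shows "frontier D \<subseteq> closest_point (closure D) ` (cbox a b - box a b)"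
proof
  fix x assume x: "x \<in> frontier D"
  then have xc: "x \<in> closure D" and "x \<notin> rel_interior D"
    using D(1) by (auto simp: frontier_def interior_open rel_interior_open)
  then obtain w where w: "w \<noteq> 0" "\<And>y. y \<in> closure D ==> w \<bullet> x \<le> w \<bullet> y"
    using supporting_hyperplane_relative_frontier[OF D(2), of x] by metis
  have cp: "closest_point (closure D) (x - t *\<^sub>R w) = x" if t: "0 \<le> t" for t
  proof (rule closest_point_unique[symmetric])
    show "\<forall>y\<in>closure D. dist (x - t *\<^sub>R w) x \<le> dist (x - t *\<^sub>R w) y"
    proof
      fix y assume y: "y \<in> closure D"
      have "(norm (t *\<^sub>R w))\<^sup>2 \<le> (norm (t *\<^sub>R w))\<^sup>2 + 2 * t * (w \<bullet> y - w \<bullet> x) + (norm (x - y))\<^sup>2"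
        using w(2)[OF y] t by simp
      also have "... = (norm (x - t *\<^sub>R w - y))\<^sup>2"
        unfolding power2_norm_eq_inner by (simp add: inner_diff_left inner_diff_right inner_commute algebra_simps)
      finally have "norm (t *\<^sub>R w) \<le> norm (x - t *\<^sub>R w - y)" by (rule power2_le_imp_le) simp
      then show "dist (x - t *\<^sub>R w) x \<le> dist (x - t *\<^sub>R w) y" by (simp add: dist_norm)
    qed
  qed (use xc D convex_closure in auto)
  have xb: "x \<in> cbox a b"
    using closure_minimal[OF order_trans[OF D(3) box_subset_cbox] closed_cbox] xc by blast
  show "x \<in> closest_point (closure D) ` (cbox a b - box a b)"
  proof (cases "x \<in> box a b")
    case False
    then show ?thesis using xb cp[of 0] by (metis DiffI image_eqI diff_zero order_refl scaleR_zero_left)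
  next
    case True
    have xi: "x \<in> interior (box a b)" using True by (simp add: interior_open open_box)
    obtain t where t: "0 < t" "x + t *\<^sub>R (- w) \<in> frontier (box a b)"
      by (rule ray_to_frontier[OF bounded_box xi, of "- w"]) (use w(1) in auto)
    have "frontier (box a b) \<subseteq> cbox a b - box a b"
      unfolding frontier_def interior_open[OF open_box]
      using closure_minimal[OF box_subset_cbox closed_cbox, of a b] by blast
    then have "x - t *\<^sub>R w \<in> cbox a b - box a b" using t(2) by auto
    then show ?thesis using cp[of t] t(1) by (metis image_eqI less_imp_le)
  qed
qed

text \<open>The closest-point map is 1-Lipschitz, so a grid on the faces of an enclosing box is
  mapped to a cover of the frontier. With N the dimension there are 2 N m^(N-1) cells of diameter
  O(1/m), and the power N - 1 of the diameter cancels the growth of their number.\<close>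

lemma hausdorff_outer_frontier_finite:
  fixes D :: "'a::euclidean_space set"
  assumes D: "open D" "bounded D" "convex D"
  shows "hausdorff_outer (DIM('a) - 1) (frontier D) < \<infinity>"
proof (cases "D = {}")
  case True then show ?thesis by simp
next
  case False
  let ?k = "DIM('a) - 1" and ?N = "DIM('a)"
  obtain R0 where R0: "\<And>x. x \<in> D ==> norm x \<le> R0" using D(2) by (auto simp: bounded_iff)
  define R where "R = \<bar>R0\<bar> + 1"
  have R: "0 < R" by (simp add: R_def)
  let ?a = "- (R *\<^sub>R One) :: 'a" and ?b = "R *\<^sub>R One :: 'a"
  have Dbox: "D \<subseteq> box ?a ?b"
  proof
    fix x assume x: "x \<in> D"
    have "- R < x \<bullet> i \<and> x \<bullet> i < R" if "i \<in> Basis" for i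
      using Basis_le_norm[OF that, of x] R0[OF x] unfolding R_def by linarith
    then show "x \<in> box ?a ?b" by (simp add: mem_box)
  qed
  define q where "q = closest_point (closure D)"
  have q: "dist (q x) (q y) \<le> dist x y" for x y
    unfolding q_def using D False by (intro closest_point_lipschitz convex_closure) auto
  \<comment> \<open>A cell is given by the direction \<open>i\<close> normal to its face, the side
    \<epsilon> = -1 or 1, and a grid index for each of the other coordinates.\<close>
  define cell where "cell m = (\<lambda>(i :: 'a, \<epsilon> :: real, c :: 'a => nat). {y. y \<bullet> i = \<epsilon> * R \<and> (\<forall>j\<in>Basis - {i}. - R + 2 * R * real (c j) / real m \<le> y \<bullet> j \<and> y \<bullet> j \<le> - R + 2 * R * (real (c j) + 1) / real m)})"
    for m :: nat
  define I where "I m = (SIGMA i:(Basis :: 'a set). {-1, 1 :: real} \<times> ((Basis - {i}) \<rightarrow>\<^sub>E {..<m}))" for m :: nat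
  have finI: "finite (I m)" for m unfolding I_def by (intro finite_SigmaI finite_cartesian_product finite_PiE) auto
  have cardI: "card (I m) = ?N * (2 * m ^ ?k)" for m
  proof -
    have "card (I m) = (\<Sum>i\<in>(Basis::'a set). card ({-1, 1 :: real} \<times> ((Basis - {i}) \<rightarrow>\<^sub>E {..<m})))"
      unfolding I_def by (intro card_SigmaI) (auto intro!: finite_cartesian_product finite_PiE)
    also have "... = (\<Sum>i\<in>(Basis::'a set). 2 * m ^ ?k)"
      by (intro sum.cong refl) (simp add: card_cartesian_product card_PiE card_Diff_singleton)
    finally show ?thesis by simp
  qed
  have dcell: "dist x y \<le> real ?N * (2 * R / real m)" if "x \<in> cell m p" "y \<in> cell m p" "p \<in> I m" "0 < m" for x y m p
  proof -
    obtain i \<epsilon> c where p: "p = (i, \<epsilon>, c)" by (cases p)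
    have "\<bar>(x - y) \<bullet> j\<bar> \<le> 2 * R / real m" if j: "j \<in> Basis" for j
    proof (cases "j = i")
      case True
      then show ?thesis using \<open>x \<in> cell m p\<close> \<open>y \<in> cell m p\<close> R by (simp add: cell_def p inner_diff_left)
    next
      case False
      then have "- R + 2 * R * real (c j) / real m \<le> x \<bullet> j" "x \<bullet> j \<le> - R + 2 * R * (real (c j) + 1) / real m"
        "- R + 2 * R * real (c j) / real m \<le> y \<bullet> j" "y \<bullet> j \<le> - R + 2 * R * (real (c j) + 1) / real m"
        using \<open>x \<in> cell m p\<close> \<open>y \<in> cell m p\<close> j by (auto simp: cell_def p)
      moreover have "2 * R * (real (c j) + 1) / real m = 2 * R * real (c j) / real m + 2 * R / real m"
        by (simp add: distrib_left add_divide_distrib)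
      ultimately show ?thesis by (simp add: inner_diff_left)
    qed
    then have "(\<Sum>j\<in>Basis. \<bar>(x - y) \<bullet> j\<bar>) \<le> (\<Sum>j\<in>(Basis::'a set). 2 * R / real m)" by (rule sum_mono)
    then show ?thesis using norm_le_l1[of "x - y"] by (simp add: dist_norm)
  qed
  have cover: "cbox ?a ?b - box ?a ?b \<subseteq> (\<Union>p\<in>I m. cell m p)" if m: "0 < m" for m
  proof
    fix y assume "y \<in> cbox ?a ?b - box ?a ?b"
    then have y: "\<And>j. j \<in> Basis ==> - R \<le> y \<bullet> j \<and> y \<bullet> j \<le> R" and "y \<notin> box ?a ?b" by (auto simp: mem_box)
    then obtain i where i: "i \<in> Basis" "\<not> (- R < y \<bullet> i \<and> y \<bullet> i < R)" by (auto simp: mem_box)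
    then obtain \<epsilon> where \<epsilon>: "\<epsilon> \<in> {-1, 1 :: real}" "y \<bullet> i = \<epsilon> * R"
      using y[OF i(1)] by (cases "y \<bullet> i = R") (auto intro: that[of "-1"] that[of 1])
    \<comment> \<open>The minimum with \<open>int m - 1\<close> puts coordinates equal to
      \<open>R\<close> into the last cell.\<close>
    define c where "c = (\<lambda>j\<in>Basis - {i}. nat (min (\<lfloor>(y \<bullet> j + R) * real m / (2 * R)\<rfloor>) (int m - 1)))"
    have c: "c \<in> (Basis - {i}) \<rightarrow>\<^sub>E {..<m}" using m by (auto simp: c_def)
    have "- R + 2 * R * real (c j) / real m \<le> y \<bullet> j \<and> y \<bullet> j \<le> - R + 2 * R * (real (c j) + 1) / real m"
      if j: "j \<in> Basis - {i}" for j
    proof -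
      define t where "t = (y \<bullet> j + R) * real m / (2 * R)"
      have yj: "y \<bullet> j = - R + 2 * R * t / real m" using R m by (simp add: t_def)
      have t: "0 \<le> t" "t \<le> real m" using y[of j] j R m by (auto simp: t_def divide_le_eq mult_left_mono)
      have f0: "0 \<le> \<lfloor>t\<rfloor>" using t by simp
      have "c j = nat (min \<lfloor>t\<rfloor> (int m - 1))" using j by (simp add: c_def t_def)
      then have cj: "real (c j) = of_int (min \<lfloor>t\<rfloor> (int m - 1))" using f0 m by simp
      have "real (c j) \<le> t" "t \<le> real (c j) + 1"
        unfolding cj using t by (cases "\<lfloor>t\<rfloor> \<le> int m - 1"; simp add: min_def; linarith)+
      then show ?thesis unfolding yj using R m
        by (auto intro!: divide_right_mono mult_left_mono)
    qed
    then have "y \<in> cell m (i, \<epsilon>, c)" using \<epsilon>(2) by (auto simp: cell_def)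
    moreover have "(i, \<epsilon>, c) \<in> I m" using i \<epsilon> c by (auto simp: I_def)
    ultimately show "y \<in> (\<Union>p\<in>I m. cell m p)" by blast
  qed
  \<comment> \<open>The 2 N faces, the volume of the unit ball, and the power of half the diameter
    bound \<open>N * (2 * R / m)\<close>; the powers of \<open>m\<close> have cancelled.\<close>
  define K where "K = real ?N * 2 * (unit_ball_vol (real ?k) * (real ?N * R) ^ ?k)"
  have pre: "hausdorff_premeasure ?k \<delta> (frontier D) \<le> ennreal K" if \<delta>: "0 < \<delta>" for \<delta>
  proof -
    obtain m0 where m0: "real ?N * (2 * R) < real m0 * \<delta>" using reals_Archimedean3[OF \<delta>] by blast
    define m where "m = Suc m0"
    have m: "0 < m" by (simp add: m_def)
    have md: "real ?N * (2 * R / real m) \<le> \<delta>" using m0 \<delta> by (simp add: m_def field_simps)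
    have dist_cell: "dist x y \<le> real ?N * (2 * R / real m)" if xyp: "x \<in> q ` cell m p" "y \<in> q ` cell m p" "p \<in> I m" for x y p
    proof -
      obtain x' y' where "x = q x'" "y = q y'" "x' \<in> cell m p" "y' \<in> cell m p" using xyp by blast
      then show ?thesis using order_trans[OF q dcell[OF _ _ xyp(3) m]] by simp
    qed
    have bc: "bounded (q ` cell m p)" if "p \<in> I m" for p
      unfolding bounded_two_points using dist_cell[OF _ _ that] by blast
    have dc: "diameter (q ` cell m p) \<le> real ?N * (2 * R / real m)" if "p \<in> I m" for p
    proof (rule diameter_le)
      show "q ` cell m p \<noteq> {} \<or> 0 \<le> real ?N * (2 * R / real m)" using R by simp
      show "norm (x - y) \<le> real ?N * (2 * R / real m)" if "x \<in> q ` cell m p" "y \<in> q ` cell m p" for x y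
        using dist_cell[OF that \<open>p \<in> I m\<close>] by (simp add: dist_norm)
    qed
    have "hausdorff_premeasure ?k \<delta> (frontier D) \<le> (\<Sum>p\<in>I m. hausdorff_cost ?k (q ` cell m p))"
    proof (rule hausdorff_premeasure_finite_cover[OF finI])
      show "frontier D \<subseteq> (\<Union>p\<in>I m. q ` cell m p)"
      proof
        fix x assume "x \<in> frontier D"
        then obtain y where y: "x = q y" "y \<in> cbox ?a ?b - box ?a ?b"
          using subsetD[OF frontier_convex_subset_closest_point[OF D(1,3) Dbox]] unfolding q_def by (metis imageE)
        obtain p where "p \<in> I m" "y \<in> cell m p" using subsetD[OF cover[OF m] y(2)] by (elim UN_E)
        then show "x \<in> (\<Union>p\<in>I m. q ` cell m p)" unfolding y(1) by (intro UN_I imageI)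
      qed
      show "diameter (q ` cell m p) \<le> \<delta>" if "p \<in> I m" for p by (rule order_trans[OF dc[OF that] md])
    qed (use bc \<delta> in simp_all)
    also have "... \<le> (\<Sum>p\<in>I m. ennreal (unit_ball_vol (real ?k) * (real ?N * (2 * R / real m) / 2) ^ ?k))"
    proof (rule sum_mono)
      fix p assume p: "p \<in> I m"
      show "hausdorff_cost ?k (q ` cell m p) \<le> ennreal (unit_ball_vol (real ?k) * (real ?N * (2 * R / real m) / 2) ^ ?k)"
        by (rule hausdorff_cost_le[OF dc[OF p] bc[OF p]]) (use R in simp)
    qed
    also have "... = ennreal (real (card (I m)) * (unit_ball_vol (real ?k) * (real ?N * (2 * R / real m) / 2) ^ ?k))"
      using R by (subst sum_ennreal) auto
    also have "real (card (I m)) * (unit_ball_vol (real ?k) * (real ?N * (2 * R / real m) / 2) ^ ?k) = K"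
      using m by (simp add: cardI K_def power_mult_distrib power_divide)
    finally show ?thesis .
  qed
  have "hausdorff_outer ?k (frontier D) \<le> ennreal K"
    unfolding hausdorff_outer_def by (rule SUP_least) (use pre in auto)
  then show ?thesis by (simp add: order.strict_trans1)
qed

text \<open>For a radius \<open>r\<close> slightly above the diameter, about
  \<open>T * norm v / r\<close> balls of radius \<open>2 * r\<close> suffice along the tube. Their
  number costs one power of \<open>r\<close>, so the total volume is of order r^(N-1), with N the
  dimension.\<close>

lemma tube_cover:
  fixes X :: "'a::euclidean_space set"
  assumes X: "bounded X" "X \<noteq> {}" "diameter X \<le> 1" and T: "0 \<le> T" and v: "v \<noteq> 0" and e: "0 < e"
  shows "\<exists>W\<in>sets borel. {x + s *\<^sub>R v |x s. x \<in> X \<and> 0 \<le> s \<and> s \<le> T} \<subseteq> W \<and>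
    emeasure lborel W \<le> ennreal (unit_ball_vol (real DIM('a)) * 2 ^ DIM('a) * (T * norm v + 2) * diameter X ^ (DIM('a) - 1)) + ennreal e"
proof -
  let ?N = "DIM('a)" and ?k = "DIM('a) - 1" and ?d = "diameter X"
  define K where "K = unit_ball_vol (real ?N) * 2 ^ ?N * (T * norm v + 2)"
  have K: "0 \<le> K" using T by (simp add: K_def)
  have N: "?N = Suc ?k" using DIM_positive[where 'a='a] by simp
  have d0: "0 \<le> ?d" by (rule diameter_ge_0[OF X(1)])
  have "((\<lambda>r. K * r ^ ?k) \<longlongrightarrow> K * ?d ^ ?k) (at_right ?d)" by (intro tendsto_intros)
  then have "eventually (\<lambda>r. K * r ^ ?k < K * ?d ^ ?k + e) (at_right ?d)" by (rule order_tendstoD) (use e in simp)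
  then obtain b where b: "?d < b" "\<And>r. ?d < r ==> r < b ==> K * r ^ ?k < K * ?d ^ ?k + e"
    unfolding eventually_at_right_field by blast
  \<comment> \<open>Strictly above the diameter, which may be 0, and at most 2, which accounts for
    the summand 2 in \<open>T * norm v + 2\<close>.\<close>
  define r where "r = min ((?d + b) / 2) 2"
  have r1: "r \<le> (?d + b) / 2" and r2: "r \<le> 2" unfolding r_def by (rule min.cobounded1, rule min.cobounded2)
  have r3: "?d < r" using b(1) X(3) unfolding r_def min_less_iff_conj by simp
  have rb: "r < b" by (rule le_less_trans[OF r1]) (use b(1) in simp)
  have r0: "0 < r" by (rule le_less_trans[OF d0 r3])
  note r = r3 rb r2 r0
  have Kr: "K * r ^ ?k \<le> K * ?d ^ ?k + e" using b(2)[OF r(1,2)] by simp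
  obtain x0 where x0: "x0 \<in> X" using X(2) by blast
  define L where "L = nat \<lfloor>T * norm v / r\<rfloor>"
  have Lle: "real L \<le> T * norm v / r" using T r by (simp add: L_def)
  let ?c = "\<lambda>j::nat. x0 + (real j * r / norm v) *\<^sub>R v"
  define W where "W = (\<Union>j\<in>{..L}. cball (?c j) (2 * r))"
  have sub: "{x + s *\<^sub>R v |x s. x \<in> X \<and> 0 \<le> s \<and> s \<le> T} \<subseteq> W"
  proof safe
    fix x s assume x: "x \<in> X" and s: "0 \<le> s" "s \<le> T"
    define j where "j = nat \<lfloor>s * norm v / r\<rfloor>"
    have sn: "0 \<le> s * norm v / r" using s r by simp
    have jr: "real j \<le> s * norm v / r" "s * norm v / r < real j + 1" using sn by (auto simp: j_def)
    have "s * norm v / r \<le> T * norm v / r" using s r by (intro divide_right_mono mult_right_mono) auto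
    then have jL: "j \<le> L" unfolding j_def L_def by (intro nat_mono floor_mono)
    have j2: "0 \<le> s * norm v - real j * r" "s * norm v - real j * r \<le> r"
      using jr r by (auto simp: field_simps)
    have "norm ((s - real j * r / norm v) *\<^sub>R v) = \<bar>(s - real j * r / norm v) * norm v\<bar>" by (simp add: abs_mult)
    also have "(s - real j * r / norm v) * norm v = s * norm v - real j * r" using v by (simp add: left_diff_distrib)
    finally have n1: "norm ((s - real j * r / norm v) *\<^sub>R v) \<le> r" using j2 by simp
    have n2: "norm (x - x0) \<le> r" using diameter_bounded_bound[OF X(1) x x0] r by (simp add: dist_norm)
    have "(x + s *\<^sub>R v) - ?c j = (x - x0) + (s - real j * r / norm v) *\<^sub>R v" by (simp add: algebra_simps)
    then have "norm ((x + s *\<^sub>R v) - ?c j) \<le> norm (x - x0) + norm ((s - real j * r / norm v) *\<^sub>R v)"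
      by (simp only: norm_triangle_ineq)
    also have "... \<le> r + r" by (rule add_mono[OF n2 n1])
    also have "... = 2 * r" by simp
    finally have "norm ((x + s *\<^sub>R v) - ?c j) \<le> 2 * r" .
    then have "x + s *\<^sub>R v \<in> cball (?c j) (2 * r)" by (simp add: dist_norm norm_minus_commute)
    then show "x + s *\<^sub>R v \<in> W" using jL by (auto simp: W_def)
  qed
  have Wb: "W \<in> sets borel" unfolding W_def by (intro sets.finite_UN borel_closed closed_cball) auto
  have "emeasure lborel W \<le> (\<Sum>j\<in>{..L}. emeasure lborel (cball (?c j) (2 * r)))"
    unfolding W_def by (rule emeasure_subadditive_finite) auto
  also have "... = (\<Sum>j\<in>{..L}. ennreal (unit_ball_vol (real ?N) * (2 * r) ^ ?N))"
    using r by (intro sum.cong refl emeasure_cball) simp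
  also have "... = ennreal (\<Sum>j\<in>{..L}. unit_ball_vol (real ?N) * (2 * r) ^ ?N)"
    using r by (intro sum_ennreal) simp
  also have "(\<Sum>j\<in>{..L}. unit_ball_vol (real ?N) * (2 * r) ^ ?N) = real (Suc L) * (unit_ball_vol (real ?N) * (2 * r) ^ ?N)"
    by simp
  also have "... \<le> ennreal (K * r ^ ?k)"
  proof (rule ennreal_leI)
    have "real (Suc L) * r \<le> T * norm v + 2" using Lle r by (simp add: field_simps)
    then have "(real (Suc L) * r) * (unit_ball_vol (real ?N) * 2 ^ ?N * r ^ ?k) \<le> (T * norm v + 2) * (unit_ball_vol (real ?N) * 2 ^ ?N * r ^ ?k)"
      using r by (intro mult_right_mono) auto
    moreover have "r ^ ?N = r * r ^ ?k" using N by (metis power_Suc)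
    then have "(2 * r) ^ ?N = 2 ^ ?N * (r * r ^ ?k)" unfolding power_mult_distrib by simp
    ultimately show "real (Suc L) * (unit_ball_vol (real ?N) * (2 * r) ^ ?N) \<le> K * r ^ ?k"
      unfolding K_def by (simp only: mult_ac)
  qed
  also have "... \<le> ennreal (K * ?d ^ ?k) + ennreal e"
    using Kr K d0 e by (simp add: ennreal_plus[symmetric] del: ennreal_plus)
  finally show ?thesis using sub Wb unfolding K_def by blast
qed

text \<open>Covers of \<open>A\<close> with small total cost sweep out tubes of small total volume,
  as the volume of a tube is controlled by the power of the diameter that enters the cost.\<close>

lemma hausdorff_null_tube_null:
  fixes A :: "'a::euclidean_space set"
  assumes A: "hausdorff_outer (DIM('a) - 1) A = 0" and T: "0 \<le> T" and v: "v \<noteq> 0"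
  shows "\<exists>Z\<in>null_sets lborel. {x + s *\<^sub>R v |x s. x \<in> A \<and> 0 \<le> s \<and> s \<le> T} \<subseteq> Z"
proof -
  let ?N = "DIM('a)" and ?k = "DIM('a) - 1" and ?t = "\<lambda>X. {x + s *\<^sub>R v |x s. x \<in> X \<and> 0 \<le> s \<and> s \<le> T}"
  define K where "K = unit_ball_vol (real ?N) * 2 ^ ?N * (T * norm v + 2)"
  have K: "0 \<le> K" using T by (simp add: K_def)
  define u where "u = unit_ball_vol (real ?k)"
  have u: "0 < u" by (simp add: u_def del: of_nat_diff)
  \<comment> \<open>Converts the power of the diameter in the tube bound into
    \<open>hausdorff_cost\<close>.\<close>
  define K' where "K' = K * 2 ^ ?k / u"
  have K': "0 \<le> K'" using K u by (simp add: K'_def)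
  have step: "\<exists>W\<in>sets borel. ?t A \<subseteq> W \<and> emeasure lborel W \<le> ennreal ((K' + 1) * e)" if e: "0 < e" for e
  proof -
    have p0: "hausdorff_premeasure ?k 1 A = 0" using hausdorff_premeasure_le_outer[of 1 ?k A] A by simp
    obtain C where C: "A \<subseteq> (\<Union>i::nat. C i)" "\<And>i. bounded (C i)" "\<And>i. diameter (C i) \<le> 1"
      "(\<Sum>i. hausdorff_cost ?k (C i)) < hausdorff_premeasure ?k 1 A + ennreal e"
      by (rule hausdorff_premeasure_cover[of ?k 1 A e]) (use p0 e in auto)
    have "\<exists>W. W \<in> sets borel \<and> ?t (C i) \<subseteq> W \<and> emeasure lborel W \<le> ennreal K' * hausdorff_cost ?k (C i) + ennreal (e * (1/2) ^ Suc i)" for i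
    proof (cases "C i = {}")
      case True
      then show ?thesis by (intro exI[of _ "{}"]) auto
    next
      case False
      have "ennreal (K * diameter (C i) ^ ?k) = ennreal K' * hausdorff_cost ?k (C i)"
        unfolding hausdorff_cost_def u_def[symmetric]
        using False u K' diameter_ge_0[OF C(2), of i] by (simp add: K'_def ennreal_mult'[symmetric] power_divide)
      then show ?thesis
        using tube_cover[OF C(2) False C(3) T v, of "e * (1/2) ^ Suc i"] e unfolding K_def[symmetric] by auto
    qed
    then have "\<exists>W. \<forall>i. W i \<in> sets borel \<and> ?t (C i) \<subseteq> W i \<and> emeasure lborel (W i) \<le> ennreal K' * hausdorff_cost ?k (C i) + ennreal (e * (1/2) ^ Suc i)"
      by (intro choice allI)
    then obtain W where W: "\<And>i. W i \<in> sets borel" "\<And>i. ?t (C i) \<subseteq> W i"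
      "\<And>i. emeasure lborel (W i) \<le> ennreal K' * hausdorff_cost ?k (C i) + ennreal (e * (1/2) ^ Suc i)" by blast
    have "emeasure lborel (\<Union>i. W i) \<le> (\<Sum>i. emeasure lborel (W i))"
      by (rule emeasure_subadditive_countably) (use W in auto)
    also have "... \<le> (\<Sum>i. ennreal K' * hausdorff_cost ?k (C i) + ennreal (e * (1/2) ^ Suc i))"
      by (intro suminf_le W) auto
    also have "... = ennreal K' * (\<Sum>i. hausdorff_cost ?k (C i)) + (\<Sum>i. ennreal (e * (1/2) ^ Suc i))"
      by (subst suminf_add[symmetric]) (auto simp: ennreal_suminf_cmult)
    also have "(\<Sum>i. ennreal (e * (1/2) ^ Suc i)) = ennreal (e * 1)"
      using e by (intro suminf_ennreal_eq sums_mult power_half_series) auto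
    also have "ennreal K' * (\<Sum>i. hausdorff_cost ?k (C i)) \<le> ennreal K' * ennreal e"
      using C(4) p0 by (intro mult_left_mono) auto
    finally have "emeasure lborel (\<Union>i. W i) \<le> ennreal K' * ennreal e + ennreal e" by (simp add: add_right_mono)
    also have "... = ennreal ((K' + 1) * e)" using K' e
      by (simp add: ennreal_mult'[symmetric] ennreal_plus[symmetric] algebra_simps del: ennreal_plus)
    finally have "emeasure lborel (\<Union>i. W i) \<le> ennreal ((K' + 1) * e)" .
    moreover have "?t A \<subseteq> (\<Union>i. W i)"
    proof
      fix y assume "y \<in> ?t A"
      then obtain x s where y: "y = x + s *\<^sub>R v" "x \<in> A" "0 \<le> s" "s \<le> T" by blast
      then obtain i where "x \<in> C i" using C(1) by blast
      then have "y \<in> ?t (C i)" using y by blast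
      then show "y \<in> (\<Union>i. W i)" using W(2) by blast
    qed
    moreover have "(\<Union>i. W i) \<in> sets borel" using W(1) by auto
    ultimately show ?thesis by blast
  qed
  have "\<exists>W. W \<in> sets borel \<and> ?t A \<subseteq> W \<and> emeasure lborel W \<le> ennreal (inverse (real (Suc n)))" for n
  proof -
    have "0 < inverse (real (Suc n)) / (K' + 1)" using K' by (intro divide_pos_pos) auto
    from step[OF this] show ?thesis using K' by auto
  qed
  then have "\<exists>W. \<forall>n. W n \<in> sets borel \<and> ?t A \<subseteq> W n \<and> emeasure lborel (W n) \<le> ennreal (inverse (real (Suc n)))"
    by (intro choice allI)
  then obtain W where W: "\<And>n. W n \<in> sets borel" "\<And>n. ?t A \<subseteq> W n" "\<And>n. emeasure lborel (W n) \<le> ennreal (inverse (real (Suc n)))"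
    by blast
  have Zb: "(\<Inter>n. W n) \<in> sets borel" using W(1) by auto
  have "emeasure lborel (\<Inter>n. W n) \<le> ennreal (inverse (real (Suc n)))" for n
    by (rule order_trans[OF emeasure_mono W(3)]) (use W(1) in auto)
  moreover have "(\<lambda>n. ennreal (inverse (real (Suc n)))) \<longlonglongrightarrow> ennreal 0"
    by (intro tendsto_ennrealI LIMSEQ_inverse_real_of_nat)
  ultimately have "emeasure lborel (\<Inter>n. W n) \<le> ennreal 0" by (intro LIMSEQ_le_const) auto
  then have "(\<Inter>n. W n) \<in> null_sets lborel" using Zb by (auto simp: null_sets_def)
  then show ?thesis using W(2) by (intro bexI[of _ "\<Inter>n. W n"]) auto
qed

section \<open>The outward normal of a smooth convex domain\<close>

lemma local_defining_function_gradient: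
  assumes "local_defining_function D x V \<rho>"
  obtains g where "GDERIV \<rho> x :> g" "g \<noteq> 0"
proof -
  have V: "open V" "x \<in> V" and sm: "smooth_on \<rho> V" and nz: "\<not> GDERIV \<rho> x :> 0"
    using assms by (auto simp: local_defining_function_def)
  have "\<rho> differentiable_on V" using sm[unfolded smooth_on_def, rule_format, of "Suc 0"] by simp
  then have "\<rho> differentiable (at x)" using V by (simp add: differentiable_on_eq_differentiable_at)
  then obtain f' where f': "(\<rho> has_derivative f') (at x)" by (auto simp: differentiable_def)
  define g where "g = (\<Sum>b\<in>Basis. f' b *\<^sub>R b)"
  have "f' = inner g"
  proof
    fix h
    have "f' h = f' (\<Sum>b\<in>Basis. (h \<bullet> b) *\<^sub>R b)" by (simp add: euclidean_representation)
    also have "... = (\<Sum>b\<in>Basis. (h \<bullet> b) * f' b)"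
      using has_derivative_linear[OF f'] by (simp only: linear_sum linear_scale real_scaleR_def)
    also have "... = g \<bullet> h" unfolding g_def inner_sum_left by (intro sum.cong) (auto simp: inner_commute)
    finally show "f' h = g \<bullet> h" .
  qed
  moreover have "inner g = (\<lambda>h. h \<bullet> g)" by (rule ext) (rule inner_commute)
  ultimately have "GDERIV \<rho> x :> g" using f' by (simp only: gderiv_def)
  then show thesis using nz that by blast
qed

text \<open>If the first claim failed, \<open>\<rho>\<close> would increase from 0 along the segment
  towards \<open>y\<close>, although by convexity the segment runs in \<open>D\<close>, where
  \<open>\<rho>\<close> is negative. In the second claim \<open>\<rho>\<close> decreases from 0 in
  direction \<open>w\<close>, so the ray enters \<open>D\<close>.\<close>

lemma local_defining_function_rays:
  fixes D :: "'a::euclidean_space set"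
  assumes D: "open D" "convex D" and x: "x \<in> frontier D"
    and ldf: "local_defining_function D x V \<rho>" and g: "GDERIV \<rho> x :> g"
  shows "y \<in> D ==> (y - x) \<bullet> g \<le> 0" "w \<bullet> g < 0 ==> \<exists>s>0. x + s *\<^sub>R w \<in> D"
proof -
  have V: "open V" "x \<in> V" and DV: "D \<inter> V = {y \<in> V. \<rho> y < 0}" and FV: "frontier D \<inter> V = {y \<in> V. \<rho> y = 0}"
    using ldf by (auto simp: local_defining_function_def)
  have \<rho>0: "\<rho> x = 0" using x V FV by blast
  have der: "((\<lambda>s. \<rho> (x + s *\<^sub>R w)) has_real_derivative (w \<bullet> g)) (at 0)" for w
  proof -
    have "((\<lambda>s::real. x + s *\<^sub>R w) has_derivative (\<lambda>s. s *\<^sub>R w)) (at 0)" by (auto intro!: derivative_eq_intros)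
    moreover have "(\<rho> has_derivative (\<lambda>h. h \<bullet> g)) (at (x + 0 *\<^sub>R w))" using g by (simp add: gderiv_def)
    ultimately have "((\<lambda>s. \<rho> (x + s *\<^sub>R w)) has_derivative (\<lambda>s. (s *\<^sub>R w) \<bullet> g)) (at 0)"
      by (rule has_derivative_compose)
      moreover have "(\<lambda>s. (s *\<^sub>R w) \<bullet> g) = (*) (w \<bullet> g)" by (rule ext) (simp add: mult.commute)
    ultimately show ?thesis by (simp add: has_field_derivative_def)
  qed
  have inV: "\<exists>d>0. \<forall>s. 0 < s \<and> s < d --> x + s *\<^sub>R w \<in> V" for w
  proof -
    have "((\<lambda>s::real. x + s *\<^sub>R w) \<longlongrightarrow> x + 0 *\<^sub>R w) (at_right 0)" by (intro tendsto_intros)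
    then have "eventually (\<lambda>s. x + s *\<^sub>R w \<in> V) (at_right 0)"
      by (rule topological_tendstoD) (use V in auto)
    then show ?thesis unfolding eventually_at_right_field by auto
  qed
  show "(y - x) \<bullet> g \<le> 0" if y: "y \<in> D"
  proof (rule ccontr)
    assume "\<not> (y - x) \<bullet> g \<le> 0"
    then have "0 < (y - x) \<bullet> g" by simp
    from DERIV_pos_inc_right[OF der this] obtain d1 where d1: "0 < d1" "\<And>h. 0 < h ==> h < d1 ==> 0 < \<rho> (x + h *\<^sub>R (y - x))"
      using \<rho>0 by auto
    obtain d2 where d2: "0 < d2" "\<And>s. 0 < s ==> s < d2 ==> x + s *\<^sub>R (y - x) \<in> V" using inV by blast
    define s where "s = min (min d1 d2) 1 / 2"
    have s: "0 < s" "s < d1" "s < d2" "s \<le> 1" using d1(1) d2(1) by (auto simp: s_def)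
    have "x - s *\<^sub>R (x - y) \<in> interior D"
      by (rule mem_interior_closure_convex_shrink[OF D(2) _ _ s(1,4)]) (use y x D(1) in \<open>auto simp: interior_open frontier_def\<close>)
    then have "x + s *\<^sub>R (y - x) \<in> D" using D(1) by (simp add: interior_open algebra_simps)
    then have "\<rho> (x + s *\<^sub>R (y - x)) < 0" using DV d2(2)[OF s(1,3)] by blast
    then show False using d1(2)[OF s(1,2)] by simp
  qed
  show "\<exists>s>0. x + s *\<^sub>R w \<in> D" if w: "w \<bullet> g < 0"
  proof -
    from DERIV_neg_dec_right[OF der w] obtain d1 where d1: "0 < d1" "\<And>h. 0 < h ==> h < d1 ==> \<rho> (x + h *\<^sub>R w) < 0"
      using \<rho>0 by auto
    obtain d2 where d2: "0 < d2" "\<And>s. 0 < s ==> s < d2 ==> x + s *\<^sub>R w \<in> V" using inV by blast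
    define s where "s = min d1 d2 / 2"
    have s: "0 < s" "s < d1" "s < d2" using d1(1) d2(1) by (auto simp: s_def)
    have "x + s *\<^sub>R w \<in> D" using DV d2(2)[OF s(1,3)] d1(2)[OF s(1,2)] by blast
    then show ?thesis using s(1) by blast
  qed
qed

text \<open>Let n be the normalised \<open>g\<close> and c = m \<bullet> n. Testing with
  \<open>m - (c + e) n\<close> gives \<open>1 - c^2 \<le> e c\<close> for every
  \<open>e > 0\<close>; as c \<ge> 0, it follows that c \<ge> 1 and m = n.\<close>

lemma unit_supporting_vector_unique:
  fixes g :: "'a::euclidean_space"
  assumes g: "g \<noteq> 0" and m: "norm m = 1" and le: "\<And>w. w \<bullet> g < 0 ==> w \<bullet> m \<le> 0"
  shows "m = g /\<^sub>R norm g"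
proof -
  define n where "n = g /\<^sub>R norm g"
  have n: "n \<bullet> n = 1" using g by (simp add: n_def dot_square_norm power2_eq_square field_simps)
  have mm: "m \<bullet> m = 1" using m by (simp add: dot_square_norm)
  have le': "w \<bullet> m \<le> 0" if "w \<bullet> n < 0" for w
  proof (rule le)
    have "w \<bullet> n = (w \<bullet> g) / norm g" by (simp add: n_def divide_inverse mult.commute)
    then show "w \<bullet> g < 0" using that g by (simp add: divide_less_0_iff)
  qed
  define c where "c = m \<bullet> n"
  have c0: "0 \<le> c" using le'[of "- n"] n by (simp add: c_def inner_commute)
  have "1 - c\<^sup>2 \<le> e * c" if "0 < e" for e
  proof -
    have "(m - (c + e) *\<^sub>R n) \<bullet> n < 0" using that n by (simp add: inner_diff_left c_def)
    from le'[OF this] show ?thesis using mm by (simp add: inner_diff_left c_def inner_commute power2_eq_square algebra_simps)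
  qed
  note * = this
  have "1 - c\<^sup>2 \<le> 0"
  proof (rule field_le_epsilon)
    fix e :: real assume e: "0 < e"
    have "1 - c\<^sup>2 \<le> (e / (c + 1)) * c" by (rule *) (use e c0 in \<open>auto intro!: divide_pos_pos\<close>)
    also have "... \<le> e" using e c0 by (simp add: divide_le_eq field_simps)
    finally show "1 - c\<^sup>2 \<le> 0 + e" by simp
  qed
  then have "1 \<le> c" using c0 by (simp add: power2_eq_square) (smt (verit) mult_le_one mult_left_le)
  then have "(m - n) \<bullet> (m - n) \<le> 0" using n mm by (simp add: inner_diff_left inner_diff_right inner_commute c_def)
  then have "m = n" using inner_ge_zero[of "m - n"] by (simp add: antisym)
  then show ?thesis by (simp add: n_def)
qed

text \<open>The third claim characterises the normal by the convex set alone: it shows independence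
  of the defining function, and it makes the graph of the normal closed. Strictness in the second
  comes from openness, since a point of \<open>D\<close> can be moved a little further in the normal
  direction.\<close>

lemma outward_normal:
  fixes D :: "'a::euclidean_space set"
  assumes D: "smooth_domain D" "convex D" and x: "x \<in> frontier D"
  shows "norm (outward_normal D x) = 1" "y \<in> D ==> (y - x) \<bullet> outward_normal D x < 0"
    "norm m = 1 ==> (\<And>y. y \<in> D ==> (y - x) \<bullet> m \<le> 0) ==> m = outward_normal D x"
proof -
  have oD: "open D" using D(1) by (simp add: smooth_domain_def)
  obtain V \<rho> where ldf: "local_defining_function D x V \<rho>" using D(1) x by (auto simp: smooth_domain_def)
  obtain g where g: "GDERIV \<rho> x :> g" "g \<noteq> 0" using local_defining_function_gradient[OF ldf] by blast
  have uniq: "m = g /\<^sub>R norm g" if m: "norm m = 1" "\<And>y. y \<in> D ==> (y - x) \<bullet> m \<le> 0" for m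
  proof (rule unit_supporting_vector_unique[OF g(2) m(1)])
    fix w assume "w \<bullet> g < 0"
    then obtain s where s: "0 < s" "x + s *\<^sub>R w \<in> D" using local_defining_function_rays(2)[OF oD D(2) x ldf g(1)] by blast
    then show "w \<bullet> m \<le> 0" using m(2)[OF s(2)] by (simp add: mult_le_0_iff)
  qed
  have on: "outward_normal D x = g /\<^sub>R norm g"
    unfolding outward_normal_def
  proof (rule the_equality)
    show "\<exists>V \<rho> g'. local_defining_function D x V \<rho> \<and> GDERIV \<rho> x :> g' \<and> g /\<^sub>R norm g = g' /\<^sub>R norm g'" using ldf g by blast
    fix n assume "\<exists>V \<rho> g. local_defining_function D x V \<rho> \<and> GDERIV \<rho> x :> g \<and> n = g /\<^sub>R norm g"
    then obtain V' \<rho>' g' where 1: "local_defining_function D x V' \<rho>'" "GDERIV \<rho>' x :> g'" "n = g' /\<^sub>R norm g'" by blast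
    have g'0: "g' \<noteq> 0" using 1 by (auto simp: local_defining_function_def)
    show "n = g /\<^sub>R norm g"
    proof (rule uniq)
      show "norm n = 1" using g'0 by (simp add: 1(3))
      fix y assume "y \<in> D"
      then have "(y - x) \<bullet> g' \<le> 0" by (rule local_defining_function_rays(1)[OF oD D(2) x 1(1,2)])
      then show "(y - x) \<bullet> n \<le> 0" by (simp add: 1(3) mult_nonneg_nonpos)
    qed
  qed
  show n1: "norm (outward_normal D x) = 1" using g(2) by (simp add: on)
  show "m = outward_normal D x" if "norm m = 1" "\<And>y. y \<in> D ==> (y - x) \<bullet> m \<le> 0" unfolding on by (rule uniq[OF that])
  have le: "(y - x) \<bullet> outward_normal D x \<le> 0" if "y \<in> D" for y
    using local_defining_function_rays(1)[OF oD D(2) x ldf g(1) that] by (simp add: on mult_nonneg_nonpos)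
  show "(y - x) \<bullet> outward_normal D x < 0" if y: "y \<in> D"
  proof -
    obtain e where e: "0 < e" "ball y e \<subseteq> D" using oD y open_contains_ball by blast
    have "y + (e/2) *\<^sub>R outward_normal D x \<in> D" using e n1 by (intro subsetD[OF e(2)]) (simp add: dist_norm)
    from le[OF this] have "(y - x) \<bullet> outward_normal D x + e / 2 * (outward_normal D x \<bullet> outward_normal D x) \<le> 0"
      by (simp add: inner_add_left inner_diff_left)
    then show ?thesis using e(1) n1 by (simp add: dot_square_norm)
  qed
qed

text \<open>The graph is cut out by the closed conditions that the second component is a unit vector
  and supports \<open>D\<close> at the first; the sphere is compact.\<close>

lemma continuous_on_outward_normal:
  fixes D :: "'a::euclidean_space set"
  assumes D: "smooth_domain D" "convex D"
  shows "continuous_on (frontier D) (outward_normal D)"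
proof (rule continuous_from_closed_graph)
  show "compact (sphere (0::'a) 1)" by simp
  show "outward_normal D \<in> frontier D \<rightarrow> sphere 0 1" using outward_normal(1)[OF D] by auto
  have "(\<lambda>x. (x, outward_normal D x)) ` frontier D = (frontier D \<times> sphere 0 1) \<inter> (\<Inter>y\<in>D. {z. (y - fst z) \<bullet> snd z \<le> 0})"
  proof (intro set_eqI iffI)
    fix z assume "z \<in> (\<lambda>x. (x, outward_normal D x)) ` frontier D"
    then obtain x where "x \<in> frontier D" "z = (x, outward_normal D x)" by blast
    then show "z \<in> (frontier D \<times> sphere 0 1) \<inter> (\<Inter>y\<in>D. {z. (y - fst z) \<bullet> snd z \<le> 0})"
      using outward_normal(1,2)[OF D, of x] by (auto intro: less_imp_le)
  next
    fix z assume z: "z \<in> (frontier D \<times> sphere 0 1) \<inter> (\<Inter>y\<in>D. {z. (y - fst z) \<bullet> snd z \<le> 0})"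
    then have "snd z = outward_normal D (fst z)" by (intro outward_normal(3)[OF D]) auto
    then show "z \<in> (\<lambda>x. (x, outward_normal D x)) ` frontier D" using z by (intro image_eqI[of _ _ "fst z"]) (auto simp: prod_eq_iff)
  qed
  moreover have "closed ..."
    by (intro closed_Int closed_Times closed_INT ballI closed_Collect_le continuous_intros) auto
  ultimately show "closed ((\<lambda>x. (x, outward_normal D x)) ` frontier D)" by simp
qed

context bounded_convex_domain
begin

lemma surface_measure_basics:
  "space (surface_measure D) = frontier D" "sets (surface_measure D) = sets (restrict_space borel (frontier D))"
  "A \<in> sets (surface_measure D) ==> emeasure (surface_measure D) A = hausdorff_outer (DIM('a) - 1) A"
  "finite_measure (surface_measure D)"
proof -
  have F: "frontier D \<in> sets (borel :: 'a measure)" by (simp add: borel_closed)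
  show sp: "space (surface_measure D) = frontier D" by (simp add: surface_measure_def space_restrict_space)
  show st: "sets (surface_measure D) = sets (restrict_space borel (frontier D))"
    unfolding surface_measure_def by (rule sets_restrict_space_cong) simp
  show em: "emeasure (surface_measure D) A = hausdorff_outer (DIM('a) - 1) A" if "A \<in> sets (surface_measure D)" for A
  proof -
    have A: "A \<in> sets borel" "A \<subseteq> frontier D" using that F by (auto simp: st sets_restrict_space_iff)
    then show ?thesis unfolding surface_measure_def
      by (subst emeasure_restrict_space) (auto simp: F emeasure_hausdorff_measure)
  qed
  have "frontier D \<in> sets (surface_measure D)" using F by (simp add: st sets_restrict_space_iff)
  then show "finite_measure (surface_measure D)"
    using hausdorff_outer_frontier_finite[OF open_D bounded_D convex_D] by (intro finite_measureI) (simp add: sp em)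
qed

lemma exit_point_frontier:
  assumes x: "x \<in> D" and v: "v \<noteq> 0"
  shows "x - et x v *\<^sub>R v \<in> frontier D"
proof -
  have "x - et x v *\<^sub>R v \<notin> D" using exit_time_aux(3)[OF x v, of "et x v"] exit_time_pos[OF x v] by simp
  moreover have "x - et x v *\<^sub>R v \<in> closure D"
  proof (rule Lim_in_closed_set[of _ "\<lambda>s. x - s *\<^sub>R v" "at_left (et x v)"])
    show "\<forall>\<^sub>F s in at_left (et x v). x - s *\<^sub>R v \<in> closure D"
    proof -
      have "\<forall>\<^sub>F s in at_left (et x v). 0 < s \<and> s < et x v"
        unfolding eventually_at_left_field using exit_time_pos[OF x v] by (intro exI[of _ 0]) auto
      then show ?thesis by eventually_elim (use exit_time_aux(3)[OF x v] closure_subset in \<open>auto intro!: subsetD[OF closure_subset]\<close>)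
    qed
  qed (auto intro!: tendsto_intros)
  ultimately show ?thesis using open_D by (simp add: frontier_def interior_open)
qed

text \<open>The change of variables from \<open>dx dv\<close> to \<open>|v \<bullet> n| d\<gamma> ds dv\<close> along the lines is only needed in the
  form of absolute continuity; \<open>\<epsilon> = 1\<close> is the incoming, \<open>\<epsilon> = - 1\<close> the outgoing boundary.\<close>

lemma AE_flux_imp_AE_phase:
  fixes \<epsilon> :: real
  assumes smooth: "smooth_domain D" and \<epsilon>: "\<epsilon> = 1 \<or> \<epsilon> = - 1"
    and ae: "AE z in flux_measure D {(x, v). x \<in> frontier D \<and> \<epsilon> * (v \<bullet> outward_normal D x) \<le> 0}. P z"
  shows "AE z in lborel. fst z \<in> D \<and> snd z \<noteq> 0 --> P (fst z - (\<epsilon> * et (fst z) (\<epsilon> *\<^sub>R snd z)) *\<^sub>R snd z, snd z)"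
proof -
  let ?G = "{(x, v). x \<in> frontier D \<and> \<epsilon> * (v \<bullet> outward_normal D x) \<le> 0}"
  let ?n = "outward_normal D" and ?S = "surface_measure D" and ?F = "frontier D"
  interpret S: finite_measure ?S by (rule surface_measure_basics(4))
  interpret SL: pair_sigma_finite ?S "lborel :: 'a measure"
    by (intro pair_sigma_finite.intro sigma_finite_lborel S.sigma_finite_measure_axioms)
  note spS = surface_measure_basics(1) and stS = surface_measure_basics(2)
  have F: "?F \<in> sets (borel :: 'a measure)" by (simp add: borel_closed)
  have n_meas [measurable]: "?n \<in> borel_measurable ?S"
    unfolding measurable_cong_sets[OF stS refl]
    by (rule borel_measurable_continuous_on_restrict[OF continuous_on_outward_normal[OF smooth convex_D]])
  have nv [measurable]: "(\<lambda>z. snd z \<bullet> ?n (fst z)) \<in> borel_measurable (?S \<Otimes>\<^sub>M lborel)" by measurable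
  have spP: "space (?S \<Otimes>\<^sub>M lborel) = ?F \<times> UNIV" by (simp add: space_pair_measure spS)
  have G: "?G \<in> sets (?S \<Otimes>\<^sub>M lborel)"
  proof -
    have "{z \<in> space (?S \<Otimes>\<^sub>M lborel). \<epsilon> * (snd z \<bullet> ?n (fst z)) \<le> 0} \<in> sets (?S \<Otimes>\<^sub>M lborel)" by measurable
    moreover have "{z \<in> space (?S \<Otimes>\<^sub>M lborel). \<epsilon> * (snd z \<bullet> ?n (fst z)) \<le> 0} = ?G" by (auto simp: spP)
    ultimately show ?thesis by simp
  qed
  have fm: "(\<lambda>(x, v). ennreal \<bar>v \<bullet> ?n x\<bar>) \<in> borel_measurable (?S \<Otimes>\<^sub>M lborel)"
    using nv by (simp add: case_prod_unfold)
  have "AE z in ?S \<Otimes>\<^sub>M lborel. 0 < (case z of (x, v) => ennreal \<bar>v \<bullet> ?n x\<bar>) --> z \<in> ?G --> P z"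
  proof -
    have "?G \<inter> space (density (?S \<Otimes>\<^sub>M lborel) (\<lambda>(x, v). ennreal \<bar>v \<bullet> ?n x\<bar>)) \<in> sets (density (?S \<Otimes>\<^sub>M lborel) (\<lambda>(x, v). ennreal \<bar>v \<bullet> ?n x\<bar>))"
      using G by (simp add: sets.Int_space_eq2)
    from ae[unfolded flux_measure_def, THEN AE_restrict_space_iff[OF this, THEN iffD1]]
    show ?thesis by (simp only: AE_density[OF fm])
  qed
  \<comment> \<open>Pairs with flux density 0 are left out; \<open>vn\<close> below shows that the
    end points of chords are not among them.\<close>
  then obtain N where N: "{z \<in> space (?S \<Otimes>\<^sub>M lborel). \<not> (0 < (case z of (x, v) => ennreal \<bar>v \<bullet> ?n x\<bar>) --> z \<in> ?G --> P z)} \<subseteq> N"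
    "emeasure (?S \<Otimes>\<^sub>M lborel) N = 0" "N \<in> sets (?S \<Otimes>\<^sub>M lborel)" by (rule AE_E)
  have "(\<integral>\<^sup>+v. emeasure ?S ((\<lambda>x. (x, v)) -` N) \<partial>lborel) = 0"
    using N(2) SL.emeasure_pair_measure_alt2[OF N(3)] by simp
  \<comment> \<open>Fubini, with the velocity fixed: tubes are formed in one direction at a
    time.\<close>
  then have AEv: "AE v in lborel. emeasure ?S ((\<lambda>x. (x, v)) -` N) = 0"
    by (subst (asm) nn_integral_0_iff_AE) (use SL.measurable_emeasure_Pair2[OF N(3)] in auto)
  define a where "a z = et (fst z) (\<epsilon> *\<^sub>R snd z)" for z :: "'a \<times> 'a"
  define X where "X z = fst z - (\<epsilon> * a z) *\<^sub>R snd z" for z :: "'a \<times> 'a"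
  define D0 where "D0 = {z :: 'a \<times> 'a. fst z \<in> D \<and> snd z \<noteq> 0}"
  have D0: "D0 \<in> sets borel"
    unfolding D0_def by (intro borel_open open_Collect_conj open_Collect_neq open_vimage[unfolded vimage_def] open_D continuous_intros)
  have am: "a \<in> Borel"
    unfolding a_def using measurable_compose[OF borel_continuous[of "\<lambda>z. (fst z, \<epsilon> *\<^sub>R snd z)"] exit_time_measurable]
    by (simp add: continuous_intros)
  have Xm: "X \<in> Borel"
    unfolding X_def using am by measurable
  have XF: "X z \<in> ?F" if "z \<in> D0" for z
    using exit_point_frontier[of "fst z" "\<epsilon> *\<^sub>R snd z"] that \<epsilon> by (auto simp: X_def a_def D0_def)
  have apos: "0 < a z" if "z \<in> D0" for z
    using exit_time_pos[of "fst z" "\<epsilon> *\<^sub>R snd z"] that \<epsilon> by (auto simp: a_def D0_def)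
  \<comment> \<open>A chord contains a point of the open set \<open>D\<close>, so it meets the
    boundary transversally and the flux density is positive there.\<close>
  have vn: "\<epsilon> * (snd z \<bullet> ?n (X z)) < 0" if z: "z \<in> D0" for z
  proof -
    have "(fst z - X z) \<bullet> ?n (X z) < 0" using outward_normal(2)[OF smooth convex_D XF[OF z]] z by (simp add: D0_def)
    then have "a z * (\<epsilon> * (snd z \<bullet> ?n (X z))) < 0" by (simp add: X_def algebra_simps)
    then show ?thesis using apos[OF z] by (simp add: mult_less_0_iff)
  qed
  define B where "B = {z \<in> D0. (X z, snd z) \<in> N}"
  have Bm: "B \<in> sets borel"
  proof -
    have "(\<lambda>z. (X z, snd z)) \<in> measurable (restrict_space borel D0) (?S \<Otimes>\<^sub>M lborel)"
    proof (rule measurable_Pair)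
      show "X \<in> measurable (restrict_space borel D0) ?S"
        unfolding measurable_cong_sets[OF refl stS]
        by (rule measurable_restrict_space2) (use XF Xm in \<open>auto intro: measurable_restrict_space1 simp: space_restrict_space\<close>)
      show "snd \<in> measurable (restrict_space borel D0) lborel"
        using measurable_restrict_space1[OF measurable_fst_snd_borel(2)] by simp
    qed
    from measurable_sets[OF this N(3)]
    have "(\<lambda>z. (X z, snd z)) -` N \<inter> D0 \<in> sets (restrict_space borel D0)" by (simp add: space_restrict_space)
    then have "(\<lambda>z. (X z, snd z)) -` N \<inter> D0 \<in> sets borel" using D0 by (simp add: sets_restrict_space_iff)
    moreover have "(\<lambda>z. (X z, snd z)) -` N \<inter> D0 = B" by (auto simp: B_def)
    ultimately show ?thesis by simp
  qed
  obtain R where R: "\<And>x. x \<in> closure D ==> norm x \<le> R" using bounded_closure[OF bounded_D] by (auto simp: bounded_iff)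
  have "(\<integral>\<^sup>+v. (\<integral>\<^sup>+x. indicator B (x, v) \<partial>lborel) \<partial>lborel) = (\<integral>\<^sup>+v. 0 \<partial>(lborel :: 'a measure))"
  proof (rule nn_integral_cong_AE)
    show "AE v in lborel. (\<integral>\<^sup>+x. indicator B (x, v) \<partial>(lborel :: 'a measure)) = 0"
      using AEv
    proof eventually_elim
      fix v :: 'a assume v: "emeasure ?S ((\<lambda>x. (x, v)) -` N) = 0"
      show "(\<integral>\<^sup>+x. indicator B (x, v) \<partial>(lborel :: 'a measure)) = 0"
      proof (cases "v = 0")
        case True
        then show ?thesis by (simp add: B_def D0_def)
      next
        case False
        have "(\<lambda>x. (x, v)) -` N \<in> sets ?S" by (rule sets_Pair2[OF N(3)])
        then have H0: "hausdorff_outer (DIM('a) - 1) ((\<lambda>x. (x, v)) -` N) = 0" using v surface_measure_basics(3) by metis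
        have ev: "\<epsilon> *\<^sub>R v \<noteq> 0" using False \<epsilon> by auto
        \<comment> \<open>No exit time exceeds this bound, so one tube contains every point of
          \<open>D\<close> whose exit point is exceptional.\<close>
        define T where "T = 2 * \<bar>R\<bar> / norm v"
        have T: "0 \<le> T" by (simp add: T_def)
        obtain Z where Z: "Z \<in> null_sets lborel" "{x + s *\<^sub>R (\<epsilon> *\<^sub>R v) |x s. x \<in> (\<lambda>x. (x, v)) -` N \<and> 0 \<le> s \<and> s \<le> T} \<subseteq> Z"
          using hausdorff_null_tube_null[OF H0 T ev] by blast
        have sub: "x \<in> Z" if "(x, v) \<in> B" for x
        proof (rule subsetD[OF Z(2)], intro CollectI exI conjI)
          have xD: "(x, v) \<in> D0" and xN: "(X (x, v), v) \<in> N" using that by (auto simp: B_def)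
          show "x = X (x, v) + a (x, v) *\<^sub>R (\<epsilon> *\<^sub>R v)" by (simp add: X_def mult.commute)
          show "X (x, v) \<in> (\<lambda>x. (x, v)) -` N" using xN by simp
          show "0 \<le> a (x, v)" using apos[OF xD] by simp
          have "norm (x - X (x, v)) \<le> norm x + norm (X (x, v))" by (rule norm_triangle_ineq4)
          also have "... \<le> \<bar>R\<bar> + \<bar>R\<bar>"
            using R[of x] R[of "X (x, v)"] XF[OF xD] xD subsetD[OF closure_subset, of x D] by (intro add_mono) (auto simp: D0_def frontier_def)
          also have "x - X (x, v) = (\<epsilon> * a (x, v)) *\<^sub>R v" by (simp add: X_def)
          finally have "a (x, v) * norm v \<le> 2 * \<bar>R\<bar>" using \<epsilon> apos[OF xD] by (auto simp: abs_mult)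
          then show "a (x, v) \<le> T" using False by (simp add: T_def le_divide_eq)
        qed
        have "AE x in lborel. x \<notin> Z" using Z(1) by (rule AE_not_in)
        then have "AE x in lborel. indicator B (x, v) = (0::ennreal)" by eventually_elim (use sub in \<open>auto simp: indicator_def\<close>)
        then have "(\<integral>\<^sup>+x. indicator B (x, v) \<partial>(lborel :: 'a measure)) = (\<integral>\<^sup>+x. 0 \<partial>(lborel :: 'a measure))" by (rule nn_integral_cong_AE)
        then show ?thesis by simp
      qed
    qed
  qed
  then have "(\<integral>\<^sup>+z. indicator B z \<partial>lborel) = 0" using nn_integral_lborel_prod(1)[of "indicator B"] Bm by simp
  then have "B \<in> null_sets lborel" using Bm by (simp add: null_sets_def)
  then have "AE z in lborel. z \<notin> B" by (rule AE_not_in)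
  then show ?thesis
  proof eventually_elim
    fix z assume zB: "z \<notin> B"
    show "fst z \<in> D \<and> snd z \<noteq> 0 --> P (fst z - (\<epsilon> * et (fst z) (\<epsilon> *\<^sub>R snd z)) *\<^sub>R snd z, snd z)"
    proof
      assume "fst z \<in> D \<and> snd z \<noteq> 0"
      then have z: "z \<in> D0" by (simp add: D0_def)
      then have "(X z, snd z) \<notin> N" using zB by (simp add: B_def)
      moreover have "(X z, snd z) \<in> space (?S \<Otimes>\<^sub>M lborel)" using XF[OF z] by (simp add: spP)
      ultimately have "0 < ennreal \<bar>snd z \<bullet> ?n (X z)\<bar> --> (X z, snd z) \<in> ?G --> P (X z, snd z)" using N(1) by auto
      then have "P (X z, snd z)" using vn[OF z] XF[OF z] by auto
      then show "P (fst z - (\<epsilon> * et (fst z) (\<epsilon> *\<^sub>R snd z)) *\<^sub>R snd z, snd z)" by (simp add: X_def a_def)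
    qed
  qed
qed

end

section \<open>Functions that are absolutely continuous along lines\<close>

lemma AE_lborel_open_ex:
  fixes P :: "real => bool"
  assumes "AE r in lborel. P r" "a < b"
  shows "\<exists>r. a < r \<and> r < b \<and> P r"
proof (rule ccontr)
  assume no: "\<nexists>r. a < r \<and> r < b \<and> P r"
  have "AE r in lborel. r \<notin> {a<..<b}" using assms(1) by eventually_elim (use no in auto)
  then have "{a<..<b} \<in> null_sets lborel" by (subst AE_iff_null_sets[of "{a<..<b}" lborel]) auto
  then show False using assms(2) by (simp add: null_sets_def)
qed

text \<open>Functions that agree almost everywhere have common values arbitrarily close to 0. This
  links a trace, which is a limit of some representative, with the limit of the absolutely
  continuous version.\<close>

lemma tendsto_at_right_AE_unique:
  fixes h1 h2 :: "real => real"
  assumes 1: "(h1 \<longlongrightarrow> l1) (at_right 0)" and 2: "(h2 \<longlongrightarrow> l2) (at_right 0)" and c: "0 < c"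
    and eq: "AE s in lborel. 0 < s \<and> s < c --> h1 s = h2 s"
  shows "l1 = l2"
proof (rule ccontr)
  assume "l1 \<noteq> l2"
  then have e: "0 < \<bar>l1 - l2\<bar> / 2" by simp
  have "eventually (\<lambda>s. dist (h1 s) l1 < \<bar>l1 - l2\<bar> / 2 \<and> dist (h2 s) l2 < \<bar>l1 - l2\<bar> / 2) (at_right 0)"
    using tendstoD[OF 1 e] tendstoD[OF 2 e] by eventually_elim simp
  then obtain d where d: "0 < d" "\<And>s. 0 < s ==> s < d ==> dist (h1 s) l1 < \<bar>l1 - l2\<bar> / 2 \<and> dist (h2 s) l2 < \<bar>l1 - l2\<bar> / 2"
    unfolding eventually_at_right_field by auto
  obtain s where "0 < s" "s < min c d" "0 < s \<and> s < c --> h1 s = h2 s"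
    using AE_lborel_open_ex[OF eq, of 0 "min c d"] c d(1) by auto
  then have "dist (h1 s) l1 < \<bar>l1 - l2\<bar> / 2" "dist (h1 s) l2 < \<bar>l1 - l2\<bar> / 2" using d(2)[of s] by auto
  then have "2 * dist (h1 s) l1 < \<bar>l1 - l2\<bar>" "2 * dist (h1 s) l2 < \<bar>l1 - l2\<bar>" by (simp_all add: field_simps)
  moreover have "\<bar>l1 - l2\<bar> \<le> dist (h1 s) l1 + dist (h1 s) l2" unfolding dist_real_def by linarith
  ultimately show False by linarith
qed

lemma AE_lborel_affine:
  fixes P :: "real => bool"
  assumes "AE x in lborel. P x" "a \<noteq> 0"
  shows "AE x in lborel. P (c + a * x)"
proof -
  from assms obtain N where N: "{x. \<not> P x} \<subseteq> N" "N \<in> sets borel" "emeasure lborel N = 0" by (auto elim!: AE_E)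
  have "AE x in lborel. x \<notin> N" using N by (intro AE_not_in) (auto simp: null_sets_def)
  then have "AE x in lborel. c + a * x \<notin> N" by (rule AE_borel_affine[rotated 2]) (use N assms(2) in auto)
  then show ?thesis by eventually_elim (use N(1) in auto)
qed

lemma has_bochner_integral_lborel_cong_AE:
  fixes f g :: "real => real"
  assumes "has_bochner_integral lborel f I" "g \<in> Borel" "AE x in lborel. f x = g x"
  shows "has_bochner_integral lborel g I"
  using assms by (subst has_bochner_integral_cong_AE[of g lborel f I]) (auto elim: eventually_mono simp: has_bochner_integral_iff)

lemma integrable_line_indicator:
  fixes \<phi> :: "real => real"
  assumes "integrable lborel \<phi>" "A \<in> sets borel"
  shows "integrable lborel (\<lambda>s. indicator A s * \<phi> s)"
  using integrable_mult_indicator[of A lborel \<phi>] assms by simp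

text \<open>Integration from minus infinity makes the primitive compatible with a change of base
  point on the line. In the applications \<open>g\<close> vanishes outside \<open>D\<close>, so only
  a bounded chord contributes.\<close>

definition line_primitive :: "('a::euclidean_space \<times> 'a => real) => 'a \<times> 'a => real => real" where
  "line_primitive g z r = (LINT s|lborel. indicator {..r} s * g (shear s z))"

lemma line_primitive_shear: "line_primitive g (shear q z) r = line_primitive g z (r + q)"
proof -
  have "line_primitive g z (r + q) = (LINT s|lborel. indicator {..r + q} (q + 1 * s) * g (shear (q + 1 * s) z))"
    unfolding line_primitive_def by (subst lborel_integral_real_affine[of 1 _ q]) auto
  also have "... = line_primitive g (shear q z) r"
    unfolding line_primitive_def by (intro Bochner_Integration.integral_cong) (auto simp: shear_shear indicator_def)
  finally show ?thesis by simp
qed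

lemma line_primitive_diff:
  assumes i: "integrable lborel (\<lambda>s. g (shear s z))" and "a \<le> b"
  shows "has_bochner_integral lborel (\<lambda>s. indicator {a<..b} s * g (shear s z)) (line_primitive g z b - line_primitive g z a)"
proof -
  have "(\<lambda>s. indicator {a<..b} s * g (shear s z)) = (\<lambda>s. indicator {..b} s * g (shear s z) - indicator {..a} s * g (shear s z))"
    using assms(2) by (auto simp: indicator_def)
  then show ?thesis unfolding line_primitive_def
    using has_bochner_integral_diff[OF has_bochner_integral_integrable[OF integrable_line_indicator[OF i, of "{..b}"]]
      has_bochner_integral_integrable[OF integrable_line_indicator[OF i, of "{..a}"]]] by simp
qed

lemma line_primitive_tendsto:
  assumes i: "integrable lborel (\<lambda>s. g (shear s z))"
  shows "((\<lambda>s. line_primitive g z (a + s)) \<longlongrightarrow> line_primitive g z a) (at_right 0)"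
    "((\<lambda>s. line_primitive g z (a - s)) \<longlongrightarrow> line_primitive g z a) (at_right 0)"
proof -
  have *: "(\<lambda>n. line_primitive g z (a + X n)) \<longlonglongrightarrow> line_primitive g z a" if X: "X \<longlonglongrightarrow> 0" for X
    unfolding line_primitive_def
  proof (rule integral_dominated_convergence[where w = "\<lambda>s. \<bar>g (shear s z)\<bar>"])
    have ae: "AE s in lborel. s \<noteq> a" by (rule AE_lborel_singleton)
    show "AE s in lborel. (\<lambda>n. indicator {..a + X n} s * g (shear s z)) \<longlonglongrightarrow> indicator {..a} s * g (shear s z)"
      using ae
    proof eventually_elim
      fix s assume s: "s \<noteq> a"
      have Xa: "(\<lambda>n. a + X n) \<longlonglongrightarrow> a" using tendsto_add[OF tendsto_const X, of a] by simp
      have "eventually (\<lambda>n. indicator {..a + X n} s * g (shear s z) = indicator {..a} s * g (shear s z)) sequentially"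
      proof (cases "s < a")
        case True
        have "eventually (\<lambda>n. s < a + X n) sequentially" using Xa True by (rule order_tendstoD)
        then show ?thesis by eventually_elim (use True in auto)
      next
        case False
        then have "a < s" using s by simp
        have "eventually (\<lambda>n. a + X n < s) sequentially" using Xa \<open>a < s\<close> by (rule order_tendstoD)
        then show ?thesis by eventually_elim (use \<open>a < s\<close> in auto)
      qed
      then show "(\<lambda>n. indicator {..a + X n} s * g (shear s z)) \<longlonglongrightarrow> indicator {..a} s * g (shear s z)" by (rule tendsto_eventually)
    qed
    show "AE s in lborel. norm (indicator {..a + X n} s * g (shear s z)) \<le> \<bar>g (shear s z)\<bar>" for n
      by (intro AE_I2) (auto simp: indicator_def)
    show "integrable lborel (\<lambda>s. \<bar>g (shear s z)\<bar>)" using i by simp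
    show "(\<lambda>s. indicator {..a} s * g (shear s z)) \<in> borel_measurable lborel" "(\<lambda>s. indicator {..a + X n} s * g (shear s z)) \<in> borel_measurable lborel" for n
      using integrable_line_indicator[OF i, of "{..a}"] integrable_line_indicator[OF i, of "{..a + X n}"] by (auto dest: borel_measurable_integrable)
  qed
  show "((\<lambda>s. line_primitive g z (a + s)) \<longlongrightarrow> line_primitive g z a) (at_right 0)"
    by (rule tendsto_at_right_sequentially[of 0 1]) (use * in auto)
  show "((\<lambda>s. line_primitive g z (a - s)) \<longlongrightarrow> line_primitive g z a) (at_right 0)"
  proof (rule tendsto_at_right_sequentially[of 0 1])
    fix S :: "nat => real" assume "S \<longlonglongrightarrow> 0"
    then have "(\<lambda>n. - S n) \<longlonglongrightarrow> 0" using tendsto_minus by fastforce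
    from *[OF this] show "(\<lambda>n. line_primitive g z (a - S n)) \<longlonglongrightarrow> line_primitive g z a" by simp
  qed simp
qed

section \<open>Weak derivatives as derivatives along lines\<close>

context bounded_convex_domain
begin

text \<open>By \<open>\<bar>y\<bar> \<le> 1 + \<bar>y\<bar> powr p\<close>, where the constant 1 is
  integrable over balls.\<close>

lemma Lp_locally_integrable:
  assumes p: "1 \<le> p" and f: "f \<in> Borel" "f \<in> Lp_space (phase_space D) p" "\<And>z. fst z \<notin> D ==> f z = 0"
  shows "locally_integrable f"
  unfolding locally_integrable_def
proof (intro conjI allI f(1))
  fix r :: real
  have [measurable]: "f \<in> Borel" by fact
  have "integrable lborel (\<lambda>z. \<bar>f z\<bar> powr p)"
  proof (rule integrableI_nonneg)
    have "(\<integral>\<^sup>+z. ennreal (\<bar>f z\<bar> powr p) \<partial>lborel) = (\<integral>\<^sup>+z. ennreal (\<bar>f z\<bar> powr p) \<partial>phase_space D)"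
      unfolding nn_integral_phase_space[OF open_D] using f(3)
      by (intro nn_integral_cong) (auto simp: indicator_def mem_Times_iff)
    also have "... < \<infinity>" unfolding Lp_norm_powr[OF p f(2)] by simp
    finally show "(\<integral>\<^sup>+z. ennreal (\<bar>f z\<bar> powr p) \<partial>lborel) < \<infinity>" .
  qed auto
  moreover have "integrable lborel (indicator (cball 0 r) :: 'a \<times> 'a => real)"
    using emeasure_lborel_cball_finite[of "0 :: 'a \<times> 'a" r] by (simp add: borel_closed)
  ultimately have i: "integrable lborel (\<lambda>z. indicator (cball 0 r) z + \<bar>f z\<bar> powr p)" by simp
  show "integrable lborel (\<lambda>z. indicator (cball 0 r) z * f z)"
  proof (rule Bochner_Integration.integrable_bound[OF i])
    show "(\<lambda>z. indicator (cball 0 r) z * f z) \<in> borel_measurable lborel"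
      using f(1) indicator_cball_measurable(1)[of "0 :: 'a \<times> 'a" r] by (simp del: borel_measurable_indicator_iff)
    have le: "\<bar>y\<bar> \<le> 1 + \<bar>y\<bar> powr p" for y :: real
    proof (cases "\<bar>y\<bar> \<le> 1")
      case False
      then have "\<bar>y\<bar> powr 1 \<le> \<bar>y\<bar> powr p" using p by (intro powr_mono) auto
      then show ?thesis by simp
    qed (simp add: add_increasing2)
    show "AE z in lborel. norm (indicator (cball 0 r) z * f z) \<le> norm (indicator (cball 0 r) z + \<bar>f z\<bar> powr p)"
      using le by (intro AE_I2) (auto simp: indicator_def)
  qed
qed

text \<open>Local integrability gives forward windows [0,m] at almost every point, and then at all
  its shifts by \<open>- k\<close> at once. A window of length \<open>2 * k\<close> based at the
  shift by \<open>- k\<close> covers the chord as soon as \<open>k\<close> is at least its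
  length.\<close>

lemma AE_line_integrable:
  assumes g: "locally_integrable g" and g0: "\<And>z. fst z \<notin> D ==> g z = 0"
  shows "AE z in lborel. fst z \<in> D \<and> snd z \<noteq> 0 --> integrable lborel (\<lambda>s. g (shear s z))"
proof -
  have gm: "g \<in> Borel" using g by (simp add: locally_integrable_def)
  have gs: "(\<lambda>s. g (shear s z)) \<in> Borel" for z
    by (rule measurable_compose[OF borel_continuous gm]) (intro continuous_intros)
  have 1: "AE z in lborel. norm z \<le> real n --> integrable lborel (\<lambda>s. indicator {0..real m} s * g (shear s z))" for n m :: nat
  proof -
    have "integrable (lborel \<Otimes>\<^sub>M lborel) (\<lambda>y. indicator (cball 0 (real n)) (fst y) * (indicator {0..real m} (snd y) * g (shear (snd y) (fst y))))"
      by (rule shear_product_integrable(2)[OF g, of _ 1 "real n"])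
        (auto intro!: measurable_compose[OF borel_continuous[of fst] indicator_cball_measurable(1)] continuous_intros simp: indicator_def)
    from lborel_pair.AE_integrable_fst'[OF this] show ?thesis by eventually_elim (auto simp: indicator_def)
  qed
  then have "AE z in lborel. \<forall>n m. norm z \<le> real n --> integrable lborel (\<lambda>s. indicator {0..real m} s * g (shear s z))"
    unfolding AE_all_countable by blast
  then have "AE z in lborel. \<forall>m. integrable lborel (\<lambda>s. indicator {0..real m} s * g (shear s z))"
    by eventually_elim (use real_arch_simple in blast)
  then have "AE z in lborel. \<forall>m. integrable lborel (\<lambda>s. indicator {0..real m} s * g (shear s (shear (- real k) z)))" for k :: nat
    using AE_shear[of "\<lambda>z. \<forall>m. integrable lborel (\<lambda>s. indicator {0..real m} s * g (shear s z))" "- real k"]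
    unfolding shear_def[of "- real k", symmetric] by blast
  then have "AE z in lborel. \<forall>k::nat. \<forall>m. integrable lborel (\<lambda>s. indicator {0..real m} s * g (shear s (shear (- real k) z)))"
    unfolding AE_all_countable[of _ "lborel :: ('a\<times>'a) measure"] by blast
  then show ?thesis
  proof eventually_elim
    fix z assume a: "\<forall>k::nat. \<forall>m. integrable lborel (\<lambda>s. indicator {0..real m} s * g (shear s (shear (- real k) z)))"
    show "fst z \<in> D \<and> snd z \<noteq> 0 --> integrable lborel (\<lambda>s. g (shear s z))"
    proof
      assume z: "fst z \<in> D \<and> snd z \<noteq> 0"
      obtain k :: nat where k: "chord z \<le> real k" using real_arch_simple by blast
      have "integrable lborel (\<lambda>s. indicator {0..real (2*k)} s * g (shear s (shear (- real k) z)))" using a by blast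
      then have "integrable lborel (\<lambda>s. indicator {0..real (2*k)} (real k + 1 * s) * g (shear (real k + 1 * s) (shear (- real k) z)))"
        by (rule lborel_integrable_real_affine) simp
      moreover have "indicator {0..real (2*k)} (real k + 1 * s) * g (shear (real k + 1 * s) (shear (- real k) z)) = g (shear s z)" for s
      proof (cases "fst (shear s z) \<in> D")
        case True
        then have "- et (fst z) (snd z) < s \<and> s < et (fst z) (- snd z)" using line_in_D_iff[of "fst z" "snd z" s] z by simp
        moreover have "0 < et (fst z) (snd z)" "0 < et (fst z) (- snd z)" using exit_time_pos z by auto
        moreover have "et (fst z) (snd z) + et (fst z) (- snd z) \<le> real k" using k by (simp add: chord_def case_prod_beta)
        ultimately have "\<bar>s\<bar> \<le> real k" by linarith
        then show ?thesis by (simp add: shear_shear abs_le_iff)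
      next
        case False
        then show ?thesis using g0[of "shear s z"] by (simp add: shear_shear)
      qed
      ultimately show "integrable lborel (\<lambda>s. g (shear s z))" by simp
    qed
  qed
qed

text \<open>The absolutely continuous candidate along the line through \<open>z\<close>, with base
  value \<open>f z\<close> at \<open>r = 0\<close>.\<close>

definition line_value :: "('a \<times> 'a => real) => ('a \<times> 'a => real) => 'a \<times> 'a => real => real" where
  "line_value f g z r = f z + (line_primitive g z r - line_primitive g z 0)"

definition good_line :: "('a \<times> 'a => real) => ('a \<times> 'a => real) => 'a \<times> 'a => bool" where
  "good_line f g z \<longleftrightarrow> integrable lborel (\<lambda>s. g (shear s z)) \<and>
     (AE r in lborel. fst (shear r z) \<in> D --> f (shear r z) = line_value f g z r)"

text \<open>For each fixed \<open>r\<close> the increment formula holds at almost every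
  \<open>z\<close>; Fubini exchanges the quantifiers. For negative \<open>r\<close> it is the
  formula for \<open>- r\<close> at the sheared point.\<close>

lemma AE_good_line:
  assumes f: "locally_integrable f" and g: "locally_integrable g"
    and g0: "\<And>z. fst z \<notin> D ==> g z = 0"
    and weak: "\<And>\<eta>. test_function D \<eta> ==>
      (LINT z|lborel. f z * frechet_derivative \<eta> (at z) (snd z, 0)) = - (LINT z|lborel. g z * \<eta> z)"
  shows "AE z in lborel. fst z \<in> D \<and> snd z \<noteq> 0 --> good_line f g z"
proof -
  have fm: "f \<in> Borel" and gm: "g \<in> Borel"
    using f g by (auto simp: locally_integrable_def)
  have int: "AE z in lborel. fst z \<in> D \<and> snd z \<noteq> 0 --> integrable lborel (\<lambda>s. g (shear s z))"
    by (rule AE_line_integrable[OF g]) (rule g0)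
  have wd: "AE z in lborel. fst z \<in> D \<and> fst (shear h z) \<in> D --> f (shear h z) = f z + (LINT s|lborel. indicator {0..h} s * g (shear s z))"
    if "0 \<le> h" for h
    by (rule weak_derivative_shear[OF f g _ that]) (rule weak)
  have eq: "AE z in lborel. fst z \<in> D \<and> snd z \<noteq> 0 \<and> fst (shear r z) \<in> D --> f (shear r z) = line_value f g z r" for r
  proof (cases "0 \<le> r")
    case True
    show ?thesis using wd[OF True] int
    proof eventually_elim
      fix z assume a: "fst z \<in> D \<and> fst (shear r z) \<in> D --> f (shear r z) = f z + (LINT s|lborel. indicator {0..r} s * g (shear s z))"
        and i: "fst z \<in> D \<and> snd z \<noteq> 0 --> integrable lborel (\<lambda>s. g (shear s z))"
      show "fst z \<in> D \<and> snd z \<noteq> 0 \<and> fst (shear r z) \<in> D --> f (shear r z) = line_value f g z r"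
      proof
        assume z: "fst z \<in> D \<and> snd z \<noteq> 0 \<and> fst (shear r z) \<in> D"
        have "has_bochner_integral lborel (\<lambda>s. indicator {0<..r} s * g (shear s z)) (line_primitive g z r - line_primitive g z 0)"
          by (rule line_primitive_diff[OF _ True]) (use i z in simp)
        then have "(LINT s|lborel. indicator {0<..r} s * g (shear s z)) = line_primitive g z r - line_primitive g z 0"
          by (rule has_bochner_integral_integral_eq)
        moreover have "(LINT s|lborel. indicator {0<..r} s * g (shear s z)) = (LINT s|lborel. indicator {0..r} s * g (shear s z))"
        proof (rule integral_cong_AE)
          have gs: "(\<lambda>s. g (shear s z)) \<in> Borel"
            by (rule measurable_compose[OF borel_continuous gm]) (intro continuous_intros)
          then show "(\<lambda>s. indicator {0<..r} s * g (shear s z)) \<in> borel_measurable lborel" "(\<lambda>s. indicator {0..r} s * g (shear s z)) \<in> borel_measurable lborel"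
            by simp_all
          show "AE s in lborel. indicator {0<..r} s * g (shear s z) = indicator {0..r} s * g (shear s z)"
            using AE_lborel_singleton[of 0] by eventually_elim (auto simp: indicator_def)
        qed
        ultimately show "f (shear r z) = line_value f g z r" using a z by (simp add: line_value_def)
      qed
    qed
  next
    case False
    then have r: "0 \<le> - r" by simp
    show ?thesis using AE_shear[OF wd[OF r], of r] int
      unfolding shear_def[of r, symmetric] shear_shear
    proof eventually_elim
      fix z assume a: "fst (shear r z) \<in> D \<and> fst (shear (r + - r) z) \<in> D --> f (shear (r + - r) z) = f (shear r z) + (LINT s|lborel. indicator {0..- r} s * g (shear (r + s) z))"
        and i: "fst z \<in> D \<and> snd z \<noteq> 0 --> integrable lborel (\<lambda>s. g (shear s z))"
      show "fst z \<in> D \<and> snd z \<noteq> 0 \<and> fst (shear r z) \<in> D --> f (shear r z) = line_value f g z r"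
      proof
        assume z: "fst z \<in> D \<and> snd z \<noteq> 0 \<and> fst (shear r z) \<in> D"
        have "has_bochner_integral lborel (\<lambda>s. indicator {r<..0} s * g (shear s z)) (line_primitive g z 0 - line_primitive g z r)"
          by (rule line_primitive_diff) (use i z False in auto)
        then have "(LINT s|lborel. indicator {r<..0} s * g (shear s z)) = line_primitive g z 0 - line_primitive g z r"
          by (rule has_bochner_integral_integral_eq)
        also have "(LINT s|lborel. indicator {r<..0} s * g (shear s z)) = (LINT s|lborel. indicator {r<..0} (r + 1 * s) * g (shear (r + 1 * s) z))"
          by (subst lborel_integral_real_affine[of 1 _ r]) auto
        also have "... = (LINT s|lborel. indicator {0..- r} s * g (shear (r + s) z))"
        proof (rule integral_cong_AE)
          have gs: "(\<lambda>s. g (shear (r + s) z)) \<in> Borel"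
            by (rule measurable_compose[OF borel_continuous gm]) (intro continuous_intros)
          then show "(\<lambda>s. indicator {r<..0} (r + 1 * s) * g (shear (r + 1 * s) z)) \<in> borel_measurable lborel" "(\<lambda>s. indicator {0..- r} s * g (shear (r + s) z)) \<in> borel_measurable lborel"
            by simp_all
          show "AE s in lborel. indicator {r<..0} (r + 1 * s) * g (shear (r + 1 * s) z) = indicator {0..- r} s * g (shear (r + s) z)"
            using AE_lborel_singleton[of 0] by eventually_elim (auto simp: indicator_def)
        qed
        finally show "f (shear r z) = line_value f g z r" using a z by (simp add: line_value_def)
      qed
    qed
  qed
  have "AE z in lborel. AE r in lborel. fst z \<in> D \<and> snd z \<noteq> 0 \<and> fst (shear r z) \<in> D --> f (shear r z) = line_value f g z r"
  proof (rule AE_swap_param[OF _ eq])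
    have Dm: "D \<in> sets borel" using open_D by simp
    have c1: "(\<lambda>y::real\<times>('a\<times>'a). fst (snd y)) \<in> Borel" "(\<lambda>y::real\<times>('a\<times>'a). snd (snd y)) \<in> Borel"
       "(\<lambda>y::real\<times>('a\<times>'a). fst (shear (fst y) (snd y))) \<in> Borel" "(\<lambda>y::real\<times>('a\<times>'a). snd y) \<in> Borel"
      by (intro borel_continuous continuous_intros)+
    have prim: "(\<lambda>y::real\<times>('a\<times>'a). line_primitive g (snd y) (fst y)) \<in> Borel"
    proof -
      have sc: "(\<lambda>u::(real\<times>('a\<times>'a))\<times>real. shear (snd u) (snd (fst u))) \<in> Borel"
        by (intro borel_continuous continuous_intros)
      have cl: "{u::(real\<times>('a\<times>'a))\<times>real. snd u \<le> fst (fst u)} \<in> sets borel"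
        by (intro borel_closed closed_Collect_le continuous_intros)
      have "(\<lambda>u::(real\<times>('a\<times>'a))\<times>real. indicator {u. snd u \<le> fst (fst u)} u * g (shear (snd u) (snd (fst u)))) \<in> Borel"
        by (rule borel_measurable_times[OF borel_measurable_indicator[OF cl] measurable_compose[OF sc gm]])
      then have "(\<lambda>(y, s). indicator {..fst y} s * g (shear s (snd y))) \<in> borel_measurable (borel :: ((real\<times>('a\<times>'a))\<times>real) measure)"
        by (simp add: case_prod_unfold indicator_def)
      then have "(\<lambda>(y, s). indicator {..fst y} s * g (shear s (snd y))) \<in> borel_measurable ((lborel :: (real\<times>('a\<times>'a)) measure) \<Otimes>\<^sub>M (lborel :: real measure))"
        by (simp add: lborel_prod)
      then have "(\<lambda>y. LINT s|lborel. indicator {..fst y} s * g (shear s (snd y))) \<in> borel_measurable (lborel :: (real\<times>('a\<times>'a)) measure)"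
        by (rule lborel.borel_measurable_lebesgue_integral)
      then show ?thesis by (simp add: line_primitive_def)
    qed
    have prim0: "(\<lambda>y::real\<times>('a\<times>'a). line_primitive g (snd y) 0) \<in> Borel"
      using measurable_compose[OF borel_continuous[of "\<lambda>y::real\<times>('a\<times>'a). (0::real, snd y)"] prim] by (simp add: continuous_intros)
    have lv: "(\<lambda>y::real\<times>('a\<times>'a). line_value f g (snd y) (fst y)) \<in> Borel"
      unfolding line_value_def by (intro borel_measurable_add borel_measurable_diff prim prim0 measurable_compose[OF c1(4) fm])
    have fs: "(\<lambda>y::real\<times>('a\<times>'a). f (shear (fst y) (snd y))) \<in> Borel"
      by (rule measurable_compose[OF shear_measurable2 fm])
    show "Measurable.pred borel (\<lambda>y::real\<times>('a\<times>'a). fst (snd y) \<in> D \<and> snd (snd y) \<noteq> 0 \<and> fst (shear (fst y) (snd y)) \<in> D --> f (shear (fst y) (snd y)) = line_value f g (snd y) (fst y))"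
      using c1 Dm lv fs by measurable
  qed
  then show ?thesis using int
    by eventually_elim (auto simp: good_line_def elim!: eventually_mono)
qed

text \<open>Removes the exceptional parameters at one prescribed point: the candidates based at
  \<open>z\<close> and at \<open>shear q z\<close> differ by a constant along the line, and as both
  lines are good they agree somewhere.\<close>

lemma good_line_consistent:
  assumes z: "fst z \<in> D" "snd z \<noteq> 0" "good_line f g z" and w: "good_line f g (shear q z)" "fst (shear q z) \<in> D"
  shows "f (shear q z) = line_value f g z q"
proof -
  have 1: "AE r in lborel. fst (shear r z) \<in> D --> f (shear r z) = line_value f g z r"
    and 2: "AE r in lborel. fst (shear r (shear q z)) \<in> D --> f (shear r (shear q z)) = line_value f g (shear q z) r"
    using z w by (auto simp: good_line_def)
  have "AE r in lborel. fst (shear (q + r) z) \<in> D --> f (shear (q + r) z) = line_value f g z (q + r)"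
    using AE_lborel_affine[OF 1, of 1 q] by simp
  with 2 have ae: "AE r in lborel. fst (shear (q + r) z) \<in> D --> line_value f g z (q + r) = line_value f g (shear q z) r"
    by eventually_elim (auto simp: shear_shear)
  have "- et (fst z) (snd z) < q" "q < et (fst z) (- snd z)" using line_in_D_iff[OF z(1,2), of q] w(2) by auto
  then obtain r where "- et (fst z) (snd z) - q < r" "r < et (fst z) (- snd z) - q"
    and r: "fst (shear (q + r) z) \<in> D --> line_value f g z (q + r) = line_value f g (shear q z) r"
    using AE_lborel_open_ex[OF ae, of "- et (fst z) (snd z) - q" "et (fst z) (- snd z) - q"] by auto
  then have "fst (shear (q + r) z) \<in> D" using line_in_D_iff[OF z(1,2), of "q + r"] by auto
  with r have "line_value f g z (q + r) = line_value f g (shear q z) r" by simp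
  then show ?thesis by (simp add: line_value_def line_primitive_shear add.commute)
qed

end

section \<open>The boundary condition along trajectories\<close>

context bounded_convex_domain
begin

text \<open>The trace is a limit of a representative that agrees with \<open>line_value\<close> at
  almost every point of almost every line, so the limits at the end of the chord coincide. The sign
  \<epsilon> treats both ends at once.\<close>

lemma line_value_eq_trace:
  fixes \<epsilon> :: real
  assumes smooth: "smooth_domain D" and \<epsilon>: "\<epsilon> = 1 \<or> \<epsilon> = - 1"
    and good: "AE z in lborel. fst z \<in> D \<and> snd z \<noteq> 0 --> good_line f g z"
    and eq: "AE z in lborel. fst z \<in> D --> \<psi> z = f z"
    and tr: "AE z in flux_measure D {(x, v). x \<in> frontier D \<and> \<epsilon> * (v \<bullet> outward_normal D x) \<le> 0}.
      ((\<lambda>s. \<psi> (fst z + (\<epsilon> * s) *\<^sub>R snd z, snd z)) \<longlongrightarrow> k z) (at_right 0)"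
  shows "AE z in lborel. fst z \<in> D \<and> snd z \<noteq> 0 -->
    k (fst z - (\<epsilon> * et (fst z) (\<epsilon> *\<^sub>R snd z)) *\<^sub>R snd z, snd z) = line_value f g z (- \<epsilon> * et (fst z) (\<epsilon> *\<^sub>R snd z))"
  using AE_flux_imp_AE_phase[OF smooth \<epsilon> tr] good AE_imp_AE_lines[OF eq]
proof eventually_elim
  fix z :: "'a \<times> 'a"
  let ?T = "- \<epsilon> * et (fst z) (\<epsilon> *\<^sub>R snd z)"
  let ?y = "(fst z - (\<epsilon> * et (fst z) (\<epsilon> *\<^sub>R snd z)) *\<^sub>R snd z, snd z)"
  assume 1: "fst z \<in> D \<and> snd z \<noteq> 0 --> ((\<lambda>s. \<psi> (fst ?y + (\<epsilon> * s) *\<^sub>R snd ?y, snd ?y)) \<longlongrightarrow> k ?y) (at_right 0)"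
    and 2: "fst z \<in> D \<and> snd z \<noteq> 0 --> good_line f g z"
    and 3: "AE s in lborel. fst (fst z + s *\<^sub>R snd z, snd z) \<in> D --> \<psi> (fst z + s *\<^sub>R snd z, snd z) = f (fst z + s *\<^sub>R snd z, snd z)"
  show "fst z \<in> D \<and> snd z \<noteq> 0 --> k ?y = line_value f g z ?T"
  proof
    assume z: "fst z \<in> D \<and> snd z \<noteq> 0"
    have gl: "integrable lborel (\<lambda>s. g (shear s z))" and ae: "AE r in lborel. fst (shear r z) \<in> D --> f (shear r z) = line_value f g z r"
      using 2 z by (auto simp: good_line_def)
    have e1: "(fst ?y + (\<epsilon> * s) *\<^sub>R snd ?y, snd ?y) = shear (?T + \<epsilon> * s) z" for s
      by (simp add: shear_def algebra_simps)
    have e2: "(fst z + s *\<^sub>R snd z, snd z) = shear s z" for s by (simp add: shear_def)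
    have "AE r in lborel. fst (shear r z) \<in> D --> \<psi> (shear r z) = line_value f g z r"
      using ae 3 unfolding e2 by eventually_elim auto
    from AE_lborel_affine[OF this, of \<epsilon> ?T] \<epsilon> have ae2: "AE s in lborel. fst (shear (?T + \<epsilon> * s) z) \<in> D --> \<psi> (shear (?T + \<epsilon> * s) z) = line_value f g z (?T + \<epsilon> * s)"
      by auto
    have inD: "fst (shear (?T + \<epsilon> * s) z) \<in> D" if s: "0 < s" "s < chord z" for s
    proof -
      have pos: "0 < et (fst z) (snd z)" "0 < et (fst z) (- snd z)" using exit_time_pos z by auto
      show ?thesis using \<epsilon> pos s line_in_D_iff[of "fst z" "snd z" "?T + \<epsilon> * s"] z by (auto simp: chord_def)
    qed
    show "k ?y = line_value f g z ?T"
    proof (rule tendsto_at_right_AE_unique)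
      show "((\<lambda>s. \<psi> (shear (?T + \<epsilon> * s) z)) \<longlongrightarrow> k ?y) (at_right 0)" using 1 z unfolding e1 by blast
      have "((\<lambda>s. line_primitive g z (?T + \<epsilon> * s)) \<longlongrightarrow> line_primitive g z ?T) (at_right 0)"
        using \<epsilon> line_primitive_tendsto[OF gl, of ?T] by auto
      then show "((\<lambda>s. line_value f g z (?T + \<epsilon> * s)) \<longlongrightarrow> line_value f g z ?T) (at_right 0)"
        unfolding line_value_def by (intro tendsto_intros)
      show "0 < chord z" using chord_pos[of "fst z" "snd z"] z by simp
      show "AE s in lborel. 0 < s \<and> s < chord z --> \<psi> (shear (?T + \<epsilon> * s) z) = line_value f g z (?T + \<epsilon> * s)"
        using ae2 by eventually_elim (use inD in blast)
    qed
  qed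
qed

text \<open>The outgoing trace at the reversed velocity is obtained from the statement about
  \<open>has_trace_plus\<close> by reversing all velocities: the same chord is then traversed in the
  opposite direction and ends at the same boundary point.\<close>

lemma bounce_back_line_value:
  assumes smooth: "smooth_domain D"
    and good: "AE z in lborel. fst z \<in> D \<and> snd z \<noteq> 0 --> good_line f g z"
    and eq: "AE z in phase_space D. \<psi> z = f z"
    and minus: "has_trace_minus D \<psi> k\<^sub>m" and plus: "has_trace_plus D \<psi> k\<^sub>p"
    and bc: "AE (x, v) in flux_measure D (Gamma_minus D). k\<^sub>m (x, v) = \<gamma> * k\<^sub>p (x, - v)"
  shows "AE z in lborel. fst z \<in> D \<and> snd z \<noteq> 0 -->
    line_value f g z (- et (fst z) (snd z)) = \<gamma> * line_value f g (fst z, - snd z) (et (fst z) (snd z))"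
proof -
  have Gm: "Gamma_minus D = {(x, v). x \<in> frontier D \<and> 1 * (v \<bullet> outward_normal D x) \<le> 0}" by (auto simp: Gamma_minus_def)
  have Gp: "Gamma_plus D = {(x, v). x \<in> frontier D \<and> - 1 * (v \<bullet> outward_normal D x) \<le> 0}" by (auto simp: Gamma_plus_def)
  obtain \<psi>1 where \<psi>1: "AE z in phase_space D. \<psi>1 z = \<psi> z"
    and t1: "AE (x, v) in flux_measure D (Gamma_minus D). ((\<lambda>s. \<psi>1 (x + s *\<^sub>R v, v)) \<longlongrightarrow> k\<^sub>m (x, v)) (at_right 0)"
    using minus unfolding has_trace_minus_def by blast
  obtain \<psi>2 where \<psi>2: "AE z in phase_space D. \<psi>2 z = \<psi> z"
    and t2: "AE (x, v) in flux_measure D (Gamma_plus D). ((\<lambda>s. \<psi>2 (x - s *\<^sub>R v, v)) \<longlongrightarrow> k\<^sub>p (x, v)) (at_right 0)"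
    using plus unfolding has_trace_plus_def by blast
  have "AE z in phase_space D. \<psi>1 z = f z" "AE z in phase_space D. \<psi>2 z = f z"
    using \<psi>1 \<psi>2 eq by (auto elim: eventually_elim2)
  then have e: "AE z in lborel. fst z \<in> D --> \<psi>1 z = f z" "AE z in lborel. fst z \<in> D --> \<psi>2 z = f z"
    unfolding AE_phase_space[OF open_D] .
  have "AE z in lborel. fst z \<in> D \<and> snd z \<noteq> 0 --> k\<^sub>m (fst z - (1 * et (fst z) (1 *\<^sub>R snd z)) *\<^sub>R snd z, snd z) = line_value f g z (- 1 * et (fst z) (1 *\<^sub>R snd z))"
    by (rule line_value_eq_trace[OF smooth _ good e(1)]) (use t1[unfolded Gm] in \<open>simp_all add: case_prod_beta\<close>)
  moreover have "AE z in lborel. fst z \<in> D \<and> snd z \<noteq> 0 --> k\<^sub>p (fst z - (- 1 * et (fst z) (- 1 *\<^sub>R snd z)) *\<^sub>R snd z, snd z) = line_value f g z (- (- 1) * et (fst z) (- 1 *\<^sub>R snd z))"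
    by (rule line_value_eq_trace[OF smooth _ good e(2)]) (use t2[unfolded Gp] in \<open>simp_all add: case_prod_beta\<close>)
  note AE_reflect_velocity[OF this]
  moreover have "AE z in lborel. fst z \<in> D \<and> snd z \<noteq> 0 --> k\<^sub>m (fst z - (1 * et (fst z) (1 *\<^sub>R snd z)) *\<^sub>R snd z, snd z)
      = \<gamma> * k\<^sub>p (fst z - (1 * et (fst z) (1 *\<^sub>R snd z)) *\<^sub>R snd z, - snd z)"
    using AE_flux_imp_AE_phase[OF smooth _ bc[unfolded Gm]] by simp
  ultimately show ?thesis by eventually_elim auto
qed

text \<open>\<open>Z n\<close> is the line followed after \<open>n\<close> bounces,
  \<open>A n\<close> its backward exit time, and \<open>c n\<close> is the offset for which the
  trajectory is at parameter \<open>c n - s\<close> of \<open>Z n\<close> at time \<open>s\<close>.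
  Each piece integrates to an increment of \<open>line_value\<close>; the boundary condition cancels
  the values at the bounces, so the sum telescopes.\<close>

lemma bounce_op_integral_piecewise:
  fixes n :: nat and x v :: 'a
  defines "Z \<equiv> \<lambda>n::nat. if even n then (x, v) else (x, - v)"
  defines "A \<equiv> \<lambda>n. et (fst (Z n)) (snd (Z n))"
  defines "c \<equiv> \<lambda>n. et x v + real n * chord (x, v) - A n"
  assumes x: "x \<in> D" and v: "v \<noteq> 0" and gm: "g \<in> Borel"
    and int: "\<And>n. integrable lborel (\<lambda>s. g (shear s (Z n)))"
    and bc: "\<And>n. line_value f g (Z n) (- A n) = \<gamma> * line_value f g (Z (Suc n)) (A n)"
    and t: "0 \<le> t" "et x v + (real n - 1) * chord (x, v) \<le> t" "t \<le> et x v + real n * chord (x, v)"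
  shows "has_bochner_integral lborel (\<lambda>s. indicator {0<..t} s * bounce_op \<gamma> (\<lambda>_. 0) 0 s g (x, v))
    (f (x, v) - \<gamma> ^ n * line_value f g (Z n) (c n - t))"
proof -
  let ?k = "\<lambda>s. bounce_op \<gamma> (\<lambda>_. 0) 0 s g (x, v)" and ?\<tau> = "chord (x, v)"
  have \<tau>: "0 < ?\<tau>" by (rule chord_pos[OF x v])
  have A: "A n + A (Suc n) = ?\<tau>" for n by (simp add: A_def Z_def chord_def)
  have fl: "?k s = \<gamma> ^ n * g (shear (c n - s) (Z n))"
    if "et x v + (real n - 1) * ?\<tau> \<le> s" "s < et x v + real n * ?\<tau>" for n s
  proof -
    have b: "bounces s (x, v) = n" by (rule bounces_eqI[OF x v]) (use that in \<open>simp_all add: algebra_simps\<close>)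
    then have "flow s (x, v) = shear (c n - s) (Z n)"
      by (auto simp: flow_def since_def c_def A_def Z_def shear_def algebra_simps)
    with b show ?thesis by (simp add: bounce_op_def)
  qed
  have km: "?k \<in> Borel"
    using measurable_compose[OF borel_continuous[of "\<lambda>s::real. (s, (x, v))"] bounce_op_measurable[of "\<lambda>_. 0" g \<gamma> 0]] gm
    by (simp add: continuous_intros)
  have piece: "has_bochner_integral lborel (\<lambda>s. indicator {a<..b} s * ?k s)
       (\<gamma> ^ n * (line_value f g (Z n) (c n - a) - line_value f g (Z n) (c n - b)))"
    if ab: "a \<le> b" "et x v + (real n - 1) * ?\<tau> \<le> a" "b \<le> et x v + real n * ?\<tau>" for a b n
  proof -
    have "has_bochner_integral lborel (\<lambda>s. indicator {c n - b<..c n - a} s * g (shear s (Z n))) (line_primitive g (Z n) (c n - a) - line_primitive g (Z n) (c n - b))"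
      by (rule line_primitive_diff[OF int]) (use ab in simp)
    then have "has_bochner_integral lborel (\<lambda>s. indicator {c n - b<..c n - a} (c n + (- 1) * s) * g (shear (c n + (- 1) * s) (Z n))) ((line_primitive g (Z n) (c n - a) - line_primitive g (Z n) (c n - b)) /\<^sub>R \<bar>- 1\<bar>)"
      by (subst (asm) lborel_has_bochner_integral_real_affine_iff[of "-1" _ _ "c n"]) auto
    from has_bochner_integral_mult_right[OF this, of "\<gamma> ^ n"]
    have hb: "has_bochner_integral lborel (\<lambda>s. \<gamma> ^ n * (indicator {c n - b<..c n - a} (c n + (- 1) * s) * g (shear (c n + (- 1) * s) (Z n))))
       (\<gamma> ^ n * (line_value f g (Z n) (c n - a) - line_value f g (Z n) (c n - b)))"
      by (simp add: line_value_def algebra_simps)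
    show ?thesis
    proof (rule has_bochner_integral_lborel_cong_AE[OF hb])
      show "(\<lambda>s. indicator {a<..b} s * ?k s) \<in> Borel" using km by simp
      show "AE s in lborel. \<gamma> ^ n * (indicator {c n - b<..c n - a} (c n + (- 1) * s) * g (shear (c n + (- 1) * s) (Z n))) = indicator {a<..b} s * ?k s"
        using AE_lborel_singleton[of a] AE_lborel_singleton[of b]
      proof eventually_elim
        fix s assume s: "s \<noteq> a" "s \<noteq> b"
        show "\<gamma> ^ n * (indicator {c n - b<..c n - a} (c n + (- 1) * s) * g (shear (c n + (- 1) * s) (Z n))) = indicator {a<..b} s * ?k s"
        proof (cases "a < s \<and> s < b")
          case True
          then show ?thesis using fl[of n s] ab by auto
        next
          case False
          then show ?thesis using s by (auto simp: indicator_def)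
        qed
      qed
    qed
  qed
  show ?thesis using t
  proof (induction n arbitrary: t)
    case 0
    have "c 0 = 0" "Z 0 = (x, v)" by (simp_all add: c_def A_def Z_def)
    moreover have "et x v + (real 0 - 1) * ?\<tau> \<le> 0" using exit_time_less_chord[OF x v] by simp
    ultimately show ?case using piece[of 0 t 0] 0 by (simp add: line_value_def)
  next
    case (Suc n)
    let ?a = "et x v + real n * ?\<tau>"
    have a: "0 \<le> ?a" using exit_time_pos[OF x v] \<tau> by simp
    have "?\<tau> \<ge> 0" using \<tau> by simp
    then have "et x v + (real n - 1) * ?\<tau> \<le> ?a" by (simp add: algebra_simps)
    from Suc.IH[OF a this] have 1: "has_bochner_integral lborel (\<lambda>s. indicator {0<..?a} s * ?k s) (f (x, v) - \<gamma> ^ n * line_value f g (Z n) (c n - ?a))"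
      by simp
    \<comment> \<open>At the bounce the old line is left at parameter \<open>- A n\<close> and the
      new one entered at \<open>A n\<close>, which are the two arguments in
      \<open>bc\<close>.\<close>
    have c: "c n - ?a = - A n" "c (Suc n) - ?a = A n" using A[of n] by (simp_all add: c_def algebra_simps)
    have at: "?a \<le> t" using Suc.prems by simp
    have 2: "has_bochner_integral lborel (\<lambda>s. indicator {?a<..t} s * ?k s)
       (\<gamma> ^ Suc n * (line_value f g (Z (Suc n)) (c (Suc n) - ?a) - line_value f g (Z (Suc n)) (c (Suc n) - t)))"
      by (rule piece[OF at]) (use Suc.prems in simp_all)
    have "(\<lambda>s. indicator {0<..?a} s * ?k s + indicator {?a<..t} s * ?k s) = (\<lambda>s. indicator {0<..t} s * ?k s)"
      using a at by (auto simp: indicator_def)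
    with has_bochner_integral_add[OF 1 2] show ?case unfolding c bc by (simp add: algebra_simps)
  qed
qed

text \<open>The piecewise computation uses both orientations of the line, hence the facts at
  reversed velocity. The final value is that of the given representative \<open>f\<close>, because
  the end point of the trajectory lies on a good line for almost every start.\<close>

lemma bounce_op_integral:
  assumes t: "0 \<le> t" and gm: "g \<in> Borel"
    and good: "AE z in lborel. fst z \<in> D \<and> snd z \<noteq> 0 --> good_line f g z"
    and bc: "AE z in lborel. fst z \<in> D \<and> snd z \<noteq> 0 -->
      line_value f g z (- et (fst z) (snd z)) = \<gamma> * line_value f g (fst z, - snd z) (et (fst z) (snd z))"
  shows "AE z in lborel. fst z \<in> D --> has_bochner_integral lborel
    (\<lambda>s. indicator {0<..t} s * bounce_op \<gamma> (\<lambda>_. 0) 0 s g z) (f z - bounce_op \<gamma> (\<lambda>_. 0) 0 t f z)"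
proof -
  have nz: "AE z in lborel. fst z \<in> D --> good_line f g z"
    using good AE_velocity_nonzero by eventually_elim auto
  show ?thesis
    using good bc AE_reflect_velocity[OF good] AE_reflect_velocity[OF bc] AE_flow[OF t nz]
  proof eventually_elim
    fix z :: "'a \<times> 'a"
    obtain x v where zx: "z = (x, v)" by force
    assume g1: "fst z \<in> D \<and> snd z \<noteq> 0 --> good_line f g z"
      and b1: "fst z \<in> D \<and> snd z \<noteq> 0 --> line_value f g z (- et (fst z) (snd z)) = \<gamma> * line_value f g (fst z, - snd z) (et (fst z) (snd z))"
      and g2: "fst (fst z, - snd z) \<in> D \<and> snd (fst z, - snd z) \<noteq> 0 --> good_line f g (fst z, - snd z)"
      and b2: "fst (fst z, - snd z) \<in> D \<and> snd (fst z, - snd z) \<noteq> 0 -->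
         line_value f g (fst z, - snd z) (- et (fst (fst z, - snd z)) (snd (fst z, - snd z))) =
         \<gamma> * line_value f g (fst (fst z, - snd z), - snd (fst z, - snd z)) (et (fst (fst z, - snd z)) (snd (fst z, - snd z)))"
      and fl: "fst z \<in> D --> regular t z \<and> good_line f g (flow t z)"
    show "fst z \<in> D --> has_bochner_integral lborel (\<lambda>s. indicator {0<..t} s * bounce_op \<gamma> (\<lambda>_. 0) 0 s g z) (f z - bounce_op \<gamma> (\<lambda>_. 0) 0 t f z)"
    proof
      assume "fst z \<in> D"
      then have x: "x \<in> D" and reg: "regular t (x, v)" and gf: "good_line f g (flow t (x, v))" using fl zx by auto
      then have v: "v \<noteq> 0" by (simp add: regular_def)
      define n where "n = bounces t (x, v)"
      let ?Z = "\<lambda>n::nat. if even n then (x, v) else (x, - v)"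
      let ?A = "\<lambda>n. et (fst (?Z n)) (snd (?Z n))"
      let ?q = "et x v + real n * chord (x, v) - ?A n - t"
      have gl: "good_line f g (?Z m)" for m using g1 g2 x v zx by auto
      have sb: "0 < since t (x, v)" "since t (x, v) \<le> chord (x, v)" by (rule since_bounds[OF x v t])+
      have hb: "has_bochner_integral lborel (\<lambda>s. indicator {0<..t} s * bounce_op \<gamma> (\<lambda>_. 0) 0 s g (x, v)) (f (x, v) - \<gamma> ^ n * line_value f g (?Z n) ?q)"
      proof (rule bounce_op_integral_piecewise[OF x v gm _ _ t])
        show "integrable lborel (\<lambda>s. g (shear s (?Z m)))" for m using gl[of m] by (simp add: good_line_def)
        show "line_value f g (?Z m) (- ?A m) = \<gamma> * line_value f g (?Z (Suc m)) (?A m)" for m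
          using b1 b2 x v zx by (cases "even m") auto
      qed (use sb in \<open>simp_all add: since_def n_def[symmetric] algebra_simps\<close>)
      have fq: "flow t (x, v) = shear ?q (?Z n)"
        by (auto simp: flow_def since_def n_def[symmetric] shear_def algebra_simps)
      have "f (shear ?q (?Z n)) = line_value f g (?Z n) ?q"
      proof (rule good_line_consistent)
        show "fst (?Z n) \<in> D" "snd (?Z n) \<noteq> 0" using x v by auto
        show "good_line f g (?Z n)" by (rule gl)
        show "good_line f g (shear ?q (?Z n))" "fst (shear ?q (?Z n)) \<in> D" using gf flow_regular(1)[OF reg] unfolding fq by auto
      qed
      then have "bounce_op \<gamma> (\<lambda>_. 0) 0 t f (x, v) = \<gamma> ^ n * line_value f g (?Z n) ?q"
        by (simp add: bounce_op_def n_def[symmetric] fq)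
      with hb show "has_bochner_integral lborel (\<lambda>s. indicator {0<..t} s * bounce_op \<gamma> (\<lambda>_. 0) 0 s g z) (f z - bounce_op \<gamma> (\<lambda>_. 0) 0 t f z)"
        by (simp add: zx)
    qed
  qed
qed

end

section \<open>The generator on the bounce-back domain\<close>

lemma powr_above_tangent:
  fixes p c y :: real
  assumes p: "1 \<le> p" and "0 \<le> c" "0 \<le> y"
  shows "p * c powr (p - 1) * y \<le> y powr p + (p - 1) * c powr p"
proof (cases "c = 0")
  case True
  then show ?thesis using p by simp
next
  case False
  with assms have c: "0 < c" by simp
  have "p * c powr (p - 1) * (y - c) \<le> y powr p - c powr p"
  proof (rule convex_on_imp_above_tangent[OF convex_powr[OF p]])
    show "c \<in> interior {0..}" using c by simp
    show "((\<lambda>x. x powr p) has_real_derivative p * c powr (p - 1)) (at c within {0..})"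
      using c by (auto intro!: derivative_eq_intros)
  qed (use assms in auto)
  moreover have t: "c powr (p - 1) * c = c powr p" using c powr_add[of c "p - 1" 1] by simp
  have "p * c powr (p - 1) * c = p * c powr p" by (simp only: mult.assoc t)
  ultimately show ?thesis by (simp add: right_diff_distrib left_diff_distrib)
qed

text \<open>Jensen's inequality for averages over an interval, from the tangent to
  \<open>y powr p\<close> at \<open>c\<close>, the absolute value of the mean. The case of an
  infinite integral is split off so that the comparison can be made in the reals.\<close>

lemma powr_mean_le:
  fixes k :: "real => real"
  assumes p: "1 \<le> p" and h: "0 < h" and k: "k \<in> Borel"
    and hb: "has_bochner_integral lborel (\<lambda>s. indicator {0<..h} s * k s) I"
  shows "ennreal (\<bar>I / h\<bar> powr p) \<le> ennreal (1 / h) * (\<integral>\<^sup>+s. indicator {0<..h} s * ennreal (\<bar>k s\<bar> powr p) \<partial>lborel)"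
proof (cases "(\<integral>\<^sup>+s. indicator {0<..h} s * ennreal (\<bar>k s\<bar> powr p) \<partial>lborel) = \<infinity>")
  case True
  then show ?thesis using h by (simp add: ennreal_mult_eq_top_iff ennreal_mult_top)
next
  case False
  note [measurable] = k
  let ?X = "\<integral>\<^sup>+s. indicator {0<..h} s * ennreal (\<bar>k s\<bar> powr p) \<partial>lborel"
  obtain r where r: "0 \<le> r" "?X = ennreal r" using False by (cases ?X) auto
  define c where "c = \<bar>I\<bar> / h"
  have c: "0 \<le> c" "\<bar>I\<bar> = c * h" using h by (simp_all add: c_def)
  have "ennreal \<bar>I\<bar> \<le> (\<integral>\<^sup>+s. ennreal (norm (indicator {0<..h} s * k s)) \<partial>lborel)"
    using integral_norm_bound_ennreal[of lborel "\<lambda>s. indicator {0<..h} s * k s"] hb by (simp add: has_bochner_integral_iff)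
  then have "ennreal (p * c powr (p - 1)) * ennreal \<bar>I\<bar> \<le> ennreal (p * c powr (p - 1)) * (\<integral>\<^sup>+s. ennreal (norm (indicator {0<..h} s * k s)) \<partial>lborel)"
    by (rule mult_left_mono) simp
  also have "... = (\<integral>\<^sup>+s. ennreal (p * c powr (p - 1)) * ennreal (norm (indicator {0<..h} s * k s)) \<partial>lborel)"
    by (rule nn_integral_cmult[symmetric]) measurable
  also have "... \<le> (\<integral>\<^sup>+s. indicator {0<..h} s * ennreal (\<bar>k s\<bar> powr p) + ennreal ((p - 1) * c powr p) * indicator {0<..h} s \<partial>lborel)"
  proof (rule nn_integral_mono)
    fix s
    show "ennreal (p * c powr (p - 1)) * ennreal (norm (indicator {0<..h} s * k s)) \<le> indicator {0<..h} s * ennreal (\<bar>k s\<bar> powr p) + ennreal ((p - 1) * c powr p) * indicator {0<..h} s"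
      using powr_above_tangent[OF p c(1), of "\<bar>k s\<bar>"] p
      by (auto simp: indicator_def ennreal_mult[symmetric] ennreal_plus[symmetric] simp del: ennreal_plus intro!: ennreal_leI)
  qed
  also have "... = ?X + ennreal ((p - 1) * c powr p) * ennreal h"
    using h by (subst nn_integral_add) (auto simp: nn_integral_cmult_indicator)
  also have "... = ennreal (r + (p - 1) * c powr p * h)"
    using r p h by (simp add: ennreal_mult ennreal_plus)
  also have "ennreal (p * c powr (p - 1)) * ennreal \<bar>I\<bar> = ennreal (p * c powr (p - 1) * \<bar>I\<bar>)"
    by (rule ennreal_mult''[symmetric]) simp
  finally have "p * c powr (p - 1) * \<bar>I\<bar> \<le> r + (p - 1) * c powr p * h"
    by (rule ennreal_le_iff[THEN iffD1, rotated]) (use r p h in simp)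
  moreover have "c powr (p - 1) * c = c powr p"
    using c powr_add[of c "p - 1" 1] p by (cases "c = 0") auto
  then have "p * c powr (p - 1) * \<bar>I\<bar> = p * c powr p * h" unfolding c(2) by (simp add: algebra_simps)
  moreover have "(p - 1) * c powr p * h = p * c powr p * h - h * c powr p" by (simp add: algebra_simps)
  ultimately have "h * c powr p \<le> r" by linarith
  then have le: "c powr p \<le> 1 / h * r" using h by (simp add: field_simps)
  have "\<bar>I / h\<bar> = c" using h by (simp add: c_def)
  then show ?thesis unfolding r(2) using ennreal_leI[OF le] h by (simp add: ennreal_mult'[symmetric])
qed

lemma exp_minus_bounds:
  fixes y :: real assumes y: "0 \<le> y"
  shows "\<bar>exp (- y) - 1 + y\<bar> \<le> y\<^sup>2" "\<bar>1 - exp (- y)\<bar> \<le> y"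
proof -
  have 1: "1 - y \<le> exp (- y)" using exp_ge_add_one_self[of "- y"] by simp
  have "(1 + y) * exp (- y) \<le> exp y * exp (- y)" by (rule mult_right_mono) (use exp_ge_add_one_self[of y] in auto)
  also have "... = 1" by (simp add: exp_minus)
  finally have "exp (- y) + y * exp (- y) \<le> 1" by (simp add: algebra_simps)
  moreover have "y * (1 - y) \<le> y * exp (- y)" by (rule mult_left_mono[OF 1 y])
  moreover have "y * (1 - y) = y - y\<^sup>2" by (simp add: power2_eq_square algebra_simps)
  ultimately show "\<bar>exp (- y) - 1 + y\<bar> \<le> y\<^sup>2" using 1 by linarith
  show "\<bar>1 - exp (- y)\<bar> \<le> y" using 1 y by simp
qed

context bounded_convex_domain
begin

text \<open>The function is minus the average over [0,h] of the increments of the orbit of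
  \<open>g\<close>; by Jensen and Fubini its norm is at most the bound \<open>e\<close> for the
  norms of these increments.\<close>

lemma bounce_op_difference_quotient_le:
  assumes \<gamma>: "0 < \<gamma>" "\<gamma> < 1" and p: "1 \<le> p"
    and fm: "f \<in> Borel" and gm: "g \<in> Borel" and g: "g \<in> Lp_space (phase_space D) p"
    and h: "0 < h" and e: "0 \<le> e"
    and le: "\<And>s. 0 < s ==> s \<le> h ==> Lp_norm (phase_space D) p (\<lambda>z. bounce_op \<gamma> (\<lambda>_. 0) 0 s g z - g z) \<le> e"
    and int: "AE z in lborel. fst z \<in> D --> has_bochner_integral lborel
      (\<lambda>s. indicator {0<..h} s * bounce_op \<gamma> (\<lambda>_. 0) 0 s g z) (f z - bounce_op \<gamma> (\<lambda>_. 0) 0 h f z)"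
  shows "(\<lambda>z. (bounce_op \<gamma> (\<lambda>_. 0) 0 h f z - f z) / h + g z) \<in> Lp_space (phase_space D) p"
    "Lp_norm (phase_space D) p (\<lambda>z. (bounce_op \<gamma> (\<lambda>_. 0) 0 h f z - f z) / h + g z) \<le> e"
proof -
  let ?S = "bounce_op \<gamma> (\<lambda>_. 0) 0" and ?M = "phase_space D"
  let ?Q = "\<lambda>z. (?S h f z - f z) / h + g z"
  let ?k = "\<lambda>s z. ?S s g z - g z"
  let ?G = "\<lambda>s z. indicator {0<..h} s * ennreal (\<bar>?k s z\<bar> powr p)"
  have Sf: "?S h f \<in> Borel" by (rule bounce_op_measurable1) (use fm in auto)
  have Q: "?Q \<in> Borel" using Sf fm gm by measurable
  have c: "(\<lambda>y::real\<times>('a\<times>'a). fst y) \<in> Borel" "(\<lambda>y::real\<times>('a\<times>'a). snd y) \<in> Borel"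
    by (intro borel_continuous continuous_intros)+
  have jm: "(\<lambda>y::real\<times>('a\<times>'a). ?k (fst y) (snd y)) \<in> Borel"
    by (intro borel_measurable_diff bounce_op_measurable measurable_compose[OF c(2) gm]) (use gm in auto)
  have jmp: "(\<lambda>y::real\<times>('a\<times>'a). \<bar>?k (fst y) (snd y)\<bar> powr p) \<in> Borel" using jm by measurable
  have ind: "(\<lambda>y::real\<times>('a\<times>'a). indicator {0<..h} (fst y) :: ennreal) \<in> Borel"
    by (rule measurable_compose[OF c(1)]) simp
  have Gm: "(\<lambda>y::real\<times>('a\<times>'a). ?G (fst y) (snd y)) \<in> Borel"
    by (rule borel_measurable_times_ennreal[OF ind measurable_compose[OF jmp measurable_ennreal]])
  have DG: "(\<lambda>y::real\<times>('a\<times>'a). indicator (D \<times> UNIV) (snd y) :: ennreal) \<in> Borel"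
    by (rule measurable_compose[OF c(2)]) (intro borel_measurable_indicator borel_open open_Times open_D open_UNIV)
  have sm: "(\<lambda>s. ?k s z) \<in> Borel" for z
    using measurable_compose[OF borel_continuous[of "\<lambda>s::real. (s, z)"] jm] by (simp add: continuous_intros)
  have pt: "AE z in lborel. fst z \<in> D --> ennreal (\<bar>?Q z\<bar> powr p) \<le> ennreal (1 / h) * (\<integral>\<^sup>+s. ?G s z \<partial>lborel)"
    using int
  proof eventually_elim
    fix z assume hb: "fst z \<in> D --> has_bochner_integral lborel (\<lambda>s. indicator {0<..h} s * ?S s g z) (f z - ?S h f z)"
    show "fst z \<in> D --> ennreal (\<bar>?Q z\<bar> powr p) \<le> ennreal (1 / h) * (\<integral>\<^sup>+s. ?G s z \<partial>lborel)"
    proof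
      assume z: "fst z \<in> D"
      have "has_bochner_integral lborel (\<lambda>s. indicator {0<..h} s *\<^sub>R g z) (h *\<^sub>R g z)"
        using has_bochner_integral_scaleR_left[OF has_bochner_integral_real_indicator[of "{0<..h}" lborel], of "g z"] h by simp
      then have "has_bochner_integral lborel (\<lambda>s. indicator {0<..h} s * ?S s g z - indicator {0<..h} s *\<^sub>R g z) ((f z - ?S h f z) - h *\<^sub>R g z)"
        using has_bochner_integral_diff hb z by blast
      then have "has_bochner_integral lborel (\<lambda>s. indicator {0<..h} s * ?k s z) ((f z - ?S h f z) - h * g z)"
        by (simp add: right_diff_distrib)
      from powr_mean_le[OF p h sm this]
      have "ennreal (\<bar>((f z - ?S h f z) - h * g z) / h\<bar> powr p) \<le> ennreal (1 / h) * (\<integral>\<^sup>+s. ?G s z \<partial>lborel)" .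
      moreover have "((f z - ?S h f z) - h * g z) / h = - ?Q z" using h by (simp add: field_simps)
      ultimately show "ennreal (\<bar>?Q z\<bar> powr p) \<le> ennreal (1 / h) * (\<integral>\<^sup>+s. ?G s z \<partial>lborel)" by (simp only: abs_minus_cancel)
    qed
  qed
  have slice: "(\<integral>\<^sup>+z. ?G s z * indicator (D \<times> UNIV) z \<partial>lborel) \<le> indicator {0<..h} s * ennreal (e powr p)" for s
  proof (cases "s \<in> {0<..h}")
    case True
    then have s: "0 \<le> s" "0 < s" "s \<le> h" by auto
    have L: "?k s \<in> Lp_space ?M p"
      by (intro Lp_diff p g bounce_op_norm_le(1)[OF \<gamma> _ _ p s(1) g]) auto
    have "(\<integral>\<^sup>+z. ?G s z * indicator (D \<times> UNIV) z \<partial>lborel) = (\<integral>\<^sup>+z. ennreal (\<bar>?k s z\<bar> powr p) \<partial>?M)"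
      unfolding nn_integral_phase_space[OF open_D] using True by simp
    also have "... = ennreal (Lp_norm ?M p (?k s) powr p)" by (rule Lp_norm_powr[OF p L])
    also have "... \<le> ennreal (e powr p)" using le[OF s(2,3)] p by (intro ennreal_leI powr_mono2) auto
    finally show ?thesis using True by simp
  qed simp
  have nn: "(\<integral>\<^sup>+z. ennreal (\<bar>?Q z\<bar> powr p) \<partial>?M) \<le> ennreal (e powr p)"
  proof -
    have "(\<integral>\<^sup>+z. ennreal (\<bar>?Q z\<bar> powr p) \<partial>?M) = (\<integral>\<^sup>+z. ennreal (\<bar>?Q z\<bar> powr p) * indicator (D \<times> UNIV) z \<partial>lborel)"
      by (rule nn_integral_phase_space[OF open_D])
    also have "... \<le> (\<integral>\<^sup>+z. \<integral>\<^sup>+s. ennreal (1 / h) * (?G s z * indicator (D \<times> UNIV) z) \<partial>lborel \<partial>lborel)"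
    proof (rule nn_integral_mono_AE, use pt in eventually_elim)
      fix z :: "'a \<times> 'a" assume le: "fst z \<in> D --> ennreal (\<bar>?Q z\<bar> powr p) \<le> ennreal (1 / h) * (\<integral>\<^sup>+s. ?G s z \<partial>lborel)"
      have gsm: "(\<lambda>s. ?G s z) \<in> borel_measurable lborel" using sm[of z] by measurable
      show "ennreal (\<bar>?Q z\<bar> powr p) * indicator (D \<times> UNIV) z \<le> (\<integral>\<^sup>+s. ennreal (1 / h) * (?G s z * indicator (D \<times> UNIV) z) \<partial>lborel)"
        using le gsm by (cases "fst z \<in> D") (auto simp: nn_integral_cmult indicator_def[of "D \<times> UNIV"] mem_Times_iff)
    qed
    also have "... = (\<integral>\<^sup>+s. \<integral>\<^sup>+z. ennreal (1 / h) * (?G s z * indicator (D \<times> UNIV) z) \<partial>lborel \<partial>lborel)"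
      by (rule nn_integral_lborel_swap[of "\<lambda>s z. ennreal (1 / h) * (?G s z * indicator (D \<times> UNIV) z)"])
        (intro borel_measurable_times_ennreal Gm DG borel_measurable_const)
    also have "... \<le> (\<integral>\<^sup>+s. ennreal (1 / h) * (indicator {0<..h} s * ennreal (e powr p)) \<partial>lborel)"
    proof (rule nn_integral_mono)
      fix s :: real
      have "(\<lambda>z. ?k s z) \<in> Borel" using bounce_op_measurable1[OF _ gm, of "\<lambda>_. 0" \<gamma> 0 s] gm by measurable
      moreover have "(indicator (D \<times> UNIV) :: 'a \<times> 'a => ennreal) \<in> Borel"
        by (intro borel_measurable_indicator borel_open open_Times open_D open_UNIV)
      ultimately have "(\<lambda>z. ?G s z * indicator (D \<times> UNIV) z) \<in> borel_measurable lborel" by measurable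
      then have "(\<integral>\<^sup>+z. ennreal (1 / h) * (?G s z * indicator (D \<times> UNIV) z) \<partial>lborel) = ennreal (1 / h) * (\<integral>\<^sup>+z. ?G s z * indicator (D \<times> UNIV) z \<partial>lborel)"
        by (rule nn_integral_cmult)
      also have "... \<le> ennreal (1 / h) * (indicator {0<..h} s * ennreal (e powr p))" by (rule mult_left_mono[OF slice]) simp
      finally show "(\<integral>\<^sup>+z. ennreal (1 / h) * (?G s z * indicator (D \<times> UNIV) z) \<partial>lborel) \<le> ennreal (1 / h) * (indicator {0<..h} s * ennreal (e powr p))" .
    qed
    also have "... = (\<integral>\<^sup>+s. ennreal (1 / h) * ennreal (e powr p) * indicator {0<..h} s \<partial>lborel)" by (simp add: mult_ac)
    also have "... = ennreal (1 / h) * ennreal (e powr p) * ennreal h" using h by (subst nn_integral_cmult_indicator) auto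
    also have "... = ennreal (1 / h * (e powr p) * h)" using h by (simp only: ennreal_mult[symmetric] powr_ge_zero zero_le_divide_1_iff less_imp_le mult_nonneg_nonneg)
    also have "1 / h * (e powr p) * h = e powr p" using h by simp
    finally show ?thesis .
  qed
  show "?Q \<in> Lp_space ?M p" "Lp_norm ?M p ?Q \<le> e"
    by (rule Lp_space_norm_leI[OF p e borel_imp_measurable_phase_space[OF Q] nn])+
qed

text \<open>The absorption is a bounded factor exp(-\<sigma> h) on the operator with zero
  absorption: one error term carries the difference quotient of that case, the two others are of
  order \<open>h\<close>.\<close>

lemma bounce_op_right_derivative:
  assumes \<gamma>: "0 < \<gamma>" "\<gamma> < 1" and p: "1 \<le> p"
    and \<sigma>: "\<sigma> \<in> Borel" "\<And>v. 0 \<le> \<sigma> v" "\<And>v. \<sigma> v \<le> C"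
    and fm: "f \<in> Borel" and f: "f \<in> Lp_space (phase_space D) p"
    and gm: "g \<in> Borel" and g: "g \<in> Lp_space (phase_space D) p"
    and int: "\<And>h. 0 \<le> h ==> AE z in lborel. fst z \<in> D --> has_bochner_integral lborel
      (\<lambda>s. indicator {0<..h} s * bounce_op \<gamma> (\<lambda>_. 0) 0 s g z) (f z - bounce_op \<gamma> (\<lambda>_. 0) 0 h f z)"
  shows "((\<lambda>h. Lp_norm (phase_space D) p (\<lambda>z. (bounce_op \<gamma> \<sigma> 0 h f z - f z) / h - (- g z - \<sigma> (snd z) * f z))) \<longlongrightarrow> 0) (at_right 0)"
proof (rule tendstoI)
  fix e :: real assume e: "0 < e"
  let ?S = "bounce_op \<gamma> (\<lambda>_. 0) 0" and ?M = "phase_space D" and ?N = "Lp_norm (phase_space D) p"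
  let ?Q = "\<lambda>h z. (?S h f z - f z) / h + g z"
  have C: "0 \<le> C" using \<sigma>(2,3)[of 0] by linarith
  have S: "C0_semigroup ?M p ?S" by (rule bounce_op_C0_semigroup[OF \<gamma> _ _ _ p]) auto
  have e2: "0 < e / 2" using e by simp
  obtain d where d: "0 < d" "\<And>h. 0 \<le> h ==> h < d ==> ?N (\<lambda>x. ?S h g x - g x) < e / 2"
    using C0_semigroup_near_0[OF p S g e2] by blast
  have "((\<lambda>h. C\<^sup>2 * h * ?N f + C * h * ?N g) \<longlongrightarrow> C\<^sup>2 * 0 * ?N f + C * 0 * ?N g) (at_right 0)" by (intro tendsto_intros)
  then have "((\<lambda>h. C\<^sup>2 * h * ?N f + C * h * ?N g) \<longlongrightarrow> 0) (at_right 0)" by simp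
  from order_tendstoD(2)[OF this e2] have ev1: "\<forall>\<^sub>F h in at_right 0. C\<^sup>2 * h * ?N f + C * h * ?N g < e / 2" .
  have ev2: "\<forall>\<^sub>F h in at_right (0::real). 0 < h \<and> h < d" unfolding eventually_at_right_field using d(1) by auto
  from ev1 ev2 show "\<forall>\<^sub>F h in at_right 0. dist (?N (\<lambda>z. (bounce_op \<gamma> \<sigma> 0 h f z - f z) / h - (- g z - \<sigma> (snd z) * f z))) 0 < e"
  proof eventually_elim
    fix h :: real assume small: "C\<^sup>2 * h * ?N f + C * h * ?N g < e / 2" and hd: "0 < h \<and> h < d"
    then have h: "0 < h" and h0: "0 \<le> h" by auto
    have le: "?N (\<lambda>z. ?S s g z - g z) \<le> e / 2" if "0 < s" "s \<le> h" for s
      by (rule less_imp_le[OF d(2)]) (use that hd in auto)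
    have Q: "?Q h \<in> Lp_space ?M p" "?N (?Q h) \<le> e / 2"
      by (rule bounce_op_difference_quotient_le[where e = "e / 2", OF \<gamma> p fm gm g h]; (rule le | rule int[OF h0] | rule less_imp_le[OF e2]); assumption?)+
    have [measurable]: "f \<in> Borel" "g \<in> Borel" "\<sigma> \<in> Borel" by fact+
    have [measurable]: "?S h f \<in> Borel" by (rule bounce_op_measurable1) auto
    have [measurable]: "(\<lambda>z. \<sigma> (snd z)) \<in> borel_measurable (borel :: ('a \<times> 'a) measure)"
      by (rule measurable_compose[OF borel_continuous \<sigma>(1)]) (intro continuous_intros)
    \<comment> \<open>\<open>?T1\<close> is the error for zero absorption, damped;
      \<open>?T2\<close> is the error of the first-order expansion of the exponential;
      \<open>?T3\<close> restores the part of \<open>g\<close> that the damping in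
      \<open>?T1\<close> removes.\<close>
    let ?T1 = "\<lambda>z. exp (- \<sigma> (snd z) * h) * ?Q h z"
    let ?T2 = "\<lambda>z. ((exp (- \<sigma> (snd z) * h) - 1) / h + \<sigma> (snd z)) * f z"
    let ?T3 = "\<lambda>z. (1 - exp (- \<sigma> (snd z) * h)) * g z"
    have eq: "(bounce_op \<gamma> \<sigma> 0 h f z - f z) / h - (- g z - \<sigma> (snd z) * f z) = ?T1 z + (?T2 z + ?T3 z)" for z
    proof -
      have "bounce_op \<gamma> \<sigma> 0 h f z = exp (- \<sigma> (snd z) * h) * ?S h f z" by (simp add: bounce_op_def)
      then show ?thesis using h by (simp add: field_simps)
    qed
    have \<sigma>h: "0 \<le> \<sigma> v * h" "\<sigma> v * h \<le> C * h" for v using \<sigma> h by auto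
    have m1: "?T1 \<in> borel_measurable ?M" by (rule borel_imp_measurable_phase_space) measurable
    have "\<bar>?T1 z\<bar> \<le> \<bar>?Q h z\<bar>" for z using \<sigma>h(1)[of "snd z"] by (simp add: abs_mult mult_left_le_one_le)
    then have a1: "AE z in ?M. \<bar>?T1 z\<bar> \<le> \<bar>?Q h z\<bar>" by auto
    have 1: "?T1 \<in> Lp_space ?M p" "?N ?T1 \<le> ?N (?Q h)"
      by (rule Lp_dominated[OF p Q(1) m1 a1])+
    have m2: "?T2 \<in> borel_measurable ?M" by (rule borel_imp_measurable_phase_space) measurable
    have "\<bar>?T2 z\<bar> \<le> \<bar>C\<^sup>2 * h * f z\<bar>" for z
    proof -
      let ?y = "\<sigma> (snd z) * h"
      have "\<bar>exp (- ?y) - 1 + ?y\<bar> \<le> ?y\<^sup>2" by (rule exp_minus_bounds(1)[OF \<sigma>h(1)])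
      also have "... \<le> (C * h)\<^sup>2" by (rule power_mono[OF \<sigma>h(2,1)])
      finally have "\<bar>exp (- ?y) - 1 + ?y\<bar> / h \<le> (C * h)\<^sup>2 / h" by (rule divide_right_mono[OF _ h0])
      moreover have "(C * h)\<^sup>2 / h = C\<^sup>2 * h" using h by (simp add: power2_eq_square)
      moreover have "(exp (- \<sigma> (snd z) * h) - 1) / h + \<sigma> (snd z) = (exp (- ?y) - 1 + ?y) / h" using h by (simp add: field_simps)
      ultimately have "\<bar>(exp (- \<sigma> (snd z) * h) - 1) / h + \<sigma> (snd z)\<bar> \<le> C\<^sup>2 * h" using h by simp
      then show ?thesis using h C by (simp add: abs_mult mult_right_mono)
    qed
    then have a2: "AE z in ?M. \<bar>?T2 z\<bar> \<le> \<bar>C\<^sup>2 * h * f z\<bar>" by auto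
    have 2: "?T2 \<in> Lp_space ?M p" "?N ?T2 \<le> ?N (\<lambda>z. (C\<^sup>2 * h) * f z)"
      by (rule Lp_dominated[OF p Lp_scale(1)[OF p f] m2 a2])+
    have m3: "?T3 \<in> borel_measurable ?M" by (rule borel_imp_measurable_phase_space) measurable
    have "\<bar>?T3 z\<bar> \<le> \<bar>C * h * g z\<bar>" for z
    proof -
      have "\<bar>1 - exp (- (\<sigma> (snd z) * h))\<bar> \<le> C * h" using exp_minus_bounds(2)[OF \<sigma>h(1), of "snd z"] \<sigma>h(2)[of "snd z"] by linarith
      then show ?thesis using h C by (simp add: abs_mult mult_right_mono)
    qed
    then have a3: "AE z in ?M. \<bar>?T3 z\<bar> \<le> \<bar>C * h * g z\<bar>" by auto
    have 3: "?T3 \<in> Lp_space ?M p" "?N ?T3 \<le> ?N (\<lambda>z. (C * h) * g z)"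
      by (rule Lp_dominated[OF p Lp_scale(1)[OF p g] m3 a3])+
    have "?N (\<lambda>z. ?T1 z + (?T2 z + ?T3 z)) \<le> ?N ?T1 + ?N (\<lambda>z. ?T2 z + ?T3 z)" by (rule Lp_norm_triangle[OF p 1(1) Lp_add(1)[OF p 2(1) 3(1)]])
    moreover have "?N (\<lambda>z. ?T2 z + ?T3 z) \<le> ?N ?T2 + ?N ?T3" by (rule Lp_norm_triangle[OF p 2(1) 3(1)])
    moreover have "?N (\<lambda>z. (C\<^sup>2 * h) * f z) = C\<^sup>2 * h * ?N f" "?N (\<lambda>z. (C * h) * g z) = C * h * ?N g"
      using Lp_scale(2)[OF p f, of "C\<^sup>2 * h"] Lp_scale(2)[OF p g, of "C * h"] C h by simp_all
    ultimately have "?N (\<lambda>z. ?T1 z + (?T2 z + ?T3 z)) \<le> ?N (?Q h) + (C\<^sup>2 * h * ?N f + C * h * ?N g)"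
      using 1(2) 2(2) 3(2) by linarith
    also have "... < e / 2 + e / 2" using Q(2) small by (rule add_le_less_mono)
    finally show "dist (?N (\<lambda>z. (bounce_op \<gamma> \<sigma> 0 h f z - f z) / h - (- g z - \<sigma> (snd z) * f z))) 0 < e"
      unfolding eq by simp
  qed
qed

end

lemma integral_phase_space:
  fixes D :: "'a::euclidean_space set" and f :: "'a \<times> 'a => real"
  assumes D: "open D" and f: "f \<in> Borel" "\<And>z. fst z \<notin> D ==> f z = 0"
  shows "(LINT z|phase_space D. f z) = (LINT z|lborel. f z)"
proof -
  have "(LINT z|phase_space D. f z) = (LINT z|lebesgue. indicator (D \<times> UNIV) z *\<^sub>R f z)"
    unfolding phase_space_def using phase_set_lebesgue[OF D] by (subst integral_restrict_space) auto
  also have "(\<lambda>z. indicator (D \<times> UNIV) z *\<^sub>R f z) = f"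
    using f(2) by (auto simp: indicator_def mem_Times_iff fun_eq_iff)
  also have "(LINT z|lebesgue. f z) = (LINT z|lborel. f z)" by (rule integral_completion) (use f in simp)
  finally show ?thesis .
qed

lemma Lp_norm_phase_space_cong_AE:
  fixes D :: "'a::euclidean_space set" and f :: "'a \<times> 'a => real"
  assumes D: "open D" and g: "g \<in> borel_measurable (phase_space D)" and eq: "AE z in phase_space D. f z = g z"
  shows "Lp_norm (phase_space D) p f = Lp_norm (phase_space D) p g"
  by (rule Lp_norm_cong_AE[OF measurable_phase_space_AE[OF D g eq] g eq])

section \<open>Averages along lines\<close>

lemma mean_value_bound:
  fixes k :: "real => real"
  assumes h: "0 < h" and k: "continuous_on UNIV k" and e: "\<And>s. 0 \<le> s ==> s \<le> h ==> \<bar>k s - c\<bar> \<le> e"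
  shows "\<bar>(LINT s|lborel. indicator {0..h} s * k s) / h - c\<bar> \<le> e"
proof -
  have "integrable lborel (\<lambda>s. indicator {0..h} s *\<^sub>R k s)"
    by (rule borel_integrable_compact) (auto intro: continuous_on_subset[OF k])
  then have ki: "integrable lborel (\<lambda>s. indicator {0..h} s * k s)" by simp
  have ci: "has_bochner_integral lborel (\<lambda>s. indicator {0..h} s * a) (h * a)" for a :: real
    using has_bochner_integral_mult_left[OF has_bochner_integral_real_indicator[of "{0..h}" lborel], of a] h by simp
  have i: "integrable lborel (\<lambda>s. indicator {0..h} s * a)" "(LINT s|lborel. indicator {0..h} s * a) = h * a" for a :: real
    using ci[of a] unfolding has_bochner_integral_iff by auto
  let ?I = "LINT s|lborel. indicator {0..h} s * k s"
  have "(LINT s|lborel. indicator {0..h} s * (c - e)) \<le> ?I"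
  proof (rule integral_mono[OF i(1) ki])
    fix s show "indicator {0..h} s * (c - e) \<le> indicator {0..h} s * k s" using e[of s] by (auto simp: indicator_def)
  qed
  moreover have "?I \<le> (LINT s|lborel. indicator {0..h} s * (c + e))"
  proof (rule integral_mono[OF ki i(1)])
    fix s show "indicator {0..h} s * k s \<le> indicator {0..h} s * (c + e)" using e[of s] by (auto simp: indicator_def)
  qed
  ultimately have "h * (c - e) \<le> ?I" "?I \<le> h * (c + e)" unfolding i(2) .
  then have "c - e \<le> ?I / h" "?I / h \<le> c + e" using h by (simp_all add: field_simps)
  then show ?thesis by linarith
qed

lemma integrable_bounded_support:
  fixes F :: "'c::euclidean_space => real"
  assumes F: "F \<in> Borel" and C: "\<And>y. \<bar>F y\<bar> \<le> C" and r: "\<And>y. r < norm y ==> F y = 0"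
  shows "integrable lborel F"
proof (rule Bochner_Integration.integrable_bound)
  have "integrable lborel (indicator (cball 0 r) :: 'c => real)"
    using emeasure_lborel_cball_finite[of "0 :: 'c" r] by (simp add: borel_closed)
  then show "integrable lborel (\<lambda>y::'c. C * indicator (cball 0 r) y)" by (rule integrable_mult_right)
  show "AE y in lborel. norm (F y) \<le> norm (C * indicator (cball 0 r) y)"
  proof (rule AE_I2)
    fix y :: 'c
    show "norm (F y) \<le> norm (C * indicator (cball 0 r) y)" using C[of y] r[of y] by (cases "r < norm y") auto
  qed
qed (use F in simp)

text \<open>Averaging along lines makes a merely continuous \<open>\<phi>\<close> differentiable
  along them. By Fubini and a shear the average moves to the derivative of \<open>\<eta>\<close>,
  which integrates to an increment of \<open>\<eta>\<close>; a second shear moves this increment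
  back to \<open>\<phi>\<close>.\<close>

lemma forward_average_weak_derivative:
  fixes \<phi> \<eta> :: "'a::euclidean_space \<times> 'a => real"
  assumes \<phi>: "continuous_on UNIV \<phi>" and K: "compact K" "\<And>z. z \<notin> K ==> \<phi> z = 0"
    and \<eta>: "smooth_on \<eta> UNIV" "compact (closure {z. \<eta> z \<noteq> 0})" and h: "0 < h"
  shows "(LINT z|lborel. (LINT s|lborel. indicator {0..h} s * \<phi> (shear s z)) / h * frechet_derivative \<eta> (at z) (snd z, 0)) =
    - (LINT z|lborel. (\<phi> (shear h z) - \<phi> z) / h * \<eta> z)"
proof -
  let ?L = "closure {z. \<eta> z \<noteq> 0}"
  define E where "E z = frechet_derivative \<eta> (at z) (snd z, 0)" for z
  have E: "continuous_on UNIV E" "\<And>z. z \<notin> ?L ==> E z = 0"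
    using smooth_streaming_derivative[OF \<eta>(1)] unfolding E_def[abs_def] by auto
  have \<eta>c: "continuous_on UNIV \<eta>" using \<eta>(1) unfolding smooth_on_def using Ck_on.simps(1) by blast
  have \<eta>0: "\<eta> z = 0" if "z \<notin> ?L" for z using that closure_subset[of "{z. \<eta> z \<noteq> 0}"] by auto
  obtain C where C: "0 \<le> C" "\<And>z. \<bar>\<phi> z\<bar> \<le> C" using compact_support_bounded[OF \<phi> K] by blast
  obtain CE where CE: "0 \<le> CE" "\<And>z. \<bar>E z\<bar> \<le> CE" using compact_support_bounded[OF E(1) \<eta>(2) E(2)] by blast
  obtain C\<eta> where C\<eta>: "0 \<le> C\<eta>" "\<And>z. \<bar>\<eta> z\<bar> \<le> C\<eta>" using compact_support_bounded[OF \<eta>c \<eta>(2) \<eta>0] by blast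
  have "bounded (K \<union> ?L)" using compact_imp_bounded[OF K(1)] compact_imp_bounded[OF \<eta>(2)] by simp
  then obtain r where r: "\<And>z. z \<in> K \<union> ?L ==> norm z \<le> r" unfolding bounded_iff by blast
  note ci = continuous_on_compose2[OF \<phi>] continuous_on_compose2[OF E(1)] continuous_on_compose2[OF \<eta>c]
  have ind: "(\<lambda>y::('a\<times>'a)\<times>real. indicator {0..h} (snd y) :: real) \<in> Borel"
    by (rule measurable_compose[OF borel_continuous[of snd]]) (auto intro: continuous_intros)
  have fub: "(LINT z|lborel. LINT s|lborel. indicator {0..h} s * H z s) = (LINT s|lborel. LINT z|lborel. indicator {0..h} s * H z s)"
    if H: "continuous_on UNIV (\<lambda>y. H (fst y) (snd y))" and le: "\<And>z s. \<bar>H z s\<bar> \<le> B" and supp: "\<And>z s. r < norm z ==> H z s = 0"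
    for H :: "'a \<times> 'a => real => real" and B
  proof -
    have "integrable lborel (\<lambda>y. indicator {0..h} (snd y) * H (fst y) (snd y))"
    proof (rule integrable_bounded_support[where C = B and r = "r + h"])
      show "(\<lambda>y. indicator {0..h} (snd y) * H (fst y) (snd y)) \<in> Borel"
        by (rule borel_measurable_times[OF ind borel_continuous[OF H]])
      have "0 \<le> B" using le[of "(0, 0)" 0] by linarith
      then show "\<bar>indicator {0..h} (snd y) * H (fst y) (snd y)\<bar> \<le> B" for y
        using le[of "fst y" "snd y"] by (auto simp: indicator_def)
      fix y :: "('a\<times>'a)\<times>real" assume y: "r + h < norm y"
      have "norm y \<le> norm (fst y) + norm (snd y)" using norm_Pair_le[of "fst y" "snd y"] by simp
      then show "indicator {0..h} (snd y) * H (fst y) (snd y) = 0"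
        using y supp[of "fst y" "snd y"] by (cases "snd y \<in> {0..h}") auto
    qed
    then have "integrable (lborel \<Otimes>\<^sub>M lborel) (\<lambda>(z, s). indicator {0..h} s * H z s)"
      by (simp add: lborel_prod case_prod_unfold)
    from lborel_pair.Fubini_integral[OF this]
    show "(LINT z|lborel. LINT s|lborel. indicator {0..h} s * H z s) = (LINT s|lborel. LINT z|lborel. indicator {0..h} s * H z s)" by simp
  qed
  have supp: "\<phi> z = 0" "E z = 0" "\<eta> z = 0" if "r < norm z" for z using r[of z] K(2)[of z] E(2)[of z] \<eta>0[of z] that by force+
  have bd: "\<bar>\<phi> w * E z\<bar> \<le> C * CE" "\<bar>\<phi> w * \<eta> z\<bar> \<le> C * C\<eta>" for w z
    unfolding abs_mult using C CE C\<eta> by (simp_all add: mult_mono)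
  have i: "integrable lborel (\<lambda>z. \<phi> z * \<eta> z)" "integrable lborel (\<lambda>z. \<phi> z * \<eta> (shear (- h) z))" "integrable lborel (\<lambda>z. \<phi> (shear h z) * \<eta> z)"
  proof -
    have ibs: "integrable lborel (\<lambda>z. \<phi> (F z) * \<eta> (G z))"
      if "continuous_on UNIV F" "continuous_on UNIV G" "\<And>z. r < norm z ==> \<phi> (F z) * \<eta> (G z) = 0" for F G :: "'a \<times> 'a => 'a \<times> 'a"
    proof (rule integrable_bounded_support[where C = "C * C\<eta>" and r = r])
      show "(\<lambda>z. \<phi> (F z) * \<eta> (G z)) \<in> Borel"
        by (intro borel_continuous continuous_intros ci that) auto
    qed (use bd(2) that(3) in auto)
    show "integrable lborel (\<lambda>z. \<phi> z * \<eta> z)" by (rule ibs) (auto intro: continuous_intros simp: supp)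
    show "integrable lborel (\<lambda>z. \<phi> z * \<eta> (shear (- h) z))" by (rule ibs) (auto intro: continuous_intros simp: supp)
    show "integrable lborel (\<lambda>z. \<phi> (shear h z) * \<eta> z)" by (rule ibs) (auto intro: continuous_intros simp: supp)
  qed
  have inner: "(LINT s|lborel. indicator {0..h} s * (\<phi> z * E (shear (- s) z))) = \<phi> z * \<eta> z - \<phi> z * \<eta> (shear (- h) z)" for z
  proof -
    have "(LINT s|lborel. indicator {0..h} s * (\<phi> z * E (shear (- s) z))) = (LINT s|lborel. \<phi> z * (indicator {0..h} s * E (shear (- s) z)))"
      by (simp only: mult.left_commute)
    also have "... = \<phi> z * (\<eta> z - \<eta> (shear (- h) z))"
      using integral_streaming_derivative[OF \<eta>(1) less_imp_le[OF h], of z] by (simp add: E_def)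
    finally show ?thesis by (simp add: right_diff_distrib)
  qed
  have "(LINT z|lborel. (LINT s|lborel. indicator {0..h} s * \<phi> (shear s z)) / h * E z) =
      (LINT z|lborel. (LINT s|lborel. indicator {0..h} s * (\<phi> (shear s z) * E z)) / h)"
    by (intro Bochner_Integration.integral_cong refl) (simp add: mult.assoc[symmetric])
  also have "... = (LINT z|lborel. LINT s|lborel. indicator {0..h} s * (\<phi> (shear s z) * E z)) / h" by simp
  also have "(LINT z|lborel. LINT s|lborel. indicator {0..h} s * (\<phi> (shear s z) * E z)) =
      (LINT s|lborel. LINT z|lborel. indicator {0..h} s * (\<phi> (shear s z) * E z))"
    by (rule fub[OF _ bd(1)]) (auto intro!: continuous_intros ci simp: supp)
  also have "... = (LINT s|lborel. LINT z|lborel. indicator {0..h} s * (\<phi> z * E (shear (- s) z)))"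
  proof (rule Bochner_Integration.integral_cong[OF refl])
    fix s :: real
    have "(LINT z|lborel. \<phi> (shear s z) * E (shear (- s) (shear s z))) = (LINT z|lborel. \<phi> z * E (shear (- s) z))"
      by (rule integral_lborel_shear(1)) (intro borel_continuous continuous_intros ci; simp)
    then show "(LINT z|lborel. indicator {0..h} s * (\<phi> (shear s z) * E z)) = (LINT z|lborel. indicator {0..h} s * (\<phi> z * E (shear (- s) z)))"
      by (simp add: shear_shear)
  qed
  also have "... = (LINT z|lborel. LINT s|lborel. indicator {0..h} s * (\<phi> z * E (shear (- s) z)))"
    by (rule fub[OF _ bd(1), symmetric]) (auto intro!: continuous_intros ci simp: supp)
  also have "... = (LINT z|lborel. \<phi> z * \<eta> z - \<phi> z * \<eta> (shear (- h) z))" by (simp only: inner)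
  also have "... = (LINT z|lborel. \<phi> z * \<eta> z) - (LINT z|lborel. \<phi> z * \<eta> (shear (- h) z))"
    by (rule Bochner_Integration.integral_diff[OF i(1,2)])
  also have "(LINT z|lborel. \<phi> z * \<eta> (shear (- h) z)) = (LINT z|lborel. \<phi> (shear h z) * \<eta> (shear (- h) (shear h z)))"
    by (rule integral_lborel_shear(1)[symmetric]) (intro borel_continuous continuous_intros ci; simp add: \<phi>)
  also have "... = (LINT z|lborel. \<phi> (shear h z) * \<eta> z)" by (simp add: shear_shear)
  also have "(LINT z|lborel. \<phi> z * \<eta> z) - ... = (LINT z|lborel. \<phi> z * \<eta> z - \<phi> (shear h z) * \<eta> z)"
    by (rule Bochner_Integration.integral_diff[OF i(1,3), symmetric])
  also have "... / h = (LINT z|lborel. - ((\<phi> (shear h z) - \<phi> z) / h * \<eta> z))"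
    using h by (subst integral_divide_zero[symmetric]) (intro Bochner_Integration.integral_cong refl, simp add: field_simps)
  finally show ?thesis by (simp add: E_def)
qed

section \<open>The generator and a dense part of its domain\<close>

context bounded_convex_domain
begin

text \<open>The line calculus is carried out for Borel versions of \<open>F\<close> and of the
  chosen weak derivative, extended by 0, and the limit is transferred back to the given
  representatives.\<close>

lemma bounce_op_generator:
  assumes smooth: "smooth_domain D" and \<gamma>: "0 < \<gamma>" "\<gamma> < 1" and p: "1 \<le> p"
    and \<sigma>: "\<sigma> \<in> Borel" "\<And>v. 0 \<le> \<sigma> v" "\<And>v. \<sigma> v \<le> C"
    and F: "F \<in> bounce_back_domain D p \<gamma>" and \<Sigma>: "AE z in phase_space D. \<Sigma> z = \<sigma> (snd z)"
  shows "right_derivative_at_0 (phase_space D) p (bounce_op \<gamma> \<sigma> 0) F (streaming_operator D p \<Sigma> F)"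
proof -
  let ?M = "phase_space D" and ?N = "Lp_norm (phase_space D) p" and ?S = "bounce_op \<gamma> \<sigma> 0"
  define G where "G = streaming_derivative D p F"
  have FL: "F \<in> Lp_space ?M p" and ex: "\<exists>g. g \<in> Lp_space ?M p \<and> weak_streaming_derivative D F g"
    using F by (auto simp: bounce_back_domain_def W_tilde_def W_space_def)
  from someI_ex[OF ex] have GL: "G \<in> Lp_space ?M p" and weak: "weak_streaming_derivative D F G"
    unfolding G_def streaming_derivative_def by auto
  obtain k\<^sub>m k\<^sub>p where tr: "has_trace_minus D F k\<^sub>m" "has_trace_plus D F k\<^sub>p"
    and bc0: "AE (x, v) in flux_measure D (Gamma_minus D). k\<^sub>m (x, v) = \<gamma> * k\<^sub>p (x, - v)"
    using F unfolding bounce_back_domain_def by blast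
  obtain f where fm: "f \<in> Borel" and f0: "\<And>z. fst z \<notin> D ==> f z = 0"
    and fe: "AE z in ?M. f z = F z" and f: "f \<in> Lp_space ?M p" using Lp_phase_space_borel_version[OF open_D p FL] by blast
  obtain g where gm: "g \<in> Borel" and g0: "\<And>z. fst z \<notin> D ==> g z = 0"
    and ge: "AE z in ?M. g z = G z" and g: "g \<in> Lp_space ?M p" using Lp_phase_space_borel_version[OF open_D p GL] by blast
  have lf: "locally_integrable f" by (rule Lp_locally_integrable[OF p fm f f0])
  have lg: "locally_integrable g" by (rule Lp_locally_integrable[OF p gm g g0])
  have conv: "(LINT z|?M. H z * E z) = (LINT z|lborel. h z * E z)"
    if H: "H \<in> borel_measurable ?M" and h: "h \<in> Borel" "\<And>z. fst z \<notin> D ==> h z = 0" "AE z in ?M. h z = H z"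
      and E: "continuous_on UNIV E" for H h E :: "'a \<times> 'a => real"
  proof -
    have Em: "E \<in> Borel" by (rule borel_continuous[OF E])
    have "(LINT z|?M. H z * E z) = (LINT z|?M. h z * E z)"
    proof (rule integral_cong_AE)
      have Ep: "E \<in> borel_measurable ?M" and hp: "h \<in> borel_measurable ?M"
        by (rule borel_imp_measurable_phase_space, fact)+
      show "(\<lambda>z. H z * E z) \<in> borel_measurable ?M" by (rule borel_measurable_times[OF H Ep])
      show "(\<lambda>z. h z * E z) \<in> borel_measurable ?M" by (rule borel_measurable_times[OF hp Ep])
      show "AE z in ?M. H z * E z = h z * E z" using h(3) by eventually_elim simp
    qed
    also have "... = (LINT z|lborel. h z * E z)"
      by (rule integral_phase_space[OF open_D]) (use h Em in auto)
    finally show ?thesis .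
  qed
  have weak': "(LINT z|lborel. f z * frechet_derivative \<eta> (at z) (snd z, 0)) = - (LINT z|lborel. g z * \<eta> z)"
    if \<eta>: "test_function D \<eta>" for \<eta>
  proof -
    have sm: "smooth_on \<eta> UNIV" using \<eta> by (simp add: test_function_def)
    then have "continuous_on UNIV \<eta>" unfolding smooth_on_def using Ck_on.simps(1) by blast
    from conv[OF Lp_space_measurable[OF GL] gm g0 ge this] conv[OF Lp_space_measurable[OF FL] fm f0 fe smooth_streaming_derivative(1)[OF sm]]
    show ?thesis using weak \<eta> unfolding weak_streaming_derivative_def by simp
  qed
  have good: "AE z in lborel. fst z \<in> D \<and> snd z \<noteq> 0 --> good_line f g z"
    by (rule AE_good_line[OF lf lg]) (use g0 weak' in auto)
  have fe': "AE z in ?M. F z = f z" using fe by eventually_elim simp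
  have bc: "AE z in lborel. fst z \<in> D \<and> snd z \<noteq> 0 -->
      line_value f g z (- et (fst z) (snd z)) = \<gamma> * line_value f g (fst z, - snd z) (et (fst z) (snd z))"
    by (rule bounce_back_line_value[OF smooth good fe' tr bc0])
  have lim: "((\<lambda>h. ?N (\<lambda>z. (?S h f z - f z) / h - (- g z - \<sigma> (snd z) * f z))) \<longlongrightarrow> 0) (at_right 0)"
    by (rule bounce_op_right_derivative[OF \<gamma> p \<sigma> fm f gm g]) (rule bounce_op_integral[OF _ gm good bc])
  have Am: "AE z in ?M. streaming_operator D p \<Sigma> F z = - g z - \<sigma> (snd z) * f z"
    using fe ge \<Sigma> by eventually_elim (simp add: streaming_operator_def G_def)
  have \<sigma>m: "(\<lambda>z. \<sigma> (snd z)) \<in> borel_measurable (borel :: ('a \<times> 'a) measure)"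
    by (rule measurable_compose[OF borel_continuous \<sigma>(1)]) (intro continuous_intros)
  have \<sigma>f: "(\<lambda>z. \<sigma> (snd z) * f z) \<in> Lp_space ?M p"
  proof (rule Lp_dominated(1)[OF p Lp_scale(1)[OF p f, of C]])
    show "(\<lambda>z. \<sigma> (snd z) * f z) \<in> borel_measurable ?M"
      by (intro borel_imp_measurable_phase_space borel_measurable_times \<sigma>m fm)
    have "\<bar>\<sigma> (snd z) * f z\<bar> \<le> \<bar>C * f z\<bar>" for z
    proof -
      have "\<bar>\<sigma> (snd z)\<bar> \<le> \<bar>C\<bar>" using \<sigma>(2,3)[of "snd z"] by linarith
      then show ?thesis unfolding abs_mult by (rule mult_right_mono) simp
    qed
    then show "AE z in ?M. \<bar>\<sigma> (snd z) * f z\<bar> \<le> \<bar>C * f z\<bar>" by simp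
  qed
  have A': "(\<lambda>z. - g z - \<sigma> (snd z) * f z) \<in> Lp_space ?M p"
    using Lp_diff(1)[OF p Lp_scale(1)[OF p g, of "-1"] \<sigma>f] by simp
  have "AE z in ?M. - g z - \<sigma> (snd z) * f z = streaming_operator D p \<Sigma> F z" using Am by eventually_elim simp
  then have AL: "streaming_operator D p \<Sigma> F \<in> Lp_space ?M p"
    by (intro Lp_space_cong_AE[OF p A' measurable_phase_space_AE[OF open_D Lp_space_measurable[OF A'] Am]])
  have "((\<lambda>h. ?N (\<lambda>z. (?S h F z - F z) / h - streaming_operator D p \<Sigma> F z)) \<longlongrightarrow> 0) (at_right 0)"
  proof (rule Lim_transform_eventually[OF lim])
    show "\<forall>\<^sub>F h in at_right 0. ?N (\<lambda>z. (?S h f z - f z) / h - (- g z - \<sigma> (snd z) * f z)) = ?N (\<lambda>z. (?S h F z - F z) / h - streaming_operator D p \<Sigma> F z)"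
      using eventually_at_right_less[of 0]
    proof eventually_elim
      fix h :: real assume h: "0 < h"
      have Sm: "?S h f \<in> Borel" by (rule bounce_op_measurable1[OF \<sigma>(1) fm])
      have m: "(\<lambda>z. (?S h f z - f z) / h - (- g z - \<sigma> (snd z) * f z)) \<in> borel_measurable ?M"
        by (rule borel_imp_measurable_phase_space) (use Sm fm gm \<sigma>m in measurable)
      have "AE z in ?M. ?S h f z = ?S h F z" by (rule bounce_op_cong_AE[OF _ fe]) (use h in simp)
      then have "AE z in ?M. (?S h F z - F z) / h - streaming_operator D p \<Sigma> F z = (?S h f z - f z) / h - (- g z - \<sigma> (snd z) * f z)"
        using fe Am by eventually_elim simp
      from Lp_norm_phase_space_cong_AE[OF open_D m this]
      show "?N (\<lambda>z. (?S h f z - f z) / h - (- g z - \<sigma> (snd z) * f z)) = ?N (\<lambda>z. (?S h F z - F z) / h - streaming_operator D p \<Sigma> F z)"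
        by simp
    qed
  qed
  with AL show ?thesis by (simp add: right_derivative_at_0_def)
qed

text \<open>Such a function vanishes along every line close to a boundary point, so both traces are
  0, and these satisfy the bounce-back condition.\<close>

lemma bounce_back_domain_compact_support:
  assumes p: "1 \<le> p" and f: "f \<in> Lp_space (phase_space D) p" and g: "g \<in> Lp_space (phase_space D) p"
    and weak: "weak_streaming_derivative D f g"
    and K: "compact K" "K \<subseteq> D \<times> UNIV" "\<And>z. z \<notin> K ==> f z = 0"
  shows "f \<in> bounce_back_domain D p \<gamma>"
proof -
  have lim: "((\<lambda>s. f (x + s *\<^sub>R v, v)) \<longlongrightarrow> 0) (at_right 0)" "((\<lambda>s. f (x - s *\<^sub>R v, v)) \<longlongrightarrow> 0) (at_right 0)"
    if x: "x \<in> frontier D" for x v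
  proof -
    have "x \<notin> D" using x open_D by (simp add: frontier_def interior_open)
    then have nK: "(x, v) \<in> - K" using K(2) by auto
    have oK: "open (- K)" using compact_imp_closed[OF K(1)] by auto
    have "((\<lambda>s. (x + s *\<^sub>R v, v)) \<longlongrightarrow> (x + 0 *\<^sub>R v, v)) (at_right 0)" "((\<lambda>s. (x - s *\<^sub>R v, v)) \<longlongrightarrow> (x - 0 *\<^sub>R v, v)) (at_right 0)"
      by (intro tendsto_intros)+
    then have t: "((\<lambda>s. (x + s *\<^sub>R v, v)) \<longlongrightarrow> (x, v)) (at_right 0)" "((\<lambda>s. (x - s *\<^sub>R v, v)) \<longlongrightarrow> (x, v)) (at_right 0)" by simp_all
    show "((\<lambda>s. f (x + s *\<^sub>R v, v)) \<longlongrightarrow> 0) (at_right 0)"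
      by (rule tendsto_eventually) (use topological_tendstoD[OF t(1) oK nK] K(3) in \<open>auto elim: eventually_mono\<close>)
    show "((\<lambda>s. f (x - s *\<^sub>R v, v)) \<longlongrightarrow> 0) (at_right 0)"
      by (rule tendsto_eventually) (use topological_tendstoD[OF t(2) oK nK] K(3) in \<open>auto elim: eventually_mono\<close>)
  qed
  have sp: "fst z \<in> frontier D" if "z \<in> space (flux_measure D (Gamma_minus D)) \<or> z \<in> space (flux_measure D (Gamma_plus D))" for z :: "'a \<times> 'a"
    using that by (auto simp: flux_measure_def space_restrict_space Gamma_minus_def Gamma_plus_def)
  have m: "has_trace_minus D f (\<lambda>_. 0)" unfolding has_trace_minus_def
    by (intro exI[of _ f] conjI AE_I2) (use lim(1) sp in \<open>auto simp: case_prod_beta\<close>)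
  have q: "has_trace_plus D f (\<lambda>_. 0)" unfolding has_trace_plus_def
    by (intro exI[of _ f] conjI AE_I2) (use lim(2) sp in \<open>auto simp: case_prod_beta\<close>)
  have "f \<in> W_tilde D p" unfolding W_tilde_def W_space_def
    using f g weak m q Lp_zero(1) by blast
  moreover have "AE (x, v) in flux_measure D (Gamma_minus D). (\<lambda>_. 0) (x, v) = \<gamma> * (\<lambda>_. 0) (x, - v)" by simp
  ultimately show ?thesis unfolding bounce_back_domain_def using m q by blast
qed

text \<open>Forward averages over short times lie in the domain: their supports stay in one compact
  part of phase space, and their derivative along lines is a difference quotient. They converge
  pointwise by continuity and in norm by domination.\<close>

lemma bounce_back_domain_approx:
  assumes p: "1 \<le> p" and \<phi>: "continuous_on UNIV \<phi>" and K: "compact K" "K \<subseteq> D \<times> UNIV" "\<And>z. z \<notin> K ==> \<phi> z = 0"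
  shows "\<exists>u. (\<forall>n::nat. u n \<in> bounce_back_domain D p \<gamma>) \<and> (\<lambda>n. Lp_norm (phase_space D) p (\<lambda>z. u n z - \<phi> z)) \<longlonglongrightarrow> 0"
proof -
  let ?M = "phase_space D"
  obtain C where C: "0 \<le> C" "\<And>z. \<bar>\<phi> z\<bar> \<le> C" using compact_support_bounded[OF \<phi> K(1) K(3)] by blast
  obtain e where e: "0 < e" "(\<Union>z\<in>K. ball z e) \<subseteq> D \<times> UNIV"
    using compact_subset_open_imp_ball_epsilon_subset[OF K(1) open_Times[OF open_D open_UNIV] K(2)] by blast
  obtain R where R: "0 < R" "\<And>z. z \<in> K ==> norm z \<le> R" using compact_imp_bounded[OF K(1)] unfolding bounded_pos by blast
  \<comment> \<open>Velocities on \<open>K\<close> are bounded by \<open>R\<close>, so positions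
    move by less than the margin \<open>e\<close> within time \<open>h0\<close>.\<close>
  define h0 where "h0 = e / (2 * R)"
  have h0: "0 < h0" "h0 * R < e" using e R by (simp_all add: h0_def)
  \<comment> \<open>All points from which \<open>K\<close> is reached within time \<open>h0\<close>;
    the averages vanish outside this set.\<close>
  define K' where "K' = (\<lambda>y. shear (- fst y) (snd y)) ` ({0..h0} \<times> K)"
  have cK': "compact K'" unfolding K'_def
    by (intro compact_continuous_image compact_Times K(1) compact_Icc continuous_intros)
  have K'D: "K' \<subseteq> D \<times> UNIV"
  proof
    fix z assume "z \<in> K'"
    then obtain s w where w: "0 \<le> s" "s \<le> h0" "w \<in> K" and z: "z = shear (- s) w" unfolding K'_def by auto
    have "dist w z = norm ((s *\<^sub>R snd w, 0 :: 'a))" by (simp add: dist_norm z shear_def minus_prod_def)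
    also have "... = s * norm (snd w)" using w by (simp add: norm_Pair)
    also have "... \<le> h0 * R"
    proof (rule mult_mono)
      show "norm (snd w) \<le> R" using norm_snd_le[of "snd w" "fst w"] R(2)[OF w(3)] by simp
    qed (use w h0 in auto)
    also have "... < e" by (rule h0)
    finally show "z \<in> D \<times> UNIV" using e(2) w(3) by (auto simp: ball_def)
  qed
  have off: "\<phi> (shear s z) = 0" if "z \<notin> K'" "0 \<le> s" "s \<le> h0" for s z
  proof (rule K(3))
    show "shear s z \<notin> K"
    proof
      assume "shear s z \<in> K"
      then have "shear (- fst (s, shear s z)) (snd (s, shear s z)) \<in> K'" unfolding K'_def using that by (intro imageI) auto
      then show False using that(1) by (simp add: shear_shear)
    qed
  qed
  have sc: "continuous_on UNIV (\<lambda>s. \<phi> (shear s z))" for z by (intro continuous_on_compose2[OF \<phi>] continuous_intros) auto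
  have \<phi>m: "\<phi> \<in> Borel" by (rule borel_continuous[OF \<phi>])
  define A where "A h z = (LINT s|lborel. indicator {0..h} s * \<phi> (shear s z)) / h" for h z
  have Am: "A h \<in> Borel" for h
    unfolding A_def[abs_def] by (intro borel_measurable_divide line_integral_measurable \<phi>m borel_measurable_const)
  have bK': "bounded K'" by (rule compact_imp_bounded[OF cK'])
  have Ale: "\<bar>A h z\<bar> \<le> C * indicator K' z" if h: "0 < h" "h \<le> h0" for h z
  proof (cases "z \<in> K'")
    case True
    then show ?thesis using mean_value_bound[where c = 0 and e = C, OF h(1) sc, of z] C(2) by (simp add: A_def)
  next
    case False
    then show ?thesis using mean_value_bound[where c = 0 and e = 0, OF h(1) sc, of z] off[of z] h(2) by (simp add: A_def)
  qed
  have dom: "A h \<in> bounce_back_domain D p \<gamma>" if h: "0 < h" "h \<le> h0" for h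
  proof (rule bounce_back_domain_compact_support[OF p _ _ _ cK' K'D])
    let ?G = "\<lambda>z. (\<phi> (shear h z) - \<phi> z) / h"
    have Gm: "?G \<in> Borel" using \<phi>m measurable_compose[OF shear_measurable \<phi>m, of h] by measurable
    have G0: "?G z = 0" if "z \<notin> K'" for z using off[OF that, of h] off[OF that, of 0] h h0(1) by simp
    show "A h \<in> Lp_space ?M p"
      by (rule Lp_bounded_support[where C = C, OF open_D p borel_imp_measurable_phase_space[OF Am] bK']) (use Ale[OF h] in simp)
    show "?G \<in> Lp_space ?M p"
    proof (rule Lp_bounded_support[OF open_D p borel_imp_measurable_phase_space[OF Gm] bK'])
      have "\<bar>?G z\<bar> \<le> 2 * C / h * indicator K' z" for z
      proof (cases "z \<in> K'")
        case True
        have "\<bar>\<phi> (shear h z) - \<phi> z\<bar> \<le> 2 * C" using C(2)[of "shear h z"] C(2)[of z] by linarith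
        then show ?thesis using True h(1) by (simp add: divide_right_mono)
      qed (use G0 in simp)
      then show "AE z in ?M. \<bar>?G z\<bar> \<le> 2 * C / h * indicator K' z" by simp
    qed
    show A0: "A h z = 0" if "z \<notin> K'" for z using Ale[OF h, of z] that by simp
    have D0: "z \<notin> K'" if "fst z \<notin> D" for z using that K'D by auto
    show "weak_streaming_derivative D (A h) ?G"
      unfolding weak_streaming_derivative_def
    proof (intro allI impI)
      fix \<eta> assume "test_function D \<eta>"
      then have \<eta>: "smooth_on \<eta> UNIV" "compact (closure {z. \<eta> z \<noteq> 0})" by (auto simp: test_function_def)
      then have "continuous_on UNIV \<eta>" unfolding smooth_on_def using Ck_on.simps(1) by blast
      then have \<eta>m: "\<eta> \<in> Borel" by (rule borel_continuous)
      have Em: "(\<lambda>z. frechet_derivative \<eta> (at z) (snd z, 0)) \<in> Borel"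
        by (rule borel_continuous[OF smooth_streaming_derivative(1)[OF \<eta>(1)]])
      have "(LINT z|?M. A h z * frechet_derivative \<eta> (at z) (snd z, 0)) = (LINT z|lborel. A h z * frechet_derivative \<eta> (at z) (snd z, 0))"
        by (rule integral_phase_space[OF open_D borel_measurable_times[OF Am Em]]) (use A0 D0 in simp)
      moreover have "(LINT z|?M. ?G z * \<eta> z) = (LINT z|lborel. ?G z * \<eta> z)"
        by (rule integral_phase_space[OF open_D borel_measurable_times[OF Gm \<eta>m]]) (use G0 D0 in fastforce)
      moreover have "(LINT z|lborel. A h z * frechet_derivative \<eta> (at z) (snd z, 0)) = - (LINT z|lborel. ?G z * \<eta> z)"
        unfolding A_def by (rule forward_average_weak_derivative[OF \<phi> K(1) _ \<eta> h(1)]) (rule K(3))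
      ultimately show "(LINT z|?M. A h z * frechet_derivative \<eta> (at z) (snd z, 0)) = - (LINT z|?M. ?G z * \<eta> z)"
        by (simp only:)
    qed
  qed
  define h where "h n = h0 / real (Suc n)" for n
  have h: "0 < h n" "h n \<le> h0" for n using h0(1) by (simp_all add: h_def divide_le_eq mult_le_cancel_left1)
  have hlim: "h \<longlonglongrightarrow> 0" unfolding h_def[abs_def] using LIMSEQ_Suc[OF lim_const_over_n[of h0]] by simp
  have lim: "(\<lambda>n. A (h n) z) \<longlonglongrightarrow> \<phi> z" for z
  proof (rule tendstoI)
    fix \<epsilon> :: real assume \<epsilon>: "0 < \<epsilon>"
    have "isCont (\<lambda>s. \<phi> (shear s z)) 0" using sc[of z] by (simp add: continuous_on_eq_continuous_at)
    then have "((\<lambda>s. \<phi> (shear s z)) \<longlongrightarrow> \<phi> z) (at 0)" unfolding isCont_def by simp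
    from tendstoD[OF this half_gt_zero[OF \<epsilon>]] obtain d where d: "0 < d" "\<And>s. s \<noteq> 0 ==> dist s 0 < d ==> dist (\<phi> (shear s z)) (\<phi> z) < \<epsilon> / 2"
      unfolding eventually_at by auto
    have "eventually (\<lambda>n. h n < d) sequentially" by (rule order_tendstoD(2)[OF hlim d(1)])
    then show "eventually (\<lambda>n. dist (A (h n) z) (\<phi> z) < \<epsilon>) sequentially"
    proof eventually_elim
      fix n assume n: "h n < d"
      have "\<bar>\<phi> (shear s z) - \<phi> z\<bar> \<le> \<epsilon> / 2" if "0 \<le> s" "s \<le> h n" for s
        using d(2)[of s] that n \<epsilon> by (cases "s = 0") (auto simp: dist_real_def)
      from mean_value_bound[OF h(1) sc this] have "\<bar>A (h n) z - \<phi> z\<bar> \<le> \<epsilon> / 2" by (simp add: A_def)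
      also have "... < \<epsilon>" using \<epsilon> by simp
      finally show "dist (A (h n) z) (\<phi> z) < \<epsilon>" by (simp add: dist_real_def)
    qed
  qed
  have wL: "(\<lambda>z. C * indicator K' z) \<in> Lp_space ?M p"
    by (intro Lp_scale(1) p indicator_in_Lp bK' borel_compact cK')
  have "(\<lambda>n. Lp_norm ?M p (\<lambda>z. A (h n) z - \<phi> z)) \<longlonglongrightarrow> 0"
  proof (rule Lp_dominated_convergence(1)[OF p _ _ wL])
    show "A (h n) \<in> borel_measurable ?M" for n by (rule borel_imp_measurable_phase_space[OF Am])
    show "\<phi> \<in> borel_measurable ?M" by (rule borel_imp_measurable_phase_space[OF \<phi>m])
    show "AE z in ?M. \<bar>A (h n) z\<bar> \<le> \<bar>C * indicator K' z\<bar>" for n using Ale[OF h] C(1) by (auto simp: abs_mult)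
  qed (use lim in auto)
  then show ?thesis by (intro exI[of _ "\<lambda>n. A (h n)"] conjI allI dom h)
qed

end

section \<open>The series expansion\<close>

lemma AE_lborel_snd:
  fixes P :: "'b::euclidean_space => bool"
  assumes "AE v in lborel. P v"
  shows "AE z in (lborel :: ('a::euclidean_space \<times> 'b) measure). P (snd z)"
proof -
  from assms obtain N where N: "{v. \<not> P v} \<subseteq> N" "N \<in> sets borel" "emeasure lborel N = 0" by (auto elim!: AE_E)
  have "emeasure (lborel \<Otimes>\<^sub>M lborel) ((UNIV :: 'a set) \<times> N) = 0"
    using N by (subst lborel.emeasure_pair_measure_Times) auto
  then have "emeasure lborel ((UNIV :: 'a set) \<times> N) = 0" by (simp add: lborel_prod)
  moreover have "(UNIV :: 'a set) \<times> N \<in> sets lborel"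
    unfolding sets_lborel borel_prod[symmetric] by (intro pair_measureI) (use N(2) in auto)
  ultimately have "AE z in lborel. z \<notin> (UNIV :: 'a set) \<times> N" by (intro AE_not_in) auto
  then show ?thesis by eventually_elim (use N(1) in \<open>auto simp: mem_Times_iff\<close>)
qed

lemma Lp_op_bound: "Lp_bounded_operator M p A ==> \<exists>C. \<forall>f\<in>Lp_space M p. Lp_norm M p (A f) \<le> C * Lp_norm M p f"
  by (simp add: Lp_bounded_operator_def)

lemma Lp_operators_eq_limit:
  assumes p: "1 \<le> p" and A: "Lp_bounded_operator M p A" and B: "Lp_bounded_operator M p B"
    and f: "f \<in> Lp_space M p" and u: "\<And>n::nat. u n \<in> Lp_space M p" and eq: "\<And>n. AE x in M. A (u n) x = B (u n) x"
    and lim: "(\<lambda>n. Lp_norm M p (\<lambda>x. u n x - f x)) \<longlonglongrightarrow> 0"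
  shows "AE x in M. A f x = B f x"
proof -
  let ?N = "Lp_norm M p"
  obtain CA where CA: "\<And>f. f \<in> Lp_space M p ==> ?N (A f) \<le> CA * ?N f" using Lp_op_bound[OF A] by blast
  obtain CB where CB: "\<And>f. f \<in> Lp_space M p ==> ?N (B f) \<le> CB * ?N f" using Lp_op_bound[OF B] by blast
  have L: "A g \<in> Lp_space M p" "B g \<in> Lp_space M p" if "g \<in> Lp_space M p" for g
    using A B that unfolding Lp_bounded_operator_def by blast+
  have "?N (\<lambda>x. A f x - B f x) \<le> (CA + CB) * ?N (\<lambda>x. u n x - f x)" for n
  proof -
    have "?N (\<lambda>x. A f x - B f x) \<le> ?N (\<lambda>x. A f x - A (u n) x) + ?N (\<lambda>x. A (u n) x - B f x)"
      by (rule Lp_norm_triangle_diff[OF p L(1)[OF f] L(1)[OF u] L(2)[OF f]])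
    also have "?N (\<lambda>x. A f x - A (u n) x) = ?N (A (\<lambda>x. u n x - f x))"
      unfolding Lp_op_norm_diff[OF p A u f] by (rule Lp_norm_minus_commute)
    also have "?N (\<lambda>x. A (u n) x - B f x) = ?N (\<lambda>x. B (u n) x - B f x)"
      by (rule Lp_norm_triangle_diff_AE[OF p L(1)[OF u] L(2)[OF u] L(2)[OF f] L(2)[OF f] eq]) simp
    also have "... = ?N (B (\<lambda>x. u n x - f x))" by (rule Lp_op_norm_diff[OF p B u f, symmetric])
    also have "?N (A (\<lambda>x. u n x - f x)) + ?N (B (\<lambda>x. u n x - f x)) \<le> CA * ?N (\<lambda>x. u n x - f x) + CB * ?N (\<lambda>x. u n x - f x)"
      by (intro add_mono CA CB Lp_diff(1) p u f)
    finally show ?thesis by (simp add: distrib_right)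
  qed
  moreover have "(\<lambda>n. (CA + CB) * ?N (\<lambda>x. u n x - f x)) \<longlonglongrightarrow> 0" by (rule tendsto_mult_right_zero[OF lim])
  ultimately have "?N (\<lambda>x. A f x - B f x) \<le> 0" by (intro LIMSEQ_le_const[of _ 0]) auto
  then have "?N (\<lambda>x. A f x - B f x) = 0" using Lp_norm_nonneg[of M p "\<lambda>x. A f x - B f x"] by linarith
  from Lp_norm_eq_0[OF p Lp_diff(1)[OF p L(1)[OF f] L(2)[OF f]] this] show ?thesis by eventually_elim simp
qed

lemma Lp_bounded_operator_diff:
  assumes p: "1 \<le> p" and A: "Lp_bounded_operator M p A" and B: "Lp_bounded_operator M p B"
  shows "Lp_bounded_operator M p (\<lambda>f x. A f x - B f x)"
  unfolding Lp_bounded_operator_def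
proof (intro conjI ballI impI allI)
  fix f assume f: "f \<in> Lp_space M p"
  show "(\<lambda>x. A f x - B f x) \<in> Lp_space M p"
    using A B f unfolding Lp_bounded_operator_def by (intro Lp_diff(1) p) blast+
  fix g assume g: "g \<in> Lp_space M p"
  {
    assume "AE x in M. f x = g x"
    with A B f g have "AE x in M. A f x = A g x" "AE x in M. B f x = B g x" unfolding Lp_bounded_operator_def by blast+
    then show "AE x in M. A f x - B f x = A g x - B g x" by eventually_elim simp
  }
  fix a b
  have "AE x in M. A (\<lambda>y. a * f y + b * g y) x = a * A f x + b * A g x" "AE x in M. B (\<lambda>y. a * f y + b * g y) x = a * B f x + b * B g x"
    using A B f g unfolding Lp_bounded_operator_def by blast+
  then show "AE x in M. A (\<lambda>y. a * f y + b * g y) x - B (\<lambda>y. a * f y + b * g y) x = a * (A f x - B f x) + b * (A g x - B g x)"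
    by eventually_elim (simp add: algebra_simps)
next
  obtain CA where CA: "\<And>f. f \<in> Lp_space M p ==> Lp_norm M p (A f) \<le> CA * Lp_norm M p f" using Lp_op_bound[OF A] by blast
  obtain CB where CB: "\<And>f. f \<in> Lp_space M p ==> Lp_norm M p (B f) \<le> CB * Lp_norm M p f" using Lp_op_bound[OF B] by blast
  have "Lp_norm M p (\<lambda>x. A f x - B f x) \<le> (CA + CB) * Lp_norm M p f" if f: "f \<in> Lp_space M p" for f
  proof -
    have "A f \<in> Lp_space M p" "B f \<in> Lp_space M p" using A B f unfolding Lp_bounded_operator_def by blast+
    from Lp_norm_diff_triangle[OF p this] CA[OF f] CB[OF f] show ?thesis unfolding distrib_right by linarith
  qed
  then show "\<exists>C. \<forall>f\<in>Lp_space M p. Lp_norm M p (\<lambda>x. A f x - B f x) \<le> C * Lp_norm M p f" by blast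
qed

text \<open>Meant for the terms of the series: they agree almost everywhere with differences of
  \<open>bounce_op\<close>, and linearity, compatibility with null sets and the bound are inherited
  from there.\<close>

lemma Lp_bounded_operator_cong_AE:
  assumes p: "1 \<le> p" and A: "Lp_bounded_operator M p A"
    and m: "\<And>f. f \<in> Lp_space M p ==> B f \<in> borel_measurable M" and eq: "\<And>f. f \<in> Lp_space M p ==> AE x in M. B f x = A f x"
  shows "Lp_bounded_operator M p B"
proof -
  have AL: "A f \<in> Lp_space M p" if "f \<in> Lp_space M p" for f using A that unfolding Lp_bounded_operator_def by blast
  have N: "Lp_norm M p (B f) = Lp_norm M p (A f)" if f: "f \<in> Lp_space M p" for f
    by (rule Lp_norm_cong_AE[OF m[OF f] Lp_space_measurable[OF AL[OF f]] eq[OF f]])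
  show ?thesis
    unfolding Lp_bounded_operator_def
  proof (intro conjI ballI impI allI)
    fix f assume f: "f \<in> Lp_space M p"
    show "B f \<in> Lp_space M p"
      by (rule Lp_space_cong_AE[OF p AL[OF f] m[OF f]]) (use eq[OF f] in \<open>auto elim: eventually_mono\<close>)
    fix g assume g: "g \<in> Lp_space M p"
    {
      assume "AE x in M. f x = g x"
      with A f g have "AE x in M. A f x = A g x" unfolding Lp_bounded_operator_def by blast
      with eq[OF f] eq[OF g] show "AE x in M. B f x = B g x" by eventually_elim simp
    }
    fix a b
    have "AE x in M. A (\<lambda>y. a * f y + b * g y) x = a * A f x + b * A g x"
      using A f g unfolding Lp_bounded_operator_def by blast
    moreover have "(\<lambda>y. a * f y + b * g y) \<in> Lp_space M p" by (intro Lp_add(1) Lp_scale(1) p f g)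
    note eq[OF this] eq[OF f] eq[OF g]
    ultimately show "AE x in M. B (\<lambda>y. a * f y + b * g y) x = a * B f x + b * B g x" by eventually_elim simp
  next
    show "\<exists>C. \<forall>f\<in>Lp_space M p. Lp_norm M p (B f) \<le> C * Lp_norm M p f"
      using A N unfolding Lp_bounded_operator_def by auto
  qed
qed

text \<open>Symmetrising gives evenness and clipping gives the bounds, and neither changes the
  function at almost every velocity. Properties valid at every velocity can then be used at each
  point of a trajectory.\<close>

lemma even_velocity_function_version:
  fixes \<sigma> :: "'a::euclidean_space => real"
  assumes m: "\<sigma> \<in> borel_measurable lebesgue" and bd: "AE v in lebesgue. \<bar>\<sigma> v\<bar> \<le> C"
    and nonneg: "AE v in lebesgue. 0 \<le> \<sigma> v" and even: "AE v in lebesgue. \<sigma> v = \<sigma> (- v)"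
  obtains \<sigma>' B where "\<sigma>' \<in> Borel" "\<And>v. 0 \<le> \<sigma>' v" "\<And>v. \<sigma>' v \<le> B" "\<And>v. \<sigma>' (- v) = \<sigma>' v"
    "AE z in (lborel :: ('a \<times> 'a) measure). \<sigma> (snd z) = \<sigma>' (snd z)"
proof -
  obtain \<sigma>1 where \<sigma>1: "\<sigma>1 \<in> borel_measurable lborel" "AE v in lborel. \<sigma> v = \<sigma>1 v"
    using completion_ex_borel_measurable_real[OF m] by blast
  define \<sigma>' where "\<sigma>' v = min \<bar>C\<bar> (max 0 ((\<sigma>1 v + \<sigma>1 (- v)) / 2))" for v
  have m1: "\<sigma>1 \<in> Borel" using \<sigma>1(1) by simp
  have m2: "(\<lambda>v. \<sigma>1 (- v)) \<in> Borel" by (rule measurable_compose[OF borel_continuous m1]) (intro continuous_intros)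
  have "\<sigma>' \<in> Borel" unfolding \<sigma>'_def[abs_def] using m1 m2 by measurable
  moreover have "0 \<le> \<sigma>' v" "\<sigma>' v \<le> \<bar>C\<bar>" "\<sigma>' (- v) = \<sigma>' v" for v by (simp_all add: \<sigma>'_def add.commute)
  moreover have "AE z in (lborel :: ('a \<times> 'a) measure). \<sigma> (snd z) = \<sigma>' (snd z)"
  proof -
    have "AE v in lborel. \<bar>\<sigma> v\<bar> \<le> C \<and> 0 \<le> \<sigma> v \<and> \<sigma> v = \<sigma> (- v) \<and> \<sigma> v = \<sigma>1 v"
      using bd nonneg even \<sigma>1(2) unfolding AE_completion_iff by eventually_elim simp
    then have "AE z in (lborel :: ('a \<times> 'a) measure). \<bar>\<sigma> (snd z)\<bar> \<le> C \<and> 0 \<le> \<sigma> (snd z) \<and> \<sigma> (snd z) = \<sigma> (- snd z) \<and> \<sigma> (snd z) = \<sigma>1 (snd z)"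
      by (rule AE_lborel_snd)
    \<comment> \<open>Supplies the value of the Borel version at \<open>- snd z\<close>, which
      enters through the symmetrisation.\<close>
    with AE_reflect_velocity[OF this] show ?thesis
      by eventually_elim (simp add: \<sigma>'_def)
  qed
  ultimately show thesis by (rule that)
qed

section \<open>The terms of the series through the flow\<close>

context bounded_convex_domain
begin

text \<open>The intervals are closed and neighbours share an end point. At a regular point
  \<open>t\<close> is no such end point, so membership determines the number of bounces.\<close>

lemma bounces_eq_iff:
  assumes r: "regular t (x, v)"
  shows "bounces t (x, v) = n \<longleftrightarrow> (real n - 1) * chord (x, v) + et x v \<le> t \<and> t \<le> real n * chord (x, v) + et x v"
proof -
  have xv: "x \<in> D" "v \<noteq> 0" and s: "0 < since t (x, v)" "since t (x, v) < chord (x, v)" using r by (auto simp: regular_def)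
  have c: "0 < chord (x, v)" by (rule chord_pos[OF xv])
  let ?b = "bounces t (x, v)"
  have s': "0 < et x v - t + real ?b * chord (x, v)" "et x v - t + real ?b * chord (x, v) < chord (x, v)" using s by (simp_all add: since_def)
  show ?thesis
  proof
    assume "?b = n"
    then show "(real n - 1) * chord (x, v) + et x v \<le> t \<and> t \<le> real n * chord (x, v) + et x v" using s' by (simp add: algebra_simps)
  next
    assume t: "(real n - 1) * chord (x, v) + et x v \<le> t \<and> t \<le> real n * chord (x, v) + et x v"
    then have "real n * chord (x, v) < (1 + real ?b) * chord (x, v)" "real ?b * chord (x, v) < (1 + real n) * chord (x, v)"
      using s' by (simp_all add: algebra_simps)
    then have "real n < 1 + real ?b" "real ?b < 1 + real n" using c by (simp_all add: mult_less_cancel_right_pos)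
    then show "?b = n" by linarith
  qed
qed

text \<open>Translates the flow into the explicit formulas. The index is shifted:
  \<open>bounce_interval D k\<close> belongs to \<open>k + 1\<close> bounces, because the first
  bounce ends the initial piece.\<close>

lemma bounce_terms:
  assumes r: "regular t (x, v)" and t: "0 \<le> t"
  shows "bounces t (x, v) = 0 \<longleftrightarrow> ereal t < t_minus D x v"
    "bounces t (x, v) = Suc k \<longleftrightarrow> t \<in> bounce_interval D k x v"
    "bounces t (x, v) = 0 ==> flow t (x, v) = (x - t *\<^sub>R v, v)"
    "bounces t (x, v) = 2 * m + 2 ==> flow t (x, v) = (x - t *\<^sub>R v + (real (2 * m + 2) * real_of_ereal (tau D x v)) *\<^sub>R v, v)"
    "bounces t (x, v) = 2 * m + 1 ==> flow t (x, v) =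
      (x + t *\<^sub>R v - (2 * real_of_ereal (t_minus D x v)) *\<^sub>R v - (real (2 * m) * real_of_ereal (tau D x v)) *\<^sub>R v, - v)"
proof -
  have xv: "x \<in> D" "v \<noteq> 0" and s: "0 < since t (x, v)" using r by (auto simp: regular_def)
  have tm: "t_minus D x v = ereal (et x v)" by (rule t_minus_eq[OF xv])
  have ta: "tau D x v = ereal (chord (x, v))" by (rule tau_eq[OF xv])
  have "bounces t (x, v) = 0 \<longleftrightarrow> t \<le> et x v"
    unfolding bounces_eq_iff[OF r] using t exit_time_less_chord[OF xv] by simp
  moreover have "t \<noteq> et x v"
  proof
    assume eq: "t = et x v"
    then have "bounces t (x, v) = 0" using calculation by simp
    then show False using s eq by (simp add: since_def)
  qed
  ultimately show "bounces t (x, v) = 0 \<longleftrightarrow> ereal t < t_minus D x v" unfolding tm by auto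
  show "bounces t (x, v) = Suc k \<longleftrightarrow> t \<in> bounce_interval D k x v"
    unfolding bounces_eq_iff[OF r] bounce_interval_def tm ta by simp
  show "bounces t (x, v) = 0 ==> flow t (x, v) = (x - t *\<^sub>R v, v)"
    by (simp add: flow_def since_def algebra_simps)
  show "bounces t (x, v) = 2 * m + 2 ==> flow t (x, v) = (x - t *\<^sub>R v + (real (2 * m + 2) * real_of_ereal (tau D x v)) *\<^sub>R v, v)"
    by (simp add: flow_def since_def ta algebra_simps)
  show "flow t (x, v) = (x + t *\<^sub>R v - (2 * real_of_ereal (t_minus D x v)) *\<^sub>R v - (real (2 * m) * real_of_ereal (tau D x v)) *\<^sub>R v, - v)"
    if b: "bounces t (x, v) = 2 * m + 1"
  proof -
    have "et x (- v) - since t (x, v) = t - 2 * real_of_ereal (t_minus D x v) - real (2 * m) * real_of_ereal (tau D x v)"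
      by (simp add: since_def b tm ta chord_def algebra_simps)
    moreover have "odd (bounces t (x, v))" using b by simp
    ultimately show ?thesis by (simp add: flow_def scaleR_left_diff_distrib)
  qed
qed

end

theorem theorem3p3:
  fixes D :: "'a::euclidean_space set"
    and p \<gamma> :: real
    and \<sigma> :: "'a \<Rightarrow> real"
    and U :: "real \<Rightarrow> ('a \<times> 'a \<Rightarrow> real) \<Rightarrow> ('a \<times> 'a \<Rightarrow> real)"
    and V :: "nat \<Rightarrow> real \<Rightarrow> ('a \<times> 'a \<Rightarrow> real) \<Rightarrow> ('a \<times> 'a \<Rightarrow> real)"
  assumes D: "smooth_domain D" "bounded D" "convex D"
    and p: "1 \<le> p"
    and \<gamma>: "0 < \<gamma>" "\<gamma> < 1"
    and \<sigma>_Linfty: "\<sigma> \<in> borel_measurable lebesgue" "\<exists>C. AE v in lebesgue. \<bar>\<sigma> v\<bar> \<le> C"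
    and \<sigma>_nonneg: "AE v in lebesgue. 0 \<le> \<sigma> v"
    and \<sigma>_even: "AE v in lebesgue. \<sigma> v = \<sigma> (- v)"
    and U_semigroup: "C0_semigroup (phase_space D) p U"
    and U_generator: "is_generator (phase_space D) p U
          (streaming_operator D p (\<lambda>(x, v). \<sigma> v)) (bounce_back_domain D p \<gamma>)"
    and U_0: "\<And>t \<phi> x v. t \<ge> 0 \<Longrightarrow> \<phi> \<in> Lp_space (phase_space D) p \<Longrightarrow> x \<in> D \<Longrightarrow>
          V 0 t \<phi> (x, v) =
            \<phi> (x - t *\<^sub>R v, v) * exp (- \<sigma> v * t) * (if ereal t < t_minus D x v then 1 else 0)"
    and U_even: "\<And>n t \<phi> x v. t \<ge> 0 \<Longrightarrow> \<phi> \<in> Lp_space (phase_space D) p \<Longrightarrow> x \<in> D \<Longrightarrow>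
          V (2 * n + 2) t \<phi> (x, v) =
            \<gamma> ^ (2 * n + 2) * exp (- \<sigma> v * t) * indicator (bounce_interval D (2 * n + 1) x v) t *
            \<phi> (x - t *\<^sub>R v + (real (2 * n + 2) * real_of_ereal (tau D x v)) *\<^sub>R v, v)"
    and U_odd: "\<And>n t \<phi> x v. t \<ge> 0 \<Longrightarrow> \<phi> \<in> Lp_space (phase_space D) p \<Longrightarrow> x \<in> D \<Longrightarrow>
          V (2 * n + 1) t \<phi> (x, v) =
            \<gamma> ^ (2 * n + 1) * exp (- \<sigma> v * t) * indicator (bounce_interval D (2 * n) x v) t *
            \<phi> (x + t *\<^sub>R v - (2 * real_of_ereal (t_minus D x v)) *\<^sub>R v
                 - (real (2 * n) * real_of_ereal (tau D x v)) *\<^sub>R v, - v)"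
  shows "\<forall>t\<ge>0. Lp_operator_sums (phase_space D) p (\<lambda>n. V n t) (U t)"
proof (intro allI impI)
  fix t :: real assume t: "0 \<le> t"
  let ?M = "phase_space D" and ?N = "Lp_norm (phase_space D) p"
  interpret bounded_convex_domain D
    by unfold_locales (use D in \<open>auto simp: smooth_domain_def\<close>)
  obtain C where C: "AE v in lebesgue. \<bar>\<sigma> v\<bar> \<le> C" using \<sigma>_Linfty(2) by blast
  obtain \<sigma>' B where \<sigma>': "\<sigma>' \<in> Borel" "\<And>v. 0 \<le> \<sigma>' v" and \<sigma>'_le: "\<And>v. \<sigma>' v \<le> B"
    and \<sigma>'_even: "\<And>v. \<sigma>' (- v) = \<sigma>' v" and \<sigma>_eq: "AE z in (lborel :: ('a \<times> 'a) measure). \<sigma> (snd z) = \<sigma>' (snd z)"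
    using even_velocity_function_version[OF \<sigma>_Linfty(1) C \<sigma>_nonneg \<sigma>_even] by blast
  \<comment> \<open>\<open>?S n\<close> is the remainder of the series after \<open>n\<close> terms,
    and \<open>?S 0\<close> the candidate for \<open>U t\<close>.\<close>
  let ?S = "\<lambda>n. bounce_op \<gamma> \<sigma>' n t"
  have op: "Lp_bounded_operator ?M p (?S n)" for n by (rule bounce_op_bounded_operator[OF \<gamma> \<sigma>' p t])
  have Uop: "Lp_bounded_operator ?M p (U t)" using U_semigroup t unfolding C0_semigroup_def by blast
  have \<Sigma>: "AE z in ?M. (case z of (x, v) => \<sigma> v) = \<sigma>' (snd z)"
    unfolding AE_phase_space[OF open_D] using \<sigma>_eq by eventually_elim (simp add: case_prod_beta)
  \<comment> \<open>By hypothesis the generator of \<open>U\<close> is the streaming operator, and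
    \<open>bounce_op_generator\<close> gives the same right derivative for the candidate.\<close>
  have dom: "AE z in ?M. U t f z = ?S 0 f z" if f: "f \<in> bounce_back_domain D p \<gamma>" for f
    by (rule C0_semigroup_eq_on_domain[OF p U_semigroup bounce_op_C0_semigroup[OF \<gamma> \<sigma>' \<sigma>'_even p] U_generator _ f t])
      (rule bounce_op_generator[OF D(1) \<gamma> p \<sigma>' \<sigma>'_le _ \<Sigma>])
  \<comment> \<open>Both operators are bounded, and every continuous function with compact support
    in phase space is a limit of elements of the domain.\<close>
  have US: "AE z in ?M. U t f z = ?S 0 f z" if "f \<in> Lp_space ?M p" for f
    using p that
  proof (rule Lp_phase_space_dense_induct)
    fix f g a b assume f: "f \<in> Lp_space ?M p" and g: "g \<in> Lp_space ?M p"
      and eq: "AE z in ?M. U t f z = ?S 0 f z" "AE z in ?M. U t g z = ?S 0 g z"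
    have "AE z in ?M. U t (\<lambda>z. a * f z + b * g z) z = a * U t f z + b * U t g z"
      using Uop f g unfolding Lp_bounded_operator_def by blast
    with eq show "AE z in ?M. U t (\<lambda>z. a * f z + b * g z) z = ?S 0 (\<lambda>z. a * f z + b * g z) z"
      by eventually_elim (simp add: bounce_op_linear)
  next
    fix f u assume "f \<in> Lp_space ?M p" "\<And>n::nat. u n \<in> Lp_space ?M p" "\<And>n. AE z in ?M. U t (u n) z = ?S 0 (u n) z"
      "(\<lambda>n. ?N (\<lambda>z. u n z - f z)) \<longlonglongrightarrow> 0"
    then show "AE z in ?M. U t f z = ?S 0 f z" by (rule Lp_operators_eq_limit[OF p Uop op])
  next
    fix \<phi> :: "'a \<times> 'a => real" and K assume \<phi>: "continuous_on UNIV \<phi>" and K: "compact K" "K \<subseteq> D \<times> UNIV" "\<And>z. z \<notin> K ==> \<phi> z = 0"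
    obtain u where u: "\<And>n::nat. u n \<in> bounce_back_domain D p \<gamma>" "(\<lambda>n. ?N (\<lambda>z. u n z - \<phi> z)) \<longlonglongrightarrow> 0"
      using bounce_back_domain_approx[OF p \<phi> K, of \<gamma>] by blast
    obtain c where c: "0 \<le> c" "\<And>z. \<bar>\<phi> z\<bar> \<le> c" using compact_support_bounded[OF \<phi> K(1) K(3)] by blast
    have "\<phi> \<in> Lp_space ?M p"
    proof (rule Lp_bounded_support[OF open_D p borel_imp_measurable_phase_space[OF borel_continuous[OF \<phi>]] compact_imp_bounded[OF K(1)]])
      have "\<bar>\<phi> z\<bar> \<le> c * indicator K z" for z using c(2)[of z] K(3)[of z] by (cases "z \<in> K") auto
      then show "AE z in ?M. \<bar>\<phi> z\<bar> \<le> c * indicator K z" by simp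
    qed
    moreover have "u n \<in> Lp_space ?M p" for n using u(1) by (auto simp: bounce_back_domain_def W_tilde_def W_space_def)
    ultimately show "AE z in ?M. U t \<phi> z = ?S 0 \<phi> z" by (rule Lp_operators_eq_limit[OF p Uop op _ _ dom[OF u(1)] u(2)])
  qed
  \<comment> \<open>The difference of consecutive remainders keeps exactly the trajectories with
    \<open>n\<close> bounces. The closed intervals in the formulas for \<open>V\<close> cause no
    double counting, since the identity is checked at regular points.\<close>
  have VS: "AE z in ?M. V n t f z = ?S n f z - ?S (Suc n) f z" if f: "f \<in> Lp_space ?M p" for n f
    unfolding AE_phase_space[OF open_D] using \<sigma>_eq AE_regular[OF t]
  proof eventually_elim
    fix z assume \<sigma>z: "\<sigma> (snd z) = \<sigma>' (snd z)" and reg: "fst z \<in> D --> regular t z"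
    obtain x v where z: "z = (x, v)" by force
    show "fst z \<in> D --> V n t f z = ?S n f z - ?S (Suc n) f z"
    proof
      assume "fst z \<in> D"
      then have x: "x \<in> D" and r: "regular t (x, v)" and \<sigma>v: "\<sigma> v = \<sigma>' v" using reg \<sigma>z by (auto simp: z)
      note bt = bounce_terms[OF r t]
      have S: "?S n f z - ?S (Suc n) f z = (if bounces t (x, v) = n then \<gamma> ^ n * exp (- \<sigma> v * t) * f (flow t (x, v)) else 0)"
        by (auto simp: bounce_op_def z \<sigma>v)
      consider "n = 0" | m where "n = 2 * m + 2" | m where "n = 2 * m + 1"
      proof (cases "even n")
        case True
        then obtain k where "n = 2 * k" by (auto elim: evenE)
        then show thesis using that(1) that(2)[of "k - 1"] by (cases k) auto
      next
        case False
        then show thesis using that(3) by (auto elim: oddE)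
      qed
      then show "V n t f z = ?S n f z - ?S (Suc n) f z"
      proof cases
        case 1
        show ?thesis unfolding S using U_0[OF t f x, of v] bt(1,3) by (simp add: z 1)
      next
        case (2 m)
        have "bounces t (x, v) = n \<longleftrightarrow> t \<in> bounce_interval D (2 * m + 1) x v" using bt(2)[of "2 * m + 1"] 2 by simp
        then show ?thesis unfolding S using U_even[OF t f x, of m v] bt(4)[of m] 2 by (auto simp: z)
      next
        case (3 m)
        have "bounces t (x, v) = n \<longleftrightarrow> t \<in> bounce_interval D (2 * m) x v" using bt(2)[of "2 * m"] 3 by simp
        then show ?thesis unfolding S using U_odd[OF t f x, of m v] bt(5)[of m] 3 by (auto simp: z)
      qed
    qed
  qed
  have SL: "?S n f \<in> Lp_space ?M p" if "f \<in> Lp_space ?M p" for n f by (rule bounce_op_norm_le(1)[OF \<gamma> \<sigma>' p t that])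
  have Vop: "Lp_bounded_operator ?M p (V n t)" for n
  proof (rule Lp_bounded_operator_cong_AE[OF p Lp_bounded_operator_diff[OF p op op] _ VS])
    fix f assume f: "f \<in> Lp_space ?M p"
    show "V n t f \<in> borel_measurable ?M"
      by (rule measurable_phase_space_AE[OF open_D Lp_space_measurable[OF Lp_diff(1)[OF p SL[OF f] SL[OF f]]] VS[OF f]])
  qed
  \<comment> \<open>The partial sums telescope, so the error is the remainder operator and inherits
    its norm bound.\<close>
  have rest: "?N (\<lambda>z. U t f z - (\<Sum>k<n. V k t f z)) \<le> (\<gamma> ^ n / (1 - \<gamma>)) powr (1 / p) * ?N f" if f: "f \<in> Lp_space ?M p" for n f
  proof -
    have "AE z in ?M. \<forall>k. V k t f z = ?S k f z - ?S (Suc k) f z" using VS[OF f] unfolding AE_all_countable by blast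
    with US[OF f] have "AE z in ?M. U t f z - (\<Sum>k<n. V k t f z) = ?S n f z"
    proof eventually_elim
      fix z assume U: "U t f z = ?S 0 f z" and V: "\<forall>k. V k t f z = ?S k f z - ?S (Suc k) f z"
      have "(\<Sum>k<n. V k t f z) = (\<Sum>k<n. ?S k f z - ?S (Suc k) f z)" using V by simp
      also have "... = ?S 0 f z - ?S n f z" by (rule sum_lessThan_telescope')
      finally show "U t f z - (\<Sum>k<n. V k t f z) = ?S n f z" using U by simp
    qed
    from Lp_norm_phase_space_cong_AE[OF open_D Lp_space_measurable[OF SL[OF f]] this]
    show ?thesis using bounce_op_norm_le(2)[OF \<gamma> \<sigma>' p t f, of n] by simp
  qed
  have lim: "(\<lambda>n. (\<gamma> ^ n / (1 - \<gamma>)) powr (1 / p)) \<longlonglongrightarrow> 0"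
  proof (rule tendsto_zero_powrI[where b = "1 / p"])
    have "(\<lambda>n. \<gamma> ^ n / (1 - \<gamma>)) \<longlonglongrightarrow> 0 / (1 - \<gamma>)" by (intro tendsto_intros LIMSEQ_power_zero) (use \<gamma> in auto)
    then show "(\<lambda>n. \<gamma> ^ n / (1 - \<gamma>)) \<longlonglongrightarrow> 0" by simp
  qed (use \<gamma> p in auto)
  show "Lp_operator_sums ?M p (\<lambda>n. V n t) (U t)"
    unfolding Lp_operator_sums_def
  proof (intro conjI allI impI Vop Uop)
    fix e :: real assume e: "0 < e"
    obtain m where m: "\<And>n. m \<le> n ==> (\<gamma> ^ n / (1 - \<gamma>)) powr (1 / p) < e"
      using order_tendstoD(2)[OF lim e] unfolding eventually_sequentially by blast
    have "?N (\<lambda>z. U t f z - (\<Sum>k<n. V k t f z)) \<le> e * ?N f" if "m \<le> n" "f \<in> Lp_space ?M p" for n f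
      using rest[OF that(2), of n] mult_right_mono[OF less_imp_le[OF m[OF that(1)]], of "?N f"] by simp
    then show "\<exists>m. \<forall>n\<ge>m. \<forall>f\<in>Lp_space ?M p. ?N (\<lambda>z. U t f z - (\<Sum>k<n. V k t f z)) \<le> e * ?N f" by blast
  qed
qed

end
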